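(* Real coordinates $(w,z,x,y)$ can be chosen such that all anti-self-dual null-Kähler metrics are locally given by $$g=dw\,dx+dz\,dy-\Theta_{xx}\,dz^2-\Theta_{yy}\,dw^2+2\Theta_{xy}\,dw\,dz,$$ where $\Theta(w,z,x,y)$ is a solution to a fourth order PDE, which is written as a system of two second order PDEs for $\Theta$ and a function $f(w,z,x,y)$: $$\Theta_{wx}+\Theta_{zy}+\Theta_{xx}\Theta_{yy}-\Theta_{xy}^2=f,\qquad(1)$$ $$\square f=f_{xw}+f_{yz}+\Theta_{yy}f_{xx}+\Theta_{xx}f_{yy}-2\Theta_{xy}f_{xy}=0.\qquad(2)$$ Moreover (1), (2) arise as an integrability condition for the linear system $L_0\Psi=L_1\Psi=0$, where $\Psi=\Psi(w,z,x,y,\lambda)$ and $$L_0=(\partial_w-\Theta_{xy}\partial_y+\Theta_{yy}\partial_x)-\lambda\partial_y+f_y\partial_\lambda,$$ $$L_1=(\partial_z+\Theta_{xx}\partial_y-\Theta_{xy}\partial_x)+\lambda\partial_x-f_x\partial_\lambda.$$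
   Context: A null-Kähler structure on a four-manifold ${\cal M}$ consists of a metric $g$ of signature $(++--)$ and a (non-zero) real spinor field parallel with respect to the Levi-Civita connection of $g$. Here, in signature $(++--)$, the spin group is $SL(2,\mathbb{R})\times\widetilde{SL}(2,\mathbb{R})$ and there are two real rank-two spin bundles $S^A$, $S^{A'}$ with $T{\cal M}\cong S^A\otimes S^{A'}$; the parallel spinor is taken to be a section $\iota^{A'}$ of $S^{A'}$, the bundle such that self-dual two-forms are sections of ${\rm Sym}^2(S^{A'})$. The structure is anti-self-dual (ASD) if the self-dual part $C_{A'B'C'D'}$ of the Weyl curvature vanishes. Subscripts $w,z,x,y$ on $\Theta$ and $f$ denote partial derivatives, and $\lambda$ is an auxiliary (spectral) parameter, the coordinate on the fibres $\mathbb{CP}^1$ of the projectivised primed spin bundle. *)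

theory Defs
  imports "HOL-Analysis.Analysis"
begin

section \<open>Smooth functions and partial derivatives\<close>

primrec ck_on :: "nat \<Rightarrow> 'a::real_normed_vector set \<Rightarrow> ('a \<Rightarrow> 'b::real_normed_vector) \<Rightarrow> bool" where
  "ck_on 0 S F \<longleftrightarrow> continuous_on S F"
| "ck_on (Suc k) S F \<longleftrightarrow> (\<forall>q\<in>S. F differentiable (at q)) \<and>
     (\<forall>v. ck_on k S (\<lambda>q. frechet_derivative F (at q) v))"

text \<open>Only used for open sets \<open>S\<close>.\<close>

definition smooth_on :: "'a::real_normed_vector set \<Rightarrow> ('a \<Rightarrow> 'b::real_normed_vector) \<Rightarrow> bool" where
  "smooth_on S F \<longleftrightarrow> (\<forall>k. ck_on k S F)"

definition pd :: "4 \<Rightarrow> (real^4 \<Rightarrow> 'b::real_normed_vector) \<Rightarrow> real^4 \<Rightarrow> 'b" where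
  "pd i F q = frechet_derivative F (at q) (axis i 1)"

abbreviation pd2 :: "4 \<Rightarrow> 4 \<Rightarrow> (real^4 \<Rightarrow> 'b::real_normed_vector) \<Rightarrow> real^4 \<Rightarrow> 'b" where
  "pd2 i j F \<equiv> pd j (pd i F)"


section \<open>Smooth four-manifolds\<close>

text \<open>A chart is a pair of its domain and its coordinate map. The manifold underlying an atlas
  is the union of the chart domains.\<close>

type_synonym 'm chart = "'m set \<times> ('m \<Rightarrow> real^4)"

definition is_chart :: "'m::topological_space chart \<Rightarrow> bool" where
  "is_chart c \<longleftrightarrow> open (fst c) \<and> open (snd c ` fst c) \<and>
     homeomorphism (fst c) (snd c ` fst c) (snd c) (inv_into (fst c) (snd c))"

definition range_of :: "'m chart \<Rightarrow> (real^4) set" where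
  "range_of c = snd c ` fst c"

definition overlap :: "'m chart \<Rightarrow> 'm chart \<Rightarrow> (real^4) set" where
  "overlap c d = snd c ` (fst c \<inter> fst d)"

definition transition :: "'m chart \<Rightarrow> 'm chart \<Rightarrow> real^4 \<Rightarrow> real^4" where
  "transition c d = snd d \<circ> inv_into (fst c) (snd c)"

definition smooth_atlas :: "'m::topological_space chart set \<Rightarrow> bool" where
  "smooth_atlas A \<longleftrightarrow> (\<forall>c\<in>A. is_chart c) \<and>
     (\<forall>c\<in>A. \<forall>d\<in>A. smooth_on (overlap c d) (transition c d))"

definition carrier_of :: "'m chart set \<Rightarrow> 'm set" where
  "carrier_of A = (\<Union>c\<in>A. fst c)"

text \<open>The differential at \<open>q\<close> of the change of coordinates from \<open>c\<close> to \<open>d\<close>.\<close>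

definition dtrans :: "'m chart \<Rightarrow> 'm chart \<Rightarrow> real^4 \<Rightarrow> real^4 \<Rightarrow> real^4" where
  "dtrans c d q = frechet_derivative (transition c d) (at q)"


section \<open>Metrics of neutral signature and their curvature\<close>

definition signature_2_2 :: "real^4^4 \<Rightarrow> bool" where
  "signature_2_2 G \<longleftrightarrow> (\<exists>P :: real^4^4. invertible P \<and>
     transpose P ** G ** P = (\<chi> i j. if i \<noteq> j then 0 else if i = 1 \<or> i = 2 then 1 else - 1))"

text \<open>A metric is given by its component matrix in each chart, as a function of the coordinates.\<close>

definition neutral_metric ::
  "'m::topological_space chart set \<Rightarrow> ('m chart \<Rightarrow> real^4 \<Rightarrow> real^4^4) \<Rightarrow> bool" where
  "neutral_metric A g \<longleftrightarrow>
     (\<forall>c\<in>A. smooth_on (range_of c) (g c) \<and>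
        (\<forall>q\<in>range_of c. transpose (g c q) = g c q \<and> signature_2_2 (g c q))) \<and>
     (\<forall>c\<in>A. \<forall>d\<in>A. \<forall>q\<in>overlap c d. \<forall>u v.
        u \<bullet> (g c q *v v) = dtrans c d q u \<bullet> (g d (transition c d q) *v dtrans c d q v))"

text \<open>From here to the Weyl tensor, \<open>G\<close> is the component matrix of a metric on an open subset of
  coordinate space.\<close>

definition christoffel :: "(real^4 \<Rightarrow> real^4^4) \<Rightarrow> 4 \<Rightarrow> 4 \<Rightarrow> 4 \<Rightarrow> real^4 \<Rightarrow> real" where
  "christoffel G k i j q = (1/2) * (\<Sum>l\<in>UNIV. matrix_inv (G q) $ k $ l *
     (pd i (\<lambda>r. G r $ j $ l) q + pd j (\<lambda>r. G r $ i $ l) q - pd l (\<lambda>r. G r $ i $ j) q))"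

text \<open>The Levi-Civita covariant derivative of a vector field in the \<open>i\<close>-th coordinate direction.\<close>

definition nabla :: "(real^4 \<Rightarrow> real^4^4) \<Rightarrow> 4 \<Rightarrow> (real^4 \<Rightarrow> real^4) \<Rightarrow> real^4 \<Rightarrow> real^4" where
  "nabla G i X q = (\<chi> k. pd i (\<lambda>r. X r $ k) q + (\<Sum>j\<in>UNIV. christoffel G k i j q * X q $ j))"

text \<open>\<open>riemann G l k i j\<close> is \<open>R\<^sup>l\<^sub>k\<^sub>i\<^sub>j\<close>, the \<open>l\<close>-component of \<open>R(\<partial>\<^sub>i, \<partial>\<^sub>j) \<partial>\<^sub>k\<close>.\<close>

definition riemann :: "(real^4 \<Rightarrow> real^4^4) \<Rightarrow> 4 \<Rightarrow> 4 \<Rightarrow> 4 \<Rightarrow> 4 \<Rightarrow> real^4 \<Rightarrow> real" where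
  "riemann G l k i j q =
     pd i (christoffel G l j k) q - pd j (christoffel G l i k) q +
     (\<Sum>m\<in>UNIV. christoffel G l i m q * christoffel G m j k q
               - christoffel G l j m q * christoffel G m i k q)"

definition riemann_low :: "(real^4 \<Rightarrow> real^4^4) \<Rightarrow> 4 \<Rightarrow> 4 \<Rightarrow> 4 \<Rightarrow> 4 \<Rightarrow> real^4 \<Rightarrow> real" where
  "riemann_low G a b c d q = (\<Sum>m\<in>UNIV. G q $ a $ m * riemann G m b c d q)"

definition ricci :: "(real^4 \<Rightarrow> real^4^4) \<Rightarrow> 4 \<Rightarrow> 4 \<Rightarrow> real^4 \<Rightarrow> real" where
  "ricci G b d q = (\<Sum>i\<in>UNIV. riemann G i b i d q)"

definition scalar_curv :: "(real^4 \<Rightarrow> real^4^4) \<Rightarrow> real^4 \<Rightarrow> real" where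
  "scalar_curv G q = (\<Sum>a\<in>UNIV. \<Sum>b\<in>UNIV. matrix_inv (G q) $ a $ b * ricci G a b q)"

definition weyl :: "(real^4 \<Rightarrow> real^4^4) \<Rightarrow> 4 \<Rightarrow> 4 \<Rightarrow> 4 \<Rightarrow> 4 \<Rightarrow> real^4 \<Rightarrow> real" where
  "weyl G a b c d q = riemann_low G a b c d q
     - (1/2) * (G q $ a $ c * ricci G b d q - G q $ a $ d * ricci G b c q
              - G q $ b $ c * ricci G a d q + G q $ b $ d * ricci G a c q)
     + (scalar_curv G q / 6) * (G q $ a $ c * G q $ b $ d - G q $ a $ d * G q $ b $ c)"


section \<open>Spinors in neutral signature\<close>

text \<open>The symplectic form on either spin space. The spinor indices \<open>0, 1\<close> (and \<open>0', 1'\<close>) are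
  represented by \<open>1, 2 :: 2\<close>. In a symplectic basis the form with upper indices has the same
  components.\<close>

definition eps :: "2 \<Rightarrow> 2 \<Rightarrow> real" where
  "eps a b = (if a = 1 \<and> b = 2 then 1 else if a = 2 \<and> b = 1 then - 1 else 0)"

text \<open>The isomorphism of the tangent bundle with the tensor product of the spin bundles is given,
  over each chart \<open>c\<close>, by the vector fields \<open>e c a a'\<close> corresponding to the tensor products of
  the elements of symplectic bases of the unprimed (first index) and primed (second index) spin
  bundles; the metric is the tensor product of the two symplectic forms.
  The matrices \<open>L c d\<close> and \<open>R c d\<close> are the transition functions of the unprimed and the primed
  spin bundle.\<close>

definition spin_structure ::
  "'m::topological_space chart set \<Rightarrow> ('m chart \<Rightarrow> real^4 \<Rightarrow> real^4^4) \<Rightarrow>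
   ('m chart \<Rightarrow> 2 \<Rightarrow> 2 \<Rightarrow> real^4 \<Rightarrow> real^4) \<Rightarrow>
   ('m chart \<Rightarrow> 'm chart \<Rightarrow> real^4 \<Rightarrow> real^2^2) \<Rightarrow>
   ('m chart \<Rightarrow> 'm chart \<Rightarrow> real^4 \<Rightarrow> real^2^2) \<Rightarrow> bool" where
  "spin_structure A g e L R \<longleftrightarrow>
     (\<forall>c\<in>A. \<forall>a a'. smooth_on (range_of c) (e c a a')) \<and>
     (\<forall>c\<in>A. \<forall>q\<in>range_of c. \<forall>a a' b b'.
        e c a a' q \<bullet> (g c q *v e c b b' q) = eps a b * eps a' b') \<and>
     (\<forall>c\<in>A. \<forall>d\<in>A. smooth_on (overlap c d) (L c d) \<and> smooth_on (overlap c d) (R c d) \<and>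
        (\<forall>q\<in>overlap c d. det (L c d q) = 1 \<and> det (R c d q) = 1 \<and>
           (\<forall>b b'. dtrans c d q (e c b b' q) =
              (\<Sum>a\<in>UNIV. \<Sum>a'\<in>UNIV.
                 (L c d q $ a $ b * R c d q $ a' $ b') *\<^sub>R e d a a' (transition c d q))))) \<and>
     (\<forall>c\<in>A. \<forall>d\<in>A. \<forall>h\<in>A. \<forall>q\<in>overlap c d \<inter> overlap c h.
        L d h (transition c d q) ** L c d q = L c h q \<and>
        R d h (transition c d q) ** R c d q = R c h q)"

text \<open>A section of the primed spin bundle, given by its components over each chart.\<close>

definition primed_spinor_field ::
  "'m::topological_space chart set \<Rightarrow> ('m chart \<Rightarrow> 'm chart \<Rightarrow> real^4 \<Rightarrow> real^2^2) \<Rightarrow>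
   ('m chart \<Rightarrow> real^4 \<Rightarrow> real^2) \<Rightarrow> bool" where
  "primed_spinor_field A R \<iota> \<longleftrightarrow>
     (\<forall>c\<in>A. smooth_on (range_of c) (\<iota> c)) \<and>
     (\<forall>c\<in>A. \<forall>d\<in>A. \<forall>q\<in>overlap c d. \<iota> d (transition c d q) = R c d q *v \<iota> c q)"

text \<open>The coefficients at \<open>q\<close> of the connections on the two spin bundles induced by the Levi-Civita
  connection: both preserve the symplectic forms (i.e. are trace-free), and their tensor product is
  the Levi-Civita connection. With \<open>o\<^sub>a'\<close> the primed basis, the derivative of \<open>o\<^sub>b'\<close> in the
  \<open>i\<close>-th coordinate direction is the sum over \<open>a'\<close> of \<open>\<Gamma>' i a' b'\<close> times \<open>o\<^sub>a'\<close>.\<close>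

definition spin_connection_at ::
  "(real^4 \<Rightarrow> real^4^4) \<Rightarrow> (2 \<Rightarrow> 2 \<Rightarrow> real^4 \<Rightarrow> real^4) \<Rightarrow> real^4 \<Rightarrow>
   (4 \<Rightarrow> 2 \<Rightarrow> 2 \<Rightarrow> real) \<Rightarrow> (4 \<Rightarrow> 2 \<Rightarrow> 2 \<Rightarrow> real) \<Rightarrow> bool" where
  "spin_connection_at G E q \<Gamma> \<Gamma>' \<longleftrightarrow>
     (\<forall>i. (\<Sum>a\<in>UNIV. \<Gamma> i a a) = 0 \<and> (\<Sum>a'\<in>UNIV. \<Gamma>' i a' a') = 0) \<and>
     (\<forall>i b b'. nabla G i (E b b') q =
        (\<Sum>a\<in>UNIV. \<Gamma> i a b *\<^sub>R E a b' q) + (\<Sum>a'\<in>UNIV. \<Gamma>' i a' b' *\<^sub>R E b a' q))"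

text \<open>The induced connection exists and is unique, since \<open>so(2,2) = sl(2,R) \<oplus> sl(2,R)\<close>.\<close>

definition parallel_spinor ::
  "'m::topological_space chart set \<Rightarrow> ('m chart \<Rightarrow> real^4 \<Rightarrow> real^4^4) \<Rightarrow>
   ('m chart \<Rightarrow> 2 \<Rightarrow> 2 \<Rightarrow> real^4 \<Rightarrow> real^4) \<Rightarrow> ('m chart \<Rightarrow> real^4 \<Rightarrow> real^2) \<Rightarrow> bool" where
  "parallel_spinor A g e \<iota> \<longleftrightarrow>
     (\<forall>c\<in>A. \<forall>q\<in>range_of c. \<exists>\<Gamma> \<Gamma>'. spin_connection_at (g c) (e c) q \<Gamma> \<Gamma>' \<and>
        (\<forall>i a'. pd i (\<lambda>r. \<iota> c r $ a') q + (\<Sum>b'\<in>UNIV. \<Gamma>' i a' b' * \<iota> c q $ b') = 0))"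

text \<open>On a connected manifold a parallel spinor which is not identically zero vanishes nowhere;
  on a general manifold ``non-zero'' is to be read as non-vanishing.\<close>

definition null_kaehler where
  "null_kaehler A g e L R \<iota> \<longleftrightarrow>
     smooth_atlas A \<and> neutral_metric A g \<and> spin_structure A g e L R \<and>
     primed_spinor_field A R \<iota> \<and> parallel_spinor A g e \<iota> \<and>
     (\<forall>c\<in>A. \<forall>q\<in>range_of c. \<iota> c q \<noteq> 0)"

text \<open>The primed Weyl spinor \<open>C_{A'B'C'D'}\<close>. It is obtained from the decomposition
  \<open>C_{abcd} = C_{ABCD} \<epsilon>_{A'B'} \<epsilon>_{C'D'} + C_{A'B'C'D'} \<epsilon>_{AB} \<epsilon>_{CD}\<close> of the Weyl tensor into
  its anti-self-dual and self-dual parts (self-dual two-forms being \<open>\<phi>_{A'B'} \<epsilon>_{AB}\<close> with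
  symmetric \<open>\<phi>\<close>) by contracting with \<open>\<epsilon>^{AB} \<epsilon>^{CD}\<close>.\<close>

definition sd_weyl_spinor ::
  "(real^4 \<Rightarrow> real^4^4) \<Rightarrow> (2 \<Rightarrow> 2 \<Rightarrow> real^4 \<Rightarrow> real^4) \<Rightarrow>
   2 \<Rightarrow> 2 \<Rightarrow> 2 \<Rightarrow> 2 \<Rightarrow> real^4 \<Rightarrow> real" where
  "sd_weyl_spinor G E a' b' c' d' q =
     (1/4) * (\<Sum>a\<in>UNIV. \<Sum>b\<in>UNIV. \<Sum>c\<in>UNIV. \<Sum>d\<in>UNIV. eps a b * eps c d *
       (\<Sum>i\<in>UNIV. \<Sum>j\<in>UNIV. \<Sum>k\<in>UNIV. \<Sum>l\<in>UNIV. weyl G i j k l q *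
          E a a' q $ i * E b b' q $ j * E c c' q $ k * E d d' q $ l))"

definition asd_null_kaehler where
  "asd_null_kaehler A g e L R \<iota> \<longleftrightarrow> null_kaehler A g e L R \<iota> \<and>
     (\<forall>c\<in>A. \<forall>q\<in>range_of c. \<forall>a' b' c' d'. sd_weyl_spinor (g c) (e c) a' b' c' d' q = 0)"


section \<open>The normal form, the equations and the linear system\<close>

text \<open>In the sequel the coordinates \<open>w, z, x, y\<close> are the components \<open>1, 2, 3, 4\<close> of \<open>real^4\<close>.
  A product of two differentials is the symmetric product, so a metric written in
  terms of them is a quadratic form in a tangent vector \<open>v = (dw, dz, dx, dy)\<close>.\<close>

definition normal_form :: "(real^4 \<Rightarrow> real) \<Rightarrow> real^4 \<Rightarrow> real^4 \<Rightarrow> real" where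
  "normal_form \<Theta> q v =
     v$1 * v$3 + v$2 * v$4 - pd2 3 3 \<Theta> q * (v$2)\<^sup>2 - pd2 4 4 \<Theta> q * (v$1)\<^sup>2
     + 2 * pd2 3 4 \<Theta> q * v$1 * v$2"

definition eq1 :: "(real^4) set \<Rightarrow> (real^4 \<Rightarrow> real) \<Rightarrow> (real^4 \<Rightarrow> real) \<Rightarrow> bool" where
  "eq1 U \<Theta> f \<longleftrightarrow> (\<forall>q\<in>U.
     pd2 1 3 \<Theta> q + pd2 2 4 \<Theta> q + pd2 3 3 \<Theta> q * pd2 4 4 \<Theta> q - (pd2 3 4 \<Theta> q)\<^sup>2 = f q)"

definition eq2 :: "(real^4) set \<Rightarrow> (real^4 \<Rightarrow> real) \<Rightarrow> (real^4 \<Rightarrow> real) \<Rightarrow> bool" where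
  "eq2 U \<Theta> f \<longleftrightarrow> (\<forall>q\<in>U.
     pd2 3 1 f q + pd2 4 2 f q + pd2 4 4 \<Theta> q * pd2 3 3 f q + pd2 3 3 \<Theta> q * pd2 4 4 f q
     - 2 * pd2 3 4 \<Theta> q * pd2 3 4 f q = 0)"

text \<open>The spectral parameter \<open>\<lambda>\<close> is the affine coordinate on the complex projective line, and
  \<open>\<Psi>\<close> is a complex-valued function of \<open>(w, z, x, y, \<lambda>)\<close>, smooth and holomorphic in \<open>\<lambda>\<close>.\<close>

type_synonym spectral_fun = "(real^4) \<times> complex \<Rightarrow> complex"

definition admissible :: "((real^4) \<times> complex) set \<Rightarrow> spectral_fun \<Rightarrow> bool" where
  "admissible W \<Psi> \<longleftrightarrow> smooth_on W \<Psi> \<and>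
     (\<forall>q. (\<lambda>l. \<Psi> (q, l)) holomorphic_on {l. (q, l) \<in> W})"

definition dcoord :: "4 \<Rightarrow> spectral_fun \<Rightarrow> spectral_fun" where
  "dcoord i \<Psi> = (\<lambda>(q, l). frechet_derivative \<Psi> (at (q, l)) (axis i 1, 0))"

definition dlam :: "spectral_fun \<Rightarrow> spectral_fun" where
  "dlam \<Psi> = (\<lambda>(q, l). deriv (\<lambda>l'. \<Psi> (q, l')) l)"

definition L0 :: "(real^4 \<Rightarrow> real) \<Rightarrow> (real^4 \<Rightarrow> real) \<Rightarrow> spectral_fun \<Rightarrow> spectral_fun" where
  "L0 \<Theta> f \<Psi> = (\<lambda>(q, l).
     (dcoord 1 \<Psi> (q, l) - of_real (pd2 3 4 \<Theta> q) * dcoord 4 \<Psi> (q, l)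
        + of_real (pd2 4 4 \<Theta> q) * dcoord 3 \<Psi> (q, l))
     - l * dcoord 4 \<Psi> (q, l) + of_real (pd 4 f q) * dlam \<Psi> (q, l))"

definition L1 :: "(real^4 \<Rightarrow> real) \<Rightarrow> (real^4 \<Rightarrow> real) \<Rightarrow> spectral_fun \<Rightarrow> spectral_fun" where
  "L1 \<Theta> f \<Psi> = (\<lambda>(q, l).
     (dcoord 2 \<Psi> (q, l) + of_real (pd2 3 3 \<Theta> q) * dcoord 4 \<Psi> (q, l)
        - of_real (pd2 3 4 \<Theta> q) * dcoord 3 \<Psi> (q, l))
     + l * dcoord 3 \<Psi> (q, l) - of_real (pd 3 f q) * dlam \<Psi> (q, l))"

text \<open>The integrability (Frobenius) condition of the overdetermined system \<open>L0 \<Psi> = L1 \<Psi> = 0\<close>: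
  the commutator of the two operators is a combination of them.\<close>

definition lax_integrable :: "(real^4) set \<Rightarrow> (real^4 \<Rightarrow> real) \<Rightarrow> (real^4 \<Rightarrow> real) \<Rightarrow> bool" where
  "lax_integrable U \<Theta> f \<longleftrightarrow>
     (\<exists>\<alpha> \<beta> :: spectral_fun. \<forall>W \<Psi>. open W \<longrightarrow> W \<subseteq> U \<times> UNIV \<longrightarrow> admissible W \<Psi> \<longrightarrow>
        (\<forall>s\<in>W. L0 \<Theta> f (L1 \<Theta> f \<Psi>) s - L1 \<Theta> f (L0 \<Theta> f \<Psi>) s
               = \<alpha> s * L0 \<Theta> f \<Psi> s + \<beta> s * L1 \<Theta> f \<Psi> s))"

end

theory Submission
  imports Defs
begin

text \<open>A parallel primed spinor \<open>\<iota>\<close> spans, with the unprimed spinors, a totally null plane field which is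
  parallel, and the connection on the unprimed spinors is trace-free. The plane field therefore has commuting sections
  \<open>V\<^sub>1, V\<^sub>2\<close>, and flowing along them from a transversal surface, on which the parallel
  two-form \<open>sig\<close> built from \<open>\<iota> \<otimes> \<iota>\<close> is normalised, gives coordinates \<open>(w, z, x, y)\<close>
  with \<open>x, y\<close> along the null planes and with \<open>g\<close> of the form
  \<open>dw dx + dz dy + P dw\<^sup>2 + 2 R dw dz + Q dz\<^sup>2\<close>. Trace-freeness says \<open>Q\<^sub>y = - R\<^sub>x\<close>,
  \<open>P\<^sub>x = - R\<^sub>y\<close>, so two applications of the Poincare lemma give the potential \<open>\<Theta>\<close>. For
  \<open>l\<^sub>0 = \<partial>\<^sub>w - \<Theta>\<^sub>x\<^sub>y \<partial>\<^sub>y + \<Theta>\<^sub>y\<^sub>y \<partial>\<^sub>x\<close> and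
  \<open>l\<^sub>1 = \<partial>\<^sub>z + \<Theta>\<^sub>x\<^sub>x \<partial>\<^sub>y - \<Theta>\<^sub>x\<^sub>y \<partial>\<^sub>x\<close>,
  which span a null plane of the same family as the null planes of \<open>\<iota>\<close>, the component
  \<open>g (R (l\<^sub>0, l\<^sub>1) l\<^sub>1, l\<^sub>0)\<close> of the curvature is one half of \<open>\<square> f\<close> with \<open>f\<close> the left-hand side
  of (1), and it is a component of the self-dual Weyl spinor because every term of the Weyl
  tensor containing the metric vanishes on a totally null plane.

  For the linear system, with \<open>F\<close> the left-hand side of (1) the commutator is
  \<open>[L\<^sub>0, L\<^sub>1] = (f\<^sub>y - F\<^sub>y) \<partial>\<^sub>x + (F\<^sub>x - f\<^sub>x) \<partial>\<^sub>y - (\<square> f) \<partial>\<^sub>\<lambda>\<close>. Since \<open>L\<^sub>0\<close> and \<open>L\<^sub>1\<close> are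
  the only ones of these fields with components along \<open>\<partial>\<^sub>w\<close> and \<open>\<partial>\<^sub>z\<close>, it is a combination of them only if
  it vanishes.\<close>


section \<open>Calculus of functions of class \<open>C\<^sup>k\<close>\<close>

text \<open>Coordinates are built as a map \<open>X\<close> from parameter space into a chart, and
  the connection is pulled back along \<open>X\<close> as \<open>cov\<close>, which avoids
  transformation laws for Christoffel symbols. Since \<open>X\<close> comes from flows and must be
  smooth in the sense of \<open>ck_on\<close>, smooth dependence of flows on parameters is a large
  share of the work; time is one coordinate of the parameter ball, so a flow together with its
  initial data is a single fixed point. The flow coordinates only normalise \<open>sig\<close>;
  \<open>x\<close> and \<open>y\<close> are afterwards replaced by potentials of twice the pairings
  with the \<open>w\<close>- and \<open>z\<close>-directions. The pairings become 1/2 because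
  \<open>dw dx\<close> is a symmetric product. One curvature component is enough because a parallel
  \<iota> makes the primed connection nilpotent: a complementary spinor has derivative \<gamma>
  times \<iota>, the curvature is \<open>d\<close> of \<gamma>, and
  \<open>g (\<nabla> l1, l0)\<close> turns out to be \<open>(F_x dz - F_y dw) / 2\<close>, whose
  exterior derivative on \<open>(l0, l1)\<close> is half the wave operator on \<open>F\<close>.
  \<open>L0\<close> and \<open>L1\<close> contain only \<open>f_x\<close> and \<open>f_y\<close>, so
  integrability determines \<open>f\<close> up to a summand annihilated by both derivatives.\<close>

abbreviation dd :: "'a::real_normed_vector \<Rightarrow> ('a \<Rightarrow> 'b::real_normed_vector) \<Rightarrow> 'a \<Rightarrow> 'b" where
  "dd v F \<equiv> (\<lambda>q. frechet_derivative F (at q) v)"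

lemma frechet_derivative_eqI:
  "(F has_derivative D) (at q) \<Longrightarrow> frechet_derivative F (at q) = D"
  by (rule frechet_derivative_at [symmetric])

lemma has_derivative_cong_open:
  assumes "open S" "\<And>q. q \<in> S \<Longrightarrow> F q = G q" "q \<in> S"
  shows "(F has_derivative D) (at q) \<longleftrightarrow> (G has_derivative D) (at q)"
  using has_derivative_transform_within_open[OF _ assms(1,3), of F D UNIV G]
    has_derivative_transform_within_open[OF _ assms(1,3), of G D UNIV F] assms(2) by auto

lemma frechet_derivative_cong_open:
  assumes "open S" "\<And>q. q \<in> S \<Longrightarrow> F q = G q" "q \<in> S"
  shows "frechet_derivative F (at q) = frechet_derivative G (at q)"
  unfolding frechet_derivative_def using has_derivative_cong_open[OF assms] by simp

lemma ck_on_subset: "ck_on k S F \<Longrightarrow> T \<subseteq> S \<Longrightarrow> ck_on k T F"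
proof (induction k arbitrary: F)
  case 0
  then show ?case by (auto intro: continuous_on_subset)
next
  case (Suc k)
  then show ?case by (simp add: subset_iff)
qed

lemma ck_on_cong:
  assumes "open S" "\<And>q. q \<in> S \<Longrightarrow> F q = G q"
  shows "ck_on k S F \<longleftrightarrow> ck_on k S G"
  using assms(2)
proof (induction k arbitrary: F G)
  case 0
  then show ?case by (simp cong: continuous_on_cong)
next
  case (Suc k)
  have "ck_on k S (dd v F) = ck_on k S (dd v G)" for v
    by (rule Suc.IH) (simp add: frechet_derivative_cong_open[OF assms(1) Suc.prems])
  moreover have "F differentiable (at q) \<longleftrightarrow> G differentiable (at q)" if "q \<in> S" for q
    using has_derivative_cong_open[OF assms(1) Suc.prems that]
    unfolding differentiable_def by simp
  ultimately show ?case by simp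
qed

text \<open>\<open>ck_on\<close> is phrased with \<open>frechet_derivative\<close>; this rule
  accepts a derivative in closed form instead. Openness of \<open>S\<close> makes the two agree on
  neighbourhoods, so that their own derivatives agree too.\<close>

lemma ck_on_SucI:
  assumes "open S" "\<And>q. q \<in> S \<Longrightarrow> (F has_derivative F' q) (at q)"
    "\<And>v. ck_on k S (\<lambda>q. F' q v)"
  shows "ck_on (Suc k) S F"
proof -
  have "ck_on k S (dd v F)" for v
    using assms(3)[of v] ck_on_cong[OF assms(1), of "dd v F" "\<lambda>q. F' q v"]
      frechet_derivative_eqI[OF assms(2)] by simp
  then show ?thesis
    using assms(2) by (auto simp: differentiable_def)
qed

lemma ck_on_Suc_has_derivative:
  "ck_on (Suc k) S F \<Longrightarrow> q \<in> S \<Longrightarrow> (F has_derivative frechet_derivative F (at q)) (at q)"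
  by (simp add: frechet_derivative_works[symmetric])

lemma ck_on_Suc_dd: "ck_on (Suc k) S F \<Longrightarrow> ck_on k S (dd v F)"
  by simp

lemma ck_on_imp_continuous_on: "ck_on k S F \<Longrightarrow> continuous_on S F"
  by (cases k) (auto intro!: continuous_at_imp_continuous_on differentiable_imp_continuous_within)

lemma ck_on_SucD: "ck_on (Suc k) S F \<Longrightarrow> ck_on k S F"
proof (induction k arbitrary: F)
  case 0
  then show ?case using ck_on_imp_continuous_on[of "Suc 0"] by simp
next
  case (Suc k)
  have "ck_on k S (dd v F)" for v
    using Suc.IH[of "dd v F"] Suc.prems by simp
  then show ?case using Suc.prems by simp
qed

lemma ck_on_le: "ck_on m S F \<Longrightarrow> k \<le> m \<Longrightarrow> ck_on k S F"
proof (induction m)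
  case (Suc m)
  then show ?case by (cases "k = Suc m") (auto dest: ck_on_SucD simp del: ck_on.simps(2))
qed simp

lemma ck_on_const [simp]: "ck_on k S (\<lambda>q. c)"
  by (induction k arbitrary: c) auto

lemma ck_on_bounded_linear:
  assumes "bounded_linear h" shows "ck_on k S h"
proof (cases k)
  case 0
  then show ?thesis using assms by (simp add: linear_continuous_on)
next
  case (Suc m)
  have "(h has_derivative h) (at q)" for q
    using assms by (rule bounded_linear_imp_has_derivative)
  then have "frechet_derivative h (at q) = h" for q
    by (rule frechet_derivative_eqI)
  then show ?thesis using assms Suc
    by (auto intro: bounded_linear_imp_differentiable)
qed

lemma ck_on_ident [simp]: "ck_on k S (\<lambda>q. q)"
  by (rule ck_on_bounded_linear) (rule bounded_linear_ident)

lemma ck_on_linear_compose: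
  assumes "bounded_linear h" "open S" "ck_on k S F" shows "ck_on k S (\<lambda>q. h (F q))"
  using assms(3)
proof (induction k arbitrary: F)
  case 0
  then show ?case using continuous_on_compose2[OF linear_continuous_on[OF assms(1), of UNIV], of S F]
    by simp
next
  case (Suc k)
  show ?case
    by (rule ck_on_SucI[OF assms(2)
          bounded_linear.has_derivative[OF assms(1) ck_on_Suc_has_derivative[OF Suc.prems]]])
      (assumption | rule Suc.IH[OF ck_on_Suc_dd[OF Suc.prems]])+
qed

lemma ck_on_add:
  assumes "open S" "ck_on k S F" "ck_on k S G" shows "ck_on k S (\<lambda>q. F q + G q)"
  using assms(2,3)
proof (induction k arbitrary: F G)
  case 0
  then show ?case by (simp add: continuous_on_add)
next
  case (Suc k)
  show ?case
    by (rule ck_on_SucI[OF assms(1) has_derivative_add[OF ck_on_Suc_has_derivative[OF Suc.prems(1)]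
            ck_on_Suc_has_derivative[OF Suc.prems(2)]]])
      (assumption | rule Suc.IH[OF ck_on_Suc_dd[OF Suc.prems(1)] ck_on_Suc_dd[OF Suc.prems(2)]])+
qed

lemma ck_on_minus: "open S \<Longrightarrow> ck_on k S F \<Longrightarrow> ck_on k S (\<lambda>q. - F q)"
  using ck_on_linear_compose[OF bounded_linear_minus[OF bounded_linear_ident]] by blast

lemma ck_on_diff:
  "open S \<Longrightarrow> ck_on k S F \<Longrightarrow> ck_on k S G \<Longrightarrow> ck_on k S (\<lambda>q. F q - G q)"
  using ck_on_add[of S k F "\<lambda>q. - G q"] ck_on_minus[of S k G] by simp

lemma ck_on_sum:
  assumes "open S" "\<And>i. i \<in> I \<Longrightarrow> ck_on k S (F i)" shows "ck_on k S (\<lambda>q. \<Sum>i\<in>I. F i q)"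
  using assms(2) by (induction I rule: infinite_finite_induct) (auto intro!: ck_on_add assms(1))

lemma (in bounded_bilinear) ck_on:
  assumes "open S" "ck_on k S F" "ck_on k S G" shows "ck_on k S (\<lambda>q. prod (F q) (G q))"
  using assms(2,3)
proof (induction k arbitrary: F G)
  case 0
  then show ?case using continuous_on[of S F G] by simp
next
  case (Suc k)
  note FG = ck_on_SucD[OF Suc.prems(1)] ck_on_SucD[OF Suc.prems(2)]
    ck_on_Suc_dd[OF Suc.prems(1)] ck_on_Suc_dd[OF Suc.prems(2)]
  show ?case
    by (rule ck_on_SucI[OF assms(1) FDERIV[OF ck_on_Suc_has_derivative[OF Suc.prems(1)]
            ck_on_Suc_has_derivative[OF Suc.prems(2)]]])
      (assumption | rule ck_on_add assms(1) Suc.IH FG)+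
qed

lemmas ck_on_mult = bounded_bilinear.ck_on[OF bounded_bilinear_mult]
lemmas ck_on_scaleR = bounded_bilinear.ck_on[OF bounded_bilinear_scaleR]
lemmas ck_on_inner = bounded_bilinear.ck_on[OF bounded_bilinear_inner]

lemma ck_on_prod:
  fixes F :: "'i \<Rightarrow> 'a::real_normed_vector \<Rightarrow> real"
  assumes "open S" "\<And>i. i \<in> I \<Longrightarrow> ck_on k S (F i)" shows "ck_on k S (\<lambda>q. \<Prod>i\<in>I. F i q)"
  using assms(2) by (induction I rule: infinite_finite_induct) (auto intro!: ck_on_mult assms(1))

text \<open>The derivative of \<open>1/F\<close> is \<open>-(1/F) F' (1/F)\<close>: the inverse
  itself reappears, and its regularity of order \<open>k\<close> is what the induction
  supplies.\<close>

lemma ck_on_inverse: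
  fixes F :: "'a::real_normed_vector \<Rightarrow> real"
  assumes "open S" "ck_on k S F" "\<And>q. q \<in> S \<Longrightarrow> F q \<noteq> 0"
  shows "ck_on k S (\<lambda>q. inverse (F q))"
  using assms(2)
proof (induction k)
  case 0
  then show ?case using assms(3) by (auto intro!: continuous_on_inverse)
next
  case (Suc k)
  have I: "ck_on k S (\<lambda>q. inverse (F q))"
    by (rule Suc.IH[OF ck_on_SucD[OF Suc.prems]])
  show ?case
    by (rule ck_on_SucI[OF assms(1) has_derivative_compose[OF ck_on_Suc_has_derivative[OF Suc.prems]
            has_derivative_inverse'[OF assms(3)]]])
      (assumption | rule ck_on_minus ck_on_mult assms(1) I ck_on_Suc_dd[OF Suc.prems])+
qed

lemma ck_on_divide:
  fixes F G :: "'a::real_normed_vector \<Rightarrow> real"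
  shows "open S \<Longrightarrow> ck_on k S F \<Longrightarrow> ck_on k S G \<Longrightarrow> (\<And>q. q \<in> S \<Longrightarrow> G q \<noteq> 0) \<Longrightarrow>
    ck_on k S (\<lambda>q. F q / G q)"
  unfolding divide_inverse by (intro ck_on_mult ck_on_inverse)

lemma linear_eq_sum_Basis:
  fixes h :: "'a::euclidean_space \<Rightarrow> 'b::real_vector"
  assumes "linear h" shows "h v = (\<Sum>b\<in>Basis. (v \<bullet> b) *\<^sub>R h b)"
proof -
  have "h v = h (\<Sum>b\<in>Basis. (v \<bullet> b) *\<^sub>R b)" by (simp add: euclidean_representation)
  also have "\<dots> = (\<Sum>b\<in>Basis. (v \<bullet> b) *\<^sub>R h b)"
    using assms by (simp add: linear_sum linear_cmul)
  finally show ?thesis .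
qed

text \<open>\<open>ck_on\<close> speaks of fixed directions, but the chain rule differentiates
  \<open>F\<close> in the moving direction \<open>dd v G q\<close>. Expanding it over
  \<open>Basis\<close> leaves fixed directions of \<open>F\<close> composed with \<open>G\<close>,
  to which the induction hypothesis applies.\<close>

lemma ck_on_compose:
  fixes F :: "'b::euclidean_space \<Rightarrow> 'c::real_normed_vector"
  assumes "open S" "ck_on k T F" "ck_on k S G" "G ` S \<subseteq> T"
  shows "ck_on k S (\<lambda>q. F (G q))"
  using assms(2,3)
proof (induction k arbitrary: F)
  case 0
  then show ?case using assms(4) by (auto intro: continuous_on_compose2)
next
  case (Suc k)
  have F: "(F has_derivative frechet_derivative F (at (G q))) (at (G q))" if "q \<in> S" for q
    using ck_on_Suc_has_derivative[OF Suc.prems(1)] that assms(4) by blast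
  have eq: "(\<Sum>b\<in>Basis. (dd v G q \<bullet> b) *\<^sub>R dd b F (G q)) = frechet_derivative F (at (G q)) (dd v G q)"
    if "q \<in> S" for q v
    using linear_eq_sum_Basis[OF has_derivative_linear[OF F[OF that]], of "dd v G q"] by simp
  have "((\<lambda>q. F (G q)) has_derivative
      (\<lambda>v. \<Sum>b\<in>Basis. (dd v G q \<bullet> b) *\<^sub>R dd b F (G q))) (at q)" if "q \<in> S" for q
    unfolding eq[OF that]
    by (rule has_derivative_compose[OF ck_on_Suc_has_derivative[OF Suc.prems(2) that] F[OF that]])
  then show ?case
    by (rule ck_on_SucI[OF assms(1)])
      (auto intro!: ck_on_sum ck_on_scaleR ck_on_inner assms(1) Suc.IH[of "dd _ F"]
        ck_on_Suc_dd[OF Suc.prems(1)] ck_on_Suc_dd[OF Suc.prems(2)] ck_on_SucD[OF Suc.prems(2)])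
qed

lemma ck_on_vec:
  fixes F :: "'a::real_normed_vector \<Rightarrow> real^'n"
  assumes "open S" "\<And>i. ck_on k S (\<lambda>q. F q $ i)" shows "ck_on k S F"
proof -
  have *: "ck_on k S (\<lambda>q. \<Sum>i\<in>UNIV. F q $ i *\<^sub>R axis i 1)"
    by (intro ck_on_sum ck_on_scaleR assms ck_on_const)
  have "(\<lambda>q. \<Sum>i\<in>UNIV. F q $ i *\<^sub>R axis i 1) = F"
    using basis_expansion[of "F _"] by (simp add: scalar_mult_eq_scaleR fun_eq_iff)
  then show ?thesis by (rule subst[where P = "ck_on k S"]) (rule *)
qed

lemma ck_on_vec_nth:
  "open S \<Longrightarrow> ck_on k S F \<Longrightarrow> ck_on k S (\<lambda>q. F q $ i)"
  using ck_on_linear_compose[OF bounded_linear_vec_nth] by blast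

lemma ck_on_det:
  fixes M :: "'a::real_normed_vector \<Rightarrow> real^'n^'n"
  assumes "open S" "\<And>i j. ck_on k S (\<lambda>q. M q $ i $ j)" shows "ck_on k S (\<lambda>q. det (M q))"
  unfolding det_def by (intro ck_on_sum ck_on_mult ck_on_prod ck_on_const assms)

section \<open>Closure properties of smooth functions\<close>

lemma smooth_on_subset: "smooth_on S F \<Longrightarrow> T \<subseteq> S \<Longrightarrow> smooth_on T F"
  unfolding smooth_on_def using ck_on_subset by blast

lemma smooth_on_cong:
  "open S \<Longrightarrow> (\<And>q. q \<in> S \<Longrightarrow> F q = G q) \<Longrightarrow> smooth_on S F \<longleftrightarrow> smooth_on S G"
  unfolding smooth_on_def using ck_on_cong by blast

lemma smooth_on_has_derivative:
  "smooth_on S F \<Longrightarrow> q \<in> S \<Longrightarrow> (F has_derivative frechet_derivative F (at q)) (at q)"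
  unfolding smooth_on_def using ck_on_Suc_has_derivative by blast

lemma smooth_on_imp_continuous_on: "smooth_on S F \<Longrightarrow> continuous_on S F"
  unfolding smooth_on_def using ck_on_imp_continuous_on by blast

lemma smooth_on_dd: "smooth_on S F \<Longrightarrow> smooth_on S (dd v F)"
  unfolding smooth_on_def using ck_on_Suc_dd by blast

lemma smooth_on_pd: "smooth_on S F \<Longrightarrow> smooth_on S (pd i F)"
  unfolding pd_def by (rule smooth_on_dd)

lemma smooth_on_const [simp]: "smooth_on S (\<lambda>q. c)"
  by (simp add: smooth_on_def)

lemma smooth_on_ident [simp]: "smooth_on S (\<lambda>q. q)"
  by (simp add: smooth_on_def)

lemma smooth_on_bounded_linear: "bounded_linear h \<Longrightarrow> smooth_on S h"
  by (simp add: smooth_on_def ck_on_bounded_linear)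

lemma smooth_on_linear_compose:
  "bounded_linear h \<Longrightarrow> open S \<Longrightarrow> smooth_on S F \<Longrightarrow> smooth_on S (\<lambda>q. h (F q))"
  by (simp add: smooth_on_def ck_on_linear_compose)

lemma smooth_on_add:
  "open S \<Longrightarrow> smooth_on S F \<Longrightarrow> smooth_on S G \<Longrightarrow> smooth_on S (\<lambda>q. F q + G q)"
  by (simp add: smooth_on_def ck_on_add)

lemma smooth_on_minus: "open S \<Longrightarrow> smooth_on S F \<Longrightarrow> smooth_on S (\<lambda>q. - F q)"
  by (simp add: smooth_on_def ck_on_minus)

lemma smooth_on_diff:
  "open S \<Longrightarrow> smooth_on S F \<Longrightarrow> smooth_on S G \<Longrightarrow> smooth_on S (\<lambda>q. F q - G q)"
  by (simp add: smooth_on_def ck_on_diff)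

lemma smooth_on_sum:
  "open S \<Longrightarrow> (\<And>i. i \<in> I \<Longrightarrow> smooth_on S (F i)) \<Longrightarrow> smooth_on S (\<lambda>q. \<Sum>i\<in>I. F i q)"
  by (simp add: smooth_on_def ck_on_sum)

lemma (in bounded_bilinear) smooth_on:
  "open S \<Longrightarrow> smooth_on S F \<Longrightarrow> smooth_on S G \<Longrightarrow> smooth_on S (\<lambda>q. prod (F q) (G q))"
  by (simp add: smooth_on_def ck_on)

lemmas smooth_on_mult = bounded_bilinear.smooth_on[OF bounded_bilinear_mult]
lemmas smooth_on_scaleR = bounded_bilinear.smooth_on[OF bounded_bilinear_scaleR]
lemmas smooth_on_inner = bounded_bilinear.smooth_on[OF bounded_bilinear_inner]

lemma smooth_on_power:
  fixes F :: "'a::real_normed_vector \<Rightarrow> real"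
  shows "open S \<Longrightarrow> smooth_on S F \<Longrightarrow> smooth_on S (\<lambda>q. F q ^ n)"
  by (induction n) (auto intro: smooth_on_mult)

lemma smooth_on_divide:
  fixes F G :: "'a::real_normed_vector \<Rightarrow> real"
  shows "open S \<Longrightarrow> smooth_on S F \<Longrightarrow> smooth_on S G \<Longrightarrow> (\<And>q. q \<in> S \<Longrightarrow> G q \<noteq> 0) \<Longrightarrow>
    smooth_on S (\<lambda>q. F q / G q)"
  by (simp add: smooth_on_def ck_on_divide)

lemma smooth_on_compose:
  fixes F :: "'b::euclidean_space \<Rightarrow> 'c::real_normed_vector"
  shows "open S \<Longrightarrow> smooth_on T F \<Longrightarrow> smooth_on S G \<Longrightarrow> G ` S \<subseteq> T \<Longrightarrow>
    smooth_on S (\<lambda>q. F (G q))"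
  unfolding smooth_on_def using ck_on_compose by blast

lemma smooth_on_vec:
  fixes F :: "'a::real_normed_vector \<Rightarrow> real^'n"
  shows "open S \<Longrightarrow> (\<And>i. smooth_on S (\<lambda>q. F q $ i)) \<Longrightarrow> smooth_on S F"
  by (simp add: smooth_on_def ck_on_vec)

lemma smooth_on_vec_nth: "open S \<Longrightarrow> smooth_on S F \<Longrightarrow> smooth_on S (\<lambda>q. F q $ i)"
  by (simp add: smooth_on_def ck_on_vec_nth)

lemma smooth_on_coord: "open S \<Longrightarrow> smooth_on S (\<lambda>q. q $ i)"
  using smooth_on_vec_nth[OF _ smooth_on_ident] .

lemma smooth_on_mat_nth:
  fixes F :: "'a::real_normed_vector \<Rightarrow> real^'n^'m"
  assumes "open S" "smooth_on S F" shows "smooth_on S (\<lambda>q. F q $ i $ j)"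
  by (rule smooth_on_linear_compose[OF bounded_linear_compose[OF bounded_linear_vec_nth
          bounded_linear_vec_nth] assms])

section \<open>Differentiation under the integral sign, symmetry of second derivatives, smooth
  inverse functions\<close>

lemma has_derivative_integral_param:
  fixes f :: "'a::euclidean_space \<Rightarrow> real \<Rightarrow> 'c::banach"
  assumes U: "open U" "convex U" "x0 \<in> U"
    and f: "\<And>x t. x \<in> U \<Longrightarrow> t \<in> {0..1} \<Longrightarrow> ((\<lambda>x. f x t) has_derivative f' x t) (at x)"
    and fc: "\<And>x. x \<in> U \<Longrightarrow> continuous_on {0..1} (f x)"
    and fc': "\<And>v. continuous_on (U \<times> {0..1}) (\<lambda>(x, t). f' x t v)"
  shows "((\<lambda>x. integral {0..1} (f x)) has_derivative (\<lambda>v. integral {0..1} (\<lambda>t. f' x0 t v))) (at x0)"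
proof -
  \<comment> \<open>The Leibniz rule requires the derivative as a continuous family of bounded
    linear functions. In finite dimension continuity in each basis direction is enough.\<close>
  define B where "B x t = Blinfun (f' x t)" for x t
  have B: "blinfun_apply (B x t) = f' x t" if "x \<in> U" "t \<in> {0..1}" for x t
    unfolding B_def by (rule bounded_linear_Blinfun_apply[OF has_derivative_bounded_linear[OF f[OF that]]])
  have cB: "continuous_on (U \<times> {0..1}) (\<lambda>(x, t). B x t)"
  proof (rule continuous_on_blinfun_componentwise)
    fix i :: 'a assume "i \<in> Basis"
    show "continuous_on (U \<times> {0..1}) (\<lambda>x. blinfun_apply (case x of (x, t) \<Rightarrow> B x t) i)"
      by (rule continuous_on_eq[OF fc'[of i]]) (auto simp: B)
  qed
  have L: "((\<lambda>x. integral (cbox 0 1) (f x)) has_derivative integral (cbox 0 1) (B x0)) (at x0 within U)"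
  proof (rule leibniz_rule[where fx = B and f = f, OF _ _ _ U(3,2)])
    fix x t assume x: "x \<in> U" and "t \<in> cbox 0 (1::real)"
    then have t: "t \<in> {0..1}" by simp
    show "((\<lambda>x. f x t) has_derivative blinfun_apply (B x t)) (at x within U)"
      unfolding B[OF x t] by (rule has_derivative_at_withinI[OF f[OF x t]])
  next
    show "f x integrable_on cbox 0 1" if "x \<in> U" for x
      using integrable_continuous_interval[OF fc[OF that]] by simp
    show "continuous_on (U \<times> cbox 0 1) (\<lambda>(x, t). B x t)"
      using cB by simp
  qed
  have W: "at x0 within U = at x0"
    by (rule at_within_open[OF U(3,1)])
  have "blinfun_apply (integral {0..1} (B x0)) = (\<lambda>v. integral {0..1} (\<lambda>t. f' x0 t v))"
  proof
    fix v
    have "continuous_on {0..1} (\<lambda>t::real. (x0, t))"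
      by (intro continuous_intros)
    then have "continuous_on {0..1} (B x0)"
      using continuous_on_compose2[OF cB, of "{0..1}" "\<lambda>t. (x0, t)"] U(3) by auto
    then have "B x0 integrable_on {0..1}"
      by (rule integrable_continuous_interval)
    then have "blinfun_apply (integral {0..1} (B x0)) v = integral {0..1} (\<lambda>t. blinfun_apply (B x0 t) v)"
      using integral_linear[OF _ bounded_bilinear.bounded_linear_left[OF bounded_bilinear_blinfun_apply], of "B x0" "{0..1}" v]
      by (simp add: o_def)
    also have "\<dots> = integral {0..1} (\<lambda>t. f' x0 t v)"
      by (rule integral_cong) (simp add: B U(3))
    finally show "blinfun_apply (integral {0..1} (B x0)) v = integral {0..1} (\<lambda>t. f' x0 t v)" .
  qed
  with L[unfolded W box_real] show ?thesis by (simp only:)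
qed

lemma continuous_on_ray:
  "continuous_on T (\<lambda>t. x + (t * s) *\<^sub>R (u::'a::real_normed_vector))"
  by (intro continuous_intros)

text \<open>Write \<open>F (x + s u) - F x\<close> as an integral of \<open>D\<^sub>u F\<close>, differentiate it under the integral sign
  in the direction \<open>v\<close> and then with respect to \<open>s\<close>.\<close>

lemma dd_commute:
  fixes F :: "'a::euclidean_space \<Rightarrow> 'b::banach"
  assumes S: "open S" "q \<in> S" and F: "ck_on (Suc (Suc 0)) S F"
  shows "dd u (dd v F) q = dd v (dd u F) q"
proof -
  obtain e where e: "e > 0" "ball q e \<subseteq> S"
    using S open_contains_ball by blast
  \<comment> \<open>With this bound on \<open>s\<close> the displacement \<open>s u\<close> has
    length at most \<open>e / 2\<close>, the other half of \<open>e\<close> being left to the base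
    point; the summand 1 covers \<open>u = 0\<close>.\<close>
  define d where "d = e / (2 * (norm u + 1))"
  have d: "d > 0" unfolding d_def using e(1) by (intro divide_pos_pos mult_pos_pos) (auto intro: add_nonneg_pos)
  define U where "U = ball q (e / 2)"
  have U: "open U" "convex U" "q \<in> U" using e(1) by (auto simp: U_def)
  have inS: "x + (t * s) *\<^sub>R u \<in> S" if "x \<in> U" "\<bar>s\<bar> < d" "t \<in> {0..1}" for x t s
  proof -
    have "\<bar>t * s\<bar> \<le> \<bar>s\<bar>" using that(3) by (simp add: abs_mult mult_left_le_one_le)
    then have "norm ((t * s) *\<^sub>R u) \<le> d * (norm u + 1)"
      unfolding norm_scaleR using that(2) d by (intro mult_mono) auto
    also have "\<dots> = e / 2" unfolding d_def using norm_ge_zero[of u]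
      by (simp add: field_simps add_nonneg_eq_0_iff)
    finally have "dist x (x + (t * s) *\<^sub>R u) \<le> e / 2"
      by (simp add: dist_norm)
    moreover have "dist q x < e / 2" using that(1) by (simp add: U_def)
    ultimately have "dist q (x + (t * s) *\<^sub>R u) < e"
      using dist_triangle[of q "x + (t * s) *\<^sub>R u" x] by linarith
    then show ?thesis using e(2) by auto
  qed
  have dF: "(F has_derivative frechet_derivative F (at x)) (at x)" if "x \<in> S" for x
    using ck_on_Suc_has_derivative[OF F that] .
  have F1: "ck_on (Suc 0) S (dd w F)" for w using ck_on_Suc_dd[OF F] .
  have d2F: "(dd w F has_derivative frechet_derivative (dd w F) (at x)) (at x)" if "x \<in> S" for x w
    using ck_on_Suc_has_derivative[OF F1 that] .
  have c1: "continuous_on S (dd w F)" for w using ck_on_imp_continuous_on[OF F1] .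
  have c2: "continuous_on S (dd w (dd w' F))" for w w'
    using ck_on_imp_continuous_on[OF ck_on_Suc_dd[OF F1]] .
  define I where "I s = integral {0..1} (\<lambda>t. dd v (dd u F) (q + (t * s) *\<^sub>R u))" for s
  have key: "dd v F (q + s *\<^sub>R u) - dd v F q = s *\<^sub>R I s" if s: "\<bar>s\<bar> < d" for s
  proof -
    have int: "((\<lambda>t. s *\<^sub>R dd u F (x + (t * s) *\<^sub>R u)) has_integral F (x + s *\<^sub>R u) - F x) {0..1}"
      if x: "x \<in> U" for x
    proof -
      have "((\<lambda>t. F (x + (t * s) *\<^sub>R u)) has_vector_derivative s *\<^sub>R dd u F (x + (t * s) *\<^sub>R u))
          (at t within {0..1})" if t: "t \<in> {0..1}" for t
      proof -
        have 1: "((\<lambda>t. x + (t * s) *\<^sub>R u) has_derivative (\<lambda>h. (h * s) *\<^sub>R u)) (at t within {0..1})"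
          by (auto intro!: derivative_eq_intros)
        show ?thesis
          unfolding has_vector_derivative_def
          using has_derivative_compose[OF 1 dF[OF inS[OF x s t]]]
            linear_cmul[OF has_derivative_linear[OF dF[OF inS[OF x s t]]]]
          by (simp add: mult.commute)
      qed
      from fundamental_theorem_of_calculus[OF _ this] show ?thesis by simp
    qed
    have "((\<lambda>x. integral {0..1} (\<lambda>t. s *\<^sub>R dd u F (x + (t * s) *\<^sub>R u))) has_derivative
        (\<lambda>w. integral {0..1} (\<lambda>t. s *\<^sub>R dd w (dd u F) (q + (t * s) *\<^sub>R u)))) (at q)"
    proof (rule has_derivative_integral_param[OF U])
      fix x and t :: real assume x: "x \<in> U" and t: "t \<in> {0..1}"
      have 1: "((\<lambda>x. x + (t * s) *\<^sub>R u) has_derivative (\<lambda>w. w)) (at x)"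
        by (auto intro!: derivative_eq_intros)
      show "((\<lambda>x. s *\<^sub>R dd u F (x + (t * s) *\<^sub>R u)) has_derivative
          (\<lambda>w. s *\<^sub>R dd w (dd u F) (x + (t * s) *\<^sub>R u))) (at x)"
        by (rule has_derivative_scaleR_right[OF has_derivative_compose[OF 1 d2F[OF inS[OF x s t]]]])
    next
      fix x assume x: "x \<in> U"
      show "continuous_on {0..1} (\<lambda>t. s *\<^sub>R dd u F (x + (t * s) *\<^sub>R u))"
        by (rule continuous_on_scaleR[OF continuous_on_const continuous_on_compose2[OF c1 continuous_on_ray]])
          (use inS[OF x s] in auto)
    next
      fix w
      have *: "continuous_on (U \<times> {0..1}) (\<lambda>z. fst z + (snd z * s) *\<^sub>R u)"
        by (intro continuous_intros)
      show "continuous_on (U \<times> {0..1}) (\<lambda>(x, t). s *\<^sub>R dd w (dd u F) (x + (t * s) *\<^sub>R u))"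
        unfolding case_prod_beta
        by (rule continuous_on_scaleR[OF continuous_on_const continuous_on_compose2[OF c2 *]])
          (use inS[OF _ s] in auto)
    qed
    then have A: "((\<lambda>x. F (x + s *\<^sub>R u) - F x) has_derivative
        (\<lambda>w. integral {0..1} (\<lambda>t. s *\<^sub>R dd w (dd u F) (q + (t * s) *\<^sub>R u)))) (at q)"
      by (rule has_derivative_transform_within_open[OF _ U(1,3)]) (rule integral_unique[OF int])
    have 1: "((\<lambda>x. x + s *\<^sub>R u) has_derivative (\<lambda>w. w)) (at q)"
      by (auto intro!: derivative_eq_intros)
    have "((\<lambda>x. F (x + s *\<^sub>R u) - F x) has_derivative (\<lambda>w. dd w F (q + s *\<^sub>R u) - dd w F q)) (at q)"
      by (rule has_derivative_diff[OF has_derivative_compose[OF 1 dF] dF[OF S(2)]])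
        (use inS[OF U(3) s, of 1] in simp)
    from has_derivative_unique[OF this A]
    have "dd v F (q + s *\<^sub>R u) - dd v F q = integral {0..1} (\<lambda>t. s *\<^sub>R dd v (dd u F) (q + (t * s) *\<^sub>R u))"
      by meson
    then show ?thesis by (simp add: I_def)
  qed
  have "continuous_on {-d<..<d} (\<lambda>s. integral (cbox 0 1) (\<lambda>t. dd v (dd u F) (q + (t * s) *\<^sub>R u)))"
  proof (rule integral_continuous_on_param)
    have *: "continuous_on ({-d<..<d} \<times> cbox 0 1) (\<lambda>z::real\<times>real. q + (snd z * fst z) *\<^sub>R u)"
      by (intro continuous_intros)
    show "continuous_on ({-d<..<d} \<times> cbox 0 1) (\<lambda>(s, t). dd v (dd u F) (q + (t * s) *\<^sub>R u))"
      unfolding case_prod_beta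
      by (rule continuous_on_compose2[OF c2 *]) (use inS[OF U(3)] in auto)
  qed
  then have "isCont I 0"
    unfolding I_def using d by (simp add: continuous_on_eq_continuous_at)
  then have I0: "(\<lambda>h. norm (I h - I 0)) \<midarrow>0\<rightarrow> 0"
    unfolding isCont_def using tendsto_norm_zero LIM_zero by blast
  have "((\<lambda>s. dd v F (q + s *\<^sub>R u)) has_vector_derivative I 0) (at 0)"
    unfolding has_vector_derivative_def has_derivative_at
  proof (intro conjI bounded_linear_scaleR_left)
    show "(\<lambda>h. norm (dd v F (q + (0 + h) *\<^sub>R u) - dd v F (q + 0 *\<^sub>R u) - h *\<^sub>R I 0) / norm h) \<midarrow>0\<rightarrow> 0"
    proof (rule Lim_transform_within[OF I0 d])
      fix h :: real assume h: "0 < dist h 0" "dist h 0 < d"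
      have "dd v F (q + (0 + h) *\<^sub>R u) - dd v F (q + 0 *\<^sub>R u) - h *\<^sub>R I 0 = h *\<^sub>R (I h - I 0)"
        using key[of h] h by (simp add: dist_norm scaleR_diff_right)
      then show "norm (I h - I 0) =
          norm (dd v F (q + (0 + h) *\<^sub>R u) - dd v F (q + 0 *\<^sub>R u) - h *\<^sub>R I 0) / norm h"
        using h by (simp only: norm_scaleR) (simp add: dist_norm)
    qed
  qed
  moreover have "((\<lambda>s. dd v F (q + s *\<^sub>R u)) has_vector_derivative dd u (dd v F) q) (at 0)"
  proof -
    have 1: "((\<lambda>s. q + s *\<^sub>R u) has_derivative (\<lambda>h. h *\<^sub>R u)) (at (0::real))"
      by (auto intro!: derivative_eq_intros)
    have 2: "(dd v F has_derivative frechet_derivative (dd v F) (at q)) (at (q + 0 *\<^sub>R u))"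
      using d2F[OF S(2)] by simp
    show ?thesis
      unfolding has_vector_derivative_def
      using has_derivative_compose[OF 1 2] linear_cmul[OF has_derivative_linear[OF d2F[OF S(2)]]]
      by simp
  qed
  ultimately have "dd u (dd v F) q = I 0"
    using vector_derivative_unique_at by metis
  then show ?thesis by (simp add: I_def)
qed

lemma smooth_on_dd_commute:
  fixes F :: "'a::euclidean_space \<Rightarrow> 'b::banach"
  shows "open S \<Longrightarrow> smooth_on S F \<Longrightarrow> q \<in> S \<Longrightarrow> dd u (dd v F) q = dd v (dd u F) q"
  by (rule dd_commute) (auto simp: smooth_on_def simp del: ck_on.simps)

lemma pd_commute:
  fixes F :: "real^4 \<Rightarrow> 'b::banach"
  shows "open S \<Longrightarrow> smooth_on S F \<Longrightarrow> q \<in> S \<Longrightarrow> pd i (pd j F) q = pd j (pd i F) q"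
  unfolding pd_def by (rule smooth_on_dd_commute)

text \<open>The inverse function theorem yields a differentiable inverse \<open>g\<close>. By
  Cramer's rule its derivative is a rational function of the entries of the derivative of
  \<open>f\<close> at \<open>g y\<close>, so regularity \<open>k\<close> of \<open>g\<close>
  improves to \<open>k + 1\<close>.\<close>

lemma smooth_inverse_function:
  fixes f :: "real^'n \<Rightarrow> real^'n"
  assumes S: "open S" "x0 \<in> S" and f: "smooth_on S f"
    and inj: "inj (frechet_derivative f (at x0))"
  obtains U V g where "open U" "x0 \<in> U" "U \<subseteq> S" "open V" "homeomorphism U V f g" "smooth_on V g"
proof -
  note df = smooth_on_has_derivative[OF f]
  define f' where "f' x = Blinfun (frechet_derivative f (at x))" for x
  have f': "blinfun_apply (f' x) = frechet_derivative f (at x)" if "x \<in> S" for x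
    unfolding f'_def by (rule bounded_linear_Blinfun_apply[OF has_derivative_bounded_linear[OF df[OF that]]])
  have cf': "continuous_on S f'"
  proof (rule continuous_on_blinfun_componentwise)
    fix i :: "real^'n"
    show "continuous_on S (\<lambda>x. blinfun_apply (f' x) i)"
      by (rule continuous_on_eq[OF smooth_on_imp_continuous_on[OF smooth_on_dd[OF f, of i]]])
        (simp add: f')
  qed
  obtain h where h: "linear h" "h \<circ> frechet_derivative f (at x0) = id"
    using linear_injective_left_inverse[OF has_derivative_linear[OF df[OF S(2)]] inj] by blast
  have "Blinfun h o\<^sub>L f' x0 = id_blinfun"
    using h f'[OF S(2)]
    by (intro blinfun_eqI) (simp add: bounded_linear_Blinfun_apply linear_linear fun_eq_iff)
  then obtain U V g g' where U: "open U" "U \<subseteq> S" "x0 \<in> U" and V: "open V"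
    and hom: "homeomorphism U V f g"
    and g: "\<And>y. y \<in> V \<Longrightarrow> (g has_derivative (g' y)) (at y)"
    and g': "\<And>y. y \<in> V \<Longrightarrow> g' y = inv (blinfun_apply (f' (g y)))"
    and bij: "\<And>y. y \<in> V \<Longrightarrow> bij (blinfun_apply (f' (g y)))"
    using inverse_function_theorem[OF S(1) _ cf' S(2)] df f' by metis
  have gU: "g y \<in> U" if "y \<in> V" for y using hom that by (auto simp: homeomorphism_def)
  define M where "M x = matrix (frechet_derivative f (at x))" for x
  have M: "M x *v v = frechet_derivative f (at x) v" if "x \<in> S" for x v
    unfolding M_def
    using fun_cong[OF matrix_vector_mul(2)[OF has_derivative_linear[OF df[OF that]]]] .
  have Mij: "smooth_on S (\<lambda>x. M x $ i $ j)" for i j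
    unfolding M_def matrix_def
    by (simp, intro smooth_on_vec_nth[OF S(1)] smooth_on_dd f)
  have detM: "det (M (g y)) \<noteq> 0" if "y \<in> V" for y
  proof -
    have "g y \<in> S" using gU[OF that] U by auto
    then show ?thesis
      using bij[OF that] f'[of "g y"] det_nz_iff_inj[OF has_derivative_linear[OF df, of "g y"]]
      by (simp add: M_def bij_is_inj)
  qed
  have cr: "g' y v = (\<chi> k. det (\<chi> i j. if j = k then v $ i else M (g y) $ i $ j) / det (M (g y)))"
    if "y \<in> V" for y v
  proof -
    have gS: "g y \<in> S" using gU[OF that] U by auto
    have "M (g y) *v g' y v = v"
      unfolding M[OF gS] using g'[OF that] f'[OF gS] bij[OF that]
      by (simp add: surj_f_inv_f bij_is_surj)
    then show ?thesis by (rule iffD1[OF cramer[OF detM[OF that]]])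
  qed
  have "ck_on k V g" for k
  proof (induction k)
    case 0
    then show ?case using hom by (simp add: homeomorphism_def)
  next
    case (Suc k)
    have m: "ck_on k V (\<lambda>y. M (g y) $ i $ j)" for i j
      by (rule ck_on_compose[OF V _ Suc.IH, where T = S]) (use Mij gU U in \<open>auto simp: smooth_on_def\<close>)
    have "ck_on k V (\<lambda>y. g' y v)" for v
    proof -
      have "ck_on k V (\<lambda>y. \<chi> k. det (\<chi> i j. if j = k then v $ i else M (g y) $ i $ j) / det (M (g y)))"
      proof (rule ck_on_vec[OF V])
        fix l
        have "ck_on k V (\<lambda>y. det (\<chi> i j. if j = l then v $ i else M (g y) $ i $ j) / det (M (g y)))"
        proof (intro ck_on_divide ck_on_det V m detM)
          show "ck_on k V (\<lambda>y. (\<chi> i j. if j = l then v $ i else M (g y) $ i $ j) $ i $ j)" for i j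
            by (cases "j = l") (auto simp: m)
        qed
        then show "ck_on k V (\<lambda>y. (\<chi> k. det (\<chi> i j. if j = k then v $ i else M (g y) $ i $ j) / det (M (g y))) $ l)"
          by simp
      qed
      then show ?thesis by (rule iffD2[OF ck_on_cong[OF V], rotated]) (rule cr)
    qed
    then show ?case by (rule ck_on_SucI[OF V g, rotated])
  qed
  then have "smooth_on V g" by (simp add: smooth_on_def)
  then show thesis using that U V hom by blast
qed

section \<open>Integration along a coordinate direction\<close>

text \<open>After the substitution \<open>s = t (p \<bullet> b)\<close> this is the integral of
  \<open>h\<close> in the \<open>b\<close>-coordinate from 0 to \<open>p \<bullet> b\<close>.
  Rescaling to the fixed interval \<open>{0..1}\<close> puts all dependence on \<open>p\<close> into
  the integrand.\<close>

definition segint :: "'a::euclidean_space \<Rightarrow> ('a \<Rightarrow> 'b::banach) \<Rightarrow> 'a \<Rightarrow> 'b" where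
  "segint b h p = integral {0..1} (\<lambda>t. (p \<bullet> b) *\<^sub>R h (p + ((t - 1) * (p \<bullet> b)) *\<^sub>R b))"

text \<open>The segment runs from the foot of \<open>p\<close> on the hyperplane orthogonal to
  \<open>b\<close> (\<open>t = 0\<close>) to \<open>p\<close> itself (\<open>t = 1\<close>).\<close>

definition seg_closed :: "'a::euclidean_space \<Rightarrow> 'a set \<Rightarrow> bool" where
  "seg_closed b K \<longleftrightarrow> (\<forall>p\<in>K. \<forall>t\<in>{0..1}. p + ((t - 1) * (p \<bullet> b)) *\<^sub>R b \<in> K)"

lemma seg_closedD:
  "seg_closed b K \<Longrightarrow> p \<in> K \<Longrightarrow> t \<in> {0..1} \<Longrightarrow> p + ((t - 1) * (p \<bullet> b)) *\<^sub>R b \<in> K"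
  by (simp add: seg_closed_def)

text \<open>The \<open>b\<close>-component is multiplied by \<open>t\<close> and the rest is
  unchanged; hence balls about the origin are \<open>seg_closed\<close> in every basis
  direction.\<close>

lemma norm_seg_le:
  assumes "b \<in> Basis" "t \<in> {0..1::real}"
  shows "norm (p + ((t - 1) * (p \<bullet> b)) *\<^sub>R b) \<le> norm p"
proof -
  define s where "s = p \<bullet> b"
  have bb: "b \<bullet> b = 1" using assms(1) by simp
  have "(norm (p + ((t - 1) * s) *\<^sub>R b))\<^sup>2 = (norm p)\<^sup>2 + 2 * ((t - 1) * s) * s + ((t - 1) * s)\<^sup>2"
    unfolding power2_norm_eq_inner inner_add_left inner_add_right
    by (simp add: bb s_def inner_commute power2_eq_square)
  also have "\<dots> = (norm p)\<^sup>2 - (1 - t) * (1 + t) * s\<^sup>2"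
    by (simp add: power2_eq_square algebra_simps)
  also have "\<dots> \<le> (norm p)\<^sup>2" using assms(2) by (simp add: mult_nonneg_nonneg)
  finally show ?thesis unfolding s_def by (rule power2_le_imp_le) simp
qed

lemma seg_closed_ball: "b \<in> Basis \<Longrightarrow> seg_closed b (ball 0 r)"
  unfolding seg_closed_def using norm_seg_le[of b] by (fastforce intro: le_less_trans)

lemma seg_closed_cball: "b \<in> Basis \<Longrightarrow> seg_closed b (cball 0 r)"
  unfolding seg_closed_def using norm_seg_le[of b] by (fastforce intro: order_trans)

lemma continuous_on_seg:
  assumes "seg_closed b K" "continuous_on K h"
  shows "continuous_on (K \<times> {0..1}) (\<lambda>z. h (fst z + ((snd z - 1) * (fst z \<bullet> b)) *\<^sub>R b))"
proof (rule continuous_on_compose2[OF assms(2)])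
  show "continuous_on (K \<times> {0..1}) (\<lambda>z. fst z + ((snd z - 1) * (fst z \<bullet> b)) *\<^sub>R b)"
    by (intro continuous_intros)
qed (auto intro: seg_closedD[OF assms(1)])

lemma continuous_on_seg1:
  assumes "seg_closed b K" "continuous_on K h" "p \<in> K"
  shows "continuous_on {0..1} (\<lambda>t. h (p + ((t - 1) * (p \<bullet> b)) *\<^sub>R b))"
proof (rule continuous_on_compose2[OF assms(2)])
  show "continuous_on {0..1} (\<lambda>t. p + ((t - 1) * (p \<bullet> b)) *\<^sub>R b)"
    by (intro continuous_intros)
qed (auto intro: seg_closedD[OF assms(1,3)])

lemma segint_integrable:
  fixes h :: "'a::euclidean_space \<Rightarrow> 'b::banach"
  assumes "seg_closed b K" "continuous_on K h" "p \<in> K"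
  shows "(\<lambda>t. (p \<bullet> b) *\<^sub>R h (p + ((t - 1) * (p \<bullet> b)) *\<^sub>R b)) integrable_on {0..1}"
  by (rule integrable_continuous_interval[OF continuous_on_scaleR[OF continuous_on_const
        continuous_on_seg1[OF assms]]])

lemma continuous_on_segint:
  assumes "seg_closed b K" "continuous_on K h"
  shows "continuous_on K (segint b h)"
proof -
  have *: "continuous_on (K \<times> cbox 0 1)
      (\<lambda>(p, t). (p \<bullet> b) *\<^sub>R h (p + ((t - 1) * (p \<bullet> b)) *\<^sub>R b))"
    unfolding case_prod_beta box_real
    by (rule continuous_on_scaleR[OF _ continuous_on_seg[OF assms]]) (intro continuous_intros)
  show ?thesis
    using integral_continuous_on_param[OF *] by (simp add: segint_def[abs_def])
qed

lemma norm_segint_le: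
  assumes "seg_closed b K" "continuous_on K h" "p \<in> K" "\<And>p. p \<in> K \<Longrightarrow> norm (h p) \<le> c"
  shows "norm (segint b h p) \<le> \<bar>p \<bullet> b\<bar> * c"
proof -
  have "norm (integral {0..1} (\<lambda>t. (p \<bullet> b) *\<^sub>R h (p + ((t - 1) * (p \<bullet> b)) *\<^sub>R b))) \<le> (\<bar>p \<bullet> b\<bar> * c) * (1 - 0)"
  proof (rule integral_bound)
    show "continuous_on {0..1} (\<lambda>t. (p \<bullet> b) *\<^sub>R h (p + ((t - 1) * (p \<bullet> b)) *\<^sub>R b))"
      by (rule continuous_on_scaleR[OF continuous_on_const continuous_on_seg1[OF assms(1-3)]])
    show "norm ((p \<bullet> b) *\<^sub>R h (p + ((t - 1) * (p \<bullet> b)) *\<^sub>R b)) \<le> \<bar>p \<bullet> b\<bar> * c" if "t \<in> {0..1}" for t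
      using assms(4)[OF seg_closedD[OF assms(1,3) that]] by (simp add: mult_left_mono)
  qed simp
  then show ?thesis by (simp add: segint_def)
qed

lemma segint_diff:
  assumes "seg_closed b K" "continuous_on K h" "continuous_on K k" "p \<in> K"
  shows "segint b h p - segint b k p = segint b (\<lambda>p. h p - k p) p"
  unfolding segint_def scaleR_diff_right
  by (rule integral_diff[symmetric, OF segint_integrable[OF assms(1,2,4)] segint_integrable[OF assms(1,3,4)]])

lemma segint_add:
  assumes "seg_closed b K" "continuous_on K h" "continuous_on K k" "p \<in> K"
  shows "segint b (\<lambda>p. h p + k p) p = segint b h p + segint b k p"
  unfolding segint_def scaleR_add_right
  by (rule integral_add[OF segint_integrable[OF assms(1,2,4)] segint_integrable[OF assms(1,3,4)]])

lemma segint_cong: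
  assumes "seg_closed b K" "p \<in> K" "\<And>p. p \<in> K \<Longrightarrow> h p = k p"
  shows "segint b h p = segint b k p"
  unfolding segint_def
  by (rule integral_cong) (use assms(3)[OF seg_closedD[OF assms(1,2)]] in simp)

lemma segint_eq_0: "p \<bullet> b = 0 \<Longrightarrow> segint b h p = 0"
  by (simp add: segint_def)

text \<open>Both are the fundamental theorem along the segment, applied to \<open>t h\<close> and to
  \<open>h\<close>. The first form is what the moving endpoint contributes to the derivative of
  \<open>segint\<close>.\<close>

lemma has_integral_seg:
  fixes h :: "'a::euclidean_space \<Rightarrow> 'b::banach"
  assumes K: "open K" "seg_closed b K" "p \<in> K" and h: "ck_on (Suc 0) K h"
  shows "((\<lambda>t. h (p + ((t - 1) * (p \<bullet> b)) *\<^sub>R b) +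
      t *\<^sub>R (p \<bullet> b) *\<^sub>R dd b h (p + ((t - 1) * (p \<bullet> b)) *\<^sub>R b)) has_integral h p) {0..1}"
    and "((\<lambda>t. (p \<bullet> b) *\<^sub>R dd b h (p + ((t - 1) * (p \<bullet> b)) *\<^sub>R b)) has_integral
      h p - h (p - (p \<bullet> b) *\<^sub>R b)) {0..1}"
proof -
  have d: "((\<lambda>t. h (p + ((t - 1) * (p \<bullet> b)) *\<^sub>R b)) has_vector_derivative
      (p \<bullet> b) *\<^sub>R dd b h (p + ((t - 1) * (p \<bullet> b)) *\<^sub>R b)) (at t within {0..1})"
    if t: "t \<in> {0..1}" for t
  proof -
    have 1: "((\<lambda>t. p + ((t - 1) * (p \<bullet> b)) *\<^sub>R b) has_derivative (\<lambda>s. (s * (p \<bullet> b)) *\<^sub>R b)) (at t within {0..1})"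
      by (auto intro!: derivative_eq_intros)
    note 2 = ck_on_Suc_has_derivative[OF h seg_closedD[OF K(2,3) t]]
    show ?thesis
      unfolding has_vector_derivative_def
      using has_derivative_compose[OF 1 2] linear_cmul[OF has_derivative_linear[OF 2]]
      by simp
  qed
  from fundamental_theorem_of_calculus[OF _ d]
  show "((\<lambda>t. (p \<bullet> b) *\<^sub>R dd b h (p + ((t - 1) * (p \<bullet> b)) *\<^sub>R b)) has_integral
      h p - h (p - (p \<bullet> b) *\<^sub>R b)) {0..1}"
    by simp
  have "((\<lambda>t. t *\<^sub>R h (p + ((t - 1) * (p \<bullet> b)) *\<^sub>R b)) has_vector_derivative
      (t *\<^sub>R (p \<bullet> b) *\<^sub>R dd b h (p + ((t - 1) * (p \<bullet> b)) *\<^sub>R b) +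
       1 *\<^sub>R h (p + ((t - 1) * (p \<bullet> b)) *\<^sub>R b))) (at t within {0..1})"
    if t: "t \<in> {0..1}" for t
    by (rule has_vector_derivative_scaleR[OF DERIV_ident d[OF t]])
  from fundamental_theorem_of_calculus[OF _ this]
  show "((\<lambda>t. h (p + ((t - 1) * (p \<bullet> b)) *\<^sub>R b) +
      t *\<^sub>R (p \<bullet> b) *\<^sub>R dd b h (p + ((t - 1) * (p \<bullet> b)) *\<^sub>R b)) has_integral h p) {0..1}"
    by (simp only: scaleR_one add.commute) simp
qed

lemma segint_dd:
  assumes "open K" "seg_closed b K" "p \<in> K" "ck_on (Suc 0) K h"
  shows "segint b (dd b h) p = h p - h (p - (p \<bullet> b) *\<^sub>R b)"
  unfolding segint_def by (rule integral_unique[OF has_integral_seg(2)[OF assms]])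

text \<open>Along \<open>b\<close> the integrand of the differentiated integral is the total
  derivative of \<open>t h\<close> along the segment, which integrates to \<open>h p\<close>; the
  part of \<open>v\<close> orthogonal to \<open>b\<close> passes under the integral.\<close>

lemma segint_has_derivative:
  assumes K: "open K" "convex K" "seg_closed b K" and p: "p \<in> K" and h: "ck_on (Suc 0) K h"
  shows "(segint b h has_derivative
    (\<lambda>v. (v \<bullet> b) *\<^sub>R h p + segint b (dd (v - (v \<bullet> b) *\<^sub>R b) h) p)) (at p)"
proof -
  define S where "S x t = x + ((t - 1) * (x \<bullet> b)) *\<^sub>R b" for x and t :: real
  have SK: "S x t \<in> K" if "x \<in> K" "t \<in> {0..1}" for x t
    unfolding S_def by (rule seg_closedD[OF K(3) that])
  note dh = ck_on_Suc_has_derivative[OF h]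
  have ch: "continuous_on K h" by (rule ck_on_imp_continuous_on[OF h])
  have cdh: "continuous_on K (dd v h)" for v
    by (rule ck_on_imp_continuous_on[OF ck_on_Suc_dd[OF h]])
  have dd: "dd (v + ((t - 1) * (v \<bullet> b)) *\<^sub>R b) h x =
      dd (v - (v \<bullet> b) *\<^sub>R b) h x + (t * (v \<bullet> b)) *\<^sub>R dd b h x" if "x \<in> K" for x v and t :: real
  proof -
    have "v + ((t - 1) * (v \<bullet> b)) *\<^sub>R b = (v - (v \<bullet> b) *\<^sub>R b) + (t * (v \<bullet> b)) *\<^sub>R b"
      by (simp add: algebra_simps)
    then show ?thesis
      by (simp only: linear_add[OF has_derivative_linear[OF dh[OF that]]]
        linear_cmul[OF has_derivative_linear[OF dh[OF that]]])
  qed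
  have "((\<lambda>x. integral {0..1} (\<lambda>t. (x \<bullet> b) *\<^sub>R h (S x t))) has_derivative
      (\<lambda>v. integral {0..1} (\<lambda>t. (p \<bullet> b) *\<^sub>R dd (v - (v \<bullet> b) *\<^sub>R b) h (S p t) +
        (v \<bullet> b) *\<^sub>R (h (S p t) + t *\<^sub>R (p \<bullet> b) *\<^sub>R dd b h (S p t))))) (at p)"
  proof (rule has_derivative_integral_param[OF K(1,2) p])
    fix x and t :: real assume x: "x \<in> K" and t: "t \<in> {0..1}"
    have 1: "((\<lambda>x. S x t) has_derivative (\<lambda>v. v + ((t - 1) * (v \<bullet> b)) *\<^sub>R b)) (at x)"
      unfolding S_def by (auto intro!: derivative_eq_intros)
    have 2: "((\<lambda>x. x \<bullet> b) has_derivative (\<lambda>v. v \<bullet> b)) (at x)"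
      by (auto intro!: derivative_eq_intros)
    have "((\<lambda>x. (x \<bullet> b) *\<^sub>R h (S x t)) has_derivative
      (\<lambda>v. (x \<bullet> b) *\<^sub>R dd (v + ((t - 1) * (v \<bullet> b)) *\<^sub>R b) h (S x t) + (v \<bullet> b) *\<^sub>R h (S x t))) (at x)"
      by (rule has_derivative_scaleR[OF 2 has_derivative_compose[OF 1 dh[OF SK[OF x t]]]])
    then show "((\<lambda>x. (x \<bullet> b) *\<^sub>R h (S x t)) has_derivative
      (\<lambda>v. (x \<bullet> b) *\<^sub>R dd (v - (v \<bullet> b) *\<^sub>R b) h (S x t) +
        (v \<bullet> b) *\<^sub>R (h (S x t) + t *\<^sub>R (x \<bullet> b) *\<^sub>R dd b h (S x t)))) (at x)"
      by (rule has_derivative_eq_rhs)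
        (simp only: fun_eq_iff dd[OF SK[OF x t]], simp add: algebra_simps)
  next
    fix x assume x: "x \<in> K"
    show "continuous_on {0..1} (\<lambda>t. (x \<bullet> b) *\<^sub>R h (S x t))"
      unfolding S_def
      by (rule continuous_on_scaleR[OF continuous_on_const continuous_on_seg1[OF K(3) ch x]])
  next
    fix v
    show "continuous_on (K \<times> {0..1}) (\<lambda>(x, t). (x \<bullet> b) *\<^sub>R dd (v - (v \<bullet> b) *\<^sub>R b) h (S x t) +
        (v \<bullet> b) *\<^sub>R (h (S x t) + t *\<^sub>R (x \<bullet> b) *\<^sub>R dd b h (S x t)))"
      unfolding S_def case_prod_beta
      by (intro continuous_on_add continuous_on_scaleR continuous_on_const continuous_on_seg[OF K(3)]
          ch cdh continuous_on_snd continuous_on_inner continuous_on_fst continuous_on_id)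
  qed
  moreover have "integral {0..1} (\<lambda>t. (p \<bullet> b) *\<^sub>R dd (v - (v \<bullet> b) *\<^sub>R b) h (S p t) +
        (v \<bullet> b) *\<^sub>R (h (S p t) + t *\<^sub>R (p \<bullet> b) *\<^sub>R dd b h (S p t)))
     = (v \<bullet> b) *\<^sub>R h p + segint b (dd (v - (v \<bullet> b) *\<^sub>R b) h) p" for v
  proof -
    have 1: "((\<lambda>t. (p \<bullet> b) *\<^sub>R dd (v - (v \<bullet> b) *\<^sub>R b) h (S p t)) has_integral
        segint b (dd (v - (v \<bullet> b) *\<^sub>R b) h) p) {0..1}"
      unfolding segint_def S_def
      by (rule integrable_integral[OF segint_integrable[OF K(3) cdh p]])
    have 2: "((\<lambda>t. (v \<bullet> b) *\<^sub>R (h (S p t) + t *\<^sub>R (p \<bullet> b) *\<^sub>R dd b h (S p t))) has_integral (v \<bullet> b) *\<^sub>R h p) {0..1}"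
      unfolding S_def
      by (rule has_integral_cmul[OF has_integral_seg(1)[OF K(1,3) p h]])
    show ?thesis
      using integral_unique[OF has_integral_add[OF 1 2]] by (simp add: add.commute)
  qed
  ultimately show ?thesis
    unfolding segint_def[abs_def] S_def by simp
qed

lemma ck_on_segint:
  assumes "open K" "convex K" "seg_closed b K" "ck_on k K h"
  shows "ck_on k K (segint b h)"
  using assms(4)
proof (induction k arbitrary: h)
  case 0
  then show ?case using continuous_on_segint[OF assms(3)] by simp
next
  case (Suc k)
  have h1: "ck_on (Suc 0) K h" by (rule ck_on_le[OF Suc.prems]) simp
  have "ck_on k K (\<lambda>p. (v \<bullet> b) *\<^sub>R h p + segint b (dd (v - (v \<bullet> b) *\<^sub>R b) h) p)" for v
    by (intro ck_on_add ck_on_scaleR ck_on_const assms(1) ck_on_SucD[OF Suc.prems] Suc.IH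
        ck_on_Suc_dd[OF Suc.prems])
  then show ?case
    by (rule ck_on_SucI[OF assms(1) segint_has_derivative[OF assms(1-3) _ h1], rotated])
qed

lemma smooth_on_segint:
  "open K \<Longrightarrow> convex K \<Longrightarrow> seg_closed b K \<Longrightarrow> smooth_on K h \<Longrightarrow> smooth_on K (segint b h)"
  by (simp add: smooth_on_def ck_on_segint)

lemma dd_segint:
  assumes "open K" "convex K" "seg_closed b K" "p \<in> K" "ck_on (Suc 0) K h"
  shows "dd v (segint b h) p = (v \<bullet> b) *\<^sub>R h p + segint b (dd (v - (v \<bullet> b) *\<^sub>R b) h) p"
  using frechet_derivative_eqI[OF segint_has_derivative[OF assms]] by simp

lemma dd_segint_orth:
  assumes "open K" "convex K" "seg_closed b K" "p \<in> K" "ck_on (Suc 0) K h" "v \<bullet> b = 0"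
  shows "dd v (segint b h) p = segint b (dd v h) p"
  using dd_segint[OF assms(1-5), of v] assms(6) by simp

lemma dd_segint_self:
  assumes "open K" "convex K" "seg_closed b K" "p \<in> K" "ck_on (Suc 0) K h" "b \<in> Basis"
  shows "dd b (segint b h) p = h p"
proof -
  have "segint b (dd 0 h) p = segint b (\<lambda>p. 0) p"
  proof (rule segint_cong[OF assms(3,4)])
    show "dd 0 h p = 0" if "p \<in> K" for p
      using linear_0[OF has_derivative_linear[OF ck_on_Suc_has_derivative[OF assms(5) that]]] .
  qed
  then show ?thesis using dd_segint[OF assms(1-5), of b] assms(6) by (simp add: segint_def)
qed


section \<open>Smooth dependence of flows on parameters\<close>

text \<open>The coordinate \<open>p \<bullet> b\<close> is time and the other coordinates of
  \<open>p\<close> are parameters; \<open>Q\<close> carries the initial data. Iterates are therefore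
  functions on a whole ball, not curves.\<close>

primrec picard_iter ::
  "'a::euclidean_space \<Rightarrow> ('a \<Rightarrow> 'b::banach) \<Rightarrow> ('a \<Rightarrow> 'b \<Rightarrow> 'b) \<Rightarrow> 'b \<Rightarrow> nat \<Rightarrow> 'a \<Rightarrow> 'b" where
  "picard_iter b Q G u0 0 = (\<lambda>p. u0)"
| "picard_iter b Q G u0 (Suc n) = (\<lambda>p. Q p + segint b (\<lambda>p. G p (picard_iter b Q G u0 n p)) p)"

lemma inner_Basis_le_cball:
  "b \<in> Basis \<Longrightarrow> p \<in> cball 0 r \<Longrightarrow> \<bar>p \<bullet> b\<bar> \<le> r"
  using Basis_le_norm[of b p] by auto

text \<open>On the ball \<open>\<bar>p \<bullet> b\<bar> \<le> r\<close>, so the integral term stays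
  within \<open>R / 2\<close> and the iteration contracts by 1/2; the limit is a telescoping series.
  The iterates and their uniform convergence are part of the conclusion because regularity of the
  limit is read off from them.\<close>

lemma picard:
  fixes Q :: "'a::euclidean_space \<Rightarrow> 'b::banach" and G :: "'a \<Rightarrow> 'b \<Rightarrow> 'b"
  assumes b: "b \<in> Basis" and r: "r > 0" and R: "R \<ge> 0"
    and Q: "continuous_on (cball 0 r) Q"
    and G: "continuous_on (cball 0 r \<times> cball u0 R) (\<lambda>(p, u). G p u)"
    and Qb: "\<And>p. p \<in> cball 0 r \<Longrightarrow> norm (Q p - u0) \<le> R / 2"
    and Gb: "\<And>p u. p \<in> cball 0 r \<Longrightarrow> u \<in> cball u0 R \<Longrightarrow> r * norm (G p u) \<le> R / 2"
    and GL: "\<And>p u v. p \<in> cball 0 r \<Longrightarrow> u \<in> cball u0 R \<Longrightarrow> v \<in> cball u0 R \<Longrightarrow>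
      r * norm (G p u - G p v) \<le> norm (u - v) / 2"
  obtains \<Phi> where "continuous_on (cball 0 r) \<Phi>" "\<Phi> ` cball 0 r \<subseteq> cball u0 R"
    "\<And>p. p \<in> cball 0 r \<Longrightarrow> \<Phi> p = Q p + segint b (\<lambda>p. G p (\<Phi> p)) p"
    "uniform_limit (cball 0 r) (picard_iter b Q G u0) \<Phi> sequentially"
    "\<And>n. continuous_on (cball 0 r) (picard_iter b Q G u0 n)"
    "\<And>n. picard_iter b Q G u0 n ` cball 0 r \<subseteq> cball u0 R"
proof -
  define K where "K = cball (0::'a) r"
  define P where "P = picard_iter b Q G u0"
  have sc: "seg_closed b K" unfolding K_def by (rule seg_closed_cball[OF b])
  note asm = Q[folded K_def] G[folded K_def] Qb[folded K_def] Gb[folded K_def] GL[folded K_def]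
  have P0: "P 0 = (\<lambda>p. u0)" and PS: "P (Suc n) = (\<lambda>p. Q p + segint b (\<lambda>p. G p (P n p)) p)" for n
    by (simp_all add: P_def)
  have cG: "continuous_on K (\<lambda>p. G p (F p))" if "continuous_on K F" "F ` K \<subseteq> cball u0 R" for F
  proof -
    have *: "continuous_on K (\<lambda>p. (p, F p))" by (intro continuous_intros that(1))
    show ?thesis using continuous_on_compose2[OF asm(2) *] that(2) by auto
  qed
  have P: "continuous_on K (P n) \<and> P n ` K \<subseteq> cball u0 R" for n
  proof (induction n)
    case 0
    then show ?case using R by (auto simp: P0)
  next
    case (Suc n)
    then have c: "continuous_on K (\<lambda>p. G p (P n p))" by (intro cG) auto
    have "P (Suc n) p \<in> cball u0 R" if p: "p \<in> K" for p
    proof -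
      have "norm (segint b (\<lambda>p. G p (P n p)) p) \<le> \<bar>p \<bullet> b\<bar> * (R / 2 / r)"
        by (rule norm_segint_le[OF sc c p]) (use Suc asm(4) r in \<open>auto simp: field_simps\<close>)
      also have "\<dots> \<le> r * (R / 2 / r)"
        using inner_Basis_le_cball[OF b p[unfolded K_def]] r R by (intro mult_right_mono) auto
      finally have "norm (segint b (\<lambda>p. G p (P n p)) p) \<le> R / 2" using r by simp
      moreover have "norm (P (Suc n) p - u0) \<le> norm (Q p - u0) + norm (segint b (\<lambda>p. G p (P n p)) p)"
        unfolding PS using norm_triangle_ineq[of "Q p - u0" "segint b (\<lambda>p. G p (P n p)) p"]
        by (simp add: algebra_simps)
      ultimately have "norm (P (Suc n) p - u0) \<le> R" using asm(3)[OF p] by linarith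
      then show ?thesis by (simp add: dist_norm norm_minus_commute)
    qed
    moreover have "continuous_on K (P (Suc n))"
      unfolding PS by (intro continuous_on_add asm(1) continuous_on_segint[OF sc c])
    ultimately show ?case by auto
  qed
  have contr: "norm (segint b (\<lambda>p. G p (F p)) p - segint b (\<lambda>p. G p (H p)) p) \<le> c / 2"
    if F: "continuous_on K F" "F ` K \<subseteq> cball u0 R" and H: "continuous_on K H" "H ` K \<subseteq> cball u0 R"
      and c: "\<And>p. p \<in> K \<Longrightarrow> norm (F p - H p) \<le> c" and p: "p \<in> K" for F H c p
  proof -
    have c0: "c \<ge> 0" using c[OF p] norm_ge_zero order_trans by blast
    have "norm (segint b (\<lambda>p. G p (F p) - G p (H p)) p) \<le> \<bar>p \<bullet> b\<bar> * (c / 2 / r)"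
    proof (rule norm_segint_le[OF sc _ p])
      show "continuous_on K (\<lambda>p. G p (F p) - G p (H p))"
        by (intro continuous_on_diff cG F H)
      show "norm (G p (F p) - G p (H p)) \<le> c / 2 / r" if p: "p \<in> K" for p
      proof -
        have "r * norm (G p (F p) - G p (H p)) \<le> norm (F p - H p) / 2"
          using asm(5)[OF p] F(2) H(2) p by blast
        also have "\<dots> \<le> c / 2" using c[OF p] by simp
        finally show ?thesis using r by (simp add: field_simps)
      qed
    qed
    also have "\<dots> \<le> r * (c / 2 / r)"
      using inner_Basis_le_cball[OF b p[unfolded K_def]] r c0 by (intro mult_right_mono) auto
    finally show ?thesis
      using r segint_diff[OF sc cG[OF F] cG[OF H] p] by simp
  qed
  have step: "norm (P (Suc n) p - P n p) \<le> R * (1/2) ^ n" if "p \<in> K" for n p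
    using that
  proof (induction n arbitrary: p)
    case 0
    then show ?case using conjunct2[OF P[of "Suc 0"]] by (auto simp: P0 dist_norm norm_minus_commute)
  next
    case (Suc n)
    have "P (Suc (Suc n)) p - P (Suc n) p =
      segint b (\<lambda>p. G p (P (Suc n) p)) p - segint b (\<lambda>p. G p (P n p)) p"
      by (simp add: PS)
    also have "norm \<dots> \<le> (R * (1/2) ^ n) / 2"
      by (rule contr) (use P Suc in auto)
    finally show ?case by simp
  qed
  define \<Phi> where "\<Phi> p = u0 + suminf (\<lambda>n. P (Suc n) p - P n p)" for p
  have "uniform_limit K (\<lambda>n p. \<Sum>i<n. P (Suc i) p - P i p) (\<lambda>p. suminf (\<lambda>n. P (Suc n) p - P n p)) sequentially"
    by (rule Weierstrass_m_test[where M = "\<lambda>n. R * (1/2) ^ n"])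
      (use step in \<open>auto intro!: summable_mult summable_geometric\<close>)
  then have "uniform_limit K (\<lambda>n p. u0 + (\<Sum>i<n. P (Suc i) p - P i p)) \<Phi> sequentially"
    unfolding \<Phi>_def by (intro uniform_limit_intros)
  moreover have "(\<lambda>n p. u0 + (\<Sum>i<n. P (Suc i) p - P i p)) = P"
  proof (intro ext)
    show "u0 + (\<Sum>i<n. P (Suc i) p - P i p) = P n p" for n p
      using sum_lessThan_telescope[of "\<lambda>i. P i p" n] by (simp add: P0)
  qed
  ultimately have lim: "uniform_limit K P \<Phi> sequentially" by (simp only:)
  have c\<Phi>: "continuous_on K \<Phi>"
    by (rule uniform_limit_theorem[OF _ lim]) (use P in auto)
  have pw: "(\<lambda>n. P n p) \<longlonglongrightarrow> \<Phi> p" if "p \<in> K" for p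
    using tendsto_uniform_limitI[OF lim that] .
  have r\<Phi>: "\<Phi> ` K \<subseteq> cball u0 R"
  proof clarify
    fix p assume p: "p \<in> K"
    have "P n p \<in> cball u0 R" for n using P p by blast
    then show "\<Phi> p \<in> cball u0 R"
      by (intro Lim_in_closed_set[OF closed_cball _ _ pw[OF p]]) (auto simp del: mem_cball)
  qed
  have eq: "\<Phi> p = Q p + segint b (\<lambda>p. G p (\<Phi> p)) p" if p: "p \<in> K" for p
  proof -
    have "(\<lambda>n. P (Suc n) p) \<longlonglongrightarrow> Q p + segint b (\<lambda>p. G p (\<Phi> p)) p"
    proof (rule LIMSEQ_I)
      fix e :: real assume e: "e > 0"
      obtain N where N: "\<And>n q. n \<ge> N \<Longrightarrow> q \<in> K \<Longrightarrow> dist (P n q) (\<Phi> q) < e"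
        using uniform_limitD[OF lim e] by (auto simp: eventually_sequentially)
      have "norm (P (Suc n) p - (Q p + segint b (\<lambda>p. G p (\<Phi> p)) p)) < e" if "n \<ge> N" for n
      proof -
        have "norm (segint b (\<lambda>p. G p (P n p)) p - segint b (\<lambda>p. G p (\<Phi> p)) p) \<le> e / 2"
          by (rule contr) (use P c\<Phi> r\<Phi> N[OF that] p in \<open>auto simp: dist_norm less_imp_le\<close>)
        then show ?thesis using e by (simp add: PS)
      qed
      then show "\<exists>N. \<forall>n\<ge>N. norm (P (Suc n) p - (Q p + segint b (\<lambda>p. G p (\<Phi> p)) p)) < e" by blast
    qed
    with LIMSEQ_Suc[OF pw[OF p]] show ?thesis by (rule LIMSEQ_unique)
  qed
  show thesis
    by (rule that[of \<Phi>]) (use c\<Phi> r\<Phi> eq lim P in \<open>auto simp: K_def P_def\<close>)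
qed

text \<open>At a point of the compact ball where the distance of the two solutions is maximal, say
  \<open>c\<close>, the contraction gives \<open>c \<le> c / 2\<close>.\<close>

lemma picard_unique:
  fixes Q :: "'a::euclidean_space \<Rightarrow> 'b::banach" and G :: "'a \<Rightarrow> 'b \<Rightarrow> 'b"
  assumes b: "b \<in> Basis" and r: "r > 0"
    and G: "continuous_on (cball 0 r \<times> W) (\<lambda>(p, u). G p u)"
    and GL: "\<And>p u v. p \<in> cball 0 r \<Longrightarrow> u \<in> W \<Longrightarrow> v \<in> W \<Longrightarrow> r * norm (G p u - G p v) \<le> norm (u - v) / 2"
    and F: "continuous_on (cball 0 r) F" "F ` cball 0 r \<subseteq> W"
      "\<And>p. p \<in> cball 0 r \<Longrightarrow> F p = Q p + segint b (\<lambda>p. G p (F p)) p"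
    and H: "continuous_on (cball 0 r) H" "H ` cball 0 r \<subseteq> W"
      "\<And>p. p \<in> cball 0 r \<Longrightarrow> H p = Q p + segint b (\<lambda>p. G p (H p)) p"
    and p: "p \<in> cball 0 r"
  shows "F p = H p"
proof -
  define K where "K = cball (0::'a) r"
  have sc: "seg_closed b K" unfolding K_def by (rule seg_closed_cball[OF b])
  have cG: "continuous_on K (\<lambda>p. G p (F p))" if "continuous_on K F" "F ` K \<subseteq> W" for F
  proof -
    have *: "continuous_on K (\<lambda>p. (p, F p))" by (intro continuous_intros that(1))
    show ?thesis using continuous_on_compose2[OF G[folded K_def] *] that(2) by auto
  qed
  have "compact K" "K \<noteq> {}" using r by (auto simp: K_def)
  moreover have "continuous_on K (\<lambda>q. norm (F q - H q))"
    using F(1) H(1) by (auto simp: K_def intro!: continuous_intros)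
  ultimately obtain m where m: "m \<in> K" "\<And>q. q \<in> K \<Longrightarrow> norm (F q - H q) \<le> norm (F m - H m)"
    using continuous_attains_sup[of K "\<lambda>q. norm (F q - H q)"] by blast
  define c where "c = norm (F m - H m)"
  have "norm (segint b (\<lambda>p. G p (F p) - G p (H p)) m) \<le> \<bar>m \<bullet> b\<bar> * (c / 2 / r)"
  proof (rule norm_segint_le[OF sc _ m(1)])
    show "continuous_on K (\<lambda>p. G p (F p) - G p (H p))"
      by (intro continuous_on_diff cG) (use F H in \<open>auto simp: K_def\<close>)
    show "norm (G p (F p) - G p (H p)) \<le> c / 2 / r" if p: "p \<in> K" for p
    proof -
      have "r * norm (G p (F p) - G p (H p)) \<le> norm (F p - H p) / 2"
        using p F(2) H(2) by (intro GL) (auto simp: K_def)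
      also have "\<dots> \<le> c / 2" using m(2)[OF p] by (simp add: c_def)
      finally show ?thesis using r by (simp add: field_simps)
    qed
  qed
  also have "\<dots> \<le> r * (c / 2 / r)"
    using inner_Basis_le_cball[OF b m(1)[unfolded K_def]] r by (intro mult_right_mono) (auto simp: c_def)
  finally have "norm (segint b (\<lambda>p. G p (F p)) m - segint b (\<lambda>p. G p (H p)) m) \<le> c / 2"
    using r segint_diff[OF sc cG cG m(1)] F H by (simp add: K_def)
  moreover have "F m - H m = segint b (\<lambda>p. G p (F p)) m - segint b (\<lambda>p. G p (H p)) m"
    using F(3)[of m] H(3)[of m] m(1) unfolding K_def by (metis add_diff_cancel_left)
  ultimately have "c \<le> c / 2" unfolding c_def by metis
  then have "norm (F p - H p) \<le> 0" using m(2)[of p] p by (simp add: K_def c_def)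
  then show ?thesis by simp
qed

text \<open>A recursion for uniform bounds that contracts by 1/2 up to an error which becomes
  arbitrarily small.\<close>

lemma contraction_seq:
  fixes x :: "nat \<Rightarrow> 'p \<Rightarrow> real"
  assumes C: "\<And>n p. p \<in> S \<Longrightarrow> x n p \<le> C"
    and step: "\<And>\<delta>. \<delta> > 0 \<Longrightarrow> \<exists>N. \<forall>n\<ge>N. \<forall>c. (\<forall>p\<in>S. x n p \<le> c) \<longrightarrow> (\<forall>p\<in>S. x (Suc n) p \<le> \<delta> + c / 2)"
    and \<delta>: "\<delta> > 0"
  shows "\<exists>N. \<forall>n\<ge>N. \<forall>p\<in>S. x n p \<le> \<delta>"
proof -
  \<comment> \<open>The map \<open>c \<mapsto> \<delta> / 4 + c / 2\<close> has the fixed point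
    \<open>\<delta> / 2\<close>, which leaves the other half of \<delta> for the geometrically
    decaying term.\<close>
  obtain N where N: "\<And>n c p. n \<ge> N \<Longrightarrow> (\<forall>p\<in>S. x n p \<le> c) \<Longrightarrow> p \<in> S \<Longrightarrow> x (Suc n) p \<le> \<delta> / 4 + c / 2"
    using step[of "\<delta> / 4"] \<delta> by (metis zero_less_divide_iff zero_less_numeral)
  define D where "D = \<bar>C\<bar>"
  have *: "\<forall>p\<in>S. x (N + m) p \<le> \<delta> / 2 + D * (1/2) ^ m" for m
  proof (induction m)
    case 0
    show ?case using C \<delta> by (fastforce simp: D_def intro: order_trans)
  next
    case (Suc m)
    show ?case
    proof
      fix p assume "p \<in> S"
      from N[OF _ Suc this] show "x (N + Suc m) p \<le> \<delta> / 2 + D * (1/2) ^ Suc m"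
        by (simp add: field_simps)
    qed
  qed
  have "(\<lambda>m. D * (1/2) ^ m) \<longlonglongrightarrow> D * 0"
    by (intro tendsto_mult tendsto_const LIMSEQ_realpow_zero) auto
  then obtain M where M: "\<And>m. m \<ge> M \<Longrightarrow> D * (1/2) ^ m < \<delta> / 2"
    using \<delta> order_tendstoD(2)[of _ _ sequentially "\<delta> / 2"] by (force simp: eventually_sequentially)
  have "x n p \<le> \<delta>" if n: "n \<ge> N + M" and p: "p \<in> S" for n p
  proof -
    have "D * (1/2) ^ (n - N) < \<delta> / 2" using M n by simp
    moreover have "x n p \<le> \<delta> / 2 + D * (1/2) ^ (n - N)" using bspec[OF *[of "n - N"] p] n by simp
    ultimately show ?thesis by linarith
  qed
  then show ?thesis by blast
qed

lemma ck_on_local: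
  assumes "\<And>p. p \<in> S \<Longrightarrow> \<exists>T. open T \<and> p \<in> T \<and> ck_on k T F"
  shows "ck_on k S F"
  using assms
proof (induction k arbitrary: F)
  case 0
  have "isCont F p" if p: "p \<in> S" for p
  proof -
    obtain T where "open T" "p \<in> T" "continuous_on T F" using 0[OF p] by auto
    then show ?thesis by (simp add: continuous_on_eq_continuous_at)
  qed
  then show ?case by (simp add: continuous_at_imp_continuous_on)
next
  case (Suc k)
  have "ck_on k S (dd v F)" for v
    by (rule Suc.IH) (metis Suc.prems ck_on_Suc_dd)
  moreover have "F differentiable (at p)" if "p \<in> S" for p
    using Suc.prems[OF that] by auto
  ultimately show ?case by simp
qed


lemma ck_on_Pair:
  assumes "open S" "ck_on k S F" "ck_on k S G" shows "ck_on k S (\<lambda>q. (F q, G q))"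
proof -
  have "ck_on k S (\<lambda>q. (F q, 0) + (0, G q))"
    by (intro ck_on_add assms ck_on_linear_compose[OF _ assms(1,2), of "\<lambda>x. (x, 0)"]
        ck_on_linear_compose[OF _ assms(1,3), of "\<lambda>x. (0, x)"] bounded_linear_Pair
        bounded_linear_ident bounded_linear_zero)
  then show ?thesis by simp
qed

text \<open>One-sided on purpose: it is applied to norms, for which it means uniform convergence to
  0 on \<open>K\<close>.\<close>

definition unif_small :: "'p set \<Rightarrow> (nat \<Rightarrow> 'p \<Rightarrow> real) \<Rightarrow> bool" where
  "unif_small K x \<longleftrightarrow> (\<forall>\<delta>>0. \<exists>N. \<forall>n\<ge>N. \<forall>p\<in>K. x n p \<le> \<delta>)"

lemma unif_small_mono:
  assumes "unif_small K x" "\<And>n p. p \<in> K \<Longrightarrow> y n p \<le> x n p" shows "unif_small K y"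
  using assms unfolding unif_small_def by (meson order_trans)

lemma unif_small_add:
  assumes "unif_small K x" "unif_small K y" shows "unif_small K (\<lambda>n p. x n p + y n p)"
  unfolding unif_small_def
proof (intro allI impI)
  fix \<delta> :: real assume "\<delta> > 0"
  then obtain N M where "\<And>n p. n \<ge> N \<Longrightarrow> p \<in> K \<Longrightarrow> x n p \<le> \<delta> / 2"
    "\<And>n p. n \<ge> M \<Longrightarrow> p \<in> K \<Longrightarrow> y n p \<le> \<delta> / 2"
    using assms unfolding unif_small_def by (meson half_gt_zero)
  then have "\<forall>n\<ge>max N M. \<forall>p\<in>K. x n p + y n p \<le> \<delta>" by fastforce
  then show "\<exists>N. \<forall>n\<ge>N. \<forall>p\<in>K. x n p + y n p \<le> \<delta>" by blast
qed

lemma unif_small_0: "unif_small K (\<lambda>n p. 0)"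
  by (auto simp: unif_small_def)

lemma unif_small_sum:
  "(\<And>i. i \<in> I \<Longrightarrow> unif_small K (x i)) \<Longrightarrow> unif_small K (\<lambda>n p. \<Sum>i\<in>I. x i n p)"
  by (induction I rule: infinite_finite_induct) (auto intro: unif_small_add unif_small_0)

lemma unif_small_cmult:
  assumes "unif_small K x" "c \<ge> 0" shows "unif_small K (\<lambda>n p. c * x n p)"
  unfolding unif_small_def
proof (intro allI impI)
  fix \<delta> :: real assume "\<delta> > 0"
  then obtain N where N: "\<And>n p. n \<ge> N \<Longrightarrow> p \<in> K \<Longrightarrow> x n p \<le> \<delta> / (c + 1)"
    using assms unfolding unif_small_def by (meson add_nonneg_pos divide_pos_pos zero_less_one)
  have "c * x n p \<le> \<delta>" if "n \<ge> N" "p \<in> K" for n p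
  proof -
    have "c * x n p \<le> c * (\<delta> / (c + 1))" using N[OF that] assms(2) by (rule mult_left_mono)
    also have "\<dots> \<le> \<delta>" using assms(2) \<open>\<delta> > 0\<close> by (simp add: field_simps)
    finally show ?thesis .
  qed
  then show "\<exists>N. \<forall>n\<ge>N. \<forall>p\<in>K. c * x n p \<le> \<delta>" by blast
qed

lemma unif_small_Suc:
  assumes "unif_small K (\<lambda>n. x (Suc n))" shows "unif_small K x"
  unfolding unif_small_def
proof (intro allI impI)
  fix \<delta> :: real assume "\<delta> > 0"
  then obtain N where "\<And>n p. n \<ge> N \<Longrightarrow> p \<in> K \<Longrightarrow> x (Suc n) p \<le> \<delta>"
    using assms unfolding unif_small_def by meson
  then have "\<forall>n\<ge>Suc N. \<forall>p\<in>K. x n p \<le> \<delta>" by (metis Suc_le_D Suc_le_mono)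
  then show "\<exists>N. \<forall>n\<ge>N. \<forall>p\<in>K. x n p \<le> \<delta>" by blast
qed

text \<open>Uniform continuity of \<open>F\<close> on the compact set \<open>C\<close> turns uniform
  convergence of the arguments into that of the values.\<close>

lemma unif_small_compose:
  fixes F :: "'a::metric_space \<Rightarrow> 'b::real_normed_vector"
  assumes C: "compact C" "continuous_on C F"
    and f: "\<And>n p. p \<in> K \<Longrightarrow> f n p \<in> C" "\<And>p. p \<in> K \<Longrightarrow> f' p \<in> C"
    and lim: "uniform_limit K f f' sequentially"
  shows "unif_small K (\<lambda>n p. norm (F (f n p) - F (f' p)))"
  unfolding unif_small_def
proof (intro allI impI)
  fix \<delta> :: real assume "\<delta> > 0"
  then obtain d where d: "d > 0" "\<And>x y. x \<in> C \<Longrightarrow> y \<in> C \<Longrightarrow> dist x y < d \<Longrightarrow> dist (F x) (F y) < \<delta>"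
    using compact_uniformly_continuous[OF C(2,1)] unfolding uniformly_continuous_on_def by metis
  obtain N where "\<And>n p. n \<ge> N \<Longrightarrow> p \<in> K \<Longrightarrow> dist (f n p) (f' p) < d"
    using uniform_limitD[OF lim d(1)] by (auto simp: eventually_sequentially)
  then have "\<forall>n\<ge>N. \<forall>p\<in>K. norm (F (f n p) - F (f' p)) \<le> \<delta>"
    using d(2) f by (metis dist_norm less_imp_le)
  then show "\<exists>N. \<forall>n\<ge>N. \<forall>p\<in>K. norm (F (f n p) - F (f' p)) \<le> \<delta>" by blast
qed

lemma compact_norm_bound:
  assumes "compact C" "continuous_on C f" obtains M where "M \<ge> 0" "\<And>x. x \<in> C \<Longrightarrow> norm (f x) \<le> M"
  using compact_imp_bounded[OF compact_continuous_image[OF assms(2,1)]]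
  by (auto simp: bounded_pos) (meson less_imp_le)

text \<open>The directional derivatives of the Picard iterates are themselves an iteration, contracting
  towards the solution \<open>Z\<close> of the linearised equation.\<close>

lemma picard_C1:
  fixes Q :: "'a::euclidean_space \<Rightarrow> 'b::euclidean_space" and G :: "'a \<times> 'b \<Rightarrow> 'b"
  assumes b: "b \<in> Basis" and r: "r > 0" and R: "R \<ge> 0"
    and Om: "open \<Omega>" "cball 0 r \<subseteq> \<Omega>" and W: "open W" "cball u0 R \<subseteq> W"
    and Q: "ck_on (Suc 0) \<Omega> Q" and G: "ck_on (Suc 0) (\<Omega> \<times> W) G"
    and Qb: "\<And>p. p \<in> cball 0 r \<Longrightarrow> norm (Q p - u0) \<le> R / 2"
    and Gb: "\<And>p u. p \<in> cball 0 r \<Longrightarrow> u \<in> cball u0 R \<Longrightarrow> r * norm (G (p, u)) \<le> R / 2"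
    and GL: "\<And>p u h. p \<in> cball 0 r \<Longrightarrow> u \<in> cball u0 R \<Longrightarrow> r * norm (dd (0, h) G (p, u)) \<le> norm h / 2"
  obtains \<Phi> where "continuous_on (cball 0 r) \<Phi>" "\<Phi> ` cball 0 r \<subseteq> cball u0 R"
    "\<And>p. p \<in> cball 0 r \<Longrightarrow> \<Phi> p = Q p + segint b (\<lambda>p. G (p, \<Phi> p)) p"
    "ck_on (Suc 0) (ball 0 r) \<Phi>"
proof -
  define K where "K = cball (0::'a) r"
  define B where "B = ball (0::'a) r"
  define V where "V = cball u0 R"
  note asm = Om(2)[folded K_def] W(2)[folded V_def] Qb[folded K_def] Gb[folded K_def V_def] GL[folded K_def V_def]
  have BK: "B \<subseteq> K" by (auto simp: B_def K_def)
  have B: "open B" "convex B" "seg_closed b B" "0 \<in> B"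
    using seg_closed_ball[OF b] r by (auto simp: B_def)
  have sK: "seg_closed b K" unfolding K_def by (rule seg_closed_cball[OF b])
  have cKV: "compact (K \<times> V)" "compact K" by (auto simp: K_def V_def intro: compact_Times)
  have OW: "K \<times> V \<subseteq> \<Omega> \<times> W" using asm(1,2) by auto
  have dG: "(G has_derivative frechet_derivative G (at z)) (at z)" if "z \<in> \<Omega> \<times> W" for z
    using ck_on_Suc_has_derivative[OF G that] .
  have linG: "linear (frechet_derivative G (at z))" if "z \<in> \<Omega> \<times> W" for z
    using has_derivative_linear[OF dG[OF that]] .
  have split: "dd (v, h) G z = dd (v, 0) G z + dd (0, h) G z" if "z \<in> \<Omega> \<times> W" for v h z
    using linear_add[OF linG[OF that], of "(v, 0)" "(0, h)"] by simp
  have sum0: "dd (0, h) G z = (\<Sum>e\<in>Basis. (h \<bullet> e) *\<^sub>R dd (0, e) G z)" if "z \<in> \<Omega> \<times> W" for h z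
  proof -
    have "linear (\<lambda>h. dd (0, h) G z)"
      using linG[OF that] by (simp add: linear_iff flip: zero_prod_def)
        (metis add.right_neutral add_Pair scaleR_Pair scaleR_zero_right)
    from linear_eq_sum_Basis[OF this] show ?thesis .
  qed
  have cdG: "continuous_on (\<Omega> \<times> W) (dd w G)" for w
    using ck_on_imp_continuous_on[OF ck_on_Suc_dd[OF G]] .
  have GL': "r * norm (G (p, u) - G (p, v)) \<le> norm (u - v) / 2" if p: "p \<in> K" and uv: "u \<in> V" "v \<in> V" for p u v
  proof -
    have "norm (G (p, u) - G (p, v)) \<le> (1 / (2 * r)) * norm (u - v)"
    proof (rule differentiable_bound[where f' = "\<lambda>u h. dd (0, h) G (p, u)", OF _ _ _ uv])
      show "convex V" by (simp add: V_def)
      fix x assume x: "x \<in> V"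
      have "((\<lambda>u. (p, u)) has_derivative (\<lambda>h. (0, h))) (at x within V)"
        by (auto intro!: derivative_eq_intros)
      from has_derivative_compose[OF this dG] show "((\<lambda>u. G (p, u)) has_derivative (\<lambda>h. dd (0, h) G (p, x))) (at x within V)"
        using OW p x by blast
      show "onorm (\<lambda>h. dd (0, h) G (p, x)) \<le> 1 / (2 * r)"
        by (rule onorm_bound) (use asm(5)[OF p x] r in \<open>auto simp: field_simps\<close>)
    qed
    then show ?thesis using r by (simp add: field_simps)
  qed
  have cG: "continuous_on (K \<times> V) (\<lambda>(p, u). G (p, u))"
    using continuous_on_subset[OF ck_on_imp_continuous_on[OF G] OW] by simp
  have cQ: "continuous_on K Q"
    using continuous_on_subset[OF ck_on_imp_continuous_on[OF Q] asm(1)] .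
  define P where "P = picard_iter b Q (\<lambda>p u. G (p, u)) u0"
  obtain \<Phi> where \<Phi>: "continuous_on K \<Phi>" "\<Phi> ` K \<subseteq> V"
    "\<And>p. p \<in> K \<Longrightarrow> \<Phi> p = Q p + segint b (\<lambda>p. G (p, \<Phi> p)) p"
    and lim: "uniform_limit K P \<Phi> sequentially"
    and P: "\<And>n. continuous_on K (P n)" "\<And>n. P n ` K \<subseteq> V"
    by (rule picard[where Q = Q and ?u0.0 = u0 and G = "\<lambda>p u. G (p, u)", OF b r R,
        folded K_def V_def P_def, OF cQ cG asm(3,4) GL']) (assumption | rule that)+
  have P0: "P 0 = (\<lambda>p. u0)" and PS: "P (Suc n) = (\<lambda>p. Q p + segint b (\<lambda>p. G (p, P n p)) p)" for n
    by (simp_all add: P_def)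
  have QB: "ck_on (Suc 0) B Q" using ck_on_subset[OF Q] BK asm(1) by blast
  have gck: "ck_on (Suc 0) B (\<lambda>p. G (p, F p))" if "ck_on (Suc 0) B F" "F ` K \<subseteq> V" for F
    by (rule ck_on_compose[OF B(1) G ck_on_Pair[OF B(1) ck_on_ident that(1)]]) (use that(2) OW BK in auto)
  have Pck: "ck_on (Suc 0) B (P n)" for n
  proof (induction n)
    case 0
    then show ?case unfolding P0 by (rule ck_on_const)
  next
    case (Suc n)
    then show ?case
      unfolding PS by (intro ck_on_add B(1) QB ck_on_segint B gck P)
  qed
  have Pd: "(P n has_derivative frechet_derivative (P n) (at p)) (at p)" if "p \<in> B" for n p
    using ck_on_Suc_has_derivative[OF Pck that] .
  have inOW: "(p, P n p) \<in> \<Omega> \<times> W" "(p, \<Phi> p) \<in> \<Omega> \<times> W" if "p \<in> K" for p n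
    using that P(2)[of n] \<Phi>(2) OW by blast+
  have ddg: "dd v (\<lambda>p. G (p, P n p)) p = dd (v, 0) G (p, P n p) + dd (0, dd v (P n) p) G (p, P n p)"
    if p: "p \<in> B" for v n p
  proof -
    have "((\<lambda>p. (p, P n p)) has_derivative (\<lambda>v. (v, dd v (P n) p))) (at p)"
      by (intro has_derivative_Pair has_derivative_ident Pd p)
    from has_derivative_compose[OF this dG[OF inOW(1)]]
    have "((\<lambda>p. G (p, P n p)) has_derivative (\<lambda>v. dd (v, dd v (P n) p) G (p, P n p))) (at p)"
      using p BK by blast
    then have "dd v (\<lambda>p. G (p, P n p)) p = dd (v, dd v (P n) p) G (p, P n p)"
      by (simp add: frechet_derivative_eqI)
    also have "\<dots> = dd (v, 0) G (p, P n p) + dd (0, dd v (P n) p) G (p, P n p)"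
      using p BK by (intro split inOW) auto
    finally show ?thesis .
  qed
  have ddP: "dd v (P (Suc n)) p = dd v Q p + dd v (segint b (\<lambda>p. G (p, P n p))) p" if p: "p \<in> B" for v n p
  proof -
    have "((\<lambda>p. Q p + segint b (\<lambda>p. G (p, P n p)) p) has_derivative
      (\<lambda>v. dd v Q p + dd v (segint b (\<lambda>p. G (p, P n p))) p)) (at p)"
      by (intro has_derivative_add ck_on_Suc_has_derivative[OF QB p]
          ck_on_Suc_has_derivative[OF ck_on_segint[OF B(1-3) gck[OF Pck P(2)]] p])
    then show ?thesis unfolding PS by (simp add: frechet_derivative_eqI)
  qed
  have dv0: "norm (dd v (\<lambda>p. u0) p) = 0" for v p by simp
  have small: "unif_small K (\<lambda>n p. norm (H (p, P n p) - H (p, \<Phi> p)))" if "continuous_on (\<Omega> \<times> W) H" for H :: "'a \<times> 'b \<Rightarrow> 'b"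
  proof (rule unif_small_compose[OF cKV(1) continuous_on_subset[OF that OW]])
    show "(p, P n p) \<in> K \<times> V" "(p, \<Phi> p) \<in> K \<times> V" if "p \<in> K" for p n
      using that P(2)[of n] \<Phi>(2) by auto
    show "uniform_limit K (\<lambda>n p. (p, P n p)) (\<lambda>p. (p, \<Phi> p)) sequentially"
      using lim by (auto simp: uniform_limit_iff dist_Pair_Pair)
  qed
  have "\<exists>Z. continuous_on K Z \<and> unif_small B (\<lambda>n p. norm (dd v (P n) p - Z p))" if v: "v \<in> Basis" for v
  proof (cases "v = b")
    case True
    \<comment> \<open>In the time direction the derivative of \<open>segint\<close> is its
      integrand, so convergence of the iterates themselves suffices.\<close>
    have "unif_small B (\<lambda>n p. norm (dd v (P (Suc n)) p - (dd v Q p + G (p, \<Phi> p))))"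
    proof (rule unif_small_mono)
      show "unif_small B (\<lambda>n p. norm (G (p, P n p) - G (p, \<Phi> p)))"
        using small[OF ck_on_imp_continuous_on[OF G]] BK unfolding unif_small_def by blast
      show "norm (dd v (P (Suc n)) p - (dd v Q p + G (p, \<Phi> p))) \<le> norm (G (p, P n p) - G (p, \<Phi> p))"
        if p: "p \<in> B" for n p
        using ddP[OF p, where v = v and n = n] dd_segint_self[OF B(1-3) p gck[OF Pck P(2)] b, of n] True by simp
    qed
    from unif_small_Suc[OF this] have "unif_small B (\<lambda>n p. norm (dd v (P n) p - (dd v Q p + G (p, \<Phi> p))))" .
    moreover have "continuous_on K (\<lambda>p. dd v Q p + G (p, \<Phi> p))"
    proof (intro continuous_on_add)
      show "continuous_on K (dd v Q)"
        using continuous_on_subset[OF ck_on_imp_continuous_on[OF ck_on_Suc_dd[OF Q]] asm(1)] .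
      have *: "continuous_on K (\<lambda>p. (p, \<Phi> p))" by (intro continuous_intros \<Phi>)
      show "continuous_on K (\<lambda>p. G (p, \<Phi> p))"
        by (rule continuous_on_compose2[OF ck_on_imp_continuous_on[OF G] *]) (use inOW in auto)
    qed
    ultimately show ?thesis by blast
  next
    case False
    then have vb: "v \<bullet> b = 0" using v b by (simp add: inner_Basis)
    have pair: "continuous_on T (\<lambda>p. (p, F p))" if "continuous_on T F" for T and F :: "'a \<Rightarrow> 'b"
      by (intro continuous_intros that)
    have cD: "continuous_on T (\<lambda>p. dd w G (p, F p))" if "continuous_on T F" "T \<subseteq> K" "F ` T \<subseteq> V" for w T F
      by (rule continuous_on_compose2[OF cdG pair[OF that(1)]]) (use that OW in auto)
    have cD0: "continuous_on T (\<lambda>p. dd (0, z p) G (p, F p))"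
      if "continuous_on T F" "T \<subseteq> K" "F ` T \<subseteq> V" "continuous_on T z" for T F z
    proof -
      have "continuous_on T (\<lambda>p. \<Sum>e\<in>Basis. (z p \<bullet> e) *\<^sub>R dd (0, e) G (p, F p))"
        by (intro continuous_intros cD that)
      then show ?thesis
        by (rule continuous_on_eq) (use that OW in \<open>auto intro!: sum0[symmetric]\<close>)
    qed
    \<comment> \<open>The inhomogeneous term of the linearised equation. If it is bounded by
      \<open>M\<close>, that equation satisfies the hypotheses of \<open>picard\<close> about 0 with
      radius \<open>2 * M\<close>, which produces \<open>Z\<close>.\<close>
    define q where "q p = dd v Q p + segint b (\<lambda>p. dd (v, 0) G (p, \<Phi> p)) p" for p
    have cdQ: "continuous_on K (dd v Q)"
      using continuous_on_subset[OF ck_on_imp_continuous_on[OF ck_on_Suc_dd[OF Q]] asm(1)] .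
    have cq: "continuous_on K q"
      unfolding q_def by (intro continuous_on_add cdQ continuous_on_segint[OF sK] cD \<Phi> order_refl)
    obtain M where M: "M \<ge> 0" "\<And>p. p \<in> K \<Longrightarrow> norm (q p) \<le> M"
      using compact_norm_bound[OF cKV(2) cq] by blast
    obtain Z where Z: "continuous_on K Z" "\<And>p. p \<in> K \<Longrightarrow> norm (Z p) \<le> 2 * M"
      "\<And>p. p \<in> K \<Longrightarrow> Z p = q p + segint b (\<lambda>p. dd (0, Z p) G (p, \<Phi> p)) p"
    proof -
      have 1: "continuous_on (K \<times> cball 0 (2 * M)) (\<lambda>(p, u). dd (0, u) G (p, \<Phi> p))"
      proof -
        have "continuous_on (K \<times> cball 0 (2 * M)) (\<lambda>x. \<Sum>e\<in>Basis. (snd x \<bullet> e) *\<^sub>R dd (0, e) G (fst x, \<Phi> (fst x)))"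
        proof (intro continuous_intros)
          show "continuous_on (K \<times> cball 0 (2 * M)) (\<lambda>x. dd (0, e) G (fst x, \<Phi> (fst x)))" for e
            by (rule continuous_on_compose2[OF cD[OF \<Phi>(1) order_refl \<Phi>(2)]]) (auto intro!: continuous_intros)
        qed
        then show ?thesis
          by (rule continuous_on_eq) (auto intro!: sum0[symmetric] inOW)
      qed
      have 2: "r * norm (dd (0, u) G (p, \<Phi> p)) \<le> norm u / 2" if "p \<in> K" for p u
        using asm(5)[OF that] \<Phi>(2) that by blast
      have 3: "r * norm (dd (0, u) G (p, \<Phi> p) - dd (0, u') G (p, \<Phi> p)) \<le> norm (u - u') / 2" if "p \<in> K" for p u u'
      proof -
        have "dd (0, u) G (p, \<Phi> p) - dd (0, u') G (p, \<Phi> p) = dd (0, u - u') G (p, \<Phi> p)"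
          using linear_diff[OF linG[OF inOW(2)[OF that]], of "(0, u)" "(0, u')"] by simp
        then show ?thesis using 2[OF that] by simp
      qed
      show thesis
      proof (rule picard[where Q = q and ?u0.0 = "0::'b" and R = "2 * M" and G = "\<lambda>p u. dd (0, u) G (p, \<Phi> p)",
            OF b r, folded K_def, OF _ cq 1 _ _ 3])
        show "0 \<le> 2 * M" using M(1) by simp
        show "norm (q p - 0) \<le> 2 * M / 2" if "p \<in> K" for p using M(2)[OF that] by simp
        show "r * norm (dd (0, u) G (p, \<Phi> p)) \<le> 2 * M / 2" if "p \<in> K" "u \<in> cball 0 (2 * M)" for p u
          using 2[OF that(1), of u] that(2) by simp
        fix Z assume Z: "continuous_on K Z" "Z ` K \<subseteq> cball 0 (2 * M)"
          "\<And>p. p \<in> K \<Longrightarrow> Z p = q p + segint b (\<lambda>p. dd (0, Z p) G (p, \<Phi> p)) p"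
        have "norm (Z p) \<le> 2 * M" if "p \<in> K" for p using Z(2) that by auto
        with Z show thesis using that by blast
      qed
    qed
    have Zeq: "Z p = dd v Q p + segint b (\<lambda>p. dd (v, 0) G (p, \<Phi> p) + dd (0, Z p) G (p, \<Phi> p)) p" if p: "p \<in> K" for p
      using Z(3)[OF p] unfolding q_def
      by (simp add: segint_add[OF sK cD[OF \<Phi>(1) order_refl \<Phi>(2)] cD0[OF \<Phi>(1) order_refl \<Phi>(2) Z(1)] p])
    define Zn where "Zn n = dd v (P n)" for n
    have cZn: "continuous_on B (Zn n)" for n
      unfolding Zn_def using ck_on_imp_continuous_on[OF ck_on_Suc_dd[OF Pck]] .
    have PB: "continuous_on B (P n)" "P n ` B \<subseteq> V" for n
      using continuous_on_subset[OF P(1) BK] P(2)[of n] BK by auto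
    have \<Phi>B: "continuous_on B \<Phi>" "\<Phi> ` B \<subseteq> V" "continuous_on B Z"
      using continuous_on_subset[OF \<Phi>(1) BK] \<Phi>(2) BK continuous_on_subset[OF Z(1) BK] by auto
    have ZnS: "Zn (Suc n) p = dd v Q p + segint b (\<lambda>p. dd (v, 0) G (p, P n p) + dd (0, Zn n p) G (p, P n p)) p"
      if p: "p \<in> B" for n p
    proof -
      have "dd v (segint b (\<lambda>p. G (p, P n p))) p = segint b (dd v (\<lambda>p. G (p, P n p))) p"
        by (rule dd_segint_orth[OF B(1-3) p gck[OF Pck P(2)] vb])
      also have "\<dots> = segint b (\<lambda>p. dd (v, 0) G (p, P n p) + dd (0, Zn n p) G (p, P n p)) p"
        by (rule segint_cong[OF B(3) p]) (simp add: ddg Zn_def)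
      finally show ?thesis unfolding Zn_def using ddP[OF p] by simp
    qed
    have pb: "\<bar>p \<bullet> b\<bar> \<le> r" if "p \<in> B" for p
      using inner_Basis_le_cball[OF b, of p r] that BK by (auto simp: K_def)
    obtain MQ where MQ: "MQ \<ge> 0" "\<And>p. p \<in> K \<Longrightarrow> norm (dd v Q p) \<le> MQ"
      using compact_norm_bound[OF cKV(2) cdQ] by blast
    obtain MG where MG: "MG \<ge> 0" "\<And>z. z \<in> K \<times> V \<Longrightarrow> norm (dd (v, 0) G z) \<le> MG"
      using compact_norm_bound[OF cKV(1) continuous_on_subset[OF cdG OW]] by metis
    \<comment> \<open>The fixed point of \<open>c \<mapsto> MQ + r * MG + c / 2\<close>, the bound
      passed from \<open>Zn n\<close> to \<open>Zn (Suc n)\<close>.\<close>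
    define C where "C = 2 * (MQ + r * MG)"
    have C0: "C \<ge> 0" using MQ MG r by (simp add: C_def)
    have Znb: "norm (Zn n p) \<le> C" if "p \<in> B" for n p
      using that
    proof (induction n arbitrary: p)
      case 0
      then show ?case using C0 by (simp add: Zn_def P0)
    next
      case (Suc n)
      have "norm (segint b (\<lambda>p. dd (v, 0) G (p, P n p) + dd (0, Zn n p) G (p, P n p)) p) \<le> \<bar>p \<bullet> b\<bar> * (MG + C / 2 / r)"
      proof (rule norm_segint_le[OF B(3) _ Suc.prems])
        show "continuous_on B (\<lambda>p. dd (v, 0) G (p, P n p) + dd (0, Zn n p) G (p, P n p))"
          by (intro continuous_on_add cD cD0 PB BK cZn)
        fix p assume p: "p \<in> B"
        have pPn: "p \<in> K" "P n p \<in> V" using p BK PB(2) by auto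
        have "r * norm (dd (0, Zn n p) G (p, P n p)) \<le> C / 2"
          using asm(5)[OF pPn, of "Zn n p"] Suc.IH[OF p] by simp
        then have "norm (dd (0, Zn n p) G (p, P n p)) \<le> C / 2 / r" using r by (simp add: field_simps)
        moreover have "norm (dd (v, 0) G (p, P n p)) \<le> MG" using MG(2) pPn by blast
        ultimately show "norm (dd (v, 0) G (p, P n p) + dd (0, Zn n p) G (p, P n p)) \<le> MG + C / 2 / r"
          using norm_triangle_mono by blast
      qed
      also have "\<dots> \<le> r * (MG + C / 2 / r)"
        using pb[OF Suc.prems] MG(1) C0 r by (intro mult_right_mono) auto
      also have "\<dots> = r * MG + C / 2" using r by (simp add: field_simps)
      finally have "norm (Zn (Suc n) p) \<le> MQ + (r * MG + C / 2)"
        unfolding ZnS[OF Suc.prems] using MQ(2) Suc.prems BK norm_triangle_mono by blast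
      then show ?case by (simp add: C_def field_simps)
    qed
    \<comment> \<open>The error of evaluating the coefficients of the linearised equation at
      \<open>P n\<close> instead of \<Phi>; the factor \<open>2 * M\<close> bounds the components of
      \<open>Z\<close>. It tends to 0 uniformly, which makes the recursion for
      \<open>Zn n - Z\<close> fit \<open>contraction_seq\<close>.\<close>
    define E where "E n p = norm (dd (v, 0) G (p, P n p) - dd (v, 0) G (p, \<Phi> p)) +
      2 * M * (\<Sum>e\<in>Basis. norm (dd (0, e) G (p, P n p) - dd (0, e) G (p, \<Phi> p)))" for n p
    have "unif_small K E"
      unfolding E_def using M(1) by (intro unif_small_add unif_small_cmult unif_small_sum small cdG) auto
    then have sE: "unif_small K (\<lambda>n p. r * E n p)" using r by (intro unif_small_cmult) auto
    have step: "norm (Zn (Suc n) p - Z p) \<le> \<delta> + c / 2"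
      if d: "\<And>p. p \<in> K \<Longrightarrow> r * E n p \<le> \<delta>" and c: "\<And>p. p \<in> B \<Longrightarrow> norm (Zn n p - Z p) \<le> c" and p: "p \<in> B" for n \<delta> c p
    proof -
      define hn where "hn p = dd (v, 0) G (p, P n p) + dd (0, Zn n p) G (p, P n p)" for p
      define h where "h p = dd (v, 0) G (p, \<Phi> p) + dd (0, Z p) G (p, \<Phi> p)" for p
      have chn: "continuous_on B hn" "continuous_on B h"
        unfolding hn_def h_def by (intro continuous_on_add cD cD0 PB BK cZn \<Phi>B)+
      have "norm (segint b (\<lambda>p. hn p - h p) p) \<le> \<bar>p \<bullet> b\<bar> * ((\<delta> + c / 2) / r)"
      proof (rule norm_segint_le[OF B(3) continuous_on_diff[OF chn] p])
        fix p assume p: "p \<in> B"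
        have pK: "p \<in> K" "P n p \<in> V" using p BK PB(2) by auto
        have "hn p - h p = (dd (v, 0) G (p, P n p) - dd (v, 0) G (p, \<Phi> p)) +
            dd (0, Zn n p - Z p) G (p, P n p) + (dd (0, Z p) G (p, P n p) - dd (0, Z p) G (p, \<Phi> p))"
          using linear_diff[OF linG[OF inOW(1)[OF pK(1), where n = n]], of "(0, Zn n p)" "(0, Z p)"]
          by (simp add: hn_def h_def)
        then have "norm (hn p - h p) \<le> norm (dd (v, 0) G (p, P n p) - dd (v, 0) G (p, \<Phi> p)) +
            norm (dd (0, Zn n p - Z p) G (p, P n p)) + norm (dd (0, Z p) G (p, P n p) - dd (0, Z p) G (p, \<Phi> p))"
          by (metis norm_triangle_le norm_triangle_ineq add_mono order_refl)
        moreover have "r * norm (dd (0, Zn n p - Z p) G (p, P n p)) \<le> c / 2"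
          using asm(5)[OF pK, of "Zn n p - Z p"] c[OF p] by simp
        moreover have "norm (dd (0, Z p) G (p, P n p) - dd (0, Z p) G (p, \<Phi> p)) \<le>
            2 * M * (\<Sum>e\<in>Basis. norm (dd (0, e) G (p, P n p) - dd (0, e) G (p, \<Phi> p)))"
        proof -
          have "dd (0, Z p) G (p, P n p) - dd (0, Z p) G (p, \<Phi> p) =
            (\<Sum>e\<in>Basis. (Z p \<bullet> e) *\<^sub>R (dd (0, e) G (p, P n p) - dd (0, e) G (p, \<Phi> p)))"
            by (simp add: sum0[OF inOW(1)[OF pK(1)], where h = "Z p"] sum0[OF inOW(2)[OF pK(1)], where h = "Z p"]
                sum_subtractf scaleR_diff_right)
          also have "norm \<dots> \<le> (\<Sum>e\<in>Basis. 2 * M * norm (dd (0, e) G (p, P n p) - dd (0, e) G (p, \<Phi> p)))"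
          proof (rule sum_norm_le)
            fix e :: 'b assume e: "e \<in> Basis"
            have "\<bar>Z p \<bullet> e\<bar> \<le> 2 * M" using Basis_le_norm[OF e, of "Z p"] Z(2)[OF pK(1)] by linarith
            then show "norm ((Z p \<bullet> e) *\<^sub>R (dd (0, e) G (p, P n p) - dd (0, e) G (p, \<Phi> p)))
              \<le> 2 * M * norm (dd (0, e) G (p, P n p) - dd (0, e) G (p, \<Phi> p))"
              by (simp add: mult_right_mono)
          qed
          finally show ?thesis by (simp add: sum_distrib_left)
        qed
        ultimately have "norm (hn p - h p) \<le> E n p + norm (dd (0, Zn n p - Z p) G (p, P n p))"
          unfolding E_def by linarith
        then have "r * norm (hn p - h p) \<le> r * E n p + r * norm (dd (0, Zn n p - Z p) G (p, P n p))"
          using r by (simp flip: distrib_left)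
        also have "\<dots> \<le> \<delta> + c / 2"
          using d[OF pK(1)] \<open>r * norm (dd (0, Zn n p - Z p) G (p, P n p)) \<le> c / 2\<close> by linarith
        finally show "norm (hn p - h p) \<le> (\<delta> + c / 2) / r" using r by (simp add: field_simps)
      qed
      also have "\<dots> \<le> r * ((\<delta> + c / 2) / r)"
      proof (rule mult_right_mono[OF pb[OF p]])
        have "0 \<le> r * E n p" using r M(1) by (simp add: E_def sum_nonneg)
        then have "\<delta> \<ge> 0" using d[of p] p BK by fastforce
        moreover have "c \<ge> 0" using c[OF p] norm_ge_zero order_trans by blast
        ultimately show "0 \<le> (\<delta> + c / 2) / r" using r by simp
      qed
      finally have "norm (segint b hn p - segint b h p) \<le> \<delta> + c / 2"
        using r segint_diff[OF B(3) chn p] by simp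
      moreover have "Zn (Suc n) p - Z p = segint b hn p - segint b h p"
        using ZnS[OF p, of n] Zeq[of p] p BK by (auto simp: hn_def[abs_def] h_def[abs_def])
      ultimately show ?thesis by simp
    qed
    have "unif_small B (\<lambda>n p. norm (Zn n p - Z p))"
      unfolding unif_small_def
    proof (intro allI impI)
      fix \<delta> :: real assume "\<delta> > 0"
      then show "\<exists>N. \<forall>n\<ge>N. \<forall>p\<in>B. norm (Zn n p - Z p) \<le> \<delta>"
      proof (rule contraction_seq[rotated 2])
        show "norm (Zn n p - Z p) \<le> C + 2 * M" if "p \<in> B" for n p
          using norm_triangle_ineq4[of "Zn n p" "Z p"] Znb[OF that, of n] Z(2)[of p] that BK by fastforce
        fix \<delta> :: real assume "\<delta> > 0"
        then obtain N where "\<And>n p. n \<ge> N \<Longrightarrow> p \<in> K \<Longrightarrow> r * E n p \<le> \<delta>"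
          using sE unfolding unif_small_def by meson
        then show "\<exists>N. \<forall>n\<ge>N. \<forall>c. (\<forall>p\<in>B. norm (Zn n p - Z p) \<le> c) \<longrightarrow>
            (\<forall>p\<in>B. norm (Zn (Suc n) p - Z p) \<le> \<delta> + c / 2)"
          using step by blast
      qed
    qed
    then show ?thesis using Z(1) unfolding Zn_def by blast
  qed
  then have "\<forall>v\<in>Basis. \<exists>Z. continuous_on K Z \<and> unif_small B (\<lambda>n p. norm (dd v (P n) p - Z p))"
    by blast
  from bchoice[OF this]
  obtain Z where Z: "\<And>v. v \<in> Basis \<Longrightarrow> continuous_on K (Z v)"
    "\<And>v. v \<in> Basis \<Longrightarrow> unif_small B (\<lambda>n p. norm (dd v (P n) p - Z v p))"
    by blast
  have pw: "(\<lambda>n. P n p) \<longlonglongrightarrow> \<Phi> p" if "p \<in> K" for p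
    using tendsto_uniform_limitI[OF lim that] .
  \<comment> \<open>Uniform convergence of the derivatives in each basis direction makes the limit
    differentiable, with the limits \<open>Z e\<close> as its partial derivatives.\<close>
  have "\<exists>g. \<forall>p\<in>B. (\<lambda>n. P n p) \<longlonglongrightarrow> g p \<and> (g has_derivative (\<lambda>h. \<Sum>e\<in>Basis. (h \<bullet> e) *\<^sub>R Z e p)) (at p within B)"
  proof (rule has_derivative_sequence[OF B(2) _ _ B(4) pw])
    show "(P n has_derivative frechet_derivative (P n) (at p)) (at p within B)" if "p \<in> B" for n p
      using has_derivative_at_withinI[OF Pd[OF that]] .
    show "0 \<in> K" using B(4) BK by auto
    fix e :: real assume e: "e > 0"
    have "unif_small B (\<lambda>n p. \<Sum>i\<in>Basis. norm (dd i (P n) p - Z i p))"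
      by (intro unif_small_sum Z)
    then obtain N where N: "\<And>n p. n \<ge> N \<Longrightarrow> p \<in> B \<Longrightarrow> (\<Sum>i\<in>Basis. norm (dd i (P n) p - Z i p)) \<le> e"
      using e unfolding unif_small_def by meson
    have "norm (dd h (P n) p - (\<Sum>i\<in>Basis. (h \<bullet> i) *\<^sub>R Z i p)) \<le> e * norm h" if "n \<ge> N" "p \<in> B" for n p h
    proof -
      have "dd h (P n) p - (\<Sum>i\<in>Basis. (h \<bullet> i) *\<^sub>R Z i p) = (\<Sum>i\<in>Basis. (h \<bullet> i) *\<^sub>R (dd i (P n) p - Z i p))"
        by (simp add: linear_eq_sum_Basis[OF has_derivative_linear[OF Pd[OF that(2)]], where v = h]
            sum_subtractf scaleR_diff_right)
      also have "norm \<dots> \<le> (\<Sum>i\<in>Basis. norm h * norm (dd i (P n) p - Z i p))"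
        by (rule sum_norm_le) (simp add: mult_right_mono Basis_le_norm)
      also have "\<dots> \<le> norm h * e"
        using N[OF that] by (simp flip: sum_distrib_left add: mult_left_mono)
      finally show ?thesis by (simp add: mult.commute)
    qed
    then show "\<forall>\<^sub>F n in sequentially. \<forall>p\<in>B. \<forall>h. norm (dd h (P n) p - (\<Sum>i\<in>Basis. (h \<bullet> i) *\<^sub>R Z i p)) \<le> e * norm h"
      unfolding eventually_sequentially by blast
  qed
  then obtain g where g: "\<And>p. p \<in> B \<Longrightarrow> (\<lambda>n. P n p) \<longlonglongrightarrow> g p"
    "\<And>p. p \<in> B \<Longrightarrow> (g has_derivative (\<lambda>h. \<Sum>e\<in>Basis. (h \<bullet> e) *\<^sub>R Z e p)) (at p within B)"
    by blast
  have "\<Phi> p = g p" if "p \<in> B" for p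
    using LIMSEQ_unique[OF pw g(1)[OF that]] that BK by blast
  then have "(\<Phi> has_derivative (\<lambda>h. \<Sum>e\<in>Basis. (h \<bullet> e) *\<^sub>R Z e p)) (at p)" if "p \<in> B" for p
    using g(2)[OF that] has_derivative_cong_open[OF B(1), of \<Phi> g p] that
    by (simp add: at_within_open[OF _ B(1)])
  then have "ck_on (Suc 0) B \<Phi>"
    by (rule ck_on_SucI[OF B(1)])
      (auto intro!: continuous_intros continuous_on_subset[OF Z(1) BK])
  then show thesis using that \<Phi> by (simp add: K_def B_def V_def)
qed

text \<open>Differentiating a linear equation gives one with the same coefficients \<open>m\<close>, so the regularity of
  \<open>Z\<close> is obtained by induction.\<close>

lemma ck_on_linear_fixpoint:
  fixes Z :: "'a::euclidean_space \<Rightarrow> 'b::euclidean_space" and m :: "'b \<Rightarrow> 'a \<Rightarrow> 'b"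
  assumes b: "b \<in> Basis"
    and C: "ck_on k (ball 0 r) C" and m: "\<And>e. e \<in> Basis \<Longrightarrow> ck_on k (ball 0 r) (m e)"
    and Z: "continuous_on (ball 0 r) Z"
    and eq: "\<And>p. p \<in> ball 0 r \<Longrightarrow> Z p = C p + segint b (\<lambda>p. \<Sum>e\<in>Basis. (Z p \<bullet> e) *\<^sub>R m e p) p"
    and bd: "\<And>p u. p \<in> ball 0 r \<Longrightarrow> r * norm (\<Sum>e\<in>Basis. (u \<bullet> e) *\<^sub>R m e p) \<le> norm u / 2"
  shows "ck_on k (ball 0 r) Z"
  using C m Z eq
proof (induction k arbitrary: C Z)
  case 0
  then show ?case by simp
next
  case (Suc k)
  define B where "B = ball (0::'a) r"
  have B: "open B" "convex B" "seg_closed b B"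
    using seg_closed_ball[OF b] by (auto simp: B_def)
  note asm = Suc.prems[folded B_def]
  \<comment> \<open>\<open>Z\<close> is only continuous a priori. On a slightly smaller ball, where
    all data are bounded, \<open>picard_C1\<close> produces a continuously differentiable solution,
    and uniqueness identifies it with \<open>Z\<close>.\<close>
  have Z1: "ck_on (Suc 0) B Z"
  proof (rule ck_on_local)
    fix p assume p: "p \<in> B"
    define s where "s = (norm p + r) / 2"
    have s: "norm p < s" "s < r" "s > 0" using p norm_ge_zero[of p] unfolding B_def s_def by (auto simp del: norm_ge_zero)
    have sB: "cball 0 s \<subseteq> B" using s by (auto simp: B_def)
    obtain M1 where M1: "M1 \<ge> 0" "\<And>x. x \<in> cball 0 s \<Longrightarrow> norm (C x) \<le> M1"
      using compact_norm_bound[OF compact_cball continuous_on_subset[OF ck_on_imp_continuous_on[OF asm(1)] sB]] by blast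
    obtain M2 where M2: "M2 \<ge> 0" "\<And>x. x \<in> cball 0 s \<Longrightarrow> norm (Z x) \<le> M2"
      using compact_norm_bound[OF compact_cball continuous_on_subset[OF asm(3) sB]] by blast
    define R where "R = 2 * M1 + M2"
    define G where "G z = (\<Sum>e\<in>Basis. (snd z \<bullet> e) *\<^sub>R m e (fst z))" for z :: "'a \<times> 'b"
    have BU: "open (B \<times> (UNIV::'b set))" using B(1) by (simp add: open_Times)
    have Gck: "ck_on (Suc 0) (B \<times> UNIV) G"
      unfolding G_def
    proof (intro ck_on_sum ck_on_scaleR ck_on_inner BU ck_on_const)
      show "ck_on (Suc 0) (B \<times> UNIV) (snd :: 'a \<times> 'b \<Rightarrow> 'b)"
        by (rule ck_on_bounded_linear[OF bounded_linear_snd])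
      show "ck_on (Suc 0) (B \<times> UNIV) (\<lambda>z::'a\<times>'b. m e (fst z))" if "e \<in> Basis" for e
        by (rule ck_on_compose[OF BU ck_on_le[OF asm(2)[OF that]] ck_on_bounded_linear[OF bounded_linear_fst]]) auto
    qed
    have lin: "bounded_linear (\<lambda>u. G (p, u))" for p
      unfolding G_def fst_conv snd_conv
      by (intro bounded_linear_sum bounded_linear_scaleR_const bounded_linear_inner_left)
    have G0: "dd (0, h) G (p, u) = G (p, h)" if "p \<in> B" for p h u
    proof -
      have 1: "((\<lambda>u. (p, u)) has_derivative (\<lambda>h. (0, h))) (at u)"
        by (auto intro!: derivative_eq_intros)
      have "((\<lambda>u. G (p, u)) has_derivative (\<lambda>h. dd (0, h) G (p, u))) (at u)"
        by (rule has_derivative_compose[OF 1 ck_on_Suc_has_derivative[OF Gck]]) (use that in simp)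
      from has_derivative_unique[OF this bounded_linear_imp_has_derivative[OF lin]]
      show ?thesis by meson
    qed
    have Gb: "s * norm (G (p, u)) \<le> norm u / 2" if "p \<in> cball 0 s" for p u
    proof -
      have "s * norm (G (p, u)) \<le> r * norm (G (p, u))" using s by (intro mult_right_mono) auto
      also have "\<dots> \<le> norm u / 2" unfolding G_def using bd[folded B_def] that sB by auto
      finally show ?thesis .
    qed
    obtain \<Phi> where \<Phi>: "continuous_on (cball 0 s) \<Phi>" "\<Phi> ` cball 0 s \<subseteq> cball 0 R"
      "\<And>p. p \<in> cball 0 s \<Longrightarrow> \<Phi> p = C p + segint b (\<lambda>p. G (p, \<Phi> p)) p"
      "ck_on (Suc 0) (ball 0 s) \<Phi>"
    proof (rule picard_C1[OF b s(3) _ B(1) sB open_UNIV subset_UNIV ck_on_le[OF asm(1)] Gck])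
      show "0 \<le> R" using M1 M2 by (simp add: R_def)
      show "norm (C p - 0) \<le> R / 2" if "p \<in> cball 0 s" for p
        using M1(2)[OF that] M2(1) by (simp add: R_def)
      show "s * norm (G (p, u)) \<le> R / 2" if "p \<in> cball 0 s" "u \<in> cball 0 R" for p u
        using Gb[OF that(1), of u] that(2) by simp
      show "s * norm (dd (0, h) G (p, u)) \<le> norm h / 2" if "p \<in> cball 0 s" "u \<in> cball 0 R" for p u h
        using Gb[OF that(1), of h] G0[where p = p and h = h and u = u] that(1) sB by auto
    qed (auto intro: that)
    have "Z q = \<Phi> q" if q: "q \<in> cball 0 s" for q
    proof (rule picard_unique[OF b s(3), where W = UNIV and G = "\<lambda>p u. G (p, u)"])
      show "continuous_on (cball 0 s \<times> UNIV) (\<lambda>(p, u). G (p, u))"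
        using continuous_on_subset[OF ck_on_imp_continuous_on[OF Gck], of "cball 0 s \<times> UNIV"] sB by auto
      show "s * norm (G (p, u) - G (p, v)) \<le> norm (u - v) / 2" if "p \<in> cball 0 s" for p u v
        using Gb[OF that, of "u - v"] by (simp add: linear_diff[OF bounded_linear.linear[OF lin]])
      show "continuous_on (cball 0 s) Z" using continuous_on_subset[OF asm(3) sB] .
      show "Z p = C p + segint b (\<lambda>p. G (p, Z p)) p" if "p \<in> cball 0 s" for p
        using asm(4)[of p] that sB by (auto simp: G_def)
    qed (use \<Phi> q in auto)
    then have "ck_on (Suc 0) (ball 0 s) Z"
      using \<Phi>(4) ck_on_cong[of "ball 0 s" Z \<Phi>] by simp
    then show "\<exists>T. open T \<and> p \<in> T \<and> ck_on (Suc 0) T Z"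
      using s by (intro exI[of _ "ball 0 s"]) auto
  qed
  have Zk: "ck_on k B Z"
    by (rule Suc.IH[folded B_def, OF ck_on_SucD[OF asm(1)] ck_on_SucD[OF asm(2)] asm(3,4)])
  define h where "h p = (\<Sum>e\<in>Basis. (Z p \<bullet> e) *\<^sub>R m e p)" for p
  have m1: "ck_on (Suc 0) B (m e)" if "e \<in> Basis" for e by (rule ck_on_le[OF asm(2)[OF that]]) simp
  have C1: "ck_on (Suc 0) B C" by (rule ck_on_le[OF asm(1)]) simp
  have h1: "ck_on (Suc 0) B h" unfolding h_def by (intro ck_on_sum ck_on_scaleR ck_on_inner B ck_on_const Z1 m1)
  have hk: "ck_on k B h" unfolding h_def
    by (intro ck_on_sum ck_on_scaleR ck_on_inner B ck_on_const Zk ck_on_SucD[OF asm(2)])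
  have Zd: "(Z has_derivative (\<lambda>v. dd v C p + ((v \<bullet> b) *\<^sub>R h p + segint b (dd (v - (v \<bullet> b) *\<^sub>R b) h) p))) (at p)"
    if p: "p \<in> B" for p
  proof -
    have "((\<lambda>p. C p + segint b h p) has_derivative
      (\<lambda>v. dd v C p + ((v \<bullet> b) *\<^sub>R h p + segint b (dd (v - (v \<bullet> b) *\<^sub>R b) h) p))) (at p)"
      by (intro has_derivative_add ck_on_Suc_has_derivative[OF C1 p] segint_has_derivative[OF B p h1])
    then show ?thesis
      using has_derivative_cong_open[OF B(1) _ p, of Z "\<lambda>p. C p + segint b h p"] asm(4) unfolding h_def by blast
  qed
  have orth: "ck_on k B (dd v Z)" if v: "v \<bullet> b = 0" for v
  proof -
    \<comment> \<open>Differentiating the coefficients \<open>m\<close> brings in \<open>Z\<close>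
      but not its derivative, so this new inhomogeneity has the regularity \<open>k\<close> already
      known for \<open>Z\<close>.\<close>
    define C' where "C' p = dd v C p + segint b (\<lambda>p. \<Sum>e\<in>Basis. (Z p \<bullet> e) *\<^sub>R dd v (m e) p) p" for p
    have ck: "ck_on k B (\<lambda>p. \<Sum>e\<in>Basis. (Z p \<bullet> e) *\<^sub>R dd v (m e) p)"
      by (intro ck_on_sum ck_on_scaleR ck_on_inner B ck_on_const Zk ck_on_Suc_dd[OF asm(2)])
    have cY: "continuous_on B (dd v Z)" using ck_on_imp_continuous_on[OF ck_on_Suc_dd[OF Z1]] .
    show ?thesis
    proof (rule Suc.IH[folded B_def])
      show "ck_on k B C'" unfolding C'_def
        by (intro ck_on_add B ck_on_Suc_dd[OF asm(1)] ck_on_segint ck)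
      show "ck_on k B (m e)" if "e \<in> Basis" for e using ck_on_SucD[OF asm(2)[OF that]] .
      show "continuous_on B (dd v Z)" by (rule cY)
      fix p assume p: "p \<in> B"
      have dh: "dd v h p = (\<Sum>e\<in>Basis. (Z p \<bullet> e) *\<^sub>R dd v (m e) p) + (\<Sum>e\<in>Basis. (dd v Z p \<bullet> e) *\<^sub>R m e p)"
        if p: "p \<in> B" for p
      proof -
        have "(h has_derivative (\<lambda>v. \<Sum>e\<in>Basis. (Z p \<bullet> e) *\<^sub>R dd v (m e) p + (dd v Z p \<bullet> e) *\<^sub>R m e p)) (at p)"
          unfolding h_def
          by (intro has_derivative_sum has_derivative_scaleR has_derivative_inner_left
              ck_on_Suc_has_derivative[OF Z1 p] ck_on_Suc_has_derivative[OF m1 p])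
        then show ?thesis by (simp add: frechet_derivative_eqI sum.distrib)
      qed
      have "dd v Z p = dd v C p + segint b (dd v h) p"
        using frechet_derivative_eqI[OF Zd[OF p]] v by simp
      also have "segint b (dd v h) p =
        segint b (\<lambda>p. (\<Sum>e\<in>Basis. (Z p \<bullet> e) *\<^sub>R dd v (m e) p) + (\<Sum>e\<in>Basis. (dd v Z p \<bullet> e) *\<^sub>R m e p)) p"
        by (rule segint_cong[OF B(3) p dh])
      also have "\<dots> = segint b (\<lambda>p. \<Sum>e\<in>Basis. (Z p \<bullet> e) *\<^sub>R dd v (m e) p) p +
          segint b (\<lambda>p. \<Sum>e\<in>Basis. (dd v Z p \<bullet> e) *\<^sub>R m e p) p"
        by (rule segint_add[OF B(3) ck_on_imp_continuous_on[OF ck] _ p])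
          (intro continuous_intros cY ck_on_imp_continuous_on[OF m1])
      finally show "dd v Z p = C' p + segint b (\<lambda>p. \<Sum>e\<in>Basis. (dd v Z p \<bullet> e) *\<^sub>R m e p) p"
        by (simp add: C'_def)
    qed
  qed
  have "ck_on k B (dd v Z)" for v
  proof -
    have bb: "b \<bullet> b = 1" using b by simp
    \<comment> \<open>The derivative along \<open>b\<close> needs no equation of its own: it is
      \<open>dd b C + h\<close> by the fundamental theorem.\<close>
    have "ck_on k B (\<lambda>p. dd (v - (v \<bullet> b) *\<^sub>R b) Z p + (v \<bullet> b) *\<^sub>R (dd b C p + h p))"
      by (intro ck_on_add ck_on_scaleR ck_on_const B orth hk ck_on_Suc_dd[OF asm(1)])
        (simp add: inner_diff_left bb)
    moreover have "dd v Z p = dd (v - (v \<bullet> b) *\<^sub>R b) Z p + (v \<bullet> b) *\<^sub>R (dd b C p + h p)" if p: "p \<in> B" for p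
    proof -
      note L = has_derivative_linear[OF ck_on_Suc_has_derivative[OF Z1 p]]
      have bZ: "dd b Z p = dd b C p + h p"
      proof -
        have "segint b (dd 0 h) p = segint b (\<lambda>p. 0) p"
          by (rule segint_cong[OF B(3) p])
            (rule linear_0[OF has_derivative_linear[OF ck_on_Suc_has_derivative[OF h1]]])
        then show ?thesis
          using frechet_derivative_eqI[OF Zd[OF p]] bb by (simp add: segint_def)
      qed
      show ?thesis
        unfolding bZ[symmetric] using linear_add[OF L, of "v - (v \<bullet> b) *\<^sub>R b" "(v \<bullet> b) *\<^sub>R b"]
        by (simp add: linear_cmul[OF L])
    qed
    ultimately show ?thesis using ck_on_cong[OF B(1), of "dd v Z"] by simp
  qed
  then show ?case
    using Z1 unfolding B_def by simp
qed

text \<open>The initial map \<sigma> is prescribed on the hyperplane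
  \<open>p \<bullet> b = 0\<close> and extended constantly along \<open>b\<close> as
  \<open>Q\<close>; the flow is the fixed point of \<open>Q + segint b (A \<circ> \<Phi>)\<close>.
  Continuous differentiability comes from \<open>picard_C1\<close>, higher regularity from the
  linear equations satisfied by the derivatives.\<close>

lemma local_flow:
  fixes A :: "'b::euclidean_space \<Rightarrow> 'b" and \<sigma> :: "'a::euclidean_space \<Rightarrow> 'b"
  assumes b: "b \<in> Basis" and U: "open U" "\<sigma> 0 \<in> U" "smooth_on U A"
    and S: "open S" "0 \<in> S" "smooth_on S \<sigma>"
  obtains r \<Phi> where "r > 0" "ball 0 r \<subseteq> S" "smooth_on (ball 0 r) \<Phi>" "\<Phi> ` ball 0 r \<subseteq> U"
    "\<And>p. p \<in> ball 0 r \<Longrightarrow> dd b \<Phi> p = A (\<Phi> p)"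
    "\<And>p. p \<in> ball 0 r \<Longrightarrow> p \<bullet> b = 0 \<Longrightarrow> \<Phi> p = \<sigma> p"
proof -
  define q0 where "q0 = \<sigma> 0"
  obtain R where R: "R > 0" "cball q0 R \<subseteq> U"
    using U(1,2) open_contains_cball unfolding q0_def by blast
  obtain r0 where r0: "r0 > 0" "ball 0 r0 \<subseteq> S"
    using S(1,2) open_contains_ball by blast
  have A1: "ck_on (Suc 0) U A" using U(3) by (simp add: smooth_on_def del: ck_on.simps)
  obtain M where M: "M \<ge> 0" "\<And>u. u \<in> cball q0 R \<Longrightarrow> norm (A u) \<le> M"
    using compact_norm_bound[OF compact_cball continuous_on_subset[OF smooth_on_imp_continuous_on[OF U(3)] R(2)]] by blast
  have "\<exists>L\<ge>0. \<forall>u\<in>cball q0 R. norm (dd e A u) \<le> L" for e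
  proof -
    have "continuous_on (cball q0 R) (dd e A)"
      using continuous_on_subset[OF smooth_on_imp_continuous_on[OF smooth_on_dd[OF U(3)]] R(2)] .
    from compact_norm_bound[OF compact_cball this] show ?thesis by metis
  qed
  then obtain L where L: "\<And>e. L e \<ge> 0" "\<And>e u. u \<in> cball q0 R \<Longrightarrow> norm (dd e A u) \<le> L e"
    by metis
  define LL where "LL = (\<Sum>e\<in>Basis. L e)"
  have LL0: "LL \<ge> 0" unfolding LL_def using L(1) by (simp add: sum_nonneg)
  have dA: "dd h A u = (\<Sum>e\<in>Basis. (h \<bullet> e) *\<^sub>R dd e A u)" if "u \<in> U" for h u
    using linear_eq_sum_Basis[OF has_derivative_linear[OF smooth_on_has_derivative[OF U(3) that]]] .
  have LLb: "norm (dd h A u) \<le> LL * norm h" if "u \<in> cball q0 R" for h u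
  proof -
    have "norm (dd h A u) \<le> (\<Sum>e\<in>Basis. norm h * L e)"
      using that R(2) L(1) L(2)[OF that] Basis_le_norm
      by (subst dA) (auto intro!: sum_norm_le mult_mono)
    then show ?thesis by (simp add: LL_def sum_distrib_left mult.commute)
  qed
  define pr where "pr p = p - (p \<bullet> b) *\<^sub>R b" for p :: 'a
  have pr_lin: "bounded_linear pr" unfolding pr_def
    by (intro bounded_linear_intros)
  have pr_norm: "norm (pr p) \<le> norm p" for p
    using norm_seg_le[OF b, of 0 p] by (simp add: pr_def)
  define Q where "Q p = \<sigma> (pr p)" for p
  have prB: "pr ` ball 0 r0 \<subseteq> S" using r0(2) pr_norm by (fastforce intro: le_less_trans)
  have Qs: "smooth_on (ball 0 r0) Q"
    unfolding Q_def by (rule smooth_on_compose[OF open_ball S(3) smooth_on_bounded_linear[OF pr_lin] prB])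
  have Q0: "Q 0 = q0" by (simp add: Q_def pr_def q0_def)
  have "isCont Q 0"
    using smooth_on_imp_continuous_on[OF Qs] r0(1) by (simp add: continuous_on_eq_continuous_at)
  then obtain d where d: "d > 0" "\<And>p. norm p < d \<Longrightarrow> dist (Q p) q0 < R / 2"
    using R(1) unfolding continuous_at_eps_delta Q0
    by (metis diff_zero dist_norm half_gt_zero)
  \<comment> \<open>The last two bounds give \<open>r * M \<le> R / 2\<close> and
    \<open>r * LL \<le> 1 / 2\<close>, the smallness conditions of \<open>picard_C1\<close>; the
    first two keep the ball where \<open>Q\<close> is defined and close to
    \<open>q0\<close>.\<close>
  define r where "r = min (min (r0 / 2) (d / 2)) (min (R / (2 * (M + 1))) (1 / (2 * (LL + 1))))"
  have r: "r > 0" using r0 d R M LL0 by (auto simp: r_def)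
  have rr: "r < r0" "r < d" "r \<le> R / (2 * (M + 1))" "r \<le> 1 / (2 * (LL + 1))"
    using r0 d unfolding r_def by auto
  have rM: "r * M \<le> R / 2"
  proof -
    have "r * M \<le> r * (M + 1)" using r by simp
    also have "\<dots> \<le> R / (2 * (M + 1)) * (M + 1)" using rr(3) M by (intro mult_right_mono) auto
    also have "\<dots> = R / 2" using M by (simp add: field_simps)
    finally show ?thesis .
  qed
  have rL: "r * LL \<le> 1 / 2"
  proof -
    have "r * LL \<le> r * (LL + 1)" using r by simp
    also have "\<dots> \<le> 1 / (2 * (LL + 1)) * (LL + 1)" using rr(4) LL0 by (intro mult_right_mono) auto
    also have "\<dots> = 1 / 2" using LL0 by (simp add: field_simps)
    finally show ?thesis .
  qed
  have rLh: "r * norm (dd h A u) \<le> norm h / 2" if "u \<in> cball q0 R" for h u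
  proof -
    have "r * norm (dd h A u) \<le> (r * LL) * norm h" using LLb[OF that, of h] r by simp
    also have "\<dots> \<le> (1 / 2) * norm h" by (intro mult_right_mono rL) simp
    finally show ?thesis by simp
  qed
  define B where "B = ball (0::'a) r"
  have B: "open B" "convex B" "seg_closed b B"
    using seg_closed_ball[OF b] by (auto simp: B_def)
  have sub: "cball 0 r \<subseteq> ball 0 r0" using rr(1) by auto
  define G where "G z = A (snd z)" for z :: "'a \<times> 'b"
  have op: "open (ball (0::'a) r0 \<times> U)" using U(1) by (simp add: open_Times)
  have Gck: "ck_on (Suc 0) (ball 0 r0 \<times> U) G"
    unfolding G_def by (rule ck_on_compose[OF op A1 ck_on_bounded_linear[OF bounded_linear_snd]]) auto
  have G0: "dd (0, h) G (p, u) = dd h A u" if "p \<in> ball 0 r0" "u \<in> U" for p h u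
  proof -
    have "(G has_derivative (\<lambda>h. dd (snd h) A u)) (at (p, u))"
      unfolding G_def using has_derivative_compose[OF bounded_linear_imp_has_derivative[OF bounded_linear_snd], of A _ "(p, u)"]
        smooth_on_has_derivative[OF U(3) that(2)] by simp
    then show ?thesis by (simp add: frechet_derivative_eqI)
  qed
  obtain \<Phi> where \<Phi>: "continuous_on (cball 0 r) \<Phi>" "\<Phi> ` cball 0 r \<subseteq> cball q0 R"
    "\<And>p. p \<in> cball 0 r \<Longrightarrow> \<Phi> p = Q p + segint b (\<lambda>p. G (p, \<Phi> p)) p"
    "ck_on (Suc 0) (ball 0 r) \<Phi>"
  proof (rule picard_C1[OF b r _ open_ball sub U(1) R(2) _ Gck])
    show "0 \<le> R" using R by simp
    show "ck_on (Suc 0) (ball 0 r0) Q" using Qs by (simp add: smooth_on_def del: ck_on.simps)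
    show "norm (Q p - q0) \<le> R / 2" if "p \<in> cball 0 r" for p
      using d(2)[of p] that rr(2) by (simp add: dist_norm)
    show "r * norm (G (p, u)) \<le> R / 2" if "p \<in> cball 0 r" "u \<in> cball q0 R" for p u
    proof -
      have "r * norm (A u) \<le> r * M" using M(2)[OF that(2)] r by simp
      then show ?thesis using rM by (simp add: G_def)
    qed
    show "r * norm (dd (0, h) G (p, u)) \<le> norm h / 2" if "p \<in> cball 0 r" "u \<in> cball q0 R" for p u h
    proof -
      have "dd (0, h) G (p, u) = dd h A u" by (rule G0) (use that sub R(2) in blast)+
      then show ?thesis using rLh[OF that(2)] by simp
    qed
  qed (auto intro: that)
  have BU: "\<Phi> ` B \<subseteq> U" "\<Phi> ` B \<subseteq> cball q0 R" using \<Phi>(2) R(2) ball_subset_cball[of 0 r] unfolding B_def by blast+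
  have eq: "\<Phi> p = Q p + segint b (\<lambda>p. A (\<Phi> p)) p" if "p \<in> B" for p
    using \<Phi>(3)[of p] that by (simp add: B_def G_def)
  have \<Phi>1: "ck_on (Suc 0) B \<Phi>" using \<Phi>(4) by (simp add: B_def)
  have QB: "smooth_on B Q" using smooth_on_subset[OF Qs] sub ball_subset_cball[of 0 r] unfolding B_def by blast
  have Q1: "ck_on (Suc 0) B Q" using QB by (simp add: smooth_on_def del: ck_on.simps)
  have A\<Phi>: "ck_on k B (\<lambda>p. F (\<Phi> p))" if "ck_on k B \<Phi>" "smooth_on U F" for k and F :: "'b \<Rightarrow> 'b"
    by (rule ck_on_compose[OF B(1) _ that(1) BU(1)]) (use that(2) in \<open>simp add: smooth_on_def\<close>)
  note A\<Phi>1 = A\<Phi>[OF \<Phi>1 U(3)]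
  have ddA\<Phi>: "dd v (\<lambda>p. A (\<Phi> p)) p = (\<Sum>e\<in>Basis. (dd v \<Phi> p \<bullet> e) *\<^sub>R dd e A (\<Phi> p))" if "p \<in> B" for v p
  proof -
    have *: "\<Phi> p \<in> U" using BU that by blast
    have "((\<lambda>p. A (\<Phi> p)) has_derivative (\<lambda>v. dd (dd v \<Phi> p) A (\<Phi> p))) (at p)"
      by (rule has_derivative_compose[OF ck_on_Suc_has_derivative[OF \<Phi>1 that] smooth_on_has_derivative[OF U(3) *]])
    then have "dd v (\<lambda>p. A (\<Phi> p)) p = dd (dd v \<Phi> p) A (\<Phi> p)" by (simp add: frechet_derivative_eqI)
    then show ?thesis by (rule trans[OF _ dA[OF *]])
  qed
  have dd\<Phi>: "dd v \<Phi> p = dd v Q p + dd v (segint b (\<lambda>p. A (\<Phi> p))) p" if p: "p \<in> B" for v p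
  proof -
    have "((\<lambda>p. Q p + segint b (\<lambda>p. A (\<Phi> p)) p) has_derivative
        (\<lambda>v. dd v Q p + dd v (segint b (\<lambda>p. A (\<Phi> p))) p)) (at p)"
      by (intro has_derivative_add ck_on_Suc_has_derivative[OF Q1 p]
          ck_on_Suc_has_derivative[OF ck_on_segint[OF B A\<Phi>1] p])
    then have "(\<Phi> has_derivative (\<lambda>v. dd v Q p + dd v (segint b (\<lambda>p. A (\<Phi> p))) p)) (at p)"
      using has_derivative_cong_open[OF B(1) eq p] by simp
    then show ?thesis by (simp add: frechet_derivative_eqI)
  qed
  have bb: "b \<bullet> b = 1" using b by simp
  have dbQ: "dd b Q p = 0" if p: "p \<in> B" for p
  proof -
    have "pr p \<in> S" using prB p sub ball_subset_cball[of 0 r] unfolding B_def by blast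
    then have "(Q has_derivative (\<lambda>v. dd (pr v) \<sigma> (pr p))) (at p)"
      unfolding Q_def
      by (intro has_derivative_compose[OF bounded_linear_imp_has_derivative[OF pr_lin]] smooth_on_has_derivative[OF S(3)])
    moreover have "dd 0 \<sigma> (pr p) = 0"
      using linear_0[OF has_derivative_linear[OF smooth_on_has_derivative[OF S(3) \<open>pr p \<in> S\<close>]]] .
    ultimately show ?thesis by (simp add: frechet_derivative_eqI pr_def bb)
  qed
  have db: "dd b \<Phi> p = A (\<Phi> p)" if p: "p \<in> B" for p
    using dd\<Phi>[OF p] dbQ[OF p] dd_segint_self[OF B p A\<Phi>1 b] by simp
  \<comment> \<open>Bootstrapping: regularity \<open>Suc k\<close> of \<Phi> gives the coefficients
    \<open>dd e A (\<Phi> p)\<close> of the linear equation for \<open>dd v \<Phi>\<close> that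
    regularity, then \<open>dd v \<Phi>\<close> has it, and \<Phi> gains one order. The start at 1
    rather than 0 is essential, since the linear equation already involves first
    derivatives.\<close>
  have "ck_on (Suc k) B \<Phi>" for k
  proof (induction k)
    case 0
    show ?case by (rule \<Phi>1)
  next
    case (Suc k)
    have orth: "ck_on (Suc k) B (dd v \<Phi>)" if v: "v \<bullet> b = 0" for v
    proof (rule ck_on_linear_fixpoint[OF b, where C = "dd v Q" and m = "\<lambda>e p. dd e A (\<Phi> p)" and r = r, folded B_def])
      show "ck_on (Suc k) B (dd v Q)" using smooth_on_dd[OF QB] by (simp add: smooth_on_def del: ck_on.simps)
      show "ck_on (Suc k) B (\<lambda>p. dd e A (\<Phi> p))" for e by (rule A\<Phi>[OF Suc smooth_on_dd[OF U(3)]])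
      show "continuous_on B (dd v \<Phi>)" by (rule ck_on_imp_continuous_on[OF ck_on_Suc_dd[OF \<Phi>1]])
      show "dd v \<Phi> p = dd v Q p + segint b (\<lambda>p. \<Sum>e\<in>Basis. (dd v \<Phi> p \<bullet> e) *\<^sub>R dd e A (\<Phi> p)) p" if p: "p \<in> B" for p
      proof -
        have "segint b (dd v (\<lambda>p. A (\<Phi> p))) p = segint b (\<lambda>p. \<Sum>e\<in>Basis. (dd v \<Phi> p \<bullet> e) *\<^sub>R dd e A (\<Phi> p)) p"
          by (rule segint_cong[OF B(3) p ddA\<Phi>])
        then show ?thesis using dd\<Phi>[OF p, of v] dd_segint_orth[OF B p A\<Phi>1 v] by simp
      qed
      show "r * norm (\<Sum>e\<in>Basis. (u \<bullet> e) *\<^sub>R dd e A (\<Phi> p)) \<le> norm u / 2" if p: "p \<in> B" for p u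
      proof -
        have *: "\<Phi> p \<in> U" "\<Phi> p \<in> cball q0 R" using BU p by blast+
        show ?thesis unfolding dA[OF *(1), symmetric] by (rule rLh[OF *(2)])
      qed
    qed
    have "ck_on (Suc k) B (dd v \<Phi>)" for v
    proof -
      have *: "ck_on (Suc k) B (\<lambda>p. dd (v - (v \<bullet> b) *\<^sub>R b) \<Phi> p + (v \<bullet> b) *\<^sub>R A (\<Phi> p))"
        by (intro ck_on_add ck_on_scaleR ck_on_const B orth A\<Phi>[OF Suc U(3)]) (simp add: inner_diff_left bb)
      have **: "dd v \<Phi> p = dd (v - (v \<bullet> b) *\<^sub>R b) \<Phi> p + (v \<bullet> b) *\<^sub>R A (\<Phi> p)" if p: "p \<in> B" for p
      proof -
        note L = has_derivative_linear[OF ck_on_Suc_has_derivative[OF \<Phi>1 p]]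
        show ?thesis
          unfolding db[OF p, symmetric] using linear_add[OF L, of "v - (v \<bullet> b) *\<^sub>R b" "(v \<bullet> b) *\<^sub>R b"]
          by (simp add: linear_cmul[OF L])
      qed
      show ?thesis by (rule iffD2[OF ck_on_cong[OF B(1) **] *])
    qed
    then show ?case using \<Phi>1 by simp
  qed
  then have "smooth_on B \<Phi>" unfolding smooth_on_def using ck_on_SucD by blast
  moreover have "\<Phi> p = \<sigma> p" if "p \<in> B" "p \<bullet> b = 0" for p
    using eq[OF that(1)] that(2) by (simp add: segint_eq_0 Q_def pr_def)
  moreover have "B \<subseteq> S" using r0(2) rr(1) by (auto simp: B_def)
  ultimately show thesis using that[of r \<Phi>] r BU(1) db by (simp add: B_def)
qed


section \<open>Directional derivatives, commuting flows and a Poincare lemma with parameters\<close>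

lemma dd_diff_arg: "smooth_on S F \<Longrightarrow> q \<in> S \<Longrightarrow> dd (u - v) F q = dd u F q - dd v F q"
  using linear_diff[OF has_derivative_linear[OF smooth_on_has_derivative]] by blast

lemma dd_add:
  "smooth_on S F \<Longrightarrow> smooth_on S G \<Longrightarrow> q \<in> S \<Longrightarrow> dd v (\<lambda>q. F q + G q) q = dd v F q + dd v G q"
  using frechet_derivative_eqI[OF has_derivative_add[OF smooth_on_has_derivative smooth_on_has_derivative]]
  by fastforce

lemma dd_diff:
  "smooth_on S F \<Longrightarrow> smooth_on S G \<Longrightarrow> q \<in> S \<Longrightarrow> dd v (\<lambda>q. F q - G q) q = dd v F q - dd v G q"
  using frechet_derivative_eqI[OF has_derivative_diff[OF smooth_on_has_derivative smooth_on_has_derivative]]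
  by fastforce

lemma dd_compose:
  "smooth_on T F \<Longrightarrow> smooth_on S G \<Longrightarrow> q \<in> S \<Longrightarrow> G q \<in> T \<Longrightarrow>
    dd v (\<lambda>q. F (G q)) q = dd (dd v G q) F (G q)"
  using frechet_derivative_eqI[OF has_derivative_compose[OF smooth_on_has_derivative smooth_on_has_derivative]]
  by fastforce

lemma dd_cong_open:
  "open S \<Longrightarrow> (\<And>q. q \<in> S \<Longrightarrow> F q = G q) \<Longrightarrow> q \<in> S \<Longrightarrow> dd v F q = dd v G q"
  using frechet_derivative_cong_open by metis

text \<open>The derivative \<open>J\<close> of the flow of \<open>B\<close> minus \<open>A\<close> solves the linearised equation of \<open>B\<close> and vanishes
  initially.\<close>

lemma commuting_flow:
  fixes A B :: "'b::euclidean_space \<Rightarrow> 'b" and \<Phi> :: "'a::euclidean_space \<Rightarrow> 'b"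
  assumes b: "b \<in> Basis" and U: "open U" "smooth_on U A" "smooth_on U B"
    and comm: "\<And>q. q \<in> U \<Longrightarrow> dd (A q) B q = dd (B q) A q"
    and r: "r > 0" and \<Phi>: "smooth_on (ball 0 r) \<Phi>" "\<Phi> ` ball 0 r \<subseteq> U"
    and dB: "\<And>p. p \<in> ball 0 r \<Longrightarrow> dd b \<Phi> p = B (\<Phi> p)"
    and dA: "\<And>p. p \<in> ball 0 r \<Longrightarrow> p \<bullet> b = 0 \<Longrightarrow> dd v \<Phi> p = A (\<Phi> p)"
  obtains s where "0 < s" "s \<le> r" "\<And>p. p \<in> ball 0 s \<Longrightarrow> dd v \<Phi> p = A (\<Phi> p)"
proof -
  define K where "K = ball (0::'a) r"
  have K: "open K" "convex K" "seg_closed b K"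
    using seg_closed_ball[OF b] by (auto simp: K_def)
  note \<Phi>K = \<Phi>[folded K_def]
  have \<Phi>U: "\<Phi> p \<in> U" if "p \<in> K" for p using \<Phi>K(2) that by blast
  define J where "J p = dd v \<Phi> p - A (\<Phi> p)" for p
  have sA: "smooth_on K (\<lambda>p. A (\<Phi> p))" by (rule smooth_on_compose[OF K(1) U(2) \<Phi>K])
  have sB: "smooth_on K (\<lambda>p. B (\<Phi> p))" by (rule smooth_on_compose[OF K(1) U(3) \<Phi>K])
  have J: "smooth_on K J" unfolding J_def by (intro smooth_on_diff K(1) smooth_on_dd \<Phi>K(1) sA)
  have dJ: "dd b J p = dd (J p) B (\<Phi> p)" if p: "p \<in> K" for p
  proof -
    have "dd b J p = dd b (dd v \<Phi>) p - dd b (\<lambda>p. A (\<Phi> p)) p"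
      unfolding J_def by (rule dd_diff[OF smooth_on_dd[OF \<Phi>K(1)] sA p])
    also have "dd b (dd v \<Phi>) p = dd v (dd b \<Phi>) p" by (rule smooth_on_dd_commute[OF K(1) \<Phi>K(1) p])
    also have "\<dots> = dd v (\<lambda>p. B (\<Phi> p)) p"
      by (rule dd_cong_open[OF K(1) _ p]) (use dB in \<open>simp add: K_def\<close>)
    also have "\<dots> = dd (dd v \<Phi> p) B (\<Phi> p)" by (rule dd_compose[OF U(3) \<Phi>K(1) p \<Phi>U[OF p]])
    also have "dd b (\<lambda>p. A (\<Phi> p)) p = dd (dd b \<Phi> p) A (\<Phi> p)" by (rule dd_compose[OF U(2) \<Phi>K(1) p \<Phi>U[OF p]])
    also have "dd b \<Phi> p = B (\<Phi> p)" using dB p by (simp add: K_def)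
    also have "dd (B (\<Phi> p)) A (\<Phi> p) = dd (A (\<Phi> p)) B (\<Phi> p)" using comm[OF \<Phi>U[OF p]] by simp
    finally show ?thesis unfolding J_def by (simp add: dd_diff_arg[OF U(3) \<Phi>U[OF p]])
  qed
  have Jeq: "J p = segint b (\<lambda>p. dd (J p) B (\<Phi> p)) p" if p: "p \<in> K" for p
  proof -
    have "segint b (dd b J) p = J p - J (p - (p \<bullet> b) *\<^sub>R b)"
      by (rule segint_dd[OF K(1,3) p]) (use J in \<open>simp add: smooth_on_def del: ck_on.simps\<close>)
    moreover have "J (p - (p \<bullet> b) *\<^sub>R b) = 0"
    proof -
      have "p - (p \<bullet> b) *\<^sub>R b \<in> K" using seg_closedD[OF K(3) p, of 0] by simp
      moreover have "(p - (p \<bullet> b) *\<^sub>R b) \<bullet> b = 0" using b by (simp add: inner_diff_left)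
      ultimately show ?thesis using dA unfolding J_def K_def by simp
    qed
    moreover have "segint b (dd b J) p = segint b (\<lambda>p. dd (J p) B (\<Phi> p)) p"
      by (rule segint_cong[OF K(3) p dJ])
    ultimately show ?thesis by simp
  qed
  have sub: "cball 0 (r / 2) \<subseteq> K" using r by (auto simp: K_def)
  have c: "continuous_on K (\<lambda>p. dd e B (\<Phi> p))" for e
    by (rule smooth_on_imp_continuous_on[OF smooth_on_compose[OF K(1) smooth_on_dd[OF U(3)] \<Phi>K]])
  have "\<exists>L\<ge>0. \<forall>p\<in>cball 0 (r / 2). norm (dd e B (\<Phi> p)) \<le> L" for e
    using compact_norm_bound[OF compact_cball continuous_on_subset[OF c sub]] by metis
  then obtain L where L: "\<And>e. L e \<ge> 0" "\<And>e p. p \<in> cball 0 (r / 2) \<Longrightarrow> norm (dd e B (\<Phi> p)) \<le> L e"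
    by metis
  define LL where "LL = (\<Sum>e\<in>Basis. L e)"
  have LL0: "LL \<ge> 0" unfolding LL_def using L(1) by (simp add: sum_nonneg)
  have dBs: "dd h B u = (\<Sum>e\<in>Basis. (h \<bullet> e) *\<^sub>R dd e B u)" if "u \<in> U" for h u
    using linear_eq_sum_Basis[OF has_derivative_linear[OF smooth_on_has_derivative[OF U(3) that]]] .
  have LLb: "norm (dd h B (\<Phi> p)) \<le> LL * norm h" if "p \<in> cball 0 (r / 2)" for h p
  proof -
    have "\<Phi> p \<in> U" using \<Phi>U sub that by blast
    then have "norm (dd h B (\<Phi> p)) \<le> (\<Sum>e\<in>Basis. norm h * L e)"
      using L(1) L(2)[OF that] Basis_le_norm
      by (subst dBs) (auto intro!: sum_norm_le mult_mono)
    then show ?thesis by (simp add: LL_def sum_distrib_left mult.commute)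
  qed
  define s where "s = min (r / 2) (1 / (2 * (LL + 1)))"
  have s: "s > 0" "s \<le> r / 2" "s \<le> 1 / (2 * (LL + 1))" using r LL0 by (auto simp: s_def)
  have sL: "s * LL \<le> 1 / 2"
  proof -
    have "s * LL \<le> s * (LL + 1)" using s by simp
    also have "\<dots> \<le> 1 / (2 * (LL + 1)) * (LL + 1)" using s(3) LL0 by (intro mult_right_mono) auto
    also have "\<dots> = 1 / 2" using LL0 by (simp add: field_simps)
    finally show ?thesis .
  qed
  have subs: "cball 0 s \<subseteq> cball 0 (r / 2)" using s by auto
  have *: "s * norm (dd h B (\<Phi> p)) \<le> norm h / 2" if "p \<in> cball 0 s" for h p
  proof -
    have "p \<in> cball 0 (r / 2)" using subs that by blast
    then have "s * norm (dd h B (\<Phi> p)) \<le> (s * LL) * norm h" using LLb[of p h] s by simp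
    also have "\<dots> \<le> (1 / 2) * norm h" by (intro mult_right_mono sL) simp
    finally show ?thesis by simp
  qed
  have J0: "J p = 0" if p: "p \<in> cball 0 s" for p
  proof (rule picard_unique[OF b s(1), where W = UNIV and Q = "\<lambda>p. 0" and G = "\<lambda>p h. dd h B (\<Phi> p)" and F = J and H = "\<lambda>p. 0"])
    have "continuous_on (K \<times> UNIV) (\<lambda>x. \<Sum>e\<in>Basis. (snd x \<bullet> e) *\<^sub>R dd e B (\<Phi> (fst x)))"
    proof (intro continuous_intros)
      show "continuous_on (K \<times> UNIV) (\<lambda>x. dd e B (\<Phi> (fst x)))" for e
        by (rule continuous_on_compose2[OF c]) (auto intro!: continuous_intros)
    qed
    then have "continuous_on (K \<times> UNIV) (\<lambda>(p, h). dd h B (\<Phi> p))"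
      by (rule continuous_on_eq) (use \<Phi>U in \<open>auto intro!: dBs[symmetric]\<close>)
    then show "continuous_on (cball 0 s \<times> UNIV) (\<lambda>(p, h). dd h B (\<Phi> p))"
      by (rule continuous_on_subset) (use sub subs in auto)
    show "s * norm (dd u B (\<Phi> p) - dd w B (\<Phi> p)) \<le> norm (u - w) / 2" if "p \<in> cball 0 s" for p u w
    proof -
      have "\<Phi> p \<in> U" using \<Phi>U sub subs that by blast
      then show ?thesis using *[OF that, of "u - w"] by (simp add: dd_diff_arg[OF U(3)])
    qed
    show "continuous_on (cball 0 s) J"
      using continuous_on_subset[OF smooth_on_imp_continuous_on[OF J]] sub subs by blast
    show "J p = 0 + segint b (\<lambda>p. dd (J p) B (\<Phi> p)) p" if "p \<in> cball 0 s" for p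
      using Jeq sub subs that by fastforce
    show "0 = 0 + segint b (\<lambda>p. dd 0 B (\<Phi> p)) p" if "p \<in> cball 0 s" for p
    proof -
      have pK: "p \<in> K" using sub subs that by blast
      have "segint b (\<lambda>p. dd 0 B (\<Phi> p)) p = segint b (\<lambda>p. 0) p"
        by (rule segint_cong[OF K(3) pK])
          (use linear_0[OF has_derivative_linear[OF smooth_on_has_derivative[OF U(3) \<Phi>U]]] in blast)
      then show ?thesis by (simp add: segint_def)
    qed
  qed (use p in auto)
  show thesis
  proof (rule that[of s])
    show "0 < s" "s \<le> r" using s r by auto
    show "dd v \<Phi> p = A (\<Phi> p)" if "p \<in> ball 0 s" for p
      using J0[of p] that unfolding J_def by simp
  qed
qed

text \<open>A derivative in a direction tangent to the hyperplane sees only the restriction to it.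
  This is how derivatives of a flow at time 0 are obtained from those of its initial map.\<close>

lemma dd_cong_hyperplane:
  fixes F G :: "'a::euclidean_space \<Rightarrow> 'b::real_normed_vector"
  assumes S: "open S" "p \<in> S" and F: "smooth_on S F" "smooth_on S G"
    and eq: "\<And>q. q \<in> S \<Longrightarrow> q \<bullet> b = 0 \<Longrightarrow> F q = G q" and p: "p \<bullet> b = 0" "v \<bullet> b = 0"
  shows "dd v F p = dd v G p"
proof -
  have line: "((\<lambda>t. p + t *\<^sub>R v) has_derivative (\<lambda>h. h *\<^sub>R v)) (at (0::real))"
    by (auto intro!: derivative_eq_intros)
  have d: "((\<lambda>t. H (p + t *\<^sub>R v)) has_derivative (\<lambda>h. dd (h *\<^sub>R v) H p)) (at (0::real))"
    if "smooth_on S H" for H :: "'a \<Rightarrow> 'b"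
    using has_derivative_compose[OF line, of H "frechet_derivative H (at p)"]
      smooth_on_has_derivative[OF that S(2)] by simp
  define I where "I = (\<lambda>t::real. p + t *\<^sub>R v) -` S"
  have I: "open I" "0 \<in> I"
    unfolding I_def using S by (auto intro!: open_vimage continuous_intros)
  have "((\<lambda>t. F (p + t *\<^sub>R v)) has_derivative (\<lambda>h. dd (h *\<^sub>R v) G p)) (at 0)"
    by (rule has_derivative_transform_within_open[OF d[OF F(2)] I])
      (use eq p in \<open>auto simp: I_def inner_add_left\<close>)
  from has_derivative_unique[OF d[OF F(1)] this] have "dd (1 *\<^sub>R v) F p = dd (1 *\<^sub>R v) G p" by meson
  then show ?thesis by simp
qed

lemma eq_on_segment_if_dd_0:
  fixes f :: "'a::euclidean_space \<Rightarrow> 'b::banach"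
  assumes K: "open K" "seg_closed b K" and f: "smooth_on K f" "\<And>p. p \<in> K \<Longrightarrow> dd b f p = 0" and p: "p \<in> K"
  shows "f p = f (p - (p \<bullet> b) *\<^sub>R b)"
proof -
  have "segint b (dd b f) p = f p - f (p - (p \<bullet> b) *\<^sub>R b)"
    by (rule segint_dd[OF K p]) (use f in \<open>simp add: smooth_on_def del: ck_on.simps\<close>)
  moreover have "segint b (dd b f) p = segint b (\<lambda>p. 0) p"
    by (rule segint_cong[OF K(2) p f(2)])
  ultimately show ?thesis by (simp add: segint_def)
qed

text \<open>\<open>x\<close> integrates \<open>h\<close> along \<open>b\<close> in the hyperplane
  orthogonal to \<open>c\<close> and then \<open>k\<close> along \<open>c\<close>. Closedness turns
  the \<open>b\<close>-derivative of the second integral into \<open>h p\<close> minus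
  \<open>h\<close> at the foot of \<open>p\<close>. The remaining coordinates are mere
  parameters.\<close>

lemma poincare_plane:
  fixes h k :: "'a::euclidean_space \<Rightarrow> real"
  assumes K: "open K" "convex K" "seg_closed b K" "seg_closed c K" and bc: "b \<in> Basis" "c \<in> Basis" "b \<noteq> c"
    and h: "smooth_on K h" "smooth_on K k" and closed: "\<And>p. p \<in> K \<Longrightarrow> dd c h p = dd b k p"
  obtains x where "smooth_on K x" "\<And>p. p \<in> K \<Longrightarrow> dd b x p = h p" "\<And>p. p \<in> K \<Longrightarrow> dd c x p = k p" "x 0 = 0"
proof -
  have ck1: "smooth_on K F \<Longrightarrow> ck_on (Suc 0) K F" for F :: "'a \<Rightarrow> real" by (simp add: smooth_on_def del: ck_on.simps)
  define pr where "pr p = p - (p \<bullet> c) *\<^sub>R c" for p :: 'a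
  have pr: "bounded_linear pr" unfolding pr_def by (intro bounded_linear_intros)
  have prK: "pr ` K \<subseteq> K" using seg_closedD[OF K(4), of _ 0] by (auto simp: pr_def)
  define x1 where "x1 = segint b h"
  have x1: "smooth_on K x1" unfolding x1_def by (rule smooth_on_segint[OF K(1-3) h(1)])
  define x where "x p = segint c k p + x1 (pr p)" for p
  have s1: "smooth_on K (segint c k)" by (rule smooth_on_segint[OF K(1,2,4) h(2)])
  have s2: "smooth_on K (\<lambda>p. x1 (pr p))" by (rule smooth_on_compose[OF K(1) x1 smooth_on_bounded_linear[OF pr] prK])
  have ddpr: "dd v pr p = pr v" for v p
    using frechet_derivative_eqI[OF bounded_linear_imp_has_derivative[OF pr]] by metis
  have d: "dd v x p = dd v (segint c k) p + dd (pr v) x1 (pr p)" if "p \<in> K" for v p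
    unfolding x_def dd_add[OF s1 s2 that]
    using dd_compose[OF x1 smooth_on_bounded_linear[OF pr] that] prK that by (auto simp: ddpr)
  have bc0: "b \<bullet> c = 0" "c \<bullet> c = 1" using bc by (auto simp: inner_Basis)
  show thesis
  proof (rule that[of x])
    show "smooth_on K x" unfolding x_def by (rule smooth_on_add[OF K(1) s1 s2])
    fix p assume p: "p \<in> K"
    have prp: "pr p \<in> K" using prK p by blast
    have "dd b (segint c k) p = segint c (dd b k) p"
      by (rule dd_segint_orth[OF K(1,2,4) p ck1[OF h(2)] bc0(1)])
    also have "\<dots> = segint c (dd c h) p" by (rule segint_cong[OF K(4) p closed[symmetric]])
    also have "\<dots> = h p - h (pr p)" unfolding pr_def by (rule segint_dd[OF K(1,4) p ck1[OF h(1)]])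
    finally show "dd b x p = h p"
      using d[OF p, of b] dd_segint_self[OF K(1-3) prp ck1[OF h(1)] bc(1)] by (simp add: pr_def bc0 x1_def)
    have "dd 0 x1 (pr p) = 0" using linear_0[OF has_derivative_linear[OF smooth_on_has_derivative[OF x1 prp]]] .
    then show "dd c x p = k p"
      using d[OF p, of c] dd_segint_self[OF K(1,2,4) p ck1[OF h(2)] bc(2)] by (simp add: pr_def bc0)
  next
    show "x 0 = 0" by (simp add: x_def segint_eq_0 x1_def pr_def)
  qed
qed

section \<open>The Levi-Civita connection along a map\<close>

lemma dd_mult:
  fixes F G :: "'a::real_normed_vector \<Rightarrow> 'b::real_normed_algebra"
  shows "smooth_on S F \<Longrightarrow> smooth_on S G \<Longrightarrow> q \<in> S \<Longrightarrow>
    dd v (\<lambda>q. F q * G q) q = F q * dd v G q + dd v F q * G q"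
  using frechet_derivative_eqI[OF has_derivative_mult[OF smooth_on_has_derivative smooth_on_has_derivative]]
  by fastforce

lemma dd_scaleR:
  fixes F :: "'a::real_normed_vector \<Rightarrow> real"
  shows "smooth_on S F \<Longrightarrow> smooth_on S G \<Longrightarrow> q \<in> S \<Longrightarrow>
    dd v (\<lambda>q. F q *\<^sub>R G q) q = F q *\<^sub>R dd v G q + dd v F q *\<^sub>R G q"
  using frechet_derivative_eqI[OF has_derivative_scaleR[OF smooth_on_has_derivative smooth_on_has_derivative]]
  by fastforce

lemma dd_sum:
  assumes "\<And>i. i \<in> I \<Longrightarrow> smooth_on S (F i)" "q \<in> S"
  shows "dd v (\<lambda>q. \<Sum>i\<in>I. F i q) q = (\<Sum>i\<in>I. dd v (F i) q)"
proof -
  have "((\<lambda>q. \<Sum>i\<in>I. F i q) has_derivative (\<lambda>v. \<Sum>i\<in>I. dd v (F i) q)) (at q)"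
    using assms by (intro has_derivative_sum smooth_on_has_derivative[of S])
  then show ?thesis by (simp add: frechet_derivative_eqI)
qed

lemma dd_vec_nth:
  fixes A :: "'a::real_normed_vector \<Rightarrow> real^'n"
  assumes "smooth_on S A" "q \<in> S" shows "dd v (\<lambda>q. A q $ i) q = dd v A q $ i"
  using frechet_derivative_eqI[OF bounded_linear.has_derivative[OF bounded_linear_vec_nth
        smooth_on_has_derivative[OF assms]], of i] by simp

lemma dd_eq_sum_pd:
  fixes F :: "real^4 \<Rightarrow> 'b::real_normed_vector"
  assumes "smooth_on S F" "q \<in> S" shows "dd v F q = (\<Sum>l\<in>UNIV. v $ l *\<^sub>R pd l F q)"
proof -
  note L = has_derivative_linear[OF smooth_on_has_derivative[OF assms]]
  have "dd v F q = dd (\<Sum>l\<in>UNIV. v $ l *\<^sub>R axis l 1) F q"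
    using basis_expansion[of v] by (simp add: scalar_mult_eq_scaleR)
  also have "\<dots> = (\<Sum>l\<in>UNIV. v $ l *\<^sub>R pd l F q)"
    by (simp add: linear_sum[OF L] linear_cmul[OF L] pd_def)
  finally show ?thesis .
qed

lemma sum_rotate:
  "(\<Sum>a\<in>A. \<Sum>b\<in>B. \<Sum>c\<in>C. F a b c) = (\<Sum>b\<in>B. \<Sum>c\<in>C. \<Sum>a\<in>A. F a b c)"
  by (subst sum.swap) (intro sum.cong refl sum.swap)

definition gip :: "(real^4 \<Rightarrow> real^4^4) \<Rightarrow> real^4 \<Rightarrow> real^4 \<Rightarrow> real^4 \<Rightarrow> real" where
  "gip G q u v = u \<bullet> (G q *v v)"

definition chr :: "(real^4 \<Rightarrow> real^4^4) \<Rightarrow> real^4 \<Rightarrow> real^4 \<Rightarrow> real^4 \<Rightarrow> real^4" where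
  "chr G q u v = (\<chi> k. \<Sum>i\<in>UNIV. \<Sum>j\<in>UNIV. christoffel G k i j q * u $ i * v $ j)"

text \<open>The covariant derivative, in the direction \<open>v\<close> of parameter space, of a vector field \<open>A\<close> along
  the map \<open>X\<close>.\<close>

definition cov :: "(real^4 \<Rightarrow> real^4^4) \<Rightarrow> (real^4 \<Rightarrow> real^4) \<Rightarrow> real^4 \<Rightarrow> (real^4 \<Rightarrow> real^4) \<Rightarrow> real^4 \<Rightarrow> real^4" where
  "cov G X v A p = dd v A p + chr G (X p) (dd v X p) (A p)"

text \<open>The vector \<open>R(u, v) w\<close>: in \<open>riemann\<close> the last two indices are
  the two-form indices and \<open>k\<close> belongs to the vector acted upon.\<close>

definition curv :: "(real^4 \<Rightarrow> real^4^4) \<Rightarrow> real^4 \<Rightarrow> real^4 \<Rightarrow> real^4 \<Rightarrow> real^4 \<Rightarrow> real^4" where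
  "curv G q u v w = (\<chi> l. \<Sum>k\<in>UNIV. \<Sum>i\<in>UNIV. \<Sum>j\<in>UNIV. riemann G l k i j q * u $ i * v $ j * w $ k)"

lemma gip_expand: "gip G q u v = (\<Sum>i\<in>UNIV. \<Sum>j\<in>UNIV. u $ i * G q $ i $ j * v $ j)"
  by (simp add: gip_def inner_vec_def matrix_vector_mult_def sum_distrib_left mult.assoc)

lemma gip_add: "gip G q (u + u') v = gip G q u v + gip G q u' v" "gip G q u (v + v') = gip G q u v + gip G q u v'"
  by (simp_all add: gip_def inner_add_left inner_add_right matrix_vector_right_distrib)

lemma gip_scaleR: "gip G q (c *\<^sub>R u) v = c * gip G q u v" "gip G q u (c *\<^sub>R v) = c * gip G q u v"
  by (simp_all add: gip_def matrix_vector_mult_scaleR)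

lemma gip_diff: "gip G q (u - u') v = gip G q u v - gip G q u' v" "gip G q u (v - v') = gip G q u v - gip G q u v'"
  by (simp_all add: gip_def inner_diff_left inner_diff_right matrix_vector_mult_diff_distrib)

lemma gip_minus: "gip G q (- u) v = - gip G q u v" "gip G q u (- v) = - gip G q u v"
  using gip_scaleR(1)[of G q "-1" u v] gip_scaleR(2)[of G q u "-1" v] by simp_all

lemma gip_0: "gip G q 0 v = 0" "gip G q u 0 = 0"
  by (simp_all add: gip_def)

lemmas gip_linear = gip_add gip_scaleR gip_diff gip_minus gip_0

lemma chr_add: "chr G q (u + u') v = chr G q u v + chr G q u' v" "chr G q u (v + v') = chr G q u v + chr G q u v'"
  by (simp_all add: chr_def vec_eq_iff sum.distrib distrib_left distrib_right)

lemma chr_scaleR: "chr G q (c *\<^sub>R u) v = c *\<^sub>R chr G q u v" "chr G q u (c *\<^sub>R v) = c *\<^sub>R chr G q u v"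
  by (simp_all add: chr_def vec_eq_iff sum_distrib_left mult.left_commute mult.assoc)

lemma matrix_mult_inv:
  fixes M :: "real^'n^'n"
  assumes "invertible M" shows "M ** matrix_inv M = mat 1"
proof -
  have "\<exists>M'. M ** M' = mat 1 \<and> M' ** M = mat 1" using assms by (simp add: invertible_def)
  then have "M ** matrix_inv M = mat 1 \<and> matrix_inv M ** M = mat 1"
    unfolding matrix_inv_def by (rule someI_ex)
  then show ?thesis ..
qed

text \<open>A metric on an open set of coordinate space. Smoothness of the inverse matrix is
  recorded as an assumption so that the Christoffel symbols are smooth at once; Cramer's rule
  discharges it in \<open>smooth_on_matrix_inv\<close>.\<close>

locale metric_patch =
  fixes U :: "(real^4) set" and G :: "real^4 \<Rightarrow> real^4^4"
  assumes open_U: "open U" and smooth_G: "smooth_on U G"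
    and sym_G: "q \<in> U \<Longrightarrow> transpose (G q) = G q"
    and inv_G: "q \<in> U \<Longrightarrow> invertible (G q)"
    and smooth_inv_G: "smooth_on U (\<lambda>q. matrix_inv (G q) $ i $ j)"
begin

lemma G_sym:
  assumes "q \<in> U" shows "G q $ i $ j = G q $ j $ i"
proof -
  have "transpose (G q) $ j $ i = G q $ i $ j" by (simp add: transpose_def)
  then show ?thesis by (simp only: sym_G[OF assms])
qed

lemma gip_commute: "q \<in> U \<Longrightarrow> gip G q u v = gip G q v u"
  unfolding gip_expand by (subst sum.swap) (simp add: G_sym mult.commute mult.left_commute)

lemma smooth_G_nth: "smooth_on U (\<lambda>q. G q $ i $ j)"
  by (rule smooth_on_mat_nth[OF open_U smooth_G])

lemma pd_G_sym: "q \<in> U \<Longrightarrow> pd l (\<lambda>r. G r $ i $ j) q = pd l (\<lambda>r. G r $ j $ i) q"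
  unfolding pd_def by (rule dd_cong_open[OF open_U G_sym])

lemma smooth_christoffel: "smooth_on U (christoffel G k i j)"
  unfolding christoffel_def[abs_def]
  by (intro smooth_on_mult smooth_on_const smooth_on_sum smooth_on_add smooth_on_diff smooth_on_pd
      open_U smooth_inv_G smooth_G_nth)

lemma christoffel_sym: "q \<in> U \<Longrightarrow> christoffel G k i j q = christoffel G k j i q"
  unfolding christoffel_def by (simp add: add.commute pd_G_sym[of q _ i j])

lemma chr_commute: "q \<in> U \<Longrightarrow> chr G q u v = chr G q v u"
  unfolding chr_def vec_eq_iff vec_lambda_beta
  by (intro allI, subst sum.swap) (simp add: christoffel_sym mult.commute mult.left_commute)

lemma G_christoffel:
  assumes q: "q \<in> U"
  shows "(\<Sum>k\<in>UNIV. G q $ m $ k * christoffel G k i j q) =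
    1/2 * (pd i (\<lambda>r. G r $ j $ m) q + pd j (\<lambda>r. G r $ i $ m) q - pd m (\<lambda>r. G r $ i $ j) q)"
proof -
  define B where "B = (\<chi> l. 1/2 * (pd i (\<lambda>r. G r $ j $ l) q + pd j (\<lambda>r. G r $ i $ l) q - pd l (\<lambda>r. G r $ i $ j) q))"
  have "christoffel G k i j q = (matrix_inv (G q) *v B) $ k" for k
    unfolding christoffel_def matrix_vector_mult_def B_def
    by (simp add: sum_distrib_left algebra_simps)
  then have "(\<Sum>k\<in>UNIV. G q $ m $ k * christoffel G k i j q) = (G q *v (matrix_inv (G q) *v B)) $ m"
    unfolding matrix_vector_mult_def[of "G q"] by simp
  also have "G q *v (matrix_inv (G q) *v B) = B"
    by (simp add: matrix_vector_mul_assoc matrix_mult_inv[OF inv_G[OF q]])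
  finally show ?thesis by (simp add: B_def)
qed

lemma gip_chr:
  assumes q: "q \<in> U"
  shows "gip G q a (chr G q u b) = (\<Sum>m\<in>UNIV. \<Sum>i\<in>UNIV. \<Sum>j\<in>UNIV. a $ m * u $ i * b $ j *
    (1/2 * (pd i (\<lambda>r. G r $ j $ m) q + pd j (\<lambda>r. G r $ i $ m) q - pd m (\<lambda>r. G r $ i $ j) q)))"
proof -
  have "(\<Sum>k\<in>UNIV. a $ m * G q $ m $ k * chr G q u b $ k) =
    (\<Sum>i\<in>UNIV. \<Sum>j\<in>UNIV. a $ m * u $ i * b $ j * (\<Sum>k\<in>UNIV. G q $ m $ k * christoffel G k i j q))" for m
  proof -
    have "(\<Sum>k\<in>UNIV. a $ m * G q $ m $ k * chr G q u b $ k) =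
      (\<Sum>k\<in>UNIV. \<Sum>i\<in>UNIV. \<Sum>j\<in>UNIV. a $ m * u $ i * b $ j * (G q $ m $ k * christoffel G k i j q))"
      by (simp add: chr_def sum_distrib_left mult.commute mult.left_commute)
    also have "\<dots> = (\<Sum>i\<in>UNIV. \<Sum>k\<in>UNIV. \<Sum>j\<in>UNIV. a $ m * u $ i * b $ j * (G q $ m $ k * christoffel G k i j q))"
      by (rule sum.swap)
    also have "\<dots> = (\<Sum>i\<in>UNIV. \<Sum>j\<in>UNIV. \<Sum>k\<in>UNIV. a $ m * u $ i * b $ j * (G q $ m $ k * christoffel G k i j q))"
      by (intro sum.cong refl sum.swap)
    finally show ?thesis by (simp add: sum_distrib_left)
  qed
  then show ?thesis unfolding gip_expand by (simp add: G_christoffel[OF q])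
qed

text \<open>The equation \<nabla>\<open>g = 0\<close>. In the sum of the two lowered Christoffel
  terms the derivatives in the directions \<open>a\<close> and \<open>b\<close> cancel by symmetry
  of \<open>G\<close>, and the two halves of the derivative along \<open>u\<close> add up.\<close>

lemma metric_compatible:
  assumes q: "q \<in> U"
  shows "(\<Sum>i\<in>UNIV. \<Sum>j\<in>UNIV. a $ i * (\<Sum>l\<in>UNIV. u $ l * pd l (\<lambda>r. G r $ i $ j) q) * b $ j) =
    gip G q (chr G q u a) b + gip G q a (chr G q u b)"
proof -
  let ?d = "\<lambda>l i j. pd l (\<lambda>r. G r $ i $ j) q"
  have "gip G q (chr G q u a) b = gip G q b (chr G q u a)" by (rule gip_commute[OF q])
  also have "\<dots> = (\<Sum>m\<in>UNIV. \<Sum>i\<in>UNIV. \<Sum>j\<in>UNIV. b $ m * u $ i * a $ j * (1/2 * (?d i j m + ?d j i m - ?d m i j)))"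
    by (rule gip_chr[OF q])
  also have "\<dots> = (\<Sum>m\<in>UNIV. \<Sum>j\<in>UNIV. \<Sum>i\<in>UNIV. b $ m * u $ i * a $ j * (1/2 * (?d i j m + ?d j i m - ?d m i j)))"
    by (intro sum.cong refl sum.swap)
  also have "\<dots> = (\<Sum>j\<in>UNIV. \<Sum>m\<in>UNIV. \<Sum>i\<in>UNIV. b $ m * u $ i * a $ j * (1/2 * (?d i j m + ?d j i m - ?d m i j)))"
    by (rule sum.swap)
  also have "\<dots> = (\<Sum>j\<in>UNIV. \<Sum>m\<in>UNIV. \<Sum>i\<in>UNIV. a $ j * u $ i * b $ m * (1/2 * (?d i m j + ?d j i m - ?d m i j)))"
    by (simp add: pd_G_sym[OF q, of _ _] mult.commute mult.left_commute)
  finally have 1: "gip G q (chr G q u a) b =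
    (\<Sum>m\<in>UNIV. \<Sum>j\<in>UNIV. \<Sum>i\<in>UNIV. a $ m * u $ i * b $ j * (1/2 * (?d i j m + ?d m i j - ?d j i m)))" .
  have 2: "gip G q a (chr G q u b) =
    (\<Sum>m\<in>UNIV. \<Sum>j\<in>UNIV. \<Sum>i\<in>UNIV. a $ m * u $ i * b $ j * (1/2 * (?d i j m + ?d j i m - ?d m i j)))"
    unfolding gip_chr[OF q] by (intro sum.cong refl sum.swap)
  show ?thesis
    unfolding 1 2 by (simp add: sum.distrib[symmetric] algebra_simps sum_distrib_left pd_G_sym[OF q, of _ _])
qed

lemma smooth_gip:
  assumes V: "open V" "smooth_on V X" "X ` V \<subseteq> U" and A: "smooth_on V A" "smooth_on V B"
  shows "smooth_on V (\<lambda>p. gip G (X p) (A p) (B p))"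
  unfolding gip_expand
  by (intro smooth_on_sum smooth_on_mult smooth_on_vec_nth smooth_on_compose[OF V(1) smooth_G_nth V(2,3)] V A)

lemma smooth_chr:
  assumes V: "open V" "smooth_on V X" "X ` V \<subseteq> U" and A: "smooth_on V A" "smooth_on V B"
  shows "smooth_on V (\<lambda>p. chr G (X p) (A p) (B p))"
proof (rule smooth_on_vec[OF V(1)])
  show "smooth_on V (\<lambda>p. chr G (X p) (A p) (B p) $ k)" for k
    unfolding chr_def vec_lambda_beta
    by (intro smooth_on_sum smooth_on_mult smooth_on_vec_nth smooth_on_compose[OF V(1) smooth_christoffel V(2,3)] V A)
qed

lemma smooth_cov:
  assumes V: "open V" "smooth_on V X" "X ` V \<subseteq> U" and A: "smooth_on V A"
  shows "smooth_on V (cov G X v A)"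
  unfolding cov_def[abs_def] by (intro smooth_on_add smooth_chr V A smooth_on_dd)

lemma dd_gip:
  assumes V: "open V" "smooth_on V X" "X ` V \<subseteq> U" and A: "smooth_on V A" "smooth_on V B" and p: "p \<in> V"
  shows "dd v (\<lambda>p. gip G (X p) (A p) (B p)) p = gip G (X p) (cov G X v A p) (B p) + gip G (X p) (A p) (cov G X v B p)"
proof -
  have Xp: "X p \<in> U" using V(3) p by blast
  note An = smooth_on_vec_nth[OF V(1) A(1)] and Bn = smooth_on_vec_nth[OF V(1) A(2)]
  note Gn = smooth_on_compose[OF V(1) smooth_G_nth V(2,3)]
  have Gd: "dd v (\<lambda>p. G (X p) $ i $ j) p = (\<Sum>l\<in>UNIV. dd v X p $ l * pd l (\<lambda>r. G r $ i $ j) (X p))" for i j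
    using dd_compose[OF smooth_G_nth V(2) p Xp, where v = v] dd_eq_sum_pd[OF smooth_G_nth Xp, where v = "dd v X p"]
    by simp
  have "dd v (\<lambda>p. gip G (X p) (A p) (B p)) p =
    (\<Sum>i\<in>UNIV. \<Sum>j\<in>UNIV. A p $ i * G (X p) $ i $ j * dd v B p $ j +
      (A p $ i * (\<Sum>l\<in>UNIV. dd v X p $ l * pd l (\<lambda>r. G r $ i $ j) (X p)) + dd v A p $ i * G (X p) $ i $ j) * B p $ j)"
    unfolding gip_expand
    by (simp add: dd_sum[OF _ p] dd_mult[OF _ _ p] smooth_on_sum smooth_on_mult V(1) An Bn Gn Gd
        dd_vec_nth[OF A(1) p] dd_vec_nth[OF A(2) p])
  also have "\<dots> = gip G (X p) (A p) (dd v B p) +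
      (\<Sum>i\<in>UNIV. \<Sum>j\<in>UNIV. A p $ i * (\<Sum>l\<in>UNIV. dd v X p $ l * pd l (\<lambda>r. G r $ i $ j) (X p)) * B p $ j)
      + gip G (X p) (dd v A p) (B p)"
    unfolding gip_expand by (simp add: sum.distrib[symmetric] algebra_simps)
  finally show ?thesis
    unfolding metric_compatible[OF Xp] cov_def by (simp add: gip_add)
qed

text \<open>Torsion-freeness along a map: second derivatives of \<open>X\<close> commute and the
  Christoffel symbols are symmetric.\<close>

lemma cov_dd_commute:
  assumes V: "open V" "smooth_on V X" "X ` V \<subseteq> U" and p: "p \<in> V"
  shows "cov G X u (dd v X) p = cov G X v (dd u X) p"
proof -
  have Xp: "X p \<in> U" using V(3) p by blast
  show ?thesis
    unfolding cov_def using smooth_on_dd_commute[OF V(1,2) p, of u v] chr_commute[OF Xp] by simp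
qed

lemma cov_add:
  "smooth_on V A \<Longrightarrow> smooth_on V B \<Longrightarrow> p \<in> V \<Longrightarrow> cov G X v (\<lambda>p. A p + B p) p = cov G X v A p + cov G X v B p"
  unfolding cov_def by (simp add: dd_add[of V] chr_add)

lemma cov_scaleR:
  "smooth_on V f \<Longrightarrow> smooth_on V A \<Longrightarrow> p \<in> V \<Longrightarrow>
    cov G X v (\<lambda>p. f p *\<^sub>R A p) p = dd v f p *\<^sub>R A p + f p *\<^sub>R cov G X v A p"
  unfolding cov_def by (simp add: dd_scaleR[of V] chr_scaleR scaleR_add_right)

text \<open>The link between \<open>nabla\<close>, in which the spinor hypotheses are stated, and
  derivatives along a map.\<close>

lemma cov_compose:
  assumes V: "open V" "smooth_on V X" "X ` V \<subseteq> U" and F: "smooth_on U F" and p: "p \<in> V"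
  shows "cov G X v (\<lambda>p. F (X p)) p = (\<Sum>i\<in>UNIV. dd v X p $ i *\<^sub>R nabla G i F (X p))"
proof -
  have Xp: "X p \<in> U" using V(3) p by blast
  have "dd v (\<lambda>p. F (X p)) p = (\<Sum>i\<in>UNIV. dd v X p $ i *\<^sub>R pd i F (X p))"
    using dd_compose[OF F V(2) p Xp, of v] dd_eq_sum_pd[OF F Xp, of "dd v X p"] by simp
  moreover have "pd i (\<lambda>r. F r $ k) (X p) = pd i F (X p) $ k" for i k
    unfolding pd_def by (rule dd_vec_nth[OF F Xp])
  ultimately show ?thesis
    unfolding cov_def nabla_def chr_def vec_eq_iff
    by (simp add: sum_component sum.distrib distrib_left sum_distrib_left mult.commute mult.left_commute)
qed

text \<open>The directions \<open>u\<close> and \<open>v\<close> are constant in parameter space, so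
  there is no bracket term. The second derivatives of \<open>A\<close> and of \<open>X\<close> and
  the mixed terms cancel in the antisymmetrisation.\<close>

lemma curvature:
  assumes V: "open V" "smooth_on V X" "X ` V \<subseteq> U" and A: "smooth_on V A" and p: "p \<in> V"
  shows "cov G X u (cov G X v A) p - cov G X v (cov G X u A) p = curv G (X p) (dd u X p) (dd v X p) (A p)"
proof -
  have Xp: "X p \<in> U" using V(3) p by blast
  \<comment> \<open>The derivative of the Christoffel symbols in direction \<open>w\<close>, with
    the two vector arguments frozen.\<close>
  define dchr where "dchr q w a b = (\<chi> k. \<Sum>i\<in>UNIV. \<Sum>j\<in>UNIV. (\<Sum>m\<in>UNIV. w $ m * pd m (christoffel G k i j) q) * a $ i * b $ j)"
    for q and w a b :: "real^4"
  have dchr: "dd w (\<lambda>p. chr G (X p) (B p) (C p)) p =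
      dchr (X p) (dd w X p) (B p) (C p) + chr G (X p) (dd w B p) (C p) + chr G (X p) (B p) (dd w C p)"
    if BC: "smooth_on V B" "smooth_on V C" for w B C
  proof -
    note Bn = smooth_on_vec_nth[OF V(1) BC(1)] and Cn = smooth_on_vec_nth[OF V(1) BC(2)]
    note Gn = smooth_on_compose[OF V(1) smooth_christoffel V(2,3)]
    have Gd: "dd w (\<lambda>p. christoffel G k i j (X p)) p = (\<Sum>l\<in>UNIV. dd w X p $ l * pd l (christoffel G k i j) (X p))" for k i j
      using dd_compose[OF smooth_christoffel V(2) p Xp, where v = w]
        dd_eq_sum_pd[OF smooth_christoffel Xp, where v = "dd w X p"] by simp
    have "dd w (\<lambda>p. chr G (X p) (B p) (C p)) p $ k = dd w (\<lambda>p. chr G (X p) (B p) (C p) $ k) p" for k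
      by (rule dd_vec_nth[symmetric, OF smooth_chr[OF V BC] p])
    then show ?thesis
      unfolding chr_def vec_eq_iff dchr_def
      by (simp add: dd_sum[OF _ p] dd_mult[OF _ _ p] smooth_on_sum smooth_on_mult V(1) Bn Cn Gn Gd
        dd_vec_nth[OF BC(1) p] dd_vec_nth[OF BC(2) p] sum.distrib[symmetric] algebra_simps)
  qed
  have cc: "cov G X u (cov G X v A) p = dd u (dd v A) p + (dchr (X p) (dd u X p) (dd v X p) (A p) +
      chr G (X p) (dd u (dd v X) p) (A p) + chr G (X p) (dd v X p) (dd u A p)) +
      chr G (X p) (dd u X p) (dd v A p) + chr G (X p) (dd u X p) (chr G (X p) (dd v X p) (A p))" for u v
  proof -
    have "dd u (cov G X v A) p = dd u (dd v A) p + dd u (\<lambda>p. chr G (X p) (dd v X p) (A p)) p"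
      unfolding cov_def[abs_def] by (intro dd_add[of V] smooth_on_dd smooth_chr V A p)
    then show ?thesis
      unfolding cov_def[of G X u] dchr[OF smooth_on_dd[OF V(2)] A] by (simp add: cov_def chr_add)
  qed
  have "cov G X u (cov G X v A) p - cov G X v (cov G X u A) p =
     dchr (X p) (dd u X p) (dd v X p) (A p) - dchr (X p) (dd v X p) (dd u X p) (A p) +
     chr G (X p) (dd u X p) (chr G (X p) (dd v X p) (A p)) - chr G (X p) (dd v X p) (chr G (X p) (dd u X p) (A p))"
    unfolding cc smooth_on_dd_commute[OF V(1,2) p, of u v] smooth_on_dd_commute[OF V(1) A p, of u v] by simp
  also have "\<dots> = curv G (X p) (dd u X p) (dd v X p) (A p)"
  proof -
    let ?q = "X p" and ?u = "dd u X p" and ?v = "dd v X p" and ?w = "A p"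
    have "dchr ?q ?u ?v ?w $ l = (\<Sum>k\<in>UNIV. \<Sum>i\<in>UNIV. \<Sum>j\<in>UNIV. pd i (christoffel G l j k) ?q * ?u $ i * ?v $ j * ?w $ k)" for l
    proof -
      have "dchr ?q ?u ?v ?w $ l = (\<Sum>j\<in>UNIV. \<Sum>k\<in>UNIV. \<Sum>i\<in>UNIV. pd i (christoffel G l j k) ?q * ?u $ i * ?v $ j * ?w $ k)"
        by (simp add: dchr_def sum_distrib_left sum_distrib_right ac_simps)
      then show ?thesis by (rule trans[OF _ sum_rotate])
    qed
    moreover have "dchr ?q ?v ?u ?w $ l = (\<Sum>k\<in>UNIV. \<Sum>i\<in>UNIV. \<Sum>j\<in>UNIV. pd j (christoffel G l i k) ?q * ?u $ i * ?v $ j * ?w $ k)" for l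
    proof -
      have "dchr ?q ?v ?u ?w $ l = (\<Sum>i\<in>UNIV. \<Sum>k\<in>UNIV. \<Sum>j\<in>UNIV. pd j (christoffel G l i k) ?q * ?u $ i * ?v $ j * ?w $ k)"
        by (simp add: dchr_def sum_distrib_left sum_distrib_right ac_simps)
      then show ?thesis by (rule trans[OF _ sum.swap])
    qed
    moreover have "chr G ?q ?u (chr G ?q ?v ?w) $ l = (\<Sum>k\<in>UNIV. \<Sum>i\<in>UNIV. \<Sum>j\<in>UNIV. \<Sum>m\<in>UNIV.
        christoffel G l i m ?q * christoffel G m j k ?q * ?u $ i * ?v $ j * ?w $ k)" for l
    proof -
      have "chr G ?q ?u (chr G ?q ?v ?w) $ l = (\<Sum>i\<in>UNIV. \<Sum>m\<in>UNIV. \<Sum>j\<in>UNIV. \<Sum>k\<in>UNIV.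
        christoffel G l i m ?q * christoffel G m j k ?q * ?u $ i * ?v $ j * ?w $ k)"
        by (simp add: chr_def sum_distrib_left ac_simps)
      also have "\<dots> = (\<Sum>i\<in>UNIV. \<Sum>k\<in>UNIV. \<Sum>j\<in>UNIV. \<Sum>m\<in>UNIV.
        christoffel G l i m ?q * christoffel G m j k ?q * ?u $ i * ?v $ j * ?w $ k)"
        by (rule sum.cong[OF refl], rule trans[OF sum_rotate sum.swap])
      finally show ?thesis by (rule trans[OF _ sum.swap])
    qed
    moreover have "chr G ?q ?v (chr G ?q ?u ?w) $ l = (\<Sum>k\<in>UNIV. \<Sum>i\<in>UNIV. \<Sum>j\<in>UNIV. \<Sum>m\<in>UNIV.
        christoffel G l j m ?q * christoffel G m i k ?q * ?u $ i * ?v $ j * ?w $ k)" for l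
    proof -
      have "chr G ?q ?v (chr G ?q ?u ?w) $ l = (\<Sum>j\<in>UNIV. \<Sum>m\<in>UNIV. \<Sum>i\<in>UNIV. \<Sum>k\<in>UNIV.
        christoffel G l j m ?q * christoffel G m i k ?q * ?u $ i * ?v $ j * ?w $ k)"
        by (simp add: chr_def sum_distrib_left ac_simps)
      also have "\<dots> = (\<Sum>j\<in>UNIV. \<Sum>k\<in>UNIV. \<Sum>i\<in>UNIV. \<Sum>m\<in>UNIV.
        christoffel G l j m ?q * christoffel G m i k ?q * ?u $ i * ?v $ j * ?w $ k)"
        by (rule sum.cong[OF refl], rule trans[OF sum_rotate sum.swap])
      finally show ?thesis by (rule trans[OF _ sum_rotate])
    qed
    moreover have "curv G ?q ?u ?v ?w $ l =
      (\<Sum>k\<in>UNIV. \<Sum>i\<in>UNIV. \<Sum>j\<in>UNIV. pd i (christoffel G l j k) ?q * ?u $ i * ?v $ j * ?w $ k) -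
      (\<Sum>k\<in>UNIV. \<Sum>i\<in>UNIV. \<Sum>j\<in>UNIV. pd j (christoffel G l i k) ?q * ?u $ i * ?v $ j * ?w $ k) +
      (\<Sum>k\<in>UNIV. \<Sum>i\<in>UNIV. \<Sum>j\<in>UNIV. \<Sum>m\<in>UNIV.
        christoffel G l i m ?q * christoffel G m j k ?q * ?u $ i * ?v $ j * ?w $ k) -
      (\<Sum>k\<in>UNIV. \<Sum>i\<in>UNIV. \<Sum>j\<in>UNIV. \<Sum>m\<in>UNIV.
        christoffel G l j m ?q * christoffel G m i k ?q * ?u $ i * ?v $ j * ?w $ k)" for l
      unfolding curv_def vec_lambda_beta riemann_def
      by (simp add: sum_distrib_right sum_subtractf sum.distrib distrib_right left_diff_distrib)
    ultimately show ?thesis by (simp add: vec_eq_iff)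
  qed
  finally show ?thesis .
qed

end

section \<open>Parallel null planes and adapted coordinates\<close>

text \<open>The model is \<open>X_A = o_A \<otimes> \<iota>\<close> and
  \<open>Y_A = o_A \<otimes> \<omega>\<close> with \<iota> and \<omega> a symplectic basis of the
  primed spinors, which explains the signs 1 and -1. The plane spanned by \<open>X1\<close>,
  \<open>X2\<close> is parallel, and the opposite coefficients \<open>a\<close>, \<open>-a\<close>
  say that the unprimed connection is trace-free.\<close>

locale null_frame = metric_patch +
  fixes X1 X2 Y1 Y2 :: "real^4 \<Rightarrow> real^4"
  assumes smooth_frame: "smooth_on U X1" "smooth_on U X2" "smooth_on U Y1" "smooth_on U Y2"
    and gip_frame: "q \<in> U \<Longrightarrow> gip G q (X1 q) (X1 q) = 0" "q \<in> U \<Longrightarrow> gip G q (X1 q) (X2 q) = 0"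
      "q \<in> U \<Longrightarrow> gip G q (X2 q) (X2 q) = 0" "q \<in> U \<Longrightarrow> gip G q (Y1 q) (Y1 q) = 0"
      "q \<in> U \<Longrightarrow> gip G q (Y1 q) (Y2 q) = 0" "q \<in> U \<Longrightarrow> gip G q (Y2 q) (Y2 q) = 0"
      "q \<in> U \<Longrightarrow> gip G q (X1 q) (Y1 q) = 0" "q \<in> U \<Longrightarrow> gip G q (X1 q) (Y2 q) = 1"
      "q \<in> U \<Longrightarrow> gip G q (X2 q) (Y1 q) = - 1" "q \<in> U \<Longrightarrow> gip G q (X2 q) (Y2 q) = 0"
    and parallel: "q \<in> U \<Longrightarrow> \<exists>a b c. nabla G i X1 q = a *\<^sub>R X1 q + b *\<^sub>R X2 q \<and>
      nabla G i X2 q = c *\<^sub>R X1 q - a *\<^sub>R X2 q"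
begin

lemma gip_frame':
  assumes "q \<in> U"
  shows "gip G q (X2 q) (X1 q) = 0" "gip G q (Y2 q) (Y1 q) = 0" "gip G q (Y1 q) (X1 q) = 0"
    "gip G q (Y2 q) (X1 q) = 1" "gip G q (Y1 q) (X2 q) = - 1" "gip G q (Y2 q) (X2 q) = 0"
  using gip_frame[OF assms] gip_commute[OF assms] by simp_all

text \<open>The pairings show that the four frame vectors are independent, hence span. The
  difference of both sides is then orthogonal to everything, and an invertible \<open>G\<close>
  leaves only 0.\<close>

lemma frame_expansion:
  assumes q: "q \<in> U"
  shows "v = gip G q v (Y2 q) *\<^sub>R X1 q - gip G q v (Y1 q) *\<^sub>R X2 q
    - gip G q v (X2 q) *\<^sub>R Y1 q + gip G q v (X1 q) *\<^sub>R Y2 q" (is "v = ?e")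
proof -
  note fr = gip_frame[OF q] gip_frame'[OF q]
  define f where "f c = c $ 1 *\<^sub>R X1 q + c $ 2 *\<^sub>R X2 q + c $ 3 *\<^sub>R Y1 q + c $ 4 *\<^sub>R Y2 q" for c :: "real^4"
  have lin: "linear f"
    unfolding f_def by (intro linearI) (simp_all add: algebra_simps)
  have fg: "gip G q (f c) (X1 q) = c $ 4" "gip G q (f c) (X2 q) = - c $ 3"
    "gip G q (f c) (Y1 q) = - c $ 2" "gip G q (f c) (Y2 q) = c $ 1" for c
    unfolding f_def by (simp_all add: gip_linear fr)
  have "inj f"
  proof (subst linear_injective_0[OF lin], intro allI impI)
    fix c assume "f c = 0"
    then have "gip G q (f c) u = 0" for u by (simp only: gip_0)
    then show "c = 0" using fg[of c] by (simp add: vec_eq_iff forall_4)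
  qed
  then have "surj f" using lin linear_injective_imp_surjective by blast
  have w: "gip G q (v - ?e) u = 0" for u
  proof -
    obtain c where "u = f c" using \<open>surj f\<close> by blast
    then show ?thesis unfolding f_def by (simp add: gip_linear fr)
  qed
  have "G q *v (matrix_inv (G q) *v (v - ?e)) = v - ?e"
    by (simp only: matrix_vector_mul_assoc matrix_mult_inv[OF inv_G[OF q]] matrix_vector_mul_lid)
  then have "(v - ?e) \<bullet> (v - ?e) = 0"
    using w[of "matrix_inv (G q) *v (v - ?e)"] unfolding gip_def by (simp only:)
  then show ?thesis by simp
qed

definition th1 :: "real^4 \<Rightarrow> real^4 \<Rightarrow> real" where "th1 q v = gip G q (X1 q) v"
definition th2 :: "real^4 \<Rightarrow> real^4 \<Rightarrow> real" where "th2 q v = gip G q (X2 q) v"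
definition sig :: "real^4 \<Rightarrow> real^4 \<Rightarrow> real^4 \<Rightarrow> real" where
  "sig q u v = th1 q u * th2 q v - th1 q v * th2 q u"
text \<open>Membership in the null plane, tested by pairings: a totally null plane of half the
  dimension is its own orthogonal complement. In this form it can be differentiated;
  \<open>inD_span\<close> recovers the span.\<close>

definition inD :: "real^4 \<Rightarrow> real^4 \<Rightarrow> bool" where "inD q v \<longleftrightarrow> th1 q v = 0 \<and> th2 q v = 0"

lemma inD_span:
  assumes "q \<in> U" "inD q v" obtains a b where "v = a *\<^sub>R X1 q + b *\<^sub>R X2 q"
proof -
  have "v = gip G q v (Y2 q) *\<^sub>R X1 q + (- gip G q v (Y1 q)) *\<^sub>R X2 q"
    using frame_expansion[OF assms(1), of v] assms(2) gip_commute[OF assms(1), of v]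
    by (simp add: inD_def th1_def th2_def)
  then show thesis by (rule that)
qed

lemma inD_X: "q \<in> U \<Longrightarrow> inD q (X1 q)" "q \<in> U \<Longrightarrow> inD q (X2 q)"
  by (simp_all add: inD_def th1_def th2_def gip_frame gip_frame')

lemma inD_add: "inD q u \<Longrightarrow> inD q v \<Longrightarrow> inD q (u + v)"
  and inD_diff: "inD q u \<Longrightarrow> inD q v \<Longrightarrow> inD q (u - v)"
  and inD_scaleR: "inD q u \<Longrightarrow> inD q (c *\<^sub>R u)"
  by (simp_all add: inD_def th1_def th2_def gip_linear)

lemma inD_null:
  assumes "q \<in> U" "inD q u" "inD q v" shows "gip G q u v = 0"
proof -
  obtain a b where "u = a *\<^sub>R X1 q + b *\<^sub>R X2 q" using inD_span[OF assms(1,2)] .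
  then show ?thesis using assms(3) by (simp add: gip_linear inD_def th1_def th2_def)
qed

lemma inD_null_dest: "q \<in> U \<Longrightarrow> inD q u \<Longrightarrow> inD q v \<Longrightarrow> gip G q (w + u) v = gip G q w v"
  by (simp add: gip_add inD_null)

lemma sig_inD: "inD q u \<Longrightarrow> sig q u v = 0" "inD q v \<Longrightarrow> sig q u v = 0"
  by (simp_all add: sig_def inD_def)

lemma sig_linear: "sig q (u + u') v = sig q u v + sig q u' v" "sig q u (v + v') = sig q u v + sig q u v'"
  "sig q (c *\<^sub>R u) v = c * sig q u v" "sig q u (c *\<^sub>R v) = c * sig q u v" "sig q u u = 0"
  by (simp_all add: sig_def th1_def th2_def gip_linear algebra_simps)

lemma smooth_sig:
  assumes V: "open V" "smooth_on V X" "X ` V \<subseteq> U" and A: "smooth_on V A" "smooth_on V B"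
  shows "smooth_on V (\<lambda>p. sig (X p) (A p) (B p))"
  unfolding sig_def th1_def th2_def
  by (intro smooth_on_diff smooth_on_mult smooth_gip V A
      smooth_on_compose[OF V(1) smooth_frame(1) V(2,3)] smooth_on_compose[OF V(1) smooth_frame(2) V(2,3)])

lemma cov_X:
  assumes V: "open V" "smooth_on V X" "X ` V \<subseteq> U" and p: "p \<in> V"
  obtains a b c where "cov G X v (\<lambda>p. X1 (X p)) p = a *\<^sub>R X1 (X p) + b *\<^sub>R X2 (X p)"
    "cov G X v (\<lambda>p. X2 (X p)) p = c *\<^sub>R X1 (X p) - a *\<^sub>R X2 (X p)"
proof -
  have Xp: "X p \<in> U" using V(3) p by blast
  from parallel[OF Xp] obtain a b c where abc:
    "\<And>i. nabla G i X1 (X p) = a i *\<^sub>R X1 (X p) + b i *\<^sub>R X2 (X p)"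
    "\<And>i. nabla G i X2 (X p) = c i *\<^sub>R X1 (X p) - a i *\<^sub>R X2 (X p)"
    by metis
  show thesis
  proof (rule that)
    show "cov G X v (\<lambda>p. X1 (X p)) p = (\<Sum>i\<in>UNIV. dd v X p $ i * a i) *\<^sub>R X1 (X p) + (\<Sum>i\<in>UNIV. dd v X p $ i * b i) *\<^sub>R X2 (X p)"
      unfolding cov_compose[OF V smooth_frame(1) p] abc
      by (simp add: scaleR_sum_left sum.distrib scaleR_add_right)
    show "cov G X v (\<lambda>p. X2 (X p)) p = (\<Sum>i\<in>UNIV. dd v X p $ i * c i) *\<^sub>R X1 (X p) - (\<Sum>i\<in>UNIV. dd v X p $ i * a i) *\<^sub>R X2 (X p)"
      unfolding cov_compose[OF V smooth_frame(2) p] abc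
      by (simp add: scaleR_sum_left sum_subtractf scaleR_diff_right)
  qed
qed

text \<open>The coefficients are obtained before \<open>A\<close>: with the same \<open>a\<close>,
  \<open>b\<close>, \<open>c\<close> for all fields \<open>A\<close>, the formula can be used twice
  inside one two-form.\<close>

lemma dd_th:
  assumes V: "open V" "smooth_on V X" "X ` V \<subseteq> U" and p: "p \<in> V"
  obtains a b c where
    "\<And>A. smooth_on V A \<Longrightarrow> dd v (\<lambda>p. th1 (X p) (A p)) p = th1 (X p) (cov G X v A p) + a * th1 (X p) (A p) + b * th2 (X p) (A p)"
    "\<And>A. smooth_on V A \<Longrightarrow> dd v (\<lambda>p. th2 (X p) (A p)) p = th2 (X p) (cov G X v A p) + c * th1 (X p) (A p) - a * th2 (X p) (A p)"
proof -
  obtain a b c where abc: "cov G X v (\<lambda>p. X1 (X p)) p = a *\<^sub>R X1 (X p) + b *\<^sub>R X2 (X p)"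
    "cov G X v (\<lambda>p. X2 (X p)) p = c *\<^sub>R X1 (X p) - a *\<^sub>R X2 (X p)"
    using cov_X[OF V p] .
  note XX = smooth_on_compose[OF V(1) smooth_frame(1) V(2,3)] smooth_on_compose[OF V(1) smooth_frame(2) V(2,3)]
  show thesis
  proof (rule that[of a b c])
    fix A :: "real^4 \<Rightarrow> real^4" assume A: "smooth_on V A"
    show "dd v (\<lambda>p. th1 (X p) (A p)) p = th1 (X p) (cov G X v A p) + a * th1 (X p) (A p) + b * th2 (X p) (A p)"
      using dd_gip[OF V XX(1) A p, of v] by (simp add: th1_def th2_def abc gip_linear)
    show "dd v (\<lambda>p. th2 (X p) (A p)) p = th2 (X p) (cov G X v A p) + c * th1 (X p) (A p) - a * th2 (X p) (A p)"
      using dd_gip[OF V XX(2) A p, of v] by (simp add: th1_def th2_def abc gip_linear)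
  qed
qed

text \<open>Differentiate \<open>th1 A = th2 A = 0\<close>: by \<open>dd_th\<close> the extra terms
  are multiples of quantities which themselves vanish.\<close>

lemma cov_inD:
  assumes V: "open V" "smooth_on V X" "X ` V \<subseteq> U" and A: "smooth_on V A"
    and D: "\<And>p. p \<in> V \<Longrightarrow> inD (X p) (A p)" and p: "p \<in> V"
  shows "inD (X p) (cov G X v A p)"
proof -
  have "dd v (\<lambda>p. th1 (X p) (A p)) p = dd v (\<lambda>p. 0) p" "dd v (\<lambda>p. th2 (X p) (A p)) p = dd v (\<lambda>p. 0) p"
    by (rule dd_cong_open[OF V(1) _ p]; use D in \<open>simp add: inD_def\<close>)+
  moreover obtain a b c where abc:
    "\<And>A. smooth_on V A \<Longrightarrow> dd v (\<lambda>p. th1 (X p) (A p)) p = th1 (X p) (cov G X v A p) + a * th1 (X p) (A p) + b * th2 (X p) (A p)"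
    "\<And>A. smooth_on V A \<Longrightarrow> dd v (\<lambda>p. th2 (X p) (A p)) p = th2 (X p) (cov G X v A p) + c * th1 (X p) (A p) - a * th2 (X p) (A p)"
    by (rule dd_th[OF V p, where v = v]) (rule that; assumption)
  ultimately show ?thesis using D[OF p] abc(1)[OF A] abc(2)[OF A] by (simp add: inD_def)
qed

text \<open>The two-form \<open>sig\<close> is parallel: the connection acts on it through the trace
  of its matrix on \<open>X1\<close>, \<open>X2\<close>, and \<open>a - a = 0\<close>.\<close>

lemma dd_sig:
  assumes V: "open V" "smooth_on V X" "X ` V \<subseteq> U" and A: "smooth_on V A" "smooth_on V B" and p: "p \<in> V"
  shows "dd v (\<lambda>p. sig (X p) (A p) (B p)) p = sig (X p) (cov G X v A p) (B p) + sig (X p) (A p) (cov G X v B p)"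
proof -
  obtain a b c where abc:
    "\<And>A. smooth_on V A \<Longrightarrow> dd v (\<lambda>p. th1 (X p) (A p)) p = th1 (X p) (cov G X v A p) + a * th1 (X p) (A p) + b * th2 (X p) (A p)"
    "\<And>A. smooth_on V A \<Longrightarrow> dd v (\<lambda>p. th2 (X p) (A p)) p = th2 (X p) (cov G X v A p) + c * th1 (X p) (A p) - a * th2 (X p) (A p)"
    by (rule dd_th[OF V p, where v = v]) (rule that; assumption)
  have s: "smooth_on V (\<lambda>p. th1 (X p) (A p))" "smooth_on V (\<lambda>p. th2 (X p) (A p))" if "smooth_on V A" for A
    unfolding th1_def th2_def
    by (intro smooth_gip V that smooth_on_compose[OF V(1) smooth_frame(1) V(2,3)]
      smooth_on_compose[OF V(1) smooth_frame(2) V(2,3)])+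
  show ?thesis
    unfolding sig_def
    by (simp add: dd_diff[OF smooth_on_mult smooth_on_mult] dd_mult[OF _ _ p] s A V(1) p abc algebra_simps
        dd_diff[where S = V] smooth_on_mult)
qed


lemma bounded_linear_gip: "bounded_linear (gip G q u)"
  unfolding gip_def[abs_def]
  by (rule bounded_linear_compose[OF bounded_linear_inner_right matrix_vector_mul_bounded_linear])

lemma axis_Basis [simp]: "axis i (1::real) \<in> (Basis :: (real^4) set)"
  by (simp add: axis_in_Basis_iff)

lemma axis_nth: "axis i (1::real) $ j = (if j = i then 1 else 0)"
  by (simp add: axis_def)

lemma inner_axis1: "p \<bullet> axis i 1 = p $ i" for p :: "real^4"
  by (simp add: inner_axis)

text \<open>Vector fields \<open>V1\<close>, \<open>V2\<close> spanning the null plane and normalised by two constant covectors; since the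
  plane is involutive they commute.\<close>

lemma commuting_span:
  assumes q0: "q0 \<in> U"
  obtains W V1 V2 where "open W" "q0 \<in> W" "W \<subseteq> U" "smooth_on W V1" "smooth_on W V2"
    "\<And>q. q \<in> W \<Longrightarrow> inD q (V1 q)" "\<And>q. q \<in> W \<Longrightarrow> inD q (V2 q)"
    "\<And>q. q \<in> W \<Longrightarrow> dd (V1 q) V2 q = dd (V2 q) V1 q" "V1 q0 = - X2 q0" "V2 q0 = X1 q0"
proof -
  note fr = gip_frame[OF q0] gip_frame'[OF q0]
  define la1 where "la1 = gip G q0 (Y1 q0)"
  define la2 where "la2 = gip G q0 (Y2 q0)"
  have la: "bounded_linear la1" "bounded_linear la2" unfolding la1_def la2_def by (rule bounded_linear_gip)+
  have la0: "la1 (X1 q0) = 0" "la1 (X2 q0) = - 1" "la2 (X1 q0) = 1" "la2 (X2 q0) = 0"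
    by (simp_all add: la1_def la2_def fr)
  \<comment> \<open>The determinant of \<open>la1\<close>, \<open>la2\<close> on \<open>X1\<close>,
    \<open>X2\<close>. By Cramer's rule \<open>V1\<close>, \<open>V2\<close> below are the basis of
    the plane dual to these covectors.\<close>
  define del where "del q = la1 (X1 q) * la2 (X2 q) - la1 (X2 q) * la2 (X1 q)" for q
  have sla: "smooth_on U (\<lambda>q. la1 (X1 q))" "smooth_on U (\<lambda>q. la1 (X2 q))"
    "smooth_on U (\<lambda>q. la2 (X1 q))" "smooth_on U (\<lambda>q. la2 (X2 q))"
    by (rule smooth_on_linear_compose[OF la(1) open_U smooth_frame(1)]
        smooth_on_linear_compose[OF la(1) open_U smooth_frame(2)]
        smooth_on_linear_compose[OF la(2) open_U smooth_frame(1)]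
        smooth_on_linear_compose[OF la(2) open_U smooth_frame(2)])+
  have sdel: "smooth_on U del" unfolding del_def by (intro smooth_on_diff smooth_on_mult open_U sla)
  define W where "W = {q \<in> U. del q \<noteq> 0}"
  have W: "open W" "W \<subseteq> U" "q0 \<in> W"
  proof -
    have "open (U \<inter> del -` (- {0}))"
      by (rule continuous_open_preimage[OF smooth_on_imp_continuous_on[OF sdel] open_U]) (simp add: open_Compl)
    moreover have "W = U \<inter> del -` (- {0})" by (auto simp: W_def)
    ultimately show "open W" by simp
  qed (use q0 in \<open>auto simp: W_def del_def la0\<close>)
  have nz: "del q \<noteq> 0" if "q \<in> W" for q using that by (simp add: W_def)
  define V1 where "V1 q = (la2 (X2 q) / del q) *\<^sub>R X1 q - (la2 (X1 q) / del q) *\<^sub>R X2 q" for q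
  define V2 where "V2 q = (la1 (X1 q) / del q) *\<^sub>R X2 q - (la1 (X2 q) / del q) *\<^sub>R X1 q" for q
  have sW: "smooth_on W (\<lambda>q. la1 (X1 q))" "smooth_on W (\<lambda>q. la1 (X2 q))"
    "smooth_on W (\<lambda>q. la2 (X1 q))" "smooth_on W (\<lambda>q. la2 (X2 q))" "smooth_on W del" "smooth_on W X1" "smooth_on W X2"
    using sla sdel smooth_frame(1,2) smooth_on_subset[OF _ W(2)] by blast+
  have "smooth_on W V1" unfolding V1_def
    by (intro smooth_on_diff smooth_on_scaleR smooth_on_divide W(1) sW) (simp_all add: nz)
  moreover have "smooth_on W V2" unfolding V2_def
    by (intro smooth_on_diff smooth_on_scaleR smooth_on_divide W(1) sW) (simp_all add: nz)
  ultimately have V: "smooth_on W V1" "smooth_on W V2" .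
  have D: "inD q (V1 q)" "inD q (V2 q)" if "q \<in> W" for q
    unfolding V1_def V2_def using that W(2) by (auto intro!: inD_diff inD_scaleR inD_X)
  have lin: "linear la1" "linear la2" using la by (auto intro: bounded_linear.linear)
  have laV: "la1 (V1 q) = 1" "la2 (V1 q) = 0" "la1 (V2 q) = 0" "la2 (V2 q) = 1" if "q \<in> W" for q
    using nz[OF that] unfolding V1_def V2_def
    by (simp_all add: linear_diff[OF lin(1)] linear_diff[OF lin(2)] linear_cmul[OF lin(1)] linear_cmul[OF lin(2)]
        divide_simps) (simp_all add: del_def algebra_simps)
  have dla: "l (dd u A q) = 0" if l: "bounded_linear l" and A: "smooth_on W A" and c: "\<And>q. q \<in> W \<Longrightarrow> l (A q) = c" and q: "q \<in> W"
    for l :: "real^4 \<Rightarrow> real" and A :: "real^4 \<Rightarrow> real^4" and c u q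
  proof -
    have "dd u (\<lambda>q. l (A q)) q = l (dd u A q)"
      using frechet_derivative_eqI[OF bounded_linear.has_derivative[OF l smooth_on_has_derivative[OF A q]]] by simp
    moreover have "dd u (\<lambda>q. l (A q)) q = dd u (\<lambda>q. c) q" by (rule dd_cong_open[OF W(1) c q])
    ultimately show ?thesis by simp
  qed
  have comm: "dd (V1 q) V2 q = dd (V2 q) V1 q" if q: "q \<in> W" for q
  proof -
    have qU: "q \<in> U" using q W(2) by blast
    have id: "smooth_on W (\<lambda>q. q)" "(\<lambda>q. q) ` W \<subseteq> U" using W(2) by auto
    have cv: "cov G (\<lambda>q. q) u A q = dd u A q + chr G q u (A q)" for u A by (simp add: cov_def)
    \<comment> \<open>By symmetry of the Christoffel symbols the bracket of \<open>V1\<close> and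
      \<open>V2\<close> is a difference of covariant derivatives, hence lies in the plane. Both
      \<open>la1\<close> and \<open>la2\<close> annihilate it because they are constant on
      \<open>V1\<close> and \<open>V2\<close>, and on the plane they are independent.\<close>
    have "inD q (cov G (\<lambda>q. q) (V1 q) V2 q)" "inD q (cov G (\<lambda>q. q) (V2 q) V1 q)"
      using cov_inD[OF W(1) id V(2) D(2) q] cov_inD[OF W(1) id V(1) D(1) q] by blast+
    from inD_diff[OF this] have w: "inD q (dd (V1 q) V2 q - dd (V2 q) V1 q)"
      unfolding cv using chr_commute[OF qU, of "V1 q" "V2 q"] by simp
    obtain a b where ab: "dd (V1 q) V2 q - dd (V2 q) V1 q = a *\<^sub>R X1 q + b *\<^sub>R X2 q"
      using inD_span[OF qU w] .
    have "la1 (dd (V1 q) V2 q - dd (V2 q) V1 q) = 0" "la2 (dd (V1 q) V2 q - dd (V2 q) V1 q) = 0"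
      by (simp_all add: linear_diff[OF lin(1)] linear_diff[OF lin(2)] dla[OF la(1) V(1) laV(1) q] dla[OF la(2) V(1) laV(2) q]
        dla[OF la(1) V(2) laV(3) q] dla[OF la(2) V(2) laV(4) q])
    then have e: "a * la1 (X1 q) + b * la1 (X2 q) = 0" "a * la2 (X1 q) + b * la2 (X2 q) = 0"
      unfolding ab by (simp_all add: linear_add[OF lin(1)] linear_add[OF lin(2)] linear_cmul[OF lin(1)] linear_cmul[OF lin(2)])
    have "a * del q = la2 (X2 q) * (a * la1 (X1 q) + b * la1 (X2 q)) - la1 (X2 q) * (a * la2 (X1 q) + b * la2 (X2 q))"
      "b * del q = la1 (X1 q) * (a * la2 (X1 q) + b * la2 (X2 q)) - la2 (X1 q) * (a * la1 (X1 q) + b * la1 (X2 q))"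
      unfolding del_def by (simp_all add: algebra_simps)
    then have "a = 0" "b = 0" using e nz[OF q] by auto
    then show ?thesis using ab by simp
  qed
  show thesis
    by (rule that[OF W(1,3,2) V D comm]) (simp_all add: V1_def V2_def la0 del_def)
qed

text \<open>A surface through \<open>q0\<close> transversal to the null planes is parametrised by
  \<open>w\<close>, \<open>z\<close> so that \<open>sig\<close> is 1 on its coordinate vectors; the
  commuting flows of \<open>V1\<close>, \<open>V2\<close> then carry it along the null planes with
  times \<open>x\<close>, \<open>y\<close>. As the planes and \<open>sig\<close> are parallel, the
  normalisation persists.\<close>

lemma adapted_flow:
  assumes q0: "q0 \<in> U"
  obtains r \<phi> where "r > 0" "smooth_on (ball 0 r) \<phi>" "\<phi> ` ball 0 r \<subseteq> U" "\<phi> 0 = q0"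
    "\<And>p. p \<in> ball 0 r \<Longrightarrow> inD (\<phi> p) (pd 3 \<phi> p)" "\<And>p. p \<in> ball 0 r \<Longrightarrow> inD (\<phi> p) (pd 4 \<phi> p)"
    "\<And>p. p \<in> ball 0 r \<Longrightarrow> sig (\<phi> p) (pd 1 \<phi> p) (pd 2 \<phi> p) = 1"
    "pd 1 \<phi> 0 = Y1 q0" "pd 2 \<phi> 0 = Y2 q0" "pd 3 \<phi> 0 = - X2 q0" "pd 4 \<phi> 0 = X1 q0"
proof -
  note fr = gip_frame[OF q0] gip_frame'[OF q0]
  obtain W V1 V2 where W: "open W" "q0 \<in> W" "W \<subseteq> U" and V: "smooth_on W V1" "smooth_on W V2"
    and D: "\<And>q. q \<in> W \<Longrightarrow> inD q (V1 q)" "\<And>q. q \<in> W \<Longrightarrow> inD q (V2 q)"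
    and comm: "\<And>q. q \<in> W \<Longrightarrow> dd (V1 q) V2 q = dd (V2 q) V1 q" and V0: "V1 q0 = - X2 q0" "V2 q0 = X1 q0"
    using commuting_span[OF q0] by blast
  define n0 where "n0 = Y1 q0"
  define n1 where "n1 = Y2 q0"
  have n0: "n0 \<noteq> 0" using fr unfolding n0_def by (metis gip_0(1) gip_0(2) neg_eq_iff_add_eq_0 zero_neq_neg_one)
  define S where "S q = sig q n0 n1" for q
  have sS: "smooth_on U S" unfolding S_def
    using smooth_sig[OF open_U smooth_on_ident _ smooth_on_const smooth_on_const] by auto
  have S0: "S q0 = 1" by (simp add: S_def n0_def n1_def sig_def th1_def th2_def fr)
  define U' where "U' = {q \<in> W. S q \<noteq> 0}"
  have U': "open U'" "U' \<subseteq> W" "q0 \<in> U'"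
  proof -
    have "open (W \<inter> S -` (- {0}))"
      by (rule continuous_open_preimage[OF continuous_on_subset[OF smooth_on_imp_continuous_on[OF sS] W(3)] W(1)]) (simp add: open_Compl)
    moreover have "U' = W \<inter> S -` (- {0})" by (auto simp: U'_def)
    ultimately show "open U'" by simp
  qed (use W S0 in \<open>auto simp: U'_def\<close>)
  have SU: "S q \<noteq> 0" if "q \<in> U'" for q using that by (simp add: U'_def)
  \<comment> \<open>Rescaled so that \<open>sig\<close> of \<open>N\<close> and \<open>n1\<close> is
    1. Keeping the direction \<open>n0\<close> fixed forces the flow of \<open>N\<close> to stay in
    the affine plane through \<open>q0\<close> spanned by \<open>n0\<close> and
    \<open>n1\<close>.\<close>
  define N where "N q = (1 / S q) *\<^sub>R n0" for q
  have "smooth_on U' S" using smooth_on_subset[OF sS] U'(2) W(3) by auto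
  then have N: "smooth_on U' N" unfolding N_def
    by (intro smooth_on_scaleR smooth_on_divide smooth_on_const U'(1) SU)
  have V': "smooth_on U' V1" "smooth_on U' V2" using V smooth_on_subset U'(2) by blast+
  define \<sigma> where "\<sigma> p = q0 + p $ 2 *\<^sub>R n1" for p :: "real^4"
  have \<sigma>: "smooth_on UNIV \<sigma>" unfolding \<sigma>_def
    by (intro smooth_on_add smooth_on_const smooth_on_scaleR smooth_on_coord open_UNIV)
  have \<sigma>0: "\<sigma> 0 = q0" by (simp add: \<sigma>_def)
  note ax = inner_axis1
  obtain r0 P0 where r0: "r0 > 0" and P0: "smooth_on (ball 0 r0) P0" "P0 ` ball 0 r0 \<subseteq> U'"
    "\<And>p. p \<in> ball 0 r0 \<Longrightarrow> pd 1 P0 p = N (P0 p)" "\<And>p. p \<in> ball 0 r0 \<Longrightarrow> p $ 1 = 0 \<Longrightarrow> P0 p = \<sigma> p"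
  proof (rule local_flow[of "axis 1 1" U' \<sigma> N UNIV])
    fix r \<Phi> assume "0 < r" "smooth_on (ball 0 r) \<Phi>" "\<Phi> ` ball 0 r \<subseteq> U'"
      "\<And>p. p \<in> ball 0 r \<Longrightarrow> dd (axis 1 1) \<Phi> p = N (\<Phi> p)"
      "\<And>p. p \<in> ball 0 r \<Longrightarrow> p \<bullet> axis 1 1 = 0 \<Longrightarrow> \<Phi> p = \<sigma> p"
    then show thesis using that[of r \<Phi>] by (simp add: ax pd_def)
  qed (use U' N \<sigma> \<sigma>0 in auto)
  have P00: "P0 0 = q0" using P0(4)[of 0] r0 \<sigma>0 by simp
  obtain r1 P1 where r1: "r1 > 0" "ball 0 r1 \<subseteq> ball (0::real^4) r0" and P1: "smooth_on (ball 0 r1) P1" "P1 ` ball 0 r1 \<subseteq> U'"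
    "\<And>p. p \<in> ball 0 r1 \<Longrightarrow> pd 3 P1 p = V1 (P1 p)" "\<And>p. p \<in> ball 0 r1 \<Longrightarrow> p $ 3 = 0 \<Longrightarrow> P1 p = P0 p"
  proof (rule local_flow[of "axis 3 1" U' P0 V1 "ball 0 r0"])
    fix r \<Phi> assume "0 < r" "ball 0 r \<subseteq> ball (0::real^4) r0" "smooth_on (ball 0 r) \<Phi>" "\<Phi> ` ball 0 r \<subseteq> U'"
      "\<And>p. p \<in> ball 0 r \<Longrightarrow> dd (axis 3 1) \<Phi> p = V1 (\<Phi> p)"
      "\<And>p. p \<in> ball 0 r \<Longrightarrow> p \<bullet> axis 3 1 = 0 \<Longrightarrow> \<Phi> p = P0 p"
    then show thesis using that[of r \<Phi>] by (simp add: ax pd_def)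
  qed (use U' V' P0 P00 r0 in auto)
  have P10: "P1 0 = q0" using P1(4)[of 0] r1 P00 by simp
  obtain r2 P2 where r2: "r2 > 0" "ball 0 r2 \<subseteq> ball (0::real^4) r1" and P2: "smooth_on (ball 0 r2) P2" "P2 ` ball 0 r2 \<subseteq> U'"
    "\<And>p. p \<in> ball 0 r2 \<Longrightarrow> pd 4 P2 p = V2 (P2 p)" "\<And>p. p \<in> ball 0 r2 \<Longrightarrow> p $ 4 = 0 \<Longrightarrow> P2 p = P1 p"
  proof (rule local_flow[of "axis 4 1" U' P1 V2 "ball 0 r1"])
    fix r \<Phi> assume "0 < r" "ball 0 r \<subseteq> ball (0::real^4) r1" "smooth_on (ball 0 r) \<Phi>" "\<Phi> ` ball 0 r \<subseteq> U'"
      "\<And>p. p \<in> ball 0 r \<Longrightarrow> dd (axis 4 1) \<Phi> p = V2 (\<Phi> p)"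
      "\<And>p. p \<in> ball 0 r \<Longrightarrow> p \<bullet> axis 4 1 = 0 \<Longrightarrow> \<Phi> p = P1 p"
    then show thesis using that[of r \<Phi>] by (simp add: ax pd_def)
  qed (use U' V' P1 P10 r1 in auto)
  have P20: "P2 0 = q0" using P2(4)[of 0] r2 P10 by simp
  have P1r2: "smooth_on (ball 0 r2) P1" and P0r1: "smooth_on (ball 0 r1) P0"
    using smooth_on_subset P1(1) P0(1) r1 r2 by blast+
  have tan4: "pd i P2 p = pd i P1 p" if "p \<in> ball 0 r2" "p $ 4 = 0" "i \<noteq> 4" for i p
    unfolding pd_def
    by (rule dd_cong_hyperplane[where S = "ball 0 r2" and b = "axis 4 1"])
      (use that P2 P1r2 in \<open>auto simp: ax axis_nth\<close>)
  have tan3: "pd i P1 p = pd i P0 p" if "p \<in> ball 0 r1" "p $ 3 = 0" "i \<noteq> 3" for i p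
    unfolding pd_def
    by (rule dd_cong_hyperplane[where S = "ball 0 r1" and b = "axis 3 1"])
      (use that P1 P0r1 in \<open>auto simp: ax axis_nth\<close>)
  have tan1: "pd i P0 p = pd i \<sigma> p" if "p \<in> ball 0 r0" "p $ 1 = 0" "i \<noteq> 1" for i p
    unfolding pd_def
    by (rule dd_cong_hyperplane[where S = "ball 0 r0" and b = "axis 1 1"])
      (use that P0 smooth_on_subset[OF \<sigma>] in \<open>auto simp: ax axis_nth\<close>)
  \<comment> \<open>By construction \<open>pd 3 P2\<close> is \<open>V1\<close> only where
    \<open>y = 0\<close>; commutation with \<open>V2\<close> propagates this to a smaller
    ball.\<close>
  obtain s where s: "0 < s" "s \<le> r2" "\<And>p. p \<in> ball 0 s \<Longrightarrow> dd (axis 3 1) P2 p = V1 (P2 p)"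
  proof (rule commuting_flow[of "axis 4 1" U' V1 V2 r2 P2 "axis 3 1"])
    show "dd (V1 q) V2 q = dd (V2 q) V1 q" if "q \<in> U'" for q using comm that U'(2) by blast
    show "dd (axis 4 1) P2 p = V2 (P2 p)" if "p \<in> ball 0 r2" for p using P2(3)[OF that] by (simp add: pd_def)
    show "dd (axis 3 1) P2 p = V1 (P2 p)" if p: "p \<in> ball 0 r2" and z: "p \<bullet> axis 4 1 = 0" for p
    proof -
      have "pd 3 P2 p = pd 3 P1 p" using tan4[OF p] z by (simp add: ax)
      also have "\<dots> = V1 (P1 p)" using P1(3) p r2(2) by blast
      also have "P1 p = P2 p" using P2(4)[OF p] z by (simp add: ax)
      finally show ?thesis by (simp add: pd_def)
    qed
  qed (use U' V' P2 r2 in auto)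
  define B where "B = ball (0::real^4) s"
  have sub: "B \<subseteq> ball 0 r2" "B \<subseteq> ball 0 r1" "B \<subseteq> ball 0 r0"
  proof -
    show "B \<subseteq> ball 0 r2" unfolding B_def using s(2) by (rule subset_ball)
    then show "B \<subseteq> ball 0 r1" using r2(2) by (rule order_trans)
    then show "B \<subseteq> ball 0 r0" using r1(2) by (rule order_trans)
  qed
  have B: "open B" "0 \<in> B" "seg_closed (axis i 1) B" for i
    using s(1) by (auto simp: B_def intro!: seg_closed_ball)
  have sP2: "smooth_on B P2" "P2 ` B \<subseteq> U" using smooth_on_subset[OF P2(1)] P2(2) sub U'(2) W(3) by blast+
  have inW: "P2 p \<in> W" if "p \<in> B" for p using P2(2) sub(1) that U'(2) by blast
  have T3: "pd 3 P2 p = V1 (P2 p)" if "p \<in> B" for p using s(3) that by (simp add: pd_def B_def)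
  have T4: "pd 4 P2 p = V2 (P2 p)" if "p \<in> B" for p using P2(3) that sub(1) by blast
  have D3: "inD (P2 p) (pd 3 P2 p)" if "p \<in> B" for p using T3[OF that] D(1)[OF inW[OF that]] by simp
  have D4: "inD (P2 p) (pd 4 P2 p)" if "p \<in> B" for p using T4[OF that] D(2)[OF inW[OF that]] by simp
  \<comment> \<open>\<open>h\<close> is the part of \<open>P0 - \<sigma>\<close> orthogonal to
    \<open>n0\<close>. It vanishes at \<open>w = 0\<close>, and its \<open>w\<close>-derivative is
    zero because \<open>P0\<close> moves along \<open>n0\<close>, so it vanishes identically. The
    multiple \<open>c\<close> of \<open>n0\<close> does not affect \<open>sig\<close>.\<close>
  have P0d2: "\<exists>c. pd 2 P0 p = n1 + c *\<^sub>R n0" if p: "p \<in> ball 0 r0" for p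
  proof -
    define F where "F p = P0 p - \<sigma> p" for p
    define f where "f p = (F p \<bullet> n0) / (n0 \<bullet> n0)" for p
    define h where "h p = F p - f p *\<^sub>R n0" for p
    have F: "smooth_on (ball 0 r0) F" unfolding F_def
      by (intro smooth_on_diff P0(1) smooth_on_subset[OF \<sigma>]) auto
    have f: "smooth_on (ball 0 r0) f" unfolding f_def
      by (intro smooth_on_divide smooth_on_inner F smooth_on_const) (use n0 in auto)
    have fn: "smooth_on (ball 0 r0) (\<lambda>p. f p *\<^sub>R n0)" by (intro smooth_on_scaleR f smooth_on_const open_ball)
    have h: "smooth_on (ball 0 r0) h" unfolding h_def by (intro smooth_on_diff F fn open_ball)
    have d\<sigma>: "dd v \<sigma> p = v $ 2 *\<^sub>R n1" for v p
    proof -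
      have "(\<sigma> has_derivative (\<lambda>v. v $ 2 *\<^sub>R n1)) (at p)" unfolding \<sigma>_def
        by (auto intro!: derivative_eq_intros bounded_linear.has_derivative[OF bounded_linear_vec_nth])
      then show ?thesis by (simp add: frechet_derivative_eqI)
    qed
    have dF: "dd v F p = dd v P0 p - v $ 2 *\<^sub>R n1" if "p \<in> ball 0 r0" for v p
      unfolding F_def dd_diff[OF P0(1) smooth_on_subset[OF \<sigma> subset_UNIV] that] d\<sigma> ..
    have df: "dd v f p = (dd v F p \<bullet> n0) / (n0 \<bullet> n0)" if "p \<in> ball 0 r0" for v p
    proof -
      have "(f has_derivative (\<lambda>v. (dd v F p \<bullet> n0) / (n0 \<bullet> n0))) (at p)" unfolding f_def divide_inverse
        by (intro has_derivative_mult_left has_derivative_inner_left smooth_on_has_derivative[OF F that])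
      then show ?thesis by (simp add: frechet_derivative_eqI)
    qed
    have dh: "dd v h p = dd v F p - dd v f p *\<^sub>R n0" if "p \<in> ball 0 r0" for v p
      unfolding h_def dd_diff[OF F fn that] dd_scaleR[OF f smooth_on_const that] by simp
    have "dd (axis 1 1) h p = 0" if p: "p \<in> ball 0 r0" for p
      using P0(3)[OF p] n0 unfolding dh[OF p] df[OF p] dF[OF p] pd_def by (simp add: N_def axis_nth)
    then have "h p = h (p - (p \<bullet> axis 1 1) *\<^sub>R axis 1 1)" if "p \<in> ball 0 r0" for p
      by (intro eq_on_segment_if_dd_0[OF open_ball seg_closed_ball h _ that]) auto
    moreover have "h (p - (p \<bullet> axis 1 1) *\<^sub>R axis 1 1) = 0" if p: "p \<in> ball 0 r0" for p
    proof -
      have "p - (p \<bullet> axis 1 1) *\<^sub>R axis 1 1 \<in> ball 0 r0"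
        using seg_closedD[OF seg_closed_ball[of "axis 1 1"] p, of 0] by simp
      from P0(4)[OF this] show ?thesis by (simp add: h_def F_def f_def ax axis_nth)
    qed
    ultimately have "h p = 0" if "p \<in> ball 0 r0" for p using that by simp
    then have "dd (axis 2 1) h p = dd (axis 2 1) (\<lambda>p. 0) p" by (intro dd_cong_open[OF open_ball _ p]) auto
    then have "dd (axis 2 1) P0 p = n1 + dd (axis 2 1) f p *\<^sub>R n0"
      unfolding dh[OF p] dF[OF p] by (simp add: axis_nth algebra_simps)
    then show ?thesis unfolding pd_def by blast
  qed
  have slice: "sig (P2 p) (pd 1 P2 p) (pd 2 P2 p) = 1" if p: "p \<in> B" and z: "p $ 3 = 0" "p $ 4 = 0" for p
  proof -
    have b: "p \<in> ball 0 r2" "p \<in> ball 0 r1" "p \<in> ball 0 r0" using p sub by blast+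
    have "pd 1 P2 p = N (P0 p)" "pd 2 P2 p = pd 2 P0 p"
      using tan4[OF b(1) z(2)] tan3[OF b(2) z(1)] P0(3)[OF b(3)] by simp_all
    moreover have "P2 p = P0 p" using P2(4)[OF b(1) z(2)] P1(4)[OF b(2) z(1)] by simp
    moreover obtain c where "pd 2 P0 p = n1 + c *\<^sub>R n0" using P0d2[OF b(3)] by blast
    moreover have "S (P0 p) \<noteq> 0" using SU P0(2) b(3) by blast
    ultimately show ?thesis by (simp add: N_def sig_linear S_def)
  qed
  have sg: "smooth_on B (\<lambda>p. sig (P2 p) (pd 1 P2 p) (pd 2 P2 p))"
    by (intro smooth_sig B(1) sP2 smooth_on_pd)
  \<comment> \<open>By torsion-freeness the derivative along a null direction \<open>k\<close>
    exchanges with \<open>i\<close>: the covariant derivative of \<open>pd k P2\<close> stays in the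
    null plane, where \<open>sig\<close> vanishes.\<close>
  have dsg: "dd (axis k 1) (\<lambda>p. sig (P2 p) (pd 1 P2 p) (pd 2 P2 p)) p = 0"
    if p: "p \<in> B" and k: "\<And>p. p \<in> B \<Longrightarrow> inD (P2 p) (pd k P2 p)" for k p
  proof -
    have "cov G P2 (axis k 1) (pd i P2) p = cov G P2 (axis i 1) (pd k P2) p" for i
      unfolding pd_def by (rule cov_dd_commute[OF B(1) sP2 p])
    moreover have "inD (P2 p) (cov G P2 (axis i 1) (pd k P2) p)" for i
      by (rule cov_inD[OF B(1) sP2 smooth_on_pd[OF sP2(1)] k p])
    ultimately show ?thesis
      unfolding dd_sig[OF B(1) sP2 smooth_on_pd[OF sP2(1)] smooth_on_pd[OF sP2(1)] p]
      by (simp add: sig_inD)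
  qed
  have sig1: "sig (P2 p) (pd 1 P2 p) (pd 2 P2 p) = 1" if p: "p \<in> B" for p
  proof -
    let ?f = "\<lambda>p. sig (P2 p) (pd 1 P2 p) (pd 2 P2 p)"
    define p' where "p' = p - (p \<bullet> axis 4 1) *\<^sub>R axis 4 1"
    define p'' where "p'' = p' - (p' \<bullet> axis 3 1) *\<^sub>R axis 3 1"
    have p': "p' \<in> B" using seg_closedD[OF B(3) p, of 0] by (simp add: p'_def)
    have p'': "p'' \<in> B" using seg_closedD[OF B(3) p', of 0] by (simp add: p''_def)
    have "?f p = ?f p'" unfolding p'_def by (rule eq_on_segment_if_dd_0[OF B(1,3) sg dsg[OF _ D4] p])
    also have "?f p' = ?f p''" unfolding p''_def by (rule eq_on_segment_if_dd_0[OF B(1,3) sg dsg[OF _ D3] p'])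
    also have "?f p'' = 1"
      by (rule slice[OF p'']) (simp_all add: p''_def p'_def ax axis_nth)
    finally show ?thesis .
  qed
  have z: "0 \<in> ball (0::real^4) r0" "0 \<in> ball (0::real^4) r1" "0 \<in> ball (0::real^4) r2" using r0 r1 r2 by auto
  show thesis
  proof (rule that[of s P2])
    show "pd 1 P2 0 = Y1 q0"
      using tan4[OF z(3)] tan3[OF z(2)] P0(3)[OF z(1)] by (simp add: P00 N_def S0 n0_def)
    have "pd 2 \<sigma> 0 = n1" unfolding pd_def
    proof -
      have "(\<sigma> has_derivative (\<lambda>v. v $ 2 *\<^sub>R n1)) (at 0)" unfolding \<sigma>_def
        by (auto intro!: derivative_eq_intros bounded_linear.has_derivative[OF bounded_linear_vec_nth])
      then show "dd (axis 2 1) \<sigma> 0 = n1" by (simp add: frechet_derivative_eqI)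
    qed
    then show "pd 2 P2 0 = Y2 q0"
      using tan4[OF z(3)] tan3[OF z(2)] tan1[OF z(1)] by (simp add: n1_def)
    show "pd 3 P2 0 = - X2 q0" "pd 4 P2 0 = X1 q0"
      using T3[OF B(2)] T4[OF B(2)] by (simp_all add: P20 V0)
  qed (use s sP2 P20 D3 D4 sig1 in \<open>auto simp: B_def\<close>)
qed

end

context null_frame
begin

text \<open>In the coordinates of \<open>adapted_flow\<close> the pairings \<open>g 1 3\<close> etc.
  still vary. Keeping \<open>w\<close>, \<open>z\<close> and taking as new \<open>x\<close>,
  \<open>y\<close> the functions whose derivatives along the null planes are \<open>2 g 1 k\<close>
  and \<open>2 g 2 k\<close> makes them constant. Changes of coordinates along the planes do not
  disturb \<open>sig\<close>.\<close>

lemma walker_coordinates: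
  assumes q0: "q0 \<in> U"
  obtains \<rho> X P where "\<rho> > 0" "smooth_on (ball 0 \<rho>) X" "X ` ball 0 \<rho> \<subseteq> U" "X 0 = q0"
    "open (X ` ball 0 \<rho>)" "homeomorphism (ball 0 \<rho>) (X ` ball 0 \<rho>) X P" "smooth_on (X ` ball 0 \<rho>) P"
    "\<And>p. p \<in> ball 0 \<rho> \<Longrightarrow> inD (X p) (pd 3 X p)" "\<And>p. p \<in> ball 0 \<rho> \<Longrightarrow> inD (X p) (pd 4 X p)"
    "\<And>p. p \<in> ball 0 \<rho> \<Longrightarrow> gip G (X p) (pd 1 X p) (pd 3 X p) = 1/2"
    "\<And>p. p \<in> ball 0 \<rho> \<Longrightarrow> gip G (X p) (pd 1 X p) (pd 4 X p) = 0"
    "\<And>p. p \<in> ball 0 \<rho> \<Longrightarrow> gip G (X p) (pd 2 X p) (pd 3 X p) = 0"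
    "\<And>p. p \<in> ball 0 \<rho> \<Longrightarrow> gip G (X p) (pd 2 X p) (pd 4 X p) = 1/2"
    "\<And>p. p \<in> ball 0 \<rho> \<Longrightarrow> sig (X p) (pd 1 X p) (pd 2 X p) = 1"
proof -
  note fr = gip_frame[OF q0] gip_frame'[OF q0]
  obtain r F where r: "r > 0" and F: "smooth_on (ball 0 r) F" "F ` ball 0 r \<subseteq> U" "F 0 = q0"
    and D3: "\<And>p. p \<in> ball 0 r \<Longrightarrow> inD (F p) (pd 3 F p)" and D4: "\<And>p. p \<in> ball 0 r \<Longrightarrow> inD (F p) (pd 4 F p)"
    and sg: "\<And>p. p \<in> ball 0 r \<Longrightarrow> sig (F p) (pd 1 F p) (pd 2 F p) = 1"
    and F0: "pd 1 F 0 = Y1 q0" "pd 2 F 0 = Y2 q0" "pd 3 F 0 = - X2 q0" "pd 4 F 0 = X1 q0"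
    using adapted_flow[OF q0] by blast
  define B where "B = ball (0::real^4) r"
  have B: "open B" "convex B" "0 \<in> B" and sc: "\<And>i. seg_closed (axis i 1) B"
    using r by (auto simp: B_def intro!: seg_closed_ball)
  note FB = F(1,2)[folded B_def] and D3 = D3[folded B_def] and D4 = D4[folded B_def] and sg = sg[folded B_def]
  have FU: "F p \<in> U" if "p \<in> B" for p using FB(2) that by blast
  define g where "g i j p = gip G (F p) (pd i F p) (pd j F p)" for i j p
  have sgij: "smooth_on B (g i j)" for i j
    unfolding g_def[abs_def] by (intro smooth_gip B(1) FB smooth_on_pd)
  have gs: "smooth_on B (\<lambda>p. 2 * g i j p)" for i j by (intro smooth_on_mult smooth_on_const B(1) sgij)
  have dg: "dd v (\<lambda>p. 2 * g i j p) p = 2 * (gip G (F p) (cov G F v (pd i F) p) (pd j F p) + gip G (F p) (pd i F p) (cov G F v (pd j F) p))"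
    if "p \<in> B" for v i j p
    using dd_mult[OF smooth_on_const sgij that, where v = v]
      dd_gip[OF B(1) FB smooth_on_pd[OF FB(1)] smooth_on_pd[OF FB(1)] that, where v = v]
    by (simp add: g_def[abs_def])
  \<comment> \<open>Integrability of these equations: covariant derivatives of \<open>pd i F\<close>
    along the plane equal derivatives of plane sections and are therefore orthogonal to the plane;
    the two other terms agree by torsion-freeness.\<close>
  have closed: "dd (axis 4 1) (\<lambda>p. 2 * g i 3 p) p = dd (axis 3 1) (\<lambda>p. 2 * g i 4 p) p" if p: "p \<in> B" for i p
  proof -
    have sw: "cov G F (axis k 1) (pd j F) p = cov G F (axis j 1) (pd k F) p" for j k
      unfolding pd_def by (rule cov_dd_commute[OF B(1) FB p])
    have "inD (F p) (cov G F (axis i 1) (pd 4 F) p)" "inD (F p) (cov G F (axis i 1) (pd 3 F) p)"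
      using cov_inD[OF B(1) FB smooth_on_pd[OF FB(1)] _ p] D3 D4 by blast+
    then have "gip G (F p) (cov G F (axis 4 1) (pd i F) p) (pd 3 F p) = 0" "gip G (F p) (cov G F (axis 3 1) (pd i F) p) (pd 4 F p) = 0"
      unfolding sw[of 4 i] sw[of 3 i] using D3[OF p] D4[OF p] FU[OF p] inD_null by blast+
    then show ?thesis unfolding dg[OF p] sw[of 3 4] by simp
  qed
  have ex: "\<exists>x. smooth_on B x \<and> (\<forall>p\<in>B. pd 3 x p = 2 * g i 3 p \<and> pd 4 x p = 2 * g i 4 p) \<and> x 0 = 0" for i
  proof -
    obtain x where "smooth_on B x" "\<And>p. p \<in> B \<Longrightarrow> dd (axis 3 1) x p = 2 * g i 3 p"
      "\<And>p. p \<in> B \<Longrightarrow> dd (axis 4 1) x p = 2 * g i 4 p" "x 0 = 0"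
    proof (rule poincare_plane[of B "axis 3 1" "axis 4 1" "\<lambda>p. 2 * g i 3 p" "\<lambda>p. 2 * g i 4 p"])
      show "axis 3 1 \<noteq> (axis 4 1 :: real^4)" by (simp add: axis_eq_axis)
    qed (use B sc gs closed in auto)
    then show ?thesis unfolding pd_def by blast
  qed
  obtain x where x: "smooth_on B x" "\<And>p. p \<in> B \<Longrightarrow> pd 3 x p = 2 * g 1 3 p" "\<And>p. p \<in> B \<Longrightarrow> pd 4 x p = 2 * g 1 4 p" "x 0 = 0"
    using ex[of 1] by blast
  obtain y where y: "smooth_on B y" "\<And>p. p \<in> B \<Longrightarrow> pd 3 y p = 2 * g 2 3 p" "\<And>p. p \<in> B \<Longrightarrow> pd 4 y p = 2 * g 2 4 p" "y 0 = 0"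
    using ex[of 2] by blast
  \<comment> \<open>The change from flow coordinates to the new ones. At the origin its derivative
    is invertible since there the four coordinate vectors form the null frame, up to sign and
    order.\<close>
  define psi :: "real^4 \<Rightarrow> real^4" where "psi p = (\<chi> i. if i = 1 then p $ 1 else if i = 2 then p $ 2 else if i = 3 then x p else y p)" for p
  have psi_nth: "psi p $ 1 = p $ 1" "psi p $ 2 = p $ 2" "psi p $ 3 = x p" "psi p $ 4 = y p" for p
    by (simp_all add: psi_def)
  have spsi: "smooth_on B psi"
  proof (rule smooth_on_vec[OF B(1)])
    fix i :: 4
    show "smooth_on B (\<lambda>q. psi q $ i)"
      using exhaust_4[of i] smooth_on_coord[OF B(1), of 1] smooth_on_coord[OF B(1), of 2] x(1) y(1)
      by (auto simp: psi_nth)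
  qed
  have coord: "dd v (\<lambda>p. p $ i) p = v $ i" for v p :: "real^4" and i
    using frechet_derivative_eqI[OF bounded_linear_imp_has_derivative[OF bounded_linear_vec_nth]] by metis
  have psi0: "psi 0 = 0" using psi_nth[of 0] x(4) y(4) by (simp add: vec_eq_iff forall_4)
  have injpsi: "inj (frechet_derivative psi (at 0))"
  proof (subst linear_injective_0[OF has_derivative_linear[OF smooth_on_has_derivative[OF spsi B(3)]]], intro allI impI)
    fix v assume v: "dd v psi 0 = 0"
    have c: "dd v (\<lambda>p. psi p $ i) 0 = 0" for i
      using dd_vec_nth[OF spsi B(3), where v = v and i = i] v by simp
    have v12: "v $ 1 = 0" "v $ 2 = 0" using c[of 1] c[of 2] by (simp_all add: psi_nth coord)
    have "dd v x 0 = 0" "dd v y 0 = 0" using c[of 3] c[of 4] by (simp_all add: psi_nth)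
    then show "v = 0"
      unfolding dd_eq_sum_pd[OF x(1) B(3)] dd_eq_sum_pd[OF y(1) B(3)] sum_4 x(2)[OF B(3)] x(3)[OF B(3)] y(2)[OF B(3)] y(3)[OF B(3)]
      using v12 by (simp add: g_def F(3) F0 fr gip_linear vec_eq_iff forall_4)
  qed
  obtain U2 V2 g2 where U2: "open U2" "0 \<in> U2" "U2 \<subseteq> B" and V2: "open V2" and hom: "homeomorphism U2 V2 psi g2" and g2: "smooth_on V2 g2"
    using smooth_inverse_function[OF B(1,3) spsi injpsi] .
  have z2: "0 \<in> V2" "g2 0 = 0"
    using hom U2(2) psi0 unfolding homeomorphism_def by (metis image_eqI)+
  have g2B: "g2 ` V2 \<subseteq> B" using hom U2(3) by (auto simp: homeomorphism_def)
  have pg: "psi (g2 p) = p" if "p \<in> V2" for p using hom that by (auto simp: homeomorphism_def)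
  define H where "H p = F (g2 p)" for p
  have H: "smooth_on V2 H" "H ` V2 \<subseteq> U"
    unfolding H_def using smooth_on_compose[OF V2 FB(1) g2 g2B] g2B FB(2) by auto
  have dg12: "dd v g2 p $ 1 = v $ 1" "dd v g2 p $ 2 = v $ 2" if p: "p \<in> V2" for v p
  proof -
    have "dd v (\<lambda>p. g2 p $ 1) p = dd v (\<lambda>p. p $ 1) p"
      by (rule dd_cong_open[OF V2 _ p]) (metis pg psi_nth(1))
    then show "dd v g2 p $ 1 = v $ 1" by (simp add: dd_vec_nth[OF g2 p] coord)
    have "dd v (\<lambda>p. g2 p $ 2) p = dd v (\<lambda>p. p $ 2) p"
      by (rule dd_cong_open[OF V2 _ p]) (metis pg psi_nth(2))
    then show "dd v g2 p $ 2 = v $ 2" by (simp add: dd_vec_nth[OF g2 p] coord)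
  qed
  have dx: "dd (dd v g2 p) x (g2 p) = v $ 3" "dd (dd v g2 p) y (g2 p) = v $ 4" if p: "p \<in> V2" for v p
  proof -
    have gp: "g2 p \<in> B" using g2B p by blast
    have "dd v (\<lambda>p. x (g2 p)) p = dd v (\<lambda>p. p $ 3) p"
      by (rule dd_cong_open[OF V2 _ p]) (metis pg psi_nth(3))
    then show "dd (dd v g2 p) x (g2 p) = v $ 3" by (simp add: dd_compose[OF x(1) g2 p gp] coord)
    have "dd v (\<lambda>p. y (g2 p)) p = dd v (\<lambda>p. p $ 4) p"
      by (rule dd_cong_open[OF V2 _ p]) (metis pg psi_nth(4))
    then show "dd (dd v g2 p) y (g2 p) = v $ 4" by (simp add: dd_compose[OF y(1) g2 p gp] coord)
  qed
  have dH: "dd v H p = v $ 1 *\<^sub>R pd 1 F (g2 p) + v $ 2 *\<^sub>R pd 2 F (g2 p) + dd v g2 p $ 3 *\<^sub>R pd 3 F (g2 p) + dd v g2 p $ 4 *\<^sub>R pd 4 F (g2 p)"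
    if p: "p \<in> V2" for v p
  proof -
    have gp: "g2 p \<in> B" using g2B p by blast
    show ?thesis
      unfolding H_def dd_compose[OF FB(1) g2 p gp] dd_eq_sum_pd[OF FB(1) gp] sum_4 dg12[OF p] ..
  qed
  have key: "inD (H p) (pd 3 H p) \<and> inD (H p) (pd 4 H p) \<and> gip G (H p) (pd 1 H p) (pd 3 H p) = 1/2 \<and>
      gip G (H p) (pd 1 H p) (pd 4 H p) = 0 \<and> gip G (H p) (pd 2 H p) (pd 3 H p) = 0 \<and>
      gip G (H p) (pd 2 H p) (pd 4 H p) = 1/2 \<and> sig (H p) (pd 1 H p) (pd 2 H p) = 1" if p: "p \<in> V2" for p
  proof -
    have gp: "g2 p \<in> B" using g2B p by blast
    let ?q = "F (g2 p)" and ?T = "\<lambda>i. pd i F (g2 p)"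
    have qU: "?q \<in> U" by (rule FU[OF gp])
    note d3 = D3[OF gp] and d4 = D4[OF gp]
    have T: "pd 1 H p = ?T 1 + (pd 1 g2 p $ 3 *\<^sub>R ?T 3 + pd 1 g2 p $ 4 *\<^sub>R ?T 4)"
      "pd 2 H p = ?T 2 + (pd 2 g2 p $ 3 *\<^sub>R ?T 3 + pd 2 g2 p $ 4 *\<^sub>R ?T 4)"
      "pd 3 H p = pd 3 g2 p $ 3 *\<^sub>R ?T 3 + pd 3 g2 p $ 4 *\<^sub>R ?T 4"
      "pd 4 H p = pd 4 g2 p $ 3 *\<^sub>R ?T 3 + pd 4 g2 p $ 4 *\<^sub>R ?T 4"
      unfolding pd_def dH[OF p] by (simp_all add: axis_nth)
    have n: "gip G ?q (?T 3) (?T 3) = 0" "gip G ?q (?T 3) (?T 4) = 0" "gip G ?q (?T 4) (?T 3) = 0" "gip G ?q (?T 4) (?T 4) = 0"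
      using inD_null[OF qU] d3 d4 by blast+
    \<comment> \<open>Differentiating \<open>x (g2 p) = p $ 3\<close> and
      \<open>y (g2 p) = p $ 4\<close>, where \<open>g2\<close> inverts \<open>psi\<close>. The
      left-hand sides are twice the pairings of the new coordinate vectors, whence the value
      1/2.\<close>
    have ex: "pd k g2 p $ 3 * (2 * g 1 3 (g2 p)) + pd k g2 p $ 4 * (2 * g 1 4 (g2 p)) = (if k = 3 then 1 else 0)"
      "pd k g2 p $ 3 * (2 * g 2 3 (g2 p)) + pd k g2 p $ 4 * (2 * g 2 4 (g2 p)) = (if k = 4 then 1 else 0)" if k: "k = 3 \<or> k = 4" for k
      using dx[OF p, of "axis k 1"] k
      unfolding dd_eq_sum_pd[OF x(1) gp] dd_eq_sum_pd[OF y(1) gp] sum_4 x(2)[OF gp] x(3)[OF gp] y(2)[OF gp] y(3)[OF gp]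
        dg12[OF p] pd_def[of _ g2]
      by (auto simp: axis_nth)
    have dd: "inD ?q (pd 3 H p)" "inD ?q (pd 4 H p)" unfolding T by (intro inD_add inD_scaleR d3 d4)+
    moreover have "gip G ?q (pd 1 H p) (pd 3 H p) = 1/2" "gip G ?q (pd 1 H p) (pd 4 H p) = 0"
      "gip G ?q (pd 2 H p) (pd 3 H p) = 0" "gip G ?q (pd 2 H p) (pd 4 H p) = 1/2"
      using ex[of 3] ex[of 4] unfolding T by (simp_all add: gip_linear n g_def algebra_simps)
    moreover have "sig ?q (pd 1 H p) (pd 2 H p) = 1"
    proof -
      have "sig ?q (pd 1 H p) (pd 2 H p) = sig ?q (?T 1) (?T 2)"
        unfolding T by (simp add: sig_linear sig_inD[OF d3] sig_inD(2)[OF d3] sig_inD[OF d4] sig_inD(2)[OF d4])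
      then show ?thesis using sg[OF gp] by simp
    qed
    ultimately show ?thesis unfolding H_def by blast
  qed
  have injH: "inj (frechet_derivative H (at 0))"
  proof (subst linear_injective_0[OF has_derivative_linear[OF smooth_on_has_derivative[OF H(1) z2(1)]]], intro allI impI)
    fix v assume v: "dd v H 0 = 0"
    have qU: "H 0 \<in> U" using H(2) z2(1) by blast
    note k = key[OF z2(1)]
    have n: "gip G (H 0) (pd 3 H 0) (pd 3 H 0) = 0" "gip G (H 0) (pd 3 H 0) (pd 4 H 0) = 0"
      "gip G (H 0) (pd 4 H 0) (pd 3 H 0) = 0" "gip G (H 0) (pd 4 H 0) (pd 4 H 0) = 0"
      using inD_null[OF qU] k by blast+
    have e: "v $ 1 *\<^sub>R pd 1 H 0 + v $ 2 *\<^sub>R pd 2 H 0 + v $ 3 *\<^sub>R pd 3 H 0 + v $ 4 *\<^sub>R pd 4 H 0 = 0"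
      using v unfolding dd_eq_sum_pd[OF H(1) z2(1)] sum_4 .
    have e3: "gip G (H 0) (v $ 1 *\<^sub>R pd 1 H 0 + v $ 2 *\<^sub>R pd 2 H 0 + v $ 3 *\<^sub>R pd 3 H 0 + v $ 4 *\<^sub>R pd 4 H 0) u = 0" for u
      unfolding e by (rule gip_0)
    have v12: "v $ 1 = 0" "v $ 2 = 0"
      using e3[of "pd 3 H 0"] e3[of "pd 4 H 0"] k n by (simp_all add: gip_linear)
    have sw: "gip G (H 0) (pd i H 0) (pd j H 0) = gip G (H 0) (pd j H 0) (pd i H 0)" for i j by (rule gip_commute[OF qU])
    have "v $ 3 = 0" "v $ 4 = 0"
      using e3[of "pd 1 H 0"] e3[of "pd 2 H 0"] k v12 sw[of 3 1] sw[of 4 1] sw[of 3 2] sw[of 4 2] by (simp_all add: gip_linear)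
    with v12 show "v = 0" by (simp add: vec_eq_iff forall_4)
  qed
  obtain U3 V3 P where U3: "open U3" "0 \<in> U3" "U3 \<subseteq> V2" and V3: "open V3" and homP: "homeomorphism U3 V3 H P" and P: "smooth_on V3 P"
    using smooth_inverse_function[OF V2 z2(1) H(1) injH] .
  \<comment> \<open>A ball is chosen because it is convex and \<open>seg_closed\<close> in every
    coordinate direction, as the later integrations require.\<close>
  obtain \<rho> where \<rho>: "\<rho> > 0" "ball 0 \<rho> \<subseteq> U3" using U3(1,2) open_contains_ball by blast
  have sub: "ball 0 \<rho> \<subseteq> V2" using \<rho>(2) U3(3) by blast
  have img: "H ` ball 0 \<rho> \<subseteq> V3" using homP \<rho>(2) by (auto simp: homeomorphism_def)
  have "H ` ball 0 \<rho> = V3 \<inter> P -` ball 0 \<rho>"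
    using homP \<rho>(2) unfolding homeomorphism_def by force
  moreover have "open (V3 \<inter> P -` ball 0 \<rho>)"
    by (rule continuous_open_preimage[OF _ V3 open_ball]) (use homP in \<open>simp add: homeomorphism_def\<close>)
  ultimately have op: "open (H ` ball 0 \<rho>)" by simp
  have hm: "homeomorphism (ball 0 \<rho>) (H ` ball 0 \<rho>) H P"
    by (rule homeomorphism_of_subsets[OF homP \<rho>(2) _ refl]) (use img in auto)
  show thesis
  proof (rule that[OF \<rho>(1) smooth_on_subset[OF H(1) sub] _ _ op hm smooth_on_subset[OF P img]])
    show "H ` ball 0 \<rho> \<subseteq> U" using H(2) sub by blast
    show "H 0 = q0" by (simp add: H_def z2 F(3))
  qed (use key sub in blast)+
qed

end


section \<open>Algebraic symmetries of the curvature\<close>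

lemma (in metric_patch) curv_antisym:
  assumes q: "q \<in> U"
  shows "gip G q (curv G q u v w) w' = - gip G q w (curv G q u v w')"
proof -
  have id: "smooth_on U (\<lambda>q. q)" "(\<lambda>q. q) ` U \<subseteq> U" by auto
  note W = open_U id
  let ?c = "\<lambda>v A. cov G (\<lambda>q. q) v A"
  have s: "smooth_on U (\<lambda>p. a)" for a :: "real^4" by simp
  note sc = smooth_cov[OF W s]
  have d: "dd v (\<lambda>p. gip G p w w') p = gip G p (?c v (\<lambda>p. w) p) w' + gip G p w (?c v (\<lambda>p. w') p)" if "p \<in> U" for v p
    using dd_gip[OF W s s that, where v = v] .
  \<comment> \<open>Second derivatives of \<open>g(w, w')\<close> for constant fields. Exchanging
    \<open>u\<close> and \<open>v\<close>, the mixed terms agree, and symmetry of second derivatives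
    leaves \<open>g(R w, w') + g(w, R w') = 0\<close>.\<close>
  have dd2: "dd u (dd v (\<lambda>p. gip G p w w')) q =
      gip G q (?c u (?c v (\<lambda>p. w)) q) w' + gip G q (?c v (\<lambda>p. w) q) (?c u (\<lambda>p. w') q) +
      (gip G q (?c u (\<lambda>p. w) q) (?c v (\<lambda>p. w') q) + gip G q w (?c u (?c v (\<lambda>p. w')) q))" for u v
  proof -
    have "dd u (dd v (\<lambda>p. gip G p w w')) q = dd u (\<lambda>p. gip G p (?c v (\<lambda>p. w) p) w' + gip G p w (?c v (\<lambda>p. w') p)) q"
      by (rule dd_cong_open[OF open_U d q])
    also have "\<dots> = dd u (\<lambda>p. gip G p (?c v (\<lambda>p. w) p) w') q + dd u (\<lambda>p. gip G p w (?c v (\<lambda>p. w') p)) q"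
      by (intro dd_add[of U] smooth_gip W sc s q)
    finally show ?thesis
      by (simp add: dd_gip[OF W sc s q] dd_gip[OF W s sc q])
  qed
  have sg: "smooth_on U (\<lambda>p. gip G p w w')" by (intro smooth_gip W s)
  have c: "?c u (?c v (\<lambda>p. a)) q = ?c v (?c u (\<lambda>p. a)) q + curv G q u v a" for a
    using curvature[OF W s q, of u v a] by (simp add: algebra_simps)
  show ?thesis
    using smooth_on_dd_commute[OF open_U sg q, of u v] unfolding dd2[of u v] dd2[of v u] c[of w] c[of w'] gip_add by simp
qed

lemma curv_swap: "curv G q v u w = - curv G q u v w"
proof -
  have r: "riemann G l k i j q = - riemann G l k j i q" for l k i j
    unfolding riemann_def by (simp add: sum_subtractf)
  have "curv G q v u w $ l = - (curv G q u v w $ l)" for l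
  proof -
    have "curv G q v u w $ l = (\<Sum>k\<in>UNIV. \<Sum>i\<in>UNIV. \<Sum>j\<in>UNIV. riemann G l k j i q * v $ j * u $ i * w $ k)"
      unfolding curv_def vec_lambda_beta by (intro sum.cong refl sum.swap)
    also have "\<dots> = (\<Sum>k\<in>UNIV. \<Sum>i\<in>UNIV. \<Sum>j\<in>UNIV. - (riemann G l k i j q * u $ i * v $ j * w $ k))"
      by (intro sum.cong refl, subst r) simp
    finally show ?thesis by (simp add: curv_def sum_negf)
  qed
  then show ?thesis by (simp add: vec_eq_iff)
qed

lemma curv_add: "curv G q (u + u') v w = curv G q u v w + curv G q u' v w"
  "curv G q u (v + v') w = curv G q u v w + curv G q u v' w"
  "curv G q u v (w + w') = curv G q u v w + curv G q u v w'"
  by (simp_all add: curv_def vec_eq_iff sum.distrib distrib_left distrib_right)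

lemma curv_scaleR: "curv G q (c *\<^sub>R u) v w = c *\<^sub>R curv G q u v w"
  "curv G q u (c *\<^sub>R v) w = c *\<^sub>R curv G q u v w" "curv G q u v (c *\<^sub>R w) = c *\<^sub>R curv G q u v w"
  by (simp_all add: curv_def vec_eq_iff sum_distrib_left ac_simps)

text \<open>The numerator of the sectional curvature depends on the basis of a plane only through
  the square of the determinant, by the two antisymmetries. Its vanishing is thus a property of the
  plane.\<close>

lemma (in metric_patch) sectional_span:
  assumes q: "q \<in> U"
  shows "gip G q (a *\<^sub>R m + b *\<^sub>R n) (curv G q (a *\<^sub>R m + b *\<^sub>R n) (c *\<^sub>R m + d *\<^sub>R n) (c *\<^sub>R m + d *\<^sub>R n)) =
    (a * d - b * c)\<^sup>2 * gip G q m (curv G q m n n)"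
proof -
  have 0: "curv G q m m w = 0" "curv G q n n w = 0" for w
    using curv_swap[of G q m m w] curv_swap[of G q n n w] by (simp_all add: vec_eq_iff)
  have 1: "curv G q (a *\<^sub>R m + b *\<^sub>R n) (c *\<^sub>R m + d *\<^sub>R n) w = (a * d - b * c) *\<^sub>R curv G q m n w" for w
    by (simp add: curv_add curv_scaleR 0 curv_swap[of G q n m] algebra_simps)
  have 2: "gip G q m (curv G q m n m) = 0" "gip G q n (curv G q m n n) = 0"
    "gip G q n (curv G q m n m) = - gip G q m (curv G q m n n)"
    using curv_antisym[OF q, of m n m m] curv_antisym[OF q, of m n n n] curv_antisym[OF q, of m n m n]
    by (simp_all add: gip_commute[OF q, of "curv G q _ _ _"])
  show ?thesis
    unfolding 1 by (simp add: curv_add curv_scaleR gip_linear 2 power2_eq_square algebra_simps)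
qed

section \<open>Coordinates adapted to the null planes and the potential\<close>

lemma cov_eq_sum_axis:
  assumes "smooth_on V A" "smooth_on V X" "p \<in> V"
  shows "cov G X v A p = (\<Sum>k\<in>UNIV. v $ k *\<^sub>R cov G X (axis k 1) A p)"
  unfolding cov_def scaleR_add_right sum.distrib dd_eq_sum_pd[OF assms(1,3)] dd_eq_sum_pd[OF assms(2,3)] pd_def[symmetric]
  by (simp add: sum_4 chr_add chr_scaleR)

text \<open>\<open>X\<close> goes from coordinates to the patch, so \<open>pd i X\<close> is the
  \<open>i\<close>-th coordinate vector field along it. The assumptions are the output of
  \<open>walker_coordinates\<close>.\<close>

locale walker_chart = null_frame +
  fixes V :: "(real^4) set" and X :: "real^4 \<Rightarrow> real^4"
  assumes V: "open V" "smooth_on V X" "X ` V \<subseteq> U"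
    and inD34: "p \<in> V \<Longrightarrow> inD (X p) (pd 3 X p)" "p \<in> V \<Longrightarrow> inD (X p) (pd 4 X p)"
    and gram: "p \<in> V \<Longrightarrow> gip G (X p) (pd 1 X p) (pd 3 X p) = 1/2"
      "p \<in> V \<Longrightarrow> gip G (X p) (pd 1 X p) (pd 4 X p) = 0"
      "p \<in> V \<Longrightarrow> gip G (X p) (pd 2 X p) (pd 3 X p) = 0"
      "p \<in> V \<Longrightarrow> gip G (X p) (pd 2 X p) (pd 4 X p) = 1/2"
    and sig12: "p \<in> V \<Longrightarrow> sig (X p) (pd 1 X p) (pd 2 X p) = 1"
begin

definition ip :: "4 \<Rightarrow> 4 \<Rightarrow> real^4 \<Rightarrow> real" where "ip i j p = gip G (X p) (pd i X p) (pd j X p)"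

lemma XU: "p \<in> V \<Longrightarrow> X p \<in> U" using V(3) by blast

lemma sT: "smooth_on V (pd i X)" by (rule smooth_on_pd[OF V(2)])

lemma smooth_ip: "smooth_on V (ip i j)"
  unfolding ip_def[abs_def] by (intro smooth_gip V sT)

lemma ip_commute: "p \<in> V \<Longrightarrow> ip i j p = ip j i p"
  unfolding ip_def by (rule gip_commute[OF XU])

lemma ip_values:
  assumes "p \<in> V"
  shows "ip 1 3 p = 1/2" "ip 1 4 p = 0" "ip 2 3 p = 0" "ip 2 4 p = 1/2"
    "ip 3 1 p = 1/2" "ip 4 1 p = 0" "ip 3 2 p = 0" "ip 4 2 p = 1/2"
    "ip 3 3 p = 0" "ip 3 4 p = 0" "ip 4 3 p = 0" "ip 4 4 p = 0"
  using gram[OF assms] ip_commute[OF assms, of 3 1] ip_commute[OF assms, of 4 1] ip_commute[OF assms, of 3 2]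
    ip_commute[OF assms, of 4 2] inD_null[OF XU[OF assms]] inD34[OF assms]
  unfolding ip_def by simp_all

lemma pd_zero: "(\<And>p. p \<in> V \<Longrightarrow> f p = c) \<Longrightarrow> p \<in> V \<Longrightarrow> pd k f p = 0"
  unfolding pd_def using dd_cong_open[OF V(1), of f "\<lambda>p. c" p "axis k 1"] by simp

lemma pd_ip_const:
  assumes "p \<in> V"
  shows "pd k (ip 1 3) p = 0" "pd k (ip 1 4) p = 0" "pd k (ip 2 3) p = 0" "pd k (ip 2 4) p = 0"
    "pd k (ip 3 1) p = 0" "pd k (ip 4 1) p = 0" "pd k (ip 3 2) p = 0" "pd k (ip 4 2) p = 0"
    "pd k (ip 3 3) p = 0" "pd k (ip 3 4) p = 0" "pd k (ip 4 3) p = 0" "pd k (ip 4 4) p = 0"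
  by (rule pd_zero[OF ip_values(1) assms] pd_zero[OF ip_values(2) assms] pd_zero[OF ip_values(3) assms]
      pd_zero[OF ip_values(4) assms] pd_zero[OF ip_values(5) assms] pd_zero[OF ip_values(6) assms]
      pd_zero[OF ip_values(7) assms] pd_zero[OF ip_values(8) assms] pd_zero[OF ip_values(9) assms]
      pd_zero[OF ip_values(10) assms] pd_zero[OF ip_values(11) assms] pd_zero[OF ip_values(12) assms]; assumption)+

definition cT :: "4 \<Rightarrow> 4 \<Rightarrow> real^4 \<Rightarrow> real^4" where "cT k i = cov G X (axis k 1) (pd i X)"

lemma cT_commute: "p \<in> V \<Longrightarrow> cT k i p = cT i k p"
  unfolding cT_def pd_def by (rule cov_dd_commute[OF V])

text \<open>The Christoffel symbols of the first kind in the new coordinates. They are derived along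
  \<open>X\<close> from compatibility and torsion-freeness, not by transforming those of
  \<open>G\<close>.\<close>

lemma koszul:
  assumes p: "p \<in> V"
  shows "gip G (X p) (cT k i p) (pd j X p) = (pd k (ip i j) p + pd i (ip k j) p - pd j (ip k i) p) / 2"
proof -
  have d: "pd k (ip i j) p = gip G (X p) (cT k i p) (pd j X p) + gip G (X p) (cT k j p) (pd i X p)" for k i j
  proof -
    have "pd k (ip i j) p = dd (axis k 1) (\<lambda>p. gip G (X p) (pd i X p) (pd j X p)) p"
      by (simp add: pd_def[of k] ip_def[abs_def])
    also have "\<dots> = gip G (X p) (cT k i p) (pd j X p) + gip G (X p) (pd i X p) (cT k j p)"
      unfolding cT_def by (rule dd_gip[OF V sT sT p])
    finally show ?thesis using gip_commute[OF XU[OF p], of "pd i X p"] by simp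
  qed
  have c: "cT i k p = cT k i p" "cT j k p = cT k j p" "cT j i p = cT i j p"
    by (rule cT_commute[OF p])+
  show ?thesis unfolding d c by (simp add: field_simps)
qed

text \<open>Modulo the null plane a vector is determined by its pairings with a basis of that plane;
  the factor 2 inverts the value 1/2 in \<open>gram\<close>.\<close>

lemma T_expansion:
  assumes p: "p \<in> V"
  obtains d where "v = (2 * gip G (X p) v (pd 3 X p)) *\<^sub>R pd 1 X p + (2 * gip G (X p) v (pd 4 X p)) *\<^sub>R pd 2 X p + d" "inD (X p) d"
proof -
  let ?q = "X p"
  have q: "?q \<in> U" by (rule XU[OF p])
  note iv = ip_values[OF p, unfolded ip_def]
  obtain a b where ab: "pd 3 X p = a *\<^sub>R X1 ?q + b *\<^sub>R X2 ?q" using inD_span[OF q inD34(1)[OF p]] .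
  obtain c d where cd: "pd 4 X p = c *\<^sub>R X1 ?q + d *\<^sub>R X2 ?q" using inD_span[OF q inD34(2)[OF p]] .
  \<comment> \<open>The determinant comparing \<open>pd 3 X\<close>, \<open>pd 4 X\<close> with
    \<open>X1\<close>, \<open>X2\<close>. If it vanished, the two coordinate vectors would be
    dependent, contrary to their different pairings with \<open>pd 1 X\<close> and
    \<open>pd 2 X\<close>.\<close>
  define D where "D = a * d - b * c"
  have e1: "d *\<^sub>R pd 3 X p - b *\<^sub>R pd 4 X p = D *\<^sub>R X1 ?q" and e2: "a *\<^sub>R pd 4 X p - c *\<^sub>R pd 3 X p = D *\<^sub>R X2 ?q"
    unfolding ab cd D_def by (simp_all add: algebra_simps)
  have D0: "D \<noteq> 0"
  proof
    assume "D = 0"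
    then have z: "d *\<^sub>R pd 3 X p - b *\<^sub>R pd 4 X p = 0" "a *\<^sub>R pd 4 X p - c *\<^sub>R pd 3 X p = 0" using e1 e2 by simp_all
    have "gip G ?q (pd 2 X p) (d *\<^sub>R pd 3 X p - b *\<^sub>R pd 4 X p) = 0" "gip G ?q (pd 2 X p) (a *\<^sub>R pd 4 X p - c *\<^sub>R pd 3 X p) = 0"
      unfolding z by (simp_all add: gip_0)
    then have "b = 0" "a = 0" by (simp_all add: gip_linear iv)
    then show False using iv(1) ab by (simp add: gip_0)
  qed
  define w where "w = v - (2 * gip G ?q v (pd 3 X p)) *\<^sub>R pd 1 X p - (2 * gip G ?q v (pd 4 X p)) *\<^sub>R pd 2 X p"
  have w: "gip G ?q (pd 3 X p) w = 0" "gip G ?q (pd 4 X p) w = 0"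
    unfolding w_def using gip_commute[OF q, of v] by (simp_all add: gip_linear iv)
  have "D * th1 ?q w = gip G ?q (D *\<^sub>R X1 ?q) w" "D * th2 ?q w = gip G ?q (D *\<^sub>R X2 ?q) w"
    by (simp_all add: th1_def th2_def gip_linear)
  then have "D * th1 ?q w = 0" "D * th2 ?q w = 0"
    unfolding e1[symmetric] e2[symmetric] by (simp_all add: gip_linear w)
  then have "inD ?q w" using D0 by (simp add: inD_def)
  then show thesis by (rule that[rotated]) (simp add: w_def)
qed

lemma sig_T: "p \<in> V \<Longrightarrow> sig (X p) v (pd 2 X p) = 2 * gip G (X p) v (pd 3 X p)"
  "p \<in> V \<Longrightarrow> sig (X p) (pd 1 X p) v = 2 * gip G (X p) v (pd 4 X p)"
proof -
  assume p: "p \<in> V"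
  obtain d where d: "v = (2 * gip G (X p) v (pd 3 X p)) *\<^sub>R pd 1 X p + (2 * gip G (X p) v (pd 4 X p)) *\<^sub>R pd 2 X p + d" "inD (X p) d"
    using T_expansion[OF p] .
  show "sig (X p) v (pd 2 X p) = 2 * gip G (X p) v (pd 3 X p)"
    by (subst d(1)) (simp add: sig_linear sig_inD[OF d(2)] sig12[OF p])
  show "sig (X p) (pd 1 X p) v = 2 * gip G (X p) v (pd 4 X p)"
    by (subst d(1)) (simp add: sig_linear sig_inD(2)[OF d(2)] sig12[OF p])
qed

text \<open>The induced connection on the unprimed spin bundle is trace-free.\<close>

lemma trace_free:
  assumes p: "p \<in> V"
  shows "gip G (X p) (cov G X v (pd 1 X) p) (pd 3 X p) + gip G (X p) (cov G X v (pd 2 X) p) (pd 4 X p) = 0"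
proof -
  have "dd v (\<lambda>p. sig (X p) (pd 1 X p) (pd 2 X p)) p = dd v (\<lambda>p. 1) p"
    by (rule dd_cong_open[OF V(1) sig12 p])
  then show ?thesis using dd_sig[OF V sT sT p] by (simp add: sig_T[OF p])
qed

text \<open>Trace-freeness in the directions \<open>w\<close> and \<open>z\<close>; by
  \<open>koszul\<close> every other contribution is a derivative of a constant pairing.\<close>

lemma pd_ip_eqs:
  assumes p: "p \<in> V"
  shows "pd 3 (ip 1 1) p + pd 4 (ip 1 2) p = 0" "pd 3 (ip 1 2) p + pd 4 (ip 2 2) p = 0"
proof -
  have sy: "pd k (ip i j) p = pd k (ip j i) p" for k i j unfolding pd_def by (rule dd_cong_open[OF V(1) ip_commute p])
  have t: "gip G (X p) (cT k 1 p) (pd 3 X p) + gip G (X p) (cT k 2 p) (pd 4 X p) = 0" for k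
    unfolding cT_def by (rule trace_free[OF p])
  show "pd 3 (ip 1 1) p + pd 4 (ip 1 2) p = 0"
    using t[of 1] unfolding koszul[OF p] by (simp add: pd_ip_const[OF p] algebra_simps add_divide_distrib[symmetric])
  show "pd 3 (ip 1 2) p + pd 4 (ip 2 2) p = 0"
    using t[of 2] unfolding koszul[OF p] by (simp add: pd_ip_const[OF p] sy[of _ 2 1] algebra_simps add_divide_distrib[symmetric])
qed


text \<open>Here \<alpha> and \<beta> are going to be the derivatives of \<Theta> along
  \<open>x\<close> and \<open>y\<close>. Their existence uses the two equations of
  \<open>pd_ip_eqs\<close>; both have the mixed derivative \<open>ip 1 2\<close>, which is the
  closedness condition for \<Theta> itself.\<close>

lemma potential:
  assumes VK: "convex V" "\<And>i. seg_closed (axis i 1) V"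
  obtains \<Theta> where "smooth_on V \<Theta>" "\<And>p. p \<in> V \<Longrightarrow> pd2 3 3 \<Theta> p = - ip 2 2 p"
    "\<And>p. p \<in> V \<Longrightarrow> pd2 4 4 \<Theta> p = - ip 1 1 p" "\<And>p. p \<in> V \<Longrightarrow> pd2 3 4 \<Theta> p = ip 1 2 p"
proof -
  have ne: "axis 3 1 \<noteq> (axis 4 1 :: real^4)" by (simp add: axis_eq_axis)
  note K = V(1) VK(1) VK(2)[of 3] VK(2)[of 4] axis_Basis axis_Basis ne
  have m: "smooth_on V (\<lambda>p. - ip i j p)" for i j by (rule smooth_on_minus[OF V(1) smooth_ip])
  have dm: "dd v (\<lambda>p. - ip i j p) p = - dd v (ip i j) p" if "p \<in> V" for v i j p
    using frechet_derivative_eqI[OF has_derivative_minus[OF smooth_on_has_derivative[OF smooth_ip that]]] by simp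
  have e: "dd (axis 3 1) (ip 1 1) p = - dd (axis 4 1) (ip 1 2) p" "dd (axis 4 1) (ip 2 2) p = - dd (axis 3 1) (ip 1 2) p" if "p \<in> V" for p
    using pd_ip_eqs[OF that] by (simp_all add: pd_def)
  obtain \<alpha> where \<alpha>: "smooth_on V \<alpha>" "\<And>p. p \<in> V \<Longrightarrow> dd (axis 3 1) \<alpha> p = - ip 2 2 p" "\<And>p. p \<in> V \<Longrightarrow> dd (axis 4 1) \<alpha> p = ip 1 2 p"
  proof (rule poincare_plane[OF K m smooth_ip])
    show "dd (axis 4 1) (\<lambda>p. - ip 2 2 p) p = dd (axis 3 1) (ip 1 2) p" if "p \<in> V" for p
      using e(2)[OF that] by (simp add: dm[OF that])
  qed (rule that; assumption)
  obtain \<beta> where \<beta>: "smooth_on V \<beta>" "\<And>p. p \<in> V \<Longrightarrow> dd (axis 3 1) \<beta> p = ip 1 2 p" "\<And>p. p \<in> V \<Longrightarrow> dd (axis 4 1) \<beta> p = - ip 1 1 p"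
  proof (rule poincare_plane[OF K smooth_ip m])
    show "dd (axis 4 1) (ip 1 2) p = dd (axis 3 1) (\<lambda>p. - ip 1 1 p) p" if "p \<in> V" for p
      using e(1)[OF that] by (simp add: dm[OF that])
  qed (rule that; assumption)
  obtain \<Theta> where \<Theta>: "smooth_on V \<Theta>" "\<And>p. p \<in> V \<Longrightarrow> dd (axis 3 1) \<Theta> p = \<alpha> p" "\<And>p. p \<in> V \<Longrightarrow> dd (axis 4 1) \<Theta> p = \<beta> p"
  proof (rule poincare_plane[OF K \<alpha>(1) \<beta>(1)])
    show "dd (axis 4 1) \<alpha> p = dd (axis 3 1) \<beta> p" if "p \<in> V" for p
      using \<alpha>(3) \<beta>(2) that by simp
  qed (rule that; assumption)
  have 3: "pd i (pd 3 \<Theta>) p = dd (axis i 1) \<alpha> p" and 4: "pd i (pd 4 \<Theta>) p = dd (axis i 1) \<beta> p" if "p \<in> V" for i p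
    unfolding pd_def[of i] by (rule dd_cong_open[OF V(1) _ that]; simp add: pd_def \<Theta>)+
  show thesis
    by (rule that[of \<Theta>]) (use \<Theta>(1) \<alpha> \<beta> 3 4 in auto)
qed

end

section \<open>The curvature of the metric with potential \<Theta>\<close>

locale potential_chart = walker_chart +
  fixes \<Theta> :: "real^4 \<Rightarrow> real"
  assumes smooth_\<Theta>: "smooth_on V \<Theta>"
    and ip_\<Theta>: "p \<in> V \<Longrightarrow> ip 2 2 p = - pd2 3 3 \<Theta> p" "p \<in> V \<Longrightarrow> ip 1 1 p = - pd2 4 4 \<Theta> p"
      "p \<in> V \<Longrightarrow> ip 1 2 p = pd2 3 4 \<Theta> p"
begin

abbreviation "t33 \<equiv> pd2 3 3 \<Theta>"
abbreviation "t44 \<equiv> pd2 4 4 \<Theta>"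
abbreviation "t34 \<equiv> pd2 3 4 \<Theta>"

definition F :: "real^4 \<Rightarrow> real" where
  "F q = pd2 1 3 \<Theta> q + pd2 2 4 \<Theta> q + t33 q * t44 q - (t34 q)\<^sup>2"

lemma smooth_t: "smooth_on V (pd2 i j \<Theta>)"
  by (intro smooth_on_pd smooth_\<Theta>)

lemma smooth_F: "smooth_on V F"
  unfolding F_def[abs_def] by (intro smooth_on_add smooth_on_diff smooth_on_mult smooth_on_power smooth_t V(1))

lemma pd3_swap:
  assumes p: "p \<in> V"
  shows "pd k (pd2 i j \<Theta>) p = pd j (pd2 i k \<Theta>) p" "pd k (pd2 i j \<Theta>) p = pd i (pd2 j k \<Theta>) p"
proof -
  have s: "pd i (pd j \<Theta>) q = pd j (pd i \<Theta>) q" if "q \<in> V" for i j q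
    by (rule pd_commute[OF V(1) smooth_\<Theta> that])
  have 1: "pd k (pd j (pd i \<Theta>)) p = pd j (pd k (pd i \<Theta>)) p" for i j k
    by (rule pd_commute[OF V(1) smooth_on_pd[OF smooth_\<Theta>] p])
  have 2: "pd k (pd j (pd i \<Theta>)) p = pd k (pd i (pd j \<Theta>)) p" for i j k
    unfolding pd_def[of k] by (rule dd_cong_open[OF V(1) s p])
  show "pd k (pd2 i j \<Theta>) p = pd j (pd2 i k \<Theta>) p" by (rule 1)
  show "pd k (pd2 i j \<Theta>) p = pd i (pd2 j k \<Theta>) p" using 2[of k j i] 1[of k i j] by simp
qed

lemma pd_F:
  assumes p: "p \<in> V"
  shows "pd k F p = pd k (pd2 1 3 \<Theta>) p + pd k (pd2 2 4 \<Theta>) p + pd k t33 p * t44 p + t33 p * pd k t44 p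
    - 2 * t34 p * pd k t34 p"
proof -
  have "F = (\<lambda>q. pd2 1 3 \<Theta> q + pd2 2 4 \<Theta> q + t33 q * t44 q - t34 q * t34 q)"
    by (simp add: F_def power2_eq_square fun_eq_iff)
  moreover have "dd v (\<lambda>q. pd2 1 3 \<Theta> q + pd2 2 4 \<Theta> q + t33 q * t44 q - t34 q * t34 q) p =
    dd v (pd2 1 3 \<Theta>) p + dd v (pd2 2 4 \<Theta>) p + dd v t33 p * t44 p + t33 p * dd v t44 p - 2 * t34 p * dd v t34 p" for v
    by (simp add: dd_diff[where S = V] dd_add[where S = V] dd_mult[where S = V] smooth_t smooth_on_add smooth_on_mult V(1) p)
  ultimately show ?thesis by (simp only: pd_def[of k])
qed

text \<open>The terms along the null plane cancel the metric coefficients \<open>ip 1 1\<close>,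
  \<open>ip 1 2\<close>, \<open>ip 2 2\<close>, so that \<open>l0\<close>, \<open>l1\<close> become
  null and orthogonal without changing \<open>sig\<close> or the pairings with the plane.\<close>

definition l0 :: "real^4 \<Rightarrow> real^4" where
  "l0 p = pd 1 X p + (t44 p *\<^sub>R pd 3 X p + (- t34 p) *\<^sub>R pd 4 X p)"
definition l1 :: "real^4 \<Rightarrow> real^4" where
  "l1 p = pd 2 X p + ((- t34 p) *\<^sub>R pd 3 X p + t33 p *\<^sub>R pd 4 X p)"

lemma smooth_l: "smooth_on V l0" "smooth_on V l1"
  unfolding l0_def[abs_def] l1_def[abs_def]
  by (intro smooth_on_add smooth_on_scaleR smooth_on_minus smooth_t sT V(1))+

lemma gip_l:
  assumes p: "p \<in> V"
  shows "gip G (X p) (l0 p) (l0 p) = 0" "gip G (X p) (l1 p) (l1 p) = 0" "gip G (X p) (l0 p) (l1 p) = 0"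
    "gip G (X p) (l0 p) (pd 3 X p) = 1/2" "gip G (X p) (l0 p) (pd 4 X p) = 0"
    "gip G (X p) (l1 p) (pd 3 X p) = 0" "gip G (X p) (l1 p) (pd 4 X p) = 1/2"
proof -
  have "ip 2 1 p = t34 p" using ip_commute[OF p, of 2 1] ip_\<Theta>(3)[OF p] by simp
  note iv = ip_values[OF p, unfolded ip_def] ip_\<Theta>[OF p, unfolded ip_def] this[unfolded ip_def]
  show "gip G (X p) (l0 p) (l0 p) = 0" "gip G (X p) (l1 p) (l1 p) = 0" "gip G (X p) (l0 p) (l1 p) = 0"
    "gip G (X p) (l0 p) (pd 3 X p) = 1/2" "gip G (X p) (l0 p) (pd 4 X p) = 0"
    "gip G (X p) (l1 p) (pd 3 X p) = 0" "gip G (X p) (l1 p) (pd 4 X p) = 1/2"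
    unfolding l0_def l1_def by (simp_all add: gip_linear iv)
qed

lemma pd_ip_\<Theta>:
  assumes p: "p \<in> V"
  shows "pd k (ip 1 1) p = - pd k t44 p" "pd k (ip 2 2) p = - pd k t33 p"
    "pd k (ip 1 2) p = pd k t34 p" "pd k (ip 2 1) p = pd k t34 p"
proof -
  have m: "pd k (\<lambda>q. - pd2 i j \<Theta> q) p = - pd k (pd2 i j \<Theta>) p" for i j
    unfolding pd_def[of k] using frechet_derivative_eqI[OF has_derivative_minus[OF smooth_on_has_derivative[OF smooth_t p]]] by metis
  have c: "pd k f p = pd k g p" if "\<And>q. q \<in> V \<Longrightarrow> f q = g q" for f g :: "real^4 \<Rightarrow> real"
    unfolding pd_def[of k] by (rule dd_cong_open[OF V(1) that p])
  show "pd k (ip 1 1) p = - pd k t44 p" unfolding m[symmetric] by (rule c[OF ip_\<Theta>(2)])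
  show "pd k (ip 2 2) p = - pd k t33 p" unfolding m[symmetric] by (rule c[OF ip_\<Theta>(1)])
  show "pd k (ip 1 2) p = pd k t34 p" by (rule c[OF ip_\<Theta>(3)])
  show "pd k (ip 2 1) p = pd k t34 p" by (rule c) (simp add: ip_commute[of _ 2 1] ip_\<Theta>(3))
qed

text \<open>The primed connection form, \<gamma> of the null plane spanned by \<open>l0\<close>,
  \<open>l1\<close>: it vanishes along the planes of \<iota>, and its two other components are
  derivatives of \<open>F\<close>. This is where the left-hand side of the first equation enters the
  geometry.\<close>

lemma gamma:
  assumes p: "p \<in> V"
  shows "gip G (X p) (cov G X (axis 1 1) l1 p) (l0 p) = - pd 4 F p / 2"
    "gip G (X p) (cov G X (axis 2 1) l1 p) (l0 p) = pd 3 F p / 2"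
    "gip G (X p) (cov G X (axis 3 1) l1 p) (l0 p) = 0"
    "gip G (X p) (cov G X (axis 4 1) l1 p) (l0 p) = 0"
proof -
  have c: "cov G X (axis k 1) l1 p = cT k 2 p + ((- pd k t34 p) *\<^sub>R pd 3 X p + (- t34 p) *\<^sub>R cT k 3 p
      + (pd k t33 p *\<^sub>R pd 4 X p + t33 p *\<^sub>R cT k 4 p))" for k
  proof -
    have m: "dd v (\<lambda>q. - t34 q) p = - dd v t34 p" for v
      using frechet_derivative_eqI[OF has_derivative_minus[OF smooth_on_has_derivative[OF smooth_t p]]] by metis
    note ms = smooth_on_minus[OF V(1) smooth_t]
    show ?thesis
      unfolding l1_def[abs_def] cT_def pd_def[of k]
      by (simp only: cov_add[where V = V] cov_scaleR[where V = V] smooth_on_add smooth_on_scaleR smooth_t ms sT V(1) p m)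
  qed
  have n: "gip G (X p) (cT k 3 p) (pd 3 X p) = 0" "gip G (X p) (cT k 3 p) (pd 4 X p) = 0"
    "gip G (X p) (cT k 4 p) (pd 3 X p) = 0" "gip G (X p) (cT k 4 p) (pd 4 X p) = 0" for k
  proof -
    have "inD (X p) (cT k 3 p)" "inD (X p) (cT k 4 p)"
      unfolding cT_def using cov_inD[OF V sT _ p] inD34 by blast+
    then show "gip G (X p) (cT k 3 p) (pd 3 X p) = 0" "gip G (X p) (cT k 3 p) (pd 4 X p) = 0"
      "gip G (X p) (cT k 4 p) (pd 3 X p) = 0" "gip G (X p) (cT k 4 p) (pd 4 X p) = 0"
      using inD_null[OF XU[OF p]] inD34[OF p] by blast+
  qed
  note iv = ip_values[OF p, unfolded ip_def]
  have g: "gip G (X p) (cov G X (axis k 1) l1 p) (l0 p) =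
      gip G (X p) (cT k 2 p) (pd 1 X p) + t44 p * gip G (X p) (cT k 2 p) (pd 3 X p) - t34 p * gip G (X p) (cT k 2 p) (pd 4 X p)
      - pd k t34 p / 2 - t34 p * gip G (X p) (cT k 3 p) (pd 1 X p) + t33 p * gip G (X p) (cT k 4 p) (pd 1 X p)" for k
    unfolding c l0_def by (simp add: gip_linear n iv)
  note K = koszul[OF p] pd_ip_const[OF p] pd_ip_\<Theta>[OF p]
  \<comment> \<open>Third derivatives of \<Theta> brought to the forms that occur in
    \<open>pd_F\<close>.\<close>
  have s: "pd 1 t34 p = pd 4 (pd2 1 3 \<Theta>) p" "pd 2 t44 p = pd 4 (pd2 2 4 \<Theta>) p" "pd 3 t34 p = pd 4 t33 p" "pd 3 t44 p = pd 4 t34 p"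
    "pd 1 t33 p = pd 3 (pd2 1 3 \<Theta>) p" "pd 2 t34 p = pd 3 (pd2 2 4 \<Theta>) p"
  proof -
    note a = pd3_swap(1)[OF p] and b = pd3_swap(2)[OF p]
    show "pd 3 t34 p = pd 4 t33 p" by (rule a)
    show "pd 3 t44 p = pd 4 t34 p" using b[of 3 4 4] a[of 4 4 3] b[of 4 3 4] by simp
    show "pd 1 t34 p = pd 4 (pd2 1 3 \<Theta>) p" using a[of 1 3 4] b[of 4 3 1] a[of 4 1 3] b[of 4 1 3] by simp
    show "pd 2 t44 p = pd 4 (pd2 2 4 \<Theta>) p" using a[of 2 4 4] b[of 4 4 2] by simp
    show "pd 1 t33 p = pd 3 (pd2 1 3 \<Theta>) p" using a[of 1 3 3] b[of 3 3 1] by simp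
    show "pd 2 t34 p = pd 3 (pd2 2 4 \<Theta>) p" using a[where k = 2 and i = 3 and j = 4] b[where k = 4 and i = 3 and j = 2] by simp
  qed
  show "gip G (X p) (cov G X (axis 1 1) l1 p) (l0 p) = - pd 4 F p / 2"
    unfolding g K pd_F[OF p] s by (simp add: K s field_simps)
  show "gip G (X p) (cov G X (axis 2 1) l1 p) (l0 p) = pd 3 F p / 2"
    unfolding g K pd_F[OF p] s by (simp add: K s field_simps)
  show "gip G (X p) (cov G X (axis 3 1) l1 p) (l0 p) = 0"
    unfolding g K by (simp add: K s field_simps)
  show "gip G (X p) (cov G X (axis 4 1) l1 p) (l0 p) = 0"
    unfolding g K by (simp add: K s field_simps)
qed

lemma gamma_dir:
  assumes p: "p \<in> V"
  shows "gip G (X p) (cov G X v l1 p) (l0 p) = (v $ 2 * pd 3 F p - v $ 1 * pd 4 F p) / 2"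
  by (subst cov_eq_sum_axis[OF smooth_l(2) V(2) p]) (simp add: sum_4 gip_linear gamma[OF p] field_simps)

text \<open>In the frame \<open>l0\<close>, \<open>l1\<close>, \<open>pd 3 X\<close>,
  \<open>pd 4 X\<close> the only nonzero pairings are 1/2, so the inverse Gram matrix has entries
  2.\<close>

lemma gip_null_frame:
  assumes p: "p \<in> V"
  shows "gip G (X p) a b = 2 * (gip G (X p) a (l0 p) * gip G (X p) b (pd 3 X p) + gip G (X p) a (pd 3 X p) * gip G (X p) b (l0 p)
    + gip G (X p) a (l1 p) * gip G (X p) b (pd 4 X p) + gip G (X p) a (pd 4 X p) * gip G (X p) b (l1 p))"
proof -
  let ?q = "X p"
  have q: "?q \<in> U" by (rule XU[OF p])
  note iv = ip_values[OF p, unfolded ip_def]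
  have E: "\<exists>x y. v = (2 * gip G ?q v (pd 3 X p)) *\<^sub>R l0 p + (2 * gip G ?q v (pd 4 X p)) *\<^sub>R l1 p + (x *\<^sub>R X1 ?q + y *\<^sub>R X2 ?q)" for v
  proof -
    obtain d where d: "v = (2 * gip G ?q v (pd 3 X p)) *\<^sub>R pd 1 X p + (2 * gip G ?q v (pd 4 X p)) *\<^sub>R pd 2 X p + d" "inD ?q d"
      using T_expansion[OF p] .
    define d' where "d' = d - (2 * gip G ?q v (pd 3 X p)) *\<^sub>R (t44 p *\<^sub>R pd 3 X p + (- t34 p) *\<^sub>R pd 4 X p)
      - (2 * gip G ?q v (pd 4 X p)) *\<^sub>R ((- t34 p) *\<^sub>R pd 3 X p + t33 p *\<^sub>R pd 4 X p)"
    have "inD ?q d'" unfolding d'_def by (intro inD_add inD_diff inD_scaleR inD34 d(2) p)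
    then obtain x y where "d' = x *\<^sub>R X1 ?q + y *\<^sub>R X2 ?q" using inD_span[OF q] by blast
    moreover have "v = (2 * gip G ?q v (pd 3 X p)) *\<^sub>R l0 p + (2 * gip G ?q v (pd 4 X p)) *\<^sub>R l1 p + d'"
      unfolding d'_def l0_def l1_def by (subst d(1)) (simp add: algebra_simps)
    ultimately show ?thesis by metis
  qed
  define a3 a4 b3 b4 where ab: "a3 = gip G ?q a (pd 3 X p)" "a4 = gip G ?q a (pd 4 X p)"
    "b3 = gip G ?q b (pd 3 X p)" "b4 = gip G ?q b (pd 4 X p)"
  obtain x y where a: "a = (2 * a3) *\<^sub>R l0 p + (2 * a4) *\<^sub>R l1 p + (x *\<^sub>R X1 ?q + y *\<^sub>R X2 ?q)" using E[of a] unfolding ab by blast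
  obtain z w where b: "b = (2 * b3) *\<^sub>R l0 p + (2 * b4) *\<^sub>R l1 p + (z *\<^sub>R X1 ?q + w *\<^sub>R X2 ?q)" using E[of b] unfolding ab by blast
  define A where "A = x *\<^sub>R X1 ?q + y *\<^sub>R X2 ?q"
  define B where "B = z *\<^sub>R X1 ?q + w *\<^sub>R X2 ?q"
  have n: "gip G ?q A A = 0" "gip G ?q A B = 0" "gip G ?q B A = 0"
    unfolding A_def B_def by (simp_all add: gip_linear gip_frame[OF q] gip_frame'[OF q])
  note gl = gip_l[OF p] gip_commute[OF q, of "l1 p" "l0 p"]
  note a' = a[folded A_def] and b' = b[folded B_def]
  have al: "gip G ?q a (l0 p) = gip G ?q A (l0 p)" "gip G ?q a (l1 p) = gip G ?q A (l1 p)"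
    "gip G ?q b (l0 p) = gip G ?q B (l0 p)" "gip G ?q b (l1 p) = gip G ?q B (l1 p)"
    unfolding a' b' by (simp_all add: gip_linear gl)
  have "gip G ?q a b = 2 * (b3 * gip G ?q A (l0 p) + b4 * gip G ?q A (l1 p)) + 2 * (a3 * gip G ?q B (l0 p) + a4 * gip G ?q B (l1 p))"
    unfolding a' b' using gip_commute[OF q, of "l0 p" B] gip_commute[OF q, of "l1 p" B]
    by (simp add: gip_linear gl n algebra_simps)
  then show ?thesis unfolding al ab[symmetric] by (simp add: algebra_simps)
qed

lemma curvature_l:
  assumes p: "p \<in> V"
  shows "gip G (X p) (l0 p) (curv G (X p) (l0 p) (l1 p) (l1 p)) =
    (pd2 3 1 F p + pd2 4 2 F p + t44 p * pd2 3 3 F p + t33 p * pd2 4 4 F p - 2 * t34 p * pd2 3 4 F p) / 2"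
proof -
  let ?q = "X p"
  have q: "?q \<in> U" by (rule XU[OF p])
  \<comment> \<open>The components of \<open>l0\<close> and \<open>l1\<close> frozen at
    \<open>p\<close>. Curvature depends on its directions only pointwise, so constant directions may
    be used and no bracket appears.\<close>
  define u :: "real^4" where "u = axis 1 1 + t44 p *\<^sub>R axis 3 1 + (- t34 p) *\<^sub>R axis 4 (1::real)"
  define v :: "real^4" where "v = axis 2 1 + (- t34 p) *\<^sub>R axis 3 1 + t33 p *\<^sub>R axis 4 (1::real)"
  have uv: "dd u X p = l0 p" "dd v X p = l1 p"
    unfolding dd_eq_sum_pd[OF V(2) p] sum_4 u_def v_def l0_def l1_def by (simp_all add: axis_nth)
  have uv_nth: "u $ 1 = 1" "u $ 2 = 0" "u $ 3 = t44 p" "u $ 4 = - t34 p" "v $ 1 = 0" "v $ 2 = 1" "v $ 3 = - t34 p" "v $ 4 = t33 p"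
    unfolding u_def v_def by (simp_all add: axis_nth)
  note sl = smooth_l and sc = smooth_cov[OF V smooth_l(2)] and sc0 = smooth_cov[OF V smooth_l(1)]
  define ga where "ga w p = gip G (X p) (cov G X w l1 p) (l0 p)" for w p
  have ga: "dd w' (ga w) p = (w $ 2 * dd w' (pd 3 F) p - w $ 1 * dd w' (pd 4 F) p) / 2" for w w'
  proof -
    have l: "dd w' (\<lambda>p. c * pd 3 F p - d * pd 4 F p) p = c * dd w' (pd 3 F) p - d * dd w' (pd 4 F) p" for c d
      by (simp add: dd_diff[where S = V] dd_mult[where S = V] smooth_on_mult smooth_on_pd smooth_F V(1) p)
    have "dd w' (ga w) p = dd w' (\<lambda>p. w $ 2 / 2 * pd 3 F p - w $ 1 / 2 * pd 4 F p) p"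
      by (rule dd_cong_open[OF V(1) _ p]) (simp add: ga_def gamma_dir field_simps)
    also have "\<dots> = w $ 2 / 2 * dd w' (pd 3 F) p - w $ 1 / 2 * dd w' (pd 4 F) p"
      by (rule l)
    finally show ?thesis by (simp add: field_simps)
  qed
  have dga: "dd w' (ga w) p = gip G ?q (cov G X w' (cov G X w l1) p) (l0 p) + gip G ?q (cov G X w l1 p) (cov G X w' l0 p)" for w w'
    unfolding ga_def[abs_def] by (rule dd_gip[OF V sc sl(1) p])
  have zero: "gip G ?q (cov G X w A p) (B p) + gip G ?q (A p) (cov G X w B p) = 0"
    if "smooth_on V A" "smooth_on V B" "\<And>p. p \<in> V \<Longrightarrow> gip G (X p) (A p) (B p) = c" for A B w c
  proof -
    have "dd w (\<lambda>p. gip G (X p) (A p) (B p)) p = dd w (\<lambda>p. c) p" by (rule dd_cong_open[OF V(1) that(3) p])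
    then show ?thesis using dd_gip[OF V that(1,2) p, where v = w] by simp
  qed
  have z00: "gip G ?q (cov G X w l0 p) (l0 p) = 0" for w
    using zero[OF sl(1,1) gip_l(1), of w] gip_commute[OF q, of "l0 p"] by simp
  have z11: "gip G ?q (cov G X w l1 p) (l1 p) = 0" for w
    using zero[OF sl(2,2) gip_l(2), of w] gip_commute[OF q, of "l1 p"] by simp
  have z01: "gip G ?q (cov G X w l0 p) (l1 p) = - ga w p" for w
    using zero[OF sl gip_l(3), of w] gip_commute[OF q, of "l0 p"] by (simp add: ga_def)
  \<comment> \<open>Trace-freeness again, moved from \<open>pd 1 X\<close>, \<open>pd 2 X\<close> to
    \<open>l0\<close>, \<open>l1\<close>: the corrections lie in the null plane and are orthogonal
    to derivatives of its sections.\<close>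
  have tr: "gip G ?q (cov G X w l0 p) (pd 3 X p) + gip G ?q (cov G X w l1 p) (pd 4 X p) = 0" for w
  proof -
    have d: "inD ?q (cov G X w (pd 3 X) p)" "inD ?q (cov G X w (pd 4 X) p)"
      using cov_inD[OF V sT _ p] inD34 by blast+
    have "gip G ?q (l0 p) (cov G X w (pd 3 X) p) = gip G ?q (pd 1 X p) (cov G X w (pd 3 X) p)"
      "gip G ?q (l1 p) (cov G X w (pd 4 X) p) = gip G ?q (pd 2 X p) (cov G X w (pd 4 X) p)"
      unfolding l0_def l1_def by (rule inD_null_dest[OF q _ d(1)] inD_null_dest[OF q _ d(2)]; intro inD_add inD_scaleR inD34 p)+
    then show ?thesis
      using zero[OF sl(1) sT gip_l(4), of w] zero[OF sl(2) sT gip_l(7), of w] zero[OF sT sT gram(1), of w] zero[OF sT sT gram(4), of w]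
        trace_free[OF p, of w] by simp
  qed
  \<comment> \<open>Together with \<open>tr\<close> the quadratic connection term becomes symmetric
    in \<open>w\<close> and \<open>w'\<close>, so its antisymmetrisation vanishes: the curvature is
    the exterior derivative of \<open>ga\<close>.\<close>
  have cross: "gip G ?q (cov G X w l1 p) (cov G X w' l0 p) =
      2 * (ga w p * gip G ?q (cov G X w' l0 p) (pd 3 X p) - gip G ?q (cov G X w l1 p) (pd 4 X p) * ga w' p)" for w w'
    by (subst gip_null_frame[OF p]) (simp add: z00 z11 z01 ga_def[symmetric] algebra_simps)
  have "gip G ?q (l0 p) (curv G ?q (l0 p) (l1 p) (l1 p)) =
      gip G ?q (cov G X u (cov G X v l1) p) (l0 p) - gip G ?q (cov G X v (cov G X u l1) p) (l0 p)"
    using curvature[OF V sl(2) p, of u v] unfolding uv gip_commute[OF q, of "l0 p"] by (simp add: gip_diff[symmetric])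
  also have "\<dots> = dd u (ga v) p - dd v (ga u) p - (gip G ?q (cov G X v l1 p) (cov G X u l0 p) - gip G ?q (cov G X u l1 p) (cov G X v l0 p))"
    unfolding dga by simp
  also have "gip G ?q (cov G X v l1 p) (cov G X u l0 p) - gip G ?q (cov G X u l1 p) (cov G X v l0 p) = 0"
  proof -
    have t: "gip G ?q (cov G X w l1 p) (pd 4 X p) = - gip G ?q (cov G X w l0 p) (pd 3 X p)" for w using tr[of w] by simp
    show ?thesis unfolding cross t by (simp add: algebra_simps)
  qed
  also have "dd u (ga v) p - dd v (ga u) p - 0 = (dd u (pd 3 F) p + dd v (pd 4 F) p) / 2"
    unfolding ga uv_nth by (simp add: field_simps)
  also have "\<dots> = (pd2 3 1 F p + t44 p * pd2 3 3 F p - t34 p * pd2 3 4 F p + (pd2 4 2 F p - t34 p * pd2 4 3 F p + t33 p * pd2 4 4 F p)) / 2"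
    unfolding dd_eq_sum_pd[OF smooth_on_pd[OF smooth_F] p] sum_4 uv_nth by simp
  also have "pd2 4 3 F p = pd2 3 4 F p" by (rule pd_commute[OF V(1) smooth_F p])
  finally show ?thesis by (simp add: algebra_simps)
qed

text \<open>The null planes complementary to that of \<iota> and of the same family are
  \<open>o_A \<otimes> (\<omega> + k \<iota>)\<close>. The plane of \<open>l0\<close>,
  \<open>l1\<close> is one of them, and \<open>sig\<close> gives the determinant of its
  basis.\<close>

lemma l_span:
  assumes p: "p \<in> V"
  obtains a b c d k where "l0 p = a *\<^sub>R (Y1 (X p) + k *\<^sub>R X1 (X p)) + b *\<^sub>R (Y2 (X p) + k *\<^sub>R X2 (X p))"
    "l1 p = c *\<^sub>R (Y1 (X p) + k *\<^sub>R X1 (X p)) + d *\<^sub>R (Y2 (X p) + k *\<^sub>R X2 (X p))" "a * d - b * c = 1"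
proof -
  let ?q = "X p"
  have q: "?q \<in> U" by (rule XU[OF p])
  note fr = gip_frame[OF q] gip_frame'[OF q]
  define a b b1 b2 where ab: "a = - gip G ?q (l0 p) (X2 ?q)" "b = gip G ?q (l0 p) (X1 ?q)"
    "b1 = gip G ?q (l0 p) (Y2 ?q)" "b2 = - gip G ?q (l0 p) (Y1 ?q)"
  define c d d1 d2 where cd: "c = - gip G ?q (l1 p) (X2 ?q)" "d = gip G ?q (l1 p) (X1 ?q)"
    "d1 = gip G ?q (l1 p) (Y2 ?q)" "d2 = - gip G ?q (l1 p) (Y1 ?q)"
  have e0: "l0 p = b1 *\<^sub>R X1 ?q + b2 *\<^sub>R X2 ?q + a *\<^sub>R Y1 ?q + b *\<^sub>R Y2 ?q"
    unfolding ab using frame_expansion[OF q, of "l0 p"] by (simp add: algebra_simps)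
  have e1: "l1 p = d1 *\<^sub>R X1 ?q + d2 *\<^sub>R X2 ?q + c *\<^sub>R Y1 ?q + d *\<^sub>R Y2 ?q"
    unfolding cd using frame_expansion[OF q, of "l1 p"] by (simp add: algebra_simps)
  have det: "a * d - b * c = 1"
  proof -
    have D: "inD ?q (x *\<^sub>R pd 3 X p + y *\<^sub>R pd 4 X p)" for x y
      by (intro inD_add inD_scaleR inD34 p)
    have drop: "sig ?q (u + d) (v + e) = sig ?q u v" if "inD ?q d" "inD ?q e" for u v d e
      using that by (simp add: sig_linear sig_inD)
    have "sig ?q (l0 p) (l1 p) = 1"
      unfolding l0_def l1_def by (simp only: drop[OF D D] sig12[OF p])
    then show ?thesis
      unfolding sig_def th1_def th2_def e0 e1 by (simp add: gip_linear fr algebra_simps)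
  qed
  have n: "b * b1 = a * b2" "d * d1 = c * d2" "b * d1 + d * b1 = a * d2 + c * b2"
    using gip_l(1-3)[OF p] unfolding e0 e1 by (simp_all add: gip_linear fr algebra_simps)
  \<comment> \<open>Nullity makes \<open>(b1, b2)\<close> proportional to \<open>(a, b)\<close> and
    \<open>(d1, d2)\<close> to \<open>(c, d)\<close>; orthogonality makes the two factors equal.
    Solving \<open>k a = b1\<close>, \<open>k b = b2\<close> with determinant 1 gives this
    value.\<close>
  define k where "k = b1 * d - b2 * c"
  have "k * a = b1 * (a * d - b * c)" "k * b = b2 * (a * d - b * c)"
    using n(1) unfolding k_def by algebra+
  moreover have "k * c = d1 * (a * d - b * c)" "k * d = d2 * (a * d - b * c)"
    using n unfolding k_def by algebra+
  ultimately have k: "k * a = b1" "k * b = b2" "k * c = d1" "k * d = d2" using det by simp_all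
  show thesis
    by (rule that[OF _ _ det, of k]) (simp_all add: e0 e1 k[symmetric] algebra_simps)
qed

text \<open>The slope \<open>k\<close> of the plane of \<open>l0\<close>, \<open>l1\<close> varies
  with the point and is not under control, hence the hypothesis for every \<open>k\<close>.\<close>

lemma box_F:
  assumes p: "p \<in> V"
    and asd: "\<And>k. gip G (X p) (Y1 (X p) + k *\<^sub>R X1 (X p)) (curv G (X p) (Y1 (X p) + k *\<^sub>R X1 (X p))
      (Y2 (X p) + k *\<^sub>R X2 (X p)) (Y2 (X p) + k *\<^sub>R X2 (X p))) = 0"
  shows "pd2 3 1 F p + pd2 4 2 F p + t44 p * pd2 3 3 F p + t33 p * pd2 4 4 F p - 2 * t34 p * pd2 3 4 F p = 0"
proof -
  obtain a b c d k where l: "l0 p = a *\<^sub>R (Y1 (X p) + k *\<^sub>R X1 (X p)) + b *\<^sub>R (Y2 (X p) + k *\<^sub>R X2 (X p))"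
    "l1 p = c *\<^sub>R (Y1 (X p) + k *\<^sub>R X1 (X p)) + d *\<^sub>R (Y2 (X p) + k *\<^sub>R X2 (X p))"
    using l_span[OF p] .
  have "gip G (X p) (l0 p) (curv G (X p) (l0 p) (l1 p) (l1 p)) = 0"
    unfolding l sectional_span[OF XU[OF p]] asd by simp
  then show ?thesis unfolding curvature_l[OF p] by simp
qed

end

section \<open>From a null-Kaehler structure to a null frame\<close>

lemma smooth_on_det:
  fixes M :: "'a::real_normed_vector \<Rightarrow> real^'n^'n"
  assumes "open S" "\<And>i j. smooth_on S (\<lambda>q. M q $ i $ j)" shows "smooth_on S (\<lambda>q. det (M q))"
  using assms(2) unfolding smooth_on_def by (intro allI ck_on_det assms(1)) blast

lemma smooth_on_matrix_inv:
  fixes M :: "real^4 \<Rightarrow> real^4^4"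
  assumes S: "open S" and M: "smooth_on S M" and inv: "\<And>q. q \<in> S \<Longrightarrow> invertible (M q)"
  shows "smooth_on S (\<lambda>q. matrix_inv (M q) $ i $ j)"
proof -
  have det: "det (M q) \<noteq> 0" if "q \<in> S" for q using inv[OF that] by (simp add: invertible_det_nz)
  have Mij: "smooth_on S (\<lambda>q. M q $ k $ l)" for k l by (rule smooth_on_mat_nth[OF S M])
  have eq: "matrix_inv (M q) $ i $ j =
      det (\<chi> k l. if l = i then axis j 1 $ k else M q $ k $ l) / det (M q)" if q: "q \<in> S" for q
  proof -
    have "M q *v (matrix_inv (M q) *v axis j 1) = axis j 1"
      by (simp add: matrix_vector_mul_assoc matrix_mult_inv[OF inv[OF q]])
    then have "matrix_inv (M q) *v axis j 1 = (\<chi> i. det (\<chi> k l. if l = i then axis j 1 $ k else M q $ k $ l) / det (M q))"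
      by (rule iffD1[OF cramer[OF det[OF q]]])
    then have "(matrix_inv (M q) *v axis j 1) $ i = det (\<chi> k l. if l = i then axis j 1 $ k else M q $ k $ l) / det (M q)"
      by simp
    then show ?thesis by (simp add: matrix_vector_mul_component inner_axis)
  qed
  have "smooth_on S (\<lambda>q. det (\<chi> k l. if l = i then axis j 1 $ k else M q $ k $ l) / det (M q))"
  proof (rule smooth_on_divide[OF S _ _ det])
    have *: "smooth_on S (\<lambda>q. (\<chi> k l. if l = i then axis j 1 $ k else M q $ k $ l) $ k $ l)" for k l
      by (cases "l = i") (simp_all add: Mij)
    show "smooth_on S (\<lambda>q. det (\<chi> k l. if l = i then axis j 1 $ k else M q $ k $ l))"
      by (rule smooth_on_det[OF S *])
    show "smooth_on S (\<lambda>q. det (M q))"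
      by (rule smooth_on_det[OF S Mij])
  qed
  then show ?thesis by (rule iffD2[OF smooth_on_cong[OF S], rotated]) (rule eq)
qed

lemma signature_2_2_invertible:
  assumes "signature_2_2 M" shows "invertible M"
proof -
  obtain P :: "real^4^4" where P: "transpose P ** M ** P = (\<chi> i j. if i \<noteq> j then 0 else if i = 1 \<or> i = 2 then 1 else - 1)" (is "_ = ?D")
    using assms unfolding signature_2_2_def by blast
  have "det ?D = (\<Prod>i\<in>UNIV. ?D $ i $ i)" by (rule det_diagonal) simp
  also have "\<dots> \<noteq> 0" by (subst prod_zero_iff) auto
  finally have "det (transpose P ** M ** P) \<noteq> 0" unfolding P .
  then show ?thesis by (simp add: det_mul invertible_det_nz)
qed

section \<open>The Weyl tensor on null planes and the frame of a parallel spinor\<close>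

lemma eps_simps [simp]: "eps 1 1 = 0" "eps 1 2 = 1" "eps 2 1 = - 1" "eps 2 2 = 0"
  by (simp_all add: eps_def)

definition tens4 :: "(4 \<Rightarrow> 4 \<Rightarrow> 4 \<Rightarrow> 4 \<Rightarrow> real) \<Rightarrow> real^4 \<Rightarrow> real^4 \<Rightarrow> real^4 \<Rightarrow> real^4 \<Rightarrow> real" where
  "tens4 T u v w z = (\<Sum>i\<in>UNIV. \<Sum>j\<in>UNIV. \<Sum>k\<in>UNIV. \<Sum>l\<in>UNIV. T i j k l * u $ i * v $ j * w $ k * z $ l)"

lemma tens4_add: "tens4 T (u + u') v w z = tens4 T u v w z + tens4 T u' v w z"
  "tens4 T u (v + v') w z = tens4 T u v w z + tens4 T u v' w z"
  "tens4 T u v (w + w') z = tens4 T u v w z + tens4 T u v w' z"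
  "tens4 T u v w (z + z') = tens4 T u v w z + tens4 T u v w z'"
  by (simp_all add: tens4_def sum.distrib distrib_left distrib_right)

lemma tens4_scaleR: "tens4 T (c *\<^sub>R u) v w z = c * tens4 T u v w z"
  "tens4 T u (c *\<^sub>R v) w z = c * tens4 T u v w z"
  "tens4 T u v (c *\<^sub>R w) z = c * tens4 T u v w z"
  "tens4 T u v w (c *\<^sub>R z) = c * tens4 T u v w z"
  by (simp_all add: tens4_def sum_distrib_left ac_simps)

lemma tens4_pair:
  "tens4 (\<lambda>i j k l. A i k * B j l) u v w z = (\<Sum>i\<in>UNIV. \<Sum>k\<in>UNIV. u $ i * A i k * w $ k) * (\<Sum>j\<in>UNIV. \<Sum>l\<in>UNIV. B j l * v $ j * z $ l)"
  "tens4 (\<lambda>i j k l. A i l * B j k) u v w z = (\<Sum>i\<in>UNIV. \<Sum>l\<in>UNIV. u $ i * A i l * z $ l) * (\<Sum>j\<in>UNIV. \<Sum>k\<in>UNIV. B j k * v $ j * w $ k)"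
  "tens4 (\<lambda>i j k l. A j k * B i l) u v w z = (\<Sum>j\<in>UNIV. \<Sum>k\<in>UNIV. v $ j * A j k * w $ k) * (\<Sum>i\<in>UNIV. \<Sum>l\<in>UNIV. B i l * u $ i * z $ l)"
  "tens4 (\<lambda>i j k l. A j l * B i k) u v w z = (\<Sum>j\<in>UNIV. \<Sum>l\<in>UNIV. v $ j * A j l * z $ l) * (\<Sum>i\<in>UNIV. \<Sum>k\<in>UNIV. B i k * u $ i * w $ k)"
  unfolding tens4_def sum_4 by algebra+

text \<open>Every correction term contains a factor pairing one vector of the first pair
  \<open>u\<close>, \<open>v\<close> with one of the second pair \<open>w\<close>, \<open>z\<close>;
  only these four pairings have to vanish.\<close>

lemma weyl_null_plane:
  assumes "gip G q u w = 0" "gip G q u z = 0" "gip G q v w = 0" "gip G q v z = 0"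
  shows "tens4 (\<lambda>i j k l. weyl G i j k l q) u v w z = tens4 (\<lambda>i j k l. riemann_low G i j k l q) u v w z"
proof -
  define s where "s = scalar_curv G q / 6"
  have lin: "tens4 (\<lambda>i j k l. R i j k l - 1/2 * (A i j k l - B i j k l - C i j k l + D i j k l) + s * (E i j k l - H i j k l)) u v w z =
    tens4 R u v w z - 1/2 * (tens4 A u v w z - tens4 B u v w z - tens4 C u v w z + tens4 D u v w z) + s * (tens4 E u v w z - tens4 H u v w z)"
    for R A B C D E H
    by (simp add: tens4_def sum.distrib sum_subtractf sum_distrib_left algebra_simps)
  note g = assms[unfolded gip_expand]
  show ?thesis
    unfolding weyl_def s_def[symmetric] lin tens4_pair g by simp
qed

text \<open>In \<open>riemann_low\<close> the second index belongs to the vector acted upon and the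
  last two to the two-form, which accounts for the permutation of arguments.\<close>

lemma tens4_riemann_low:
  "tens4 (\<lambda>i j k l. riemann_low G i j k l q) u v w z = gip G q u (curv G q w z v)"
proof -
  have "tens4 (\<lambda>i j k l. riemann_low G i j k l q) u v w z =
    (\<Sum>i\<in>UNIV. \<Sum>j\<in>UNIV. \<Sum>k\<in>UNIV. \<Sum>l\<in>UNIV. \<Sum>m\<in>UNIV. u $ i * G q $ i $ m * (riemann G m j k l q * w $ k * z $ l * v $ j))"
    by (simp add: tens4_def riemann_low_def sum_distrib_left sum_distrib_right ac_simps)
  also have "\<dots> = (\<Sum>i\<in>UNIV. \<Sum>m\<in>UNIV. \<Sum>j\<in>UNIV. \<Sum>k\<in>UNIV. \<Sum>l\<in>UNIV. u $ i * G q $ i $ m * (riemann G m j k l q * w $ k * z $ l * v $ j))"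
    by (rule sum.cong[OF refl], rule trans[OF _ sum_rotate[symmetric]]) (intro sum.cong refl sum.swap)
  also have "\<dots> = gip G q u (curv G q w z v)"
    by (simp add: gip_expand curv_def sum_distrib_left)
  finally show ?thesis .
qed

text \<open>The null frame is \<open>E a\<close> contracted with \<iota> and with a complementary
  spinor. Parallelism of \<iota> removes the primed connection from the derivatives of
  \<open>X1\<close>, \<open>X2\<close>; the self-dual Weyl spinor contracted four times with
  \<open>\<omega> + k \<iota>\<close> is the curvature component in the conclusion.\<close>

lemma null_frame_of_spinor:
  fixes G :: "real^4 \<Rightarrow> real^4^4" and E :: "2 \<Rightarrow> 2 \<Rightarrow> real^4 \<Rightarrow> real^4" and \<iota> :: "real^4 \<Rightarrow> real^2"
  assumes U: "open U" and G: "smooth_on U G"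
    and sym: "\<And>q. q \<in> U \<Longrightarrow> transpose (G q) = G q" and sign: "\<And>q. q \<in> U \<Longrightarrow> signature_2_2 (G q)"
    and E: "\<And>a a'. smooth_on U (E a a')"
    and gE: "\<And>q a a' b b'. q \<in> U \<Longrightarrow> E a a' q \<bullet> (G q *v E b b' q) = eps a b * eps a' b'"
    and \<iota>: "smooth_on U \<iota>" "\<And>q. q \<in> U \<Longrightarrow> \<iota> q \<noteq> 0"
    and par: "\<And>q. q \<in> U \<Longrightarrow> \<exists>\<Gamma> \<Gamma>'. spin_connection_at G E q \<Gamma> \<Gamma>' \<and>
        (\<forall>i a'. pd i (\<lambda>r. \<iota> r $ a') q + (\<Sum>b'\<in>UNIV. \<Gamma>' i a' b' * \<iota> q $ b') = 0)"
    and asd: "\<And>q a' b' c' d'. q \<in> U \<Longrightarrow> sd_weyl_spinor G E a' b' c' d' q = 0"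
  obtains X1 X2 Y1 Y2 where "null_frame U G X1 X2 Y1 Y2"
    "\<And>q k. q \<in> U \<Longrightarrow> gip G q (Y1 q + k *\<^sub>R X1 q) (curv G q (Y1 q + k *\<^sub>R X1 q) (Y2 q + k *\<^sub>R X2 q) (Y2 q + k *\<^sub>R X2 q)) = 0"
proof -
  have inv: "invertible (G q)" if "q \<in> U" for q by (rule signature_2_2_invertible[OF sign[OF that]])
  interpret metric_patch U G
    by unfold_locales (use U G sym inv smooth_on_matrix_inv[OF U G inv] in auto)
  define n where "n q = \<iota> q $ 1 * \<iota> q $ 1 + \<iota> q $ 2 * \<iota> q $ 2" for q
  have n: "n q \<noteq> 0" if "q \<in> U" for q
    using \<iota>(2)[OF that] unfolding n_def by (simp add: vec_eq_iff forall_2 sum_squares_eq_zero_iff)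
  define sp where "sp \<kappa> a q = \<kappa> q 1 *\<^sub>R E a 1 q + \<kappa> q 2 *\<^sub>R E a 2 q" for \<kappa> :: "real^4 \<Rightarrow> 2 \<Rightarrow> real" and a q
  define io where "io q a = \<iota> q $ a" for q a
  \<comment> \<open>Rotating \<iota> by a right angle and dividing by its squared length gives a
    smooth spinor whose symplectic product with \<iota> is 1. This uses that \<iota> vanishes
    nowhere.\<close>
  define om where "om q a = (if a = 1 then - \<iota> q $ 2 / n q else \<iota> q $ 1 / n q)" for q and a :: 2
  have om12: "om q 1 = - \<iota> q $ 2 / n q" "om q 2 = \<iota> q $ 1 / n q" for q by (simp_all add: om_def)
  have io12: "io q 1 * om q 2 - io q 2 * om q 1 = 1" if "q \<in> U" for q
  proof -
    have "io q 1 * om q 2 - io q 2 * om q 1 = n q / n q"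
      unfolding om12 io_def n_def by (simp only: add_divide_distrib) simp
    then show ?thesis using n[OF that] by simp
  qed
  have gE': "gip G q (E a a' q) (E b b' q) = eps a b * eps a' b'" if "q \<in> U" for q a a' b b'
    using gE[OF that] by (simp add: gip_def)
  have gsp: "gip G q (sp \<kappa> a q) (sp \<mu> b q) = eps a b * (\<kappa> q 1 * \<mu> q 2 - \<kappa> q 2 * \<mu> q 1)" if "q \<in> U" for \<kappa> \<mu> a b q
    unfolding sp_def by (simp add: gip_linear gE'[OF that] algebra_simps)
  have sio: "smooth_on U (\<lambda>q. io q a)" for a unfolding io_def by (rule smooth_on_vec_nth[OF U \<iota>(1)])
  have sn: "smooth_on U n" unfolding n_def by (intro smooth_on_add smooth_on_mult smooth_on_vec_nth U \<iota>(1))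
  have som: "smooth_on U (\<lambda>q. om q 1)" "smooth_on U (\<lambda>q. om q 2)"
    unfolding om12 by (intro smooth_on_divide smooth_on_minus smooth_on_vec_nth U \<iota>(1) sn n; assumption)+
  have ssp: "smooth_on U (sp \<kappa> a)" if "smooth_on U (\<lambda>q. \<kappa> q 1)" "smooth_on U (\<lambda>q. \<kappa> q 2)" for \<kappa> a
    unfolding sp_def[abs_def] by (intro smooth_on_add smooth_on_scaleR U E that)
  have nab: "nabla G i A q = cov G (\<lambda>q. q) (axis i 1) A q" if "smooth_on U A" "q \<in> U" for i A q
  proof -
    have "cov G (\<lambda>q. q) (axis i 1) (\<lambda>p. A p) q = (\<Sum>k\<in>UNIV. axis i 1 $ k *\<^sub>R nabla G k A q)"
      using cov_compose[OF U smooth_on_ident _ that, of "axis i 1"] by (simp add: axis_nth)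
    also have "\<dots> = nabla G i A q"
    proof -
      have *: "axis i 1 $ k *\<^sub>R nabla G k A q = (if k = i then nabla G k A q else 0)" for k by (simp add: axis_def)
      show ?thesis by (simp only: *) simp
    qed
    finally show ?thesis by simp
  qed
  have par': "\<exists>a b c. nabla G i (sp io 1) q = a *\<^sub>R sp io 1 q + b *\<^sub>R sp io 2 q \<and>
      nabla G i (sp io 2) q = c *\<^sub>R sp io 1 q - a *\<^sub>R sp io 2 q" if q: "q \<in> U" for i q
  proof -
    obtain \<Gamma> \<Gamma>' where sc: "spin_connection_at G E q \<Gamma> \<Gamma>'"
      and d: "\<And>i a'. pd i (\<lambda>r. \<iota> r $ a') q + (\<Sum>b'\<in>UNIV. \<Gamma>' i a' b' * \<iota> q $ b') = 0"
      using par[OF q] by blast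
    have tr: "\<Gamma> i 2 2 = - \<Gamma> i 1 1" using sc unfolding spin_connection_at_def sum_2 by (metis add_eq_0_iff)
    have nE: "nabla G i (E b b') q = \<Gamma> i 1 b *\<^sub>R E 1 b' q + \<Gamma> i 2 b *\<^sub>R E 2 b' q +
        (\<Gamma>' i 1 b' *\<^sub>R E b 1 q + \<Gamma>' i 2 b' *\<^sub>R E b 2 q)" for b b'
      using sc unfolding spin_connection_at_def sum_2 by blast
    have dio: "dd (axis i 1) (\<lambda>q. io q a) q = - (\<Gamma>' i a 1 * io q 1 + \<Gamma>' i a 2 * io q 2)" for a
      using d[of i a] unfolding io_def sum_2 pd_def by linarith
    \<comment> \<open>The derivatives of the components of \<iota> cancel the
      \<open>\<Gamma>'\<close> terms by parallelism, and only the unprimed connection is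
      left.\<close>
    have ns: "nabla G i (sp io b) q = \<Gamma> i 1 b *\<^sub>R sp io 1 q + \<Gamma> i 2 b *\<^sub>R sp io 2 q" for b
    proof -
      have "nabla G i (sp io b) q = cov G (\<lambda>q. q) (axis i 1) (\<lambda>q. io q 1 *\<^sub>R E b 1 q + io q 2 *\<^sub>R E b 2 q) q"
        unfolding nab[OF ssp[OF sio sio] q] by (simp add: sp_def[abs_def])
      also have "\<dots> = (dd (axis i 1) (\<lambda>q. io q 1) q *\<^sub>R E b 1 q + io q 1 *\<^sub>R nabla G i (E b 1) q) +
          (dd (axis i 1) (\<lambda>q. io q 2) q *\<^sub>R E b 2 q + io q 2 *\<^sub>R nabla G i (E b 2) q)"
        by (simp only: cov_add[where V = U] cov_scaleR[where V = U] smooth_on_scaleR sio E U q nab)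
      also have "\<dots> = \<Gamma> i 1 b *\<^sub>R sp io 1 q + \<Gamma> i 2 b *\<^sub>R sp io 2 q"
        unfolding dio nE sp_def by (simp add: algebra_simps)
      finally show ?thesis .
    qed
    have "nabla G i (sp io 1) q = \<Gamma> i 1 1 *\<^sub>R sp io 1 q + \<Gamma> i 2 1 *\<^sub>R sp io 2 q" by (rule ns)
    moreover have "nabla G i (sp io 2) q = \<Gamma> i 1 2 *\<^sub>R sp io 1 q - \<Gamma> i 1 1 *\<^sub>R sp io 2 q"
      using ns[of 2] by (simp add: tr)
    ultimately show ?thesis by blast
  qed
  have nf: "null_frame U G (sp io 1) (sp io 2) (sp om 1) (sp om 2)"
  proof (unfold_locales, goal_cases)
    \<comment> \<open>Four smoothness goals and ten pairings precede the parallelism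
      condition.\<close>
    case (15 q i)
    then show ?case by (rule par')
  qed (use ssp[OF sio sio] ssp[OF som] io12 in \<open>simp_all add: gsp\<close>)
  moreover have "gip G q (sp om 1 q + k *\<^sub>R sp io 1 q) (curv G q (sp om 1 q + k *\<^sub>R sp io 1 q)
      (sp om 2 q + k *\<^sub>R sp io 2 q) (sp om 2 q + k *\<^sub>R sp io 2 q)) = 0" if q: "q \<in> U" for q k
  proof -
    \<comment> \<open>With \<open>\<kappa> = \<omega> + k \<iota>\<close> the two vectors are
      \<open>o_A \<otimes> \<kappa>\<close>, so the null plane is given by a single primed
      spinor.\<close>
    define \<kappa> where "\<kappa> q a = om q a + k * io q a" for q and a :: 2
    have M: "sp om a q + k *\<^sub>R sp io a q = sp \<kappa> a q" for a
      by (simp add: sp_def \<kappa>_def algebra_simps)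
    let ?W = "tens4 (\<lambda>i j k l. weyl G i j k l q)"
    have sd: "?W (E 1 a' q) (E 2 b' q) (E 1 c' q) (E 2 d' q) - ?W (E 1 a' q) (E 2 b' q) (E 2 c' q) (E 1 d' q)
      - ?W (E 2 a' q) (E 1 b' q) (E 1 c' q) (E 2 d' q) + ?W (E 2 a' q) (E 1 b' q) (E 2 c' q) (E 1 d' q) = 0" for a' b' c' d'
      using asd[OF q, of a' b' c' d'] unfolding sd_weyl_spinor_def tens4_def[symmetric] sum_2 by simp
    define x y where "x = \<kappa> q 1" and "y = \<kappa> q 2"
    have S: "sp \<kappa> a q = x *\<^sub>R E a 1 q + y *\<^sub>R E a 2 q" for a by (simp add: sp_def x_def y_def)
    have ml: "?W (sp \<kappa> a q) (sp \<kappa> b q) (sp \<kappa> c q) (sp \<kappa> d q) =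
       x^4 * ?W (E a 1 q) (E b 1 q) (E c 1 q) (E d 1 q) + x^3*y * ?W (E a 1 q) (E b 1 q) (E c 1 q) (E d 2 q)
     + x^3*y * ?W (E a 1 q) (E b 1 q) (E c 2 q) (E d 1 q) + x^2*y^2 * ?W (E a 1 q) (E b 1 q) (E c 2 q) (E d 2 q)
     + x^3*y * ?W (E a 1 q) (E b 2 q) (E c 1 q) (E d 1 q) + x^2*y^2 * ?W (E a 1 q) (E b 2 q) (E c 1 q) (E d 2 q)
     + x^2*y^2 * ?W (E a 1 q) (E b 2 q) (E c 2 q) (E d 1 q) + x*y^3 * ?W (E a 1 q) (E b 2 q) (E c 2 q) (E d 2 q)
     + x^3*y * ?W (E a 2 q) (E b 1 q) (E c 1 q) (E d 1 q) + x^2*y^2 * ?W (E a 2 q) (E b 1 q) (E c 1 q) (E d 2 q)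
     + x^2*y^2 * ?W (E a 2 q) (E b 1 q) (E c 2 q) (E d 1 q) + x*y^3 * ?W (E a 2 q) (E b 1 q) (E c 2 q) (E d 2 q)
     + x^2*y^2 * ?W (E a 2 q) (E b 2 q) (E c 1 q) (E d 1 q) + x*y^3 * ?W (E a 2 q) (E b 2 q) (E c 1 q) (E d 2 q)
     + x*y^3 * ?W (E a 2 q) (E b 2 q) (E c 2 q) (E d 1 q) + y^4 * ?W (E a 2 q) (E b 2 q) (E c 2 q) (E d 2 q)" for a b c d
      unfolding S tens4_add tens4_scaleR by (simp add: algebra_simps power2_eq_square power3_eq_cube power4_eq_xxxx)
    let ?M1 = "sp \<kappa> 1 q" and ?M2 = "sp \<kappa> 2 q"
    \<comment> \<open>Four times the component of the self-dual Weyl spinor. Expanding by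
      multilinearity, each of the 16 monomials in \<open>x\<close>, \<open>y\<close> collects
      exactly one such combination.\<close>
    define Z where "Z a' b' c' d' = ?W (E 1 a' q) (E 2 b' q) (E 1 c' q) (E 2 d' q) - ?W (E 1 a' q) (E 2 b' q) (E 2 c' q) (E 1 d' q)
      - ?W (E 2 a' q) (E 1 b' q) (E 1 c' q) (E 2 d' q) + ?W (E 2 a' q) (E 1 b' q) (E 2 c' q) (E 1 d' q)" for a' b' c' d'
    have "?W ?M1 ?M2 ?M1 ?M2 - ?W ?M1 ?M2 ?M2 ?M1 - ?W ?M2 ?M1 ?M1 ?M2 + ?W ?M2 ?M1 ?M2 ?M1 =
       x^4 * Z 1 1 1 1 + x^3*y * Z 1 1 1 2 + x^3*y * Z 1 1 2 1 + x^2*y^2 * Z 1 1 2 2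
     + x^3*y * Z 1 2 1 1 + x^2*y^2 * Z 1 2 1 2 + x^2*y^2 * Z 1 2 2 1 + x*y^3 * Z 1 2 2 2
     + x^3*y * Z 2 1 1 1 + x^2*y^2 * Z 2 1 1 2 + x^2*y^2 * Z 2 1 2 1 + x*y^3 * Z 2 1 2 2
     + x^2*y^2 * Z 2 2 1 1 + x*y^3 * Z 2 2 1 2 + x*y^3 * Z 2 2 2 1 + y^4 * Z 2 2 2 2"
      unfolding ml Z_def by (simp only: right_diff_distrib distrib_left)
    also have "\<dots> = 0" using sd by (simp add: Z_def)
    finally have W0: "?W ?M1 ?M2 ?M1 ?M2 - ?W ?M1 ?M2 ?M2 ?M1 - ?W ?M2 ?M1 ?M1 ?M2 + ?W ?M2 ?M1 ?M2 ?M1 = 0" .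
    have g0: "gip G q (sp \<kappa> a q) (sp \<kappa> b q) = 0" for a b by (simp add: gsp[OF q])
    \<comment> \<open>By the antisymmetries of the curvature these four terms are equal, so each of
      them vanishes.\<close>
    have "gip G q ?M1 (curv G q ?M1 ?M2 ?M2) - gip G q ?M1 (curv G q ?M2 ?M1 ?M2)
       - gip G q ?M2 (curv G q ?M1 ?M2 ?M1) + gip G q ?M2 (curv G q ?M2 ?M1 ?M1) = 0"
      using W0 by (simp only: weyl_null_plane[OF g0 g0 g0 g0] tens4_riemann_low)
    moreover have "curv G q ?M2 ?M1 w = - curv G q ?M1 ?M2 w" for w by (rule curv_swap)
    moreover have "gip G q ?M2 (curv G q ?M1 ?M2 ?M1) = - gip G q ?M1 (curv G q ?M1 ?M2 ?M2)"
      using curv_antisym[OF q, of ?M1 ?M2 ?M1 ?M2] gip_commute[OF q, of ?M2] by simp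
    ultimately show ?thesis unfolding M by (simp add: gip_linear)
  qed
  ultimately show thesis using that by blast
qed


section \<open>The normal form in a neighbourhood of a point\<close>

lemma local_normal_form:
  fixes G :: "real^4 \<Rightarrow> real^4^4"
  assumes nf: "null_frame U G X1 X2 Y1 Y2"
    and asd: "\<And>q k. q \<in> U \<Longrightarrow> gip G q (Y1 q + k *\<^sub>R X1 q)
      (curv G q (Y1 q + k *\<^sub>R X1 q) (Y2 q + k *\<^sub>R X2 q) (Y2 q + k *\<^sub>R X2 q)) = 0"
    and q0: "q0 \<in> U"
  obtains V X P \<Theta> f where "open V" "smooth_on V X" "open (X ` V)" "X ` V \<subseteq> U" "q0 \<in> X ` V"
    "homeomorphism V (X ` V) X P" "smooth_on (X ` V) P" "smooth_on V \<Theta>" "smooth_on V f"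
    "\<And>p z. p \<in> V \<Longrightarrow> gip G (X p) (dd z X p) (dd z X p) = normal_form \<Theta> p z"
    "eq1 V \<Theta> f" "eq2 V \<Theta> f"
proof -
  interpret null_frame U G X1 X2 Y1 Y2 by (rule nf)
  obtain \<rho> X P where \<rho>: "\<rho> > 0" and X: "smooth_on (ball 0 \<rho>) X" "X ` ball 0 \<rho> \<subseteq> U" "X 0 = q0"
    and op: "open (X ` ball 0 \<rho>)" and hom: "homeomorphism (ball 0 \<rho>) (X ` ball 0 \<rho>) X P"
    and P: "smooth_on (X ` ball 0 \<rho>) P"
    and w: "\<And>p. p \<in> ball 0 \<rho> \<Longrightarrow> inD (X p) (pd 3 X p)" "\<And>p. p \<in> ball 0 \<rho> \<Longrightarrow> inD (X p) (pd 4 X p)"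
    "\<And>p. p \<in> ball 0 \<rho> \<Longrightarrow> gip G (X p) (pd 1 X p) (pd 3 X p) = 1/2"
    "\<And>p. p \<in> ball 0 \<rho> \<Longrightarrow> gip G (X p) (pd 1 X p) (pd 4 X p) = 0"
    "\<And>p. p \<in> ball 0 \<rho> \<Longrightarrow> gip G (X p) (pd 2 X p) (pd 3 X p) = 0"
    "\<And>p. p \<in> ball 0 \<rho> \<Longrightarrow> gip G (X p) (pd 2 X p) (pd 4 X p) = 1/2"
    "\<And>p. p \<in> ball 0 \<rho> \<Longrightarrow> sig (X p) (pd 1 X p) (pd 2 X p) = 1"
    using walker_coordinates[OF q0] by blast
  define V where "V = ball (0::real^4) \<rho>"
  interpret walker_chart U G X1 X2 Y1 Y2 V X
    by unfold_locales (use X w in \<open>auto simp: V_def\<close>)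
  obtain \<Theta> where \<Theta>: "smooth_on V \<Theta>" "\<And>p. p \<in> V \<Longrightarrow> pd2 3 3 \<Theta> p = - ip 2 2 p"
    "\<And>p. p \<in> V \<Longrightarrow> pd2 4 4 \<Theta> p = - ip 1 1 p" "\<And>p. p \<in> V \<Longrightarrow> pd2 3 4 \<Theta> p = ip 1 2 p"
  proof (rule potential)
    show "convex V" "seg_closed (axis i 1) V" for i by (simp_all add: V_def seg_closed_ball)
  qed (rule that; assumption)
  interpret potential_chart U G X1 X2 Y1 Y2 V X \<Theta>
    by unfold_locales (use \<Theta> in auto)
  show thesis
  proof (rule that[of V X P \<Theta> F])
    show "open V" "smooth_on V X" "open (X ` V)" "X ` V \<subseteq> U" "homeomorphism V (X ` V) X P" "smooth_on (X ` V) P"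
      using V op hom P by (simp_all add: V_def)
    show "q0 \<in> X ` V" unfolding V_def using X(3) \<rho> by force
    show "smooth_on V \<Theta>" "smooth_on V F" by (rule \<Theta>(1), rule smooth_F)
    show "eq1 V \<Theta> F" by (simp add: eq1_def F_def)
    show "eq2 V \<Theta> F" unfolding eq2_def
    proof
      fix p assume p: "p \<in> V"
      show "pd2 3 1 F p + pd2 4 2 F p + pd2 4 4 \<Theta> p * pd2 3 3 F p + pd2 3 3 \<Theta> p * pd2 4 4 F p
        - 2 * pd2 3 4 \<Theta> p * pd2 3 4 F p = 0"
        by (rule box_F[OF p]) (rule asd[OF XU[OF p]])
    qed
    fix p z assume p: "p \<in> V"
    have i2: "ip 2 1 p = ip 1 2 p" by (rule ip_commute[OF p])
    show "gip G (X p) (dd z X p) (dd z X p) = normal_form \<Theta> p z"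
      unfolding dd_eq_sum_pd[OF V(2) p] sum_4 gip_add gip_scaleR ip_def[symmetric] ip_values[OF p] i2 normal_form_def \<Theta>(2)[OF p] \<Theta>(3)[OF p] \<Theta>(4)[OF p]
      by (simp add: power2_eq_square algebra_simps)
  qed
qed

section \<open>Charts\<close>

lemma chart_inv:
  assumes "is_chart c"
  shows "m \<in> fst c \<Longrightarrow> inv_into (fst c) (snd c) (snd c m) = m"
    "q \<in> range_of c \<Longrightarrow> snd c (inv_into (fst c) (snd c) q) = q"
    "q \<in> range_of c \<Longrightarrow> inv_into (fst c) (snd c) q \<in> fst c"
  using assms unfolding is_chart_def homeomorphism_def range_of_def by auto

lemma open_overlap:
  assumes "is_chart c" "open D" shows "open (snd c ` (fst c \<inter> D))"
proof -
  let ?i = "inv_into (fst c) (snd c)"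
  have "snd c ` (fst c \<inter> D) = range_of c \<inter> ?i -` D"
  proof
    show "snd c ` (fst c \<inter> D) \<subseteq> range_of c \<inter> ?i -` D"
      using chart_inv(1)[OF assms(1)] by (auto simp: range_of_def)
    show "range_of c \<inter> ?i -` D \<subseteq> snd c ` (fst c \<inter> D)"
    proof
      fix q assume q: "q \<in> range_of c \<inter> ?i -` D"
      then have "?i q \<in> fst c \<inter> D" "snd c (?i q) = q" using chart_inv(2,3)[OF assms(1)] by simp_all
      then show "q \<in> snd c ` (fst c \<inter> D)" by (metis image_eqI)
    qed
  qed
  moreover have "open (range_of c \<inter> ?i -` D)"
    by (rule continuous_open_preimage[OF _ _ assms(2)])
      (use assms(1) in \<open>auto simp: is_chart_def homeomorphism_def range_of_def\<close>)
  ultimately show ?thesis by simp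
qed

lemma transition_chart: "is_chart c \<Longrightarrow> m \<in> fst c \<Longrightarrow> transition c d (snd c m) = snd d m"
  by (simp add: transition_def chart_inv)

text \<open>All transitions between \<open>c\<close> and the atlas factor through \<open>c0\<close>,
  composed with the smooth maps \<open>X\<close> and \<open>P\<close>. The chain rule for
  \<open>dtrans\<close> is recorded because the metric has to be compared in every chart of the
  atlas, not only in \<open>c0\<close>.\<close>

lemma refined_chart:
  fixes A :: "'m::topological_space chart set"
  assumes A: "smooth_atlas A" "c0 \<in> A" and V: "open V" "smooth_on V X" "X ` V \<subseteq> range_of c0"
    and Nh: "open (X ` V)" "homeomorphism V (X ` V) X P" "smooth_on (X ` V) P"
  defines "c \<equiv> ({m \<in> fst c0. snd c0 m \<in> X ` V}, P \<circ> snd c0)"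
  shows "is_chart c" "range_of c = V" "smooth_atlas (insert c A)"
    "\<And>d q. d \<in> A \<Longrightarrow> q \<in> overlap d c \<Longrightarrow> q \<in> overlap d c0 \<and> transition d c0 q \<in> X ` V \<and>
      transition d c q = P (transition d c0 q) \<and>
      (\<forall>v. dtrans d c q v = dd (dtrans d c0 q v) P (transition d c0 q))"
proof -
  define N where "N = X ` V"
  define C where "C = {m \<in> fst c0. snd c0 m \<in> N}"
  define h where "h = P \<circ> snd c0"
  have c: "fst c = C" "snd c = h" by (simp_all add: c_def C_def h_def N_def)
  note hN = Nh(2)[folded N_def] and sP = Nh(3)[folded N_def] and oN = Nh(1)[folded N_def] and VN = V(3)[folded N_def]
  have ch: "is_chart d" if "d \<in> A" for d using A(1) that by (simp add: smooth_atlas_def)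
  have tr: "smooth_on (overlap d d') (transition d d')" if "d \<in> A" "d' \<in> A" for d d'
    using A(1) that by (simp add: smooth_atlas_def)
  note ch0 = ch[OF A(2)]
  have PX: "P (X v) = v" if "v \<in> V" for v using hN that by (simp add: homeomorphism_def)
  have XP: "X (P q) = q" "P q \<in> V" if "q \<in> N" for q using hN that by (auto simp: homeomorphism_def)
  have XN: "X v \<in> N" if "v \<in> V" for v using that by (simp add: N_def)
  let ?i0 = "inv_into (fst c0) (snd c0)"
  have i0: "?i0 (X v) \<in> C" "snd c0 (?i0 (X v)) = X v" if "v \<in> V" for v
    using chart_inv(2,3)[OF ch0] VN XN[OF that] unfolding C_def by auto
  have hC: "h ` C = V"
  proof safe
    fix m assume "m \<in> C" then show "h m \<in> V" using XP(2) by (simp add: C_def h_def)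
  next
    fix v assume v: "v \<in> V"
    have "h (?i0 (X v)) = v" using i0(2)[OF v] PX[OF v] by (simp add: h_def)
    then show "v \<in> h ` C" using i0(1)[OF v] by (metis image_eqI)
  qed
  have inj: "inj_on h C"
  proof (rule inj_onI)
    fix m m' assume m: "m \<in> C" "m' \<in> C" "h m = h m'"
    then have "X (P (snd c0 m)) = X (P (snd c0 m'))" by (simp add: h_def)
    then have "snd c0 m = snd c0 m'" using XP(1) m by (simp add: C_def)
    then show "m = m'" using chart_inv(1)[OF ch0] m unfolding C_def by (metis (mono_tags, lifting) mem_Collect_eq)
  qed
  have inv: "inv_into C h v = ?i0 (X v)" if "v \<in> V" for v
    using inv_into_f_eq[OF inj i0(1)[OF that]] i0(2)[OF that] PX[OF that] by (simp add: h_def)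
  have Cop: "open C"
  proof -
    have "open (fst c0 \<inter> snd c0 -` N)"
      by (rule continuous_open_preimage[OF _ _ oN]) (use ch0 in \<open>auto simp: is_chart_def homeomorphism_def\<close>)
    moreover have "C = fst c0 \<inter> snd c0 -` N" by (auto simp: C_def)
    ultimately show ?thesis by simp
  qed
  show rng: "range_of c = V" by (simp add: range_of_def c hC)
  show chc: "is_chart c"
    unfolding is_chart_def c hC
  proof (intro conjI Cop V(1))
    have "continuous_on C h" unfolding h_def
    proof (rule continuous_on_compose)
      show "continuous_on C (snd c0)"
        by (rule continuous_on_subset[of "fst c0"]) (use ch0 in \<open>auto simp: is_chart_def homeomorphism_def C_def\<close>)
      show "continuous_on (snd c0 ` C) P"
        by (rule continuous_on_subset[of N]) (use hN in \<open>auto simp: homeomorphism_def C_def\<close>)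
    qed
    moreover have "continuous_on V (inv_into C h)"
    proof -
      have "continuous_on V (\<lambda>v. ?i0 (X v))"
      proof (rule continuous_on_compose2[of "range_of c0" ?i0 V X])
        show "continuous_on (range_of c0) ?i0" using ch0 by (simp add: is_chart_def homeomorphism_def range_of_def)
        show "continuous_on V X" by (rule smooth_on_imp_continuous_on[OF V(2)])
        show "X ` V \<subseteq> range_of c0" by (rule V(3))
      qed
      then show ?thesis by (rule continuous_on_eq) (simp add: inv)
    qed
    ultimately show "homeomorphism C V h (inv_into C h)"
      unfolding homeomorphism_def using hC inj by (auto simp: inv_into_into f_inv_into_f inv_into_image_cancel)
  qed
  have tc: "transition c d v = transition c0 d (X v)" if "v \<in> V" for d v
    using inv[OF that] by (simp add: transition_def c)
  have oc: "X v \<in> overlap c0 d" "v \<in> V" if v: "v \<in> overlap c d" for v d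
  proof -
    obtain m where m: "m \<in> C" "m \<in> fst d" "v = h m" using v unfolding overlap_def c by blast
    then have "X v = snd c0 m" using XP(1) by (simp add: h_def C_def)
    then show "X v \<in> overlap c0 d" using m by (auto simp: overlap_def C_def)
    show "v \<in> V" using m hC by blast
  qed
  have od: "q \<in> overlap d c0 \<and> transition d c0 q \<in> N \<and> transition d c q = P (transition d c0 q)"
    if d: "d \<in> A" and q: "q \<in> overlap d c" for d q
  proof -
    obtain m where m: "m \<in> fst d" "m \<in> C" "q = snd d m" using q unfolding overlap_def c by blast
    then show ?thesis
      using transition_chart[OF ch[OF d] m(1)] by (auto simp: overlap_def C_def c h_def)
  qed
  have oo: "open (overlap d d')" if "is_chart d" "is_chart d'" for d d' :: "'m chart"
    unfolding overlap_def by (rule open_overlap[OF that(1)]) (use that(2) in \<open>simp add: is_chart_def\<close>)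
  have s1: "smooth_on (overlap c d) (transition c d)" if d: "d \<in> A" for d
  proof -
    have o: "open (overlap c d)" by (rule oo[OF chc ch[OF d]])
    have "smooth_on (overlap c d) (\<lambda>v. transition c0 d (X v))"
      by (rule smooth_on_compose[OF o tr[OF A(2) d] smooth_on_subset[OF V(2)]]) (use oc[of _ d] in blast)+
    then show ?thesis
      by (rule iffD2[OF smooth_on_cong[OF o], rotated]) (rule tc[OF oc(2)])
  qed
  have od0: "overlap d c \<subseteq> overlap d c0" if "d \<in> A" for d using od[OF that] by blast
  have s2: "smooth_on (overlap d c) (transition d c)" if d: "d \<in> A" for d
  proof -
    have o: "open (overlap d c)" by (rule oo[OF ch[OF d] chc])
    have "smooth_on (overlap d c) (\<lambda>v. P (transition d c0 v))"
      by (rule smooth_on_compose[OF o sP smooth_on_subset[OF tr[OF d A(2)] od0[OF d]]]) (use od[OF d] in auto)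
    then show ?thesis
      by (rule iffD2[OF smooth_on_cong[OF o], rotated]) (use od[OF d] in auto)
  qed
  have s3: "smooth_on (overlap c c) (transition c c)"
  proof -
    have "overlap c c = V" by (simp add: overlap_def c hC)
    moreover have "transition c c v = v" if "v \<in> V" for v
      using that hC inj by (simp add: transition_def c f_inv_into_f)
    ultimately show ?thesis
      using smooth_on_cong[OF V(1), of "transition c c" "\<lambda>v. v"] by simp
  qed
  show "smooth_atlas (insert c A)"
    using chc ch s1 s2 s3 tr unfolding smooth_atlas_def by auto
  show "q \<in> overlap d c0 \<and> transition d c0 q \<in> X ` V \<and> transition d c q = P (transition d c0 q) \<and>
      (\<forall>v. dtrans d c q v = dd (dtrans d c0 q v) P (transition d c0 q))"
    if d: "d \<in> A" and q: "q \<in> overlap d c" for d q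
  proof -
    note o = od[OF d q]
    have "dtrans d c q v = dd v (\<lambda>q. P (transition d c0 q)) q" for v
      unfolding dtrans_def
      by (rule dd_cong_open[OF oo[OF ch[OF d] chc] _ q]) (use od[OF d] in auto)
    also have "dd v (\<lambda>q. P (transition d c0 q)) q = dd (dtrans d c0 q v) P (transition d c0 q)" for v
      unfolding dtrans_def
      by (rule dd_compose[OF sP smooth_on_subset[OF tr[OF d A(2)] od0[OF d]] q]) (use o in auto)
    finally show ?thesis using o by (simp add: N_def)
  qed
qed

lemma asd_null_kaehler_normal_form:
  fixes A :: "'m::topological_space chart set"
  assumes K: "asd_null_kaehler A g e L R \<iota>" and p: "p \<in> carrier_of A"
  shows "\<exists>c \<Theta> f. p \<in> fst c \<and> fst c \<subseteq> carrier_of A \<and> smooth_atlas (insert c A) \<and>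
         smooth_on (range_of c) \<Theta> \<and> smooth_on (range_of c) f \<and>
         (\<forall>d\<in>A. \<forall>q\<in>overlap d c. \<forall>v.
            v \<bullet> (g d q *v v) = normal_form \<Theta> (transition d c q) (dtrans d c q v)) \<and>
         eq1 (range_of c) \<Theta> f \<and> eq2 (range_of c) \<Theta> f"
proof -
  obtain c0 where c0: "c0 \<in> A" "p \<in> fst c0" using p by (auto simp: carrier_of_def)
  have at: "smooth_atlas A" and nm: "neutral_metric A g" and ss: "spin_structure A g e L R"
    and pf: "primed_spinor_field A R \<iota>" and ps: "parallel_spinor A g e \<iota>"
    and nz: "\<And>q. q \<in> range_of c0 \<Longrightarrow> \<iota> c0 q \<noteq> 0"
    and sd: "\<And>q a' b' c' d'. q \<in> range_of c0 \<Longrightarrow> sd_weyl_spinor (g c0) (e c0) a' b' c' d' q = 0"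
    using K c0(1) unfolding asd_null_kaehler_def null_kaehler_def by blast+
  have ch0: "is_chart c0" using at c0(1) by (simp add: smooth_atlas_def)
  obtain X1 X2 Y1 Y2 where nf: "null_frame (range_of c0) (g c0) X1 X2 Y1 Y2"
    and asd: "\<And>q k. q \<in> range_of c0 \<Longrightarrow> gip (g c0) q (Y1 q + k *\<^sub>R X1 q)
      (curv (g c0) q (Y1 q + k *\<^sub>R X1 q) (Y2 q + k *\<^sub>R X2 q) (Y2 q + k *\<^sub>R X2 q)) = 0"
  proof (rule null_frame_of_spinor[of "range_of c0" "g c0" "e c0" "\<iota> c0"])
    show "open (range_of c0)" using ch0 by (simp add: is_chart_def range_of_def)
    show "smooth_on (range_of c0) (g c0)" using nm c0(1) by (simp add: neutral_metric_def)
    show "transpose (g c0 q) = g c0 q" "signature_2_2 (g c0 q)" if "q \<in> range_of c0" for q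
      using nm c0(1) that by (simp_all add: neutral_metric_def)
    show "smooth_on (range_of c0) (e c0 a a')" for a a' using ss c0(1) by (simp add: spin_structure_def)
    show "e c0 a a' q \<bullet> (g c0 q *v e c0 b b' q) = eps a b * eps a' b'" if "q \<in> range_of c0" for q a a' b b'
      using ss c0(1) that by (simp add: spin_structure_def)
    show "smooth_on (range_of c0) (\<iota> c0)" using pf c0(1) by (simp add: primed_spinor_field_def)
    show "\<exists>\<Gamma> \<Gamma>'. spin_connection_at (g c0) (e c0) q \<Gamma> \<Gamma>' \<and>
        (\<forall>i a'. pd i (\<lambda>r. \<iota> c0 r $ a') q + (\<Sum>b'\<in>UNIV. \<Gamma>' i a' b' * \<iota> c0 q $ b') = 0)" if "q \<in> range_of c0" for q
      using ps c0(1) that unfolding parallel_spinor_def by blast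
  qed (use nz sd that in blast)+
  have q0: "snd c0 p \<in> range_of c0" using c0(2) by (simp add: range_of_def)
  obtain V X P \<Theta> f where V: "open V" "smooth_on V X" "X ` V \<subseteq> range_of c0" and N: "open (X ` V)" "homeomorphism V (X ` V) X P" "smooth_on (X ` V) P"
    and q0V: "snd c0 p \<in> X ` V" and \<Theta>: "smooth_on V \<Theta>" "smooth_on V f"
    and norm: "\<And>p z. p \<in> V \<Longrightarrow> gip (g c0) (X p) (dd z X p) (dd z X p) = normal_form \<Theta> p z"
    and eqs: "eq1 V \<Theta> f" "eq2 V \<Theta> f"
    using local_normal_form[OF nf asd q0] by metis
  define c where "c = ({m \<in> fst c0. snd c0 m \<in> X ` V}, P \<circ> snd c0)"
  note rc = refined_chart[OF at c0(1) V N, folded c_def]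
  have "v \<bullet> (g d q *v v) = normal_form \<Theta> (transition d c q) (dtrans d c q v)" if d: "d \<in> A" and q: "q \<in> overlap d c" for d q v
  proof -
    define q' where "q' = transition d c0 q"
    define w where "w = dtrans d c0 q v"
    have r: "q \<in> overlap d c0" "q' \<in> X ` V" "transition d c q = P q'" "dtrans d c q v = dd w P q'"
      using rc(4)[OF d q] by (simp_all add: q'_def w_def)
    have PV: "P q' \<in> V" "X (P q') = q'" using N(2) r(2) by (auto simp: homeomorphism_def)
    \<comment> \<open>Differentiating \<open>X (P q) = q\<close> shows that the coordinate
      components \<open>dd w P q'\<close> represent the vector \<open>w\<close> itself; the normal
      form along \<open>X\<close> can then be read at \<open>w\<close>.\<close>
    have "dd w (\<lambda>q. X (P q)) q' = dd w (\<lambda>q. q) q'"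
      by (rule dd_cong_open[OF N(1) _ r(2)]) (use N(2) in \<open>auto simp: homeomorphism_def\<close>)
    then have w: "dd (dd w P q') X (P q') = w"
      using dd_compose[OF V(2) N(3) r(2) PV(1), of w] by simp
    have "v \<bullet> (g d q *v v) = w \<bullet> (g c0 q' *v w)"
      using nm d c0(1) r(1) unfolding neutral_metric_def q'_def w_def by blast
    also have "\<dots> = normal_form \<Theta> (P q') (dd w P q')"
      using norm[OF PV(1), of "dd w P q'"] unfolding w PV(2) by (simp add: gip_def)
    finally show ?thesis by (simp add: r)
  qed
  then have m: "\<forall>d\<in>A. \<forall>q\<in>overlap d c. \<forall>v. v \<bullet> (g d q *v v) = normal_form \<Theta> (transition d c q) (dtrans d c q v)"
    by blast
  have "p \<in> fst c" "fst c \<subseteq> carrier_of A" using c0 q0V by (auto simp: c_def carrier_of_def)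
  then show ?thesis
    using m rc(3) \<Theta> eqs unfolding rc(2)[symmetric] by blast
qed

section \<open>The linear system\<close>

text \<open>The second-order terms cancel by symmetry of second derivatives, leaving the bracket of
  two vector fields with complex coefficients.\<close>

lemma commutator_vector_fields:
  fixes a b :: "'i \<Rightarrow> 'a::euclidean_space \<Rightarrow> complex" and \<Psi> :: "'a \<Rightarrow> complex"
  assumes S: "open S" "s \<in> S" and \<Psi>: "smooth_on S \<Psi>"
    and a: "\<And>k. k \<in> I \<Longrightarrow> smooth_on S (a k)" and b: "\<And>k. k \<in> I \<Longrightarrow> smooth_on S (b k)"
  shows "(\<Sum>j\<in>I. a j s * dd (v j) (\<lambda>s. \<Sum>k\<in>I. b k s * dd (v k) \<Psi> s) s)
       - (\<Sum>j\<in>I. b j s * dd (v j) (\<lambda>s. \<Sum>k\<in>I. a k s * dd (v k) \<Psi> s) s)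
    = (\<Sum>k\<in>I. ((\<Sum>j\<in>I. a j s * dd (v j) (b k) s) - (\<Sum>j\<in>I. b j s * dd (v j) (a k) s)) * dd (v k) \<Psi> s)"
proof -
  have expand: "(\<Sum>j\<in>I. a j s * dd (v j) (\<lambda>s. \<Sum>k\<in>I. b k s * dd (v k) \<Psi> s) s) =
      (\<Sum>j\<in>I. \<Sum>k\<in>I. a j s * b k s * dd (v j) (dd (v k) \<Psi>) s) + (\<Sum>k\<in>I. (\<Sum>j\<in>I. a j s * dd (v j) (b k) s) * dd (v k) \<Psi> s)"
    if "\<forall>k\<in>I. smooth_on S (b k)" for a b
  proof -
    have b: "smooth_on S (b k)" if "k \<in> I" for k using \<open>\<forall>k\<in>I. smooth_on S (b k)\<close> that by blast
    have "dd (v j) (\<lambda>s. \<Sum>k\<in>I. b k s * dd (v k) \<Psi> s) s =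
        (\<Sum>k\<in>I. b k s * dd (v j) (dd (v k) \<Psi>) s + dd (v j) (b k) s * dd (v k) \<Psi> s)" for j
    proof -
      have "dd (v j) (\<lambda>s. \<Sum>k\<in>I. b k s * dd (v k) \<Psi> s) s = (\<Sum>k\<in>I. dd (v j) (\<lambda>s. b k s * dd (v k) \<Psi> s) s)"
        by (rule dd_sum[OF _ S(2)]) (rule smooth_on_mult[OF S(1) b smooth_on_dd[OF \<Psi>]])
      also have "\<dots> = (\<Sum>k\<in>I. b k s * dd (v j) (dd (v k) \<Psi>) s + dd (v j) (b k) s * dd (v k) \<Psi> s)"
        by (rule sum.cong[OF refl], rule dd_mult[OF b smooth_on_dd[OF \<Psi>] S(2)])
      finally show ?thesis .
    qed
    moreover have "(\<Sum>j\<in>I. \<Sum>k\<in>I. a j s * dd (v j) (b k) s * dd (v k) \<Psi> s) =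
        (\<Sum>k\<in>I. (\<Sum>j\<in>I. a j s * dd (v j) (b k) s) * dd (v k) \<Psi> s)"
      unfolding sum_distrib_right by (rule sum.swap)
    ultimately show ?thesis
      by (simp add: sum_distrib_left sum.distrib distrib_left mult.assoc)
  qed
  have A: "\<forall>k\<in>I. smooth_on S (a k)" and B: "\<forall>k\<in>I. smooth_on S (b k)" using a b by blast+
  have "(\<Sum>j\<in>I. \<Sum>k\<in>I. a j s * b k s * dd (v j) (dd (v k) \<Psi>) s) = (\<Sum>k\<in>I. \<Sum>j\<in>I. a j s * b k s * dd (v j) (dd (v k) \<Psi>) s)"
    by (rule sum.swap)
  also have "\<dots> = (\<Sum>j\<in>I. \<Sum>k\<in>I. b j s * a k s * dd (v j) (dd (v k) \<Psi>) s)"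
    by (intro sum.cong refl) (simp add: smooth_on_dd_commute[OF S(1) \<Psi> S(2)] mult.commute)
  finally show ?thesis
    unfolding expand[where a = b and b = a, OF A] expand[where a = a and b = b, OF B] by (simp add: left_diff_distrib sum_subtractf)
qed

text \<open>The Cauchy-Riemann condition in \<lambda>, expressed as complex linearity of the real
  differential. Unlike \<open>deriv\<close>, this form commutes with directional derivatives and
  treats \<lambda> like the other variables.\<close>

definition holo :: "((real^4) \<times> complex) set \<Rightarrow> spectral_fun \<Rightarrow> bool" where
  "holo W \<Psi> \<longleftrightarrow> smooth_on W \<Psi> \<and> (\<forall>s\<in>W. \<forall>c. c * dd (0, 1) \<Psi> s = dd (0, c) \<Psi> s)"

lemma holoD: "holo W \<Psi> \<Longrightarrow> s \<in> W \<Longrightarrow> dd (0, c) \<Psi> s = c * dd (0, 1) \<Psi> s"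
  by (simp add: holo_def)

lemma slice_has_derivative:
  assumes "smooth_on W \<Psi>" "(q, l) \<in> W"
  shows "((\<lambda>l'. \<Psi> (q, l')) has_derivative (\<lambda>c. dd (0, c) \<Psi> (q, l))) (at l)"
proof -
  have "((\<lambda>l'. (q, l')) has_derivative (\<lambda>c. (0, c))) (at l)"
    by (intro has_derivative_Pair has_derivative_const has_derivative_ident)
  from has_derivative_compose[OF this smooth_on_has_derivative[OF assms]] show ?thesis .
qed

lemma admissible_holo:
  assumes W: "open W" and \<Psi>: "admissible W \<Psi>"
  shows "holo W \<Psi>"
proof -
  have sm: "smooth_on W \<Psi>" and hol: "\<And>q. (\<lambda>l. \<Psi> (q, l)) holomorphic_on {l. (q, l) \<in> W}"
    using \<Psi> by (auto simp: admissible_def)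
  have "c * dd (0, 1) \<Psi> (q, l) = dd (0, c) \<Psi> (q, l)" if "(q, l) \<in> W" for q l c
  proof -
    have "open ((\<lambda>l. (q, l)) -` W)" by (rule open_vimage[OF W]) (intro continuous_intros)
    then have "open {l. (q, l) \<in> W}" by (simp add: vimage_def)
    then have "((\<lambda>l'. \<Psi> (q, l')) has_field_derivative deriv (\<lambda>l'. \<Psi> (q, l')) l) (at l)"
      using holomorphic_derivI[OF hol, of q l] that by simp
    then have "(\<lambda>c. dd (0, c) \<Psi> (q, l)) = (\<lambda>c. deriv (\<lambda>l'. \<Psi> (q, l')) l * c)"
      unfolding has_field_derivative_def by (rule has_derivative_unique[OF slice_has_derivative[OF sm that]])
    from fun_cong[OF this, of c] fun_cong[OF this, of 1] show ?thesis by simp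
  qed
  with sm show ?thesis by (auto simp: holo_def)
qed

lemma dlam_eq:
  assumes "holo W \<Psi>" "s \<in> W" shows "dlam \<Psi> s = dd (0, 1) \<Psi> s"
proof -
  obtain q l where s: "s = (q, l)" by (cases s)
  have "(\<lambda>c. dd (0, c) \<Psi> (q, l)) = (\<lambda>c. dd (0, 1) \<Psi> (q, l) * c)"
    by (rule ext) (subst holoD[OF assms[unfolded s]], rule mult.commute)
  then have "((\<lambda>l'. \<Psi> (q, l')) has_field_derivative dd (0, 1) \<Psi> (q, l)) (at l)"
    using slice_has_derivative[of W \<Psi> q l] assms unfolding holo_def s has_field_derivative_def by simp
  then show ?thesis unfolding s dlam_def by (simp add: DERIV_imp_deriv)
qed

lemma dcoord_eq: "dcoord i \<Psi> s = dd (axis i 1, 0) \<Psi> s"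
  by (cases s) (simp add: dcoord_def)

lemma holo_cong:
  assumes "open W" "\<And>s. s \<in> W \<Longrightarrow> \<Phi> s = \<Psi> s" "holo W \<Psi>" shows "holo W \<Phi>"
  unfolding holo_def
proof (intro conjI ballI allI)
  show "smooth_on W \<Phi>"
    by (rule iffD2[OF smooth_on_cong[OF assms(1,2)]]) (use assms(3) in \<open>simp_all add: holo_def\<close>)
  fix s c assume s: "s \<in> W"
  have "dd v \<Phi> s = dd v \<Psi> s" for v by (rule dd_cong_open[OF assms(1,2) s])
  then show "c * dd (0, 1) \<Phi> s = dd (0, c) \<Phi> s"
    using assms(3) s by (simp add: holo_def)
qed

text \<open>Directional derivatives commute, so every derivative inherits the Cauchy-Riemann
  condition. This makes the composition of the two operators accessible.\<close>

lemma holo_dd: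
  assumes W: "open W" and h: "holo W \<Psi>" shows "holo W (dd v \<Psi>)"
  unfolding holo_def
proof (intro conjI ballI allI)
  have sm: "smooth_on W \<Psi>" using h by (simp add: holo_def)
  show "smooth_on W (dd v \<Psi>)" by (rule smooth_on_dd[OF sm])
  fix s c assume s: "s \<in> W"
  have "dd (0, c) (dd v \<Psi>) s = dd v (dd (0, c) \<Psi>) s" by (rule smooth_on_dd_commute[OF W sm s])
  also have "\<dots> = dd v (\<lambda>s. c * dd (0, 1) \<Psi> s) s"
    by (rule dd_cong_open[OF W holoD[OF h] s])
  also have "\<dots> = c * dd v (dd (0, 1) \<Psi>) s"
    using dd_mult[where v = v, OF smooth_on_const[where c = c] smooth_on_dd[OF sm] s] by simp
  also have "dd v (dd (0, 1) \<Psi>) s = dd (0, 1) (dd v \<Psi>) s" by (rule smooth_on_dd_commute[OF W sm s])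
  finally show "c * dd (0, 1) (dd v \<Psi>) s = dd (0, c) (dd v \<Psi>) s" by (rule sym)
qed

lemma holo_mult:
  assumes W: "open W" and h: "holo W \<Psi>" "holo W \<Phi>" shows "holo W (\<lambda>s. \<Psi> s * \<Phi> s)"
  unfolding holo_def
proof (intro conjI ballI allI)
  have sm: "smooth_on W \<Psi>" "smooth_on W \<Phi>" using h by (simp_all add: holo_def)
  show "smooth_on W (\<lambda>s. \<Psi> s * \<Phi> s)" by (rule smooth_on_mult[OF W sm])
  fix s c assume s: "s \<in> W"
  show "c * dd (0, 1) (\<lambda>s. \<Psi> s * \<Phi> s) s = dd (0, c) (\<lambda>s. \<Psi> s * \<Phi> s) s"
    unfolding dd_mult[OF sm s] holoD[OF h(1) s, of c] holoD[OF h(2) s, of c] by (simp add: algebra_simps)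
qed

lemma holo_sum:
  assumes W: "open W" and h: "\<And>k. k \<in> I \<Longrightarrow> holo W (\<Psi> k)" shows "holo W (\<lambda>s. \<Sum>k\<in>I. \<Psi> k s)"
proof -
  have sm: "\<And>k. k \<in> I \<Longrightarrow> smooth_on W (\<Psi> k)" using h by (simp add: holo_def)
  have "c * dd (0, 1) (\<lambda>s. \<Sum>k\<in>I. \<Psi> k s) s = dd (0, c) (\<lambda>s. \<Sum>k\<in>I. \<Psi> k s) s" if s: "s \<in> W" for s c
    
  proof -
    have d: "dd u (\<lambda>s. \<Sum>k\<in>I. \<Psi> k s) s = (\<Sum>k\<in>I. dd u (\<Psi> k) s)" for u by (rule dd_sum[OF sm s])
    show ?thesis
      unfolding d sum_distrib_left by (rule sum.cong[OF refl]) (use h s in \<open>simp add: holo_def\<close>)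
  qed
  then show ?thesis using smooth_on_sum[OF W sm] by (simp add: holo_def)
qed

lemma frechet_derivative_bounded_linear: "bounded_linear h \<Longrightarrow> dd v h s = h v"
  using frechet_derivative_eqI[OF bounded_linear_imp_has_derivative] by metis

lemma smooth_lift:
  fixes h :: "real^4 \<Rightarrow> real" and W :: "((real^4) \<times> complex) set"
  assumes "open U" "open W" "W \<subseteq> U \<times> UNIV" "smooth_on U h"
  shows "smooth_on W (\<lambda>s. complex_of_real (h (fst s)))"
  by (rule smooth_on_linear_compose[OF bounded_linear_of_real assms(2)],
      rule smooth_on_compose[OF assms(2,4) smooth_on_bounded_linear[OF bounded_linear_fst]]) (use assms(3) in auto)

lemma dd_lift:
  fixes h :: "real^4 \<Rightarrow> real" and s :: "(real^4) \<times> complex"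
  assumes "open U" "smooth_on U h" "fst s \<in> U"
  shows "dd v (\<lambda>s. complex_of_real (h (fst s))) s = of_real (dd (fst v) h (fst s))"
proof -
  have "((\<lambda>s. complex_of_real (h (fst s))) has_derivative (\<lambda>v. of_real (dd (fst v) h (fst s)))) (at s)"
    by (rule bounded_linear.has_derivative[OF bounded_linear_of_real],
        rule has_derivative_compose[OF bounded_linear_imp_has_derivative[OF bounded_linear_fst] smooth_on_has_derivative[OF assms(2,3)]])
  from fun_cong[OF frechet_derivative_eqI[OF this], of v] show ?thesis by simp
qed

lemma dd_0: "smooth_on U h \<Longrightarrow> q \<in> U \<Longrightarrow> dd 0 h q = 0"
  using linear_0[OF has_derivative_linear[OF smooth_on_has_derivative]] by blast

section \<open>The two operators as vector fields in five variables\<close>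

locale lax_pair =
  fixes U :: "(real^4) set" and \<Theta> f :: "real^4 \<Rightarrow> real"
  assumes U: "open U" and \<Theta>: "smooth_on U \<Theta>" and f: "smooth_on U f"
begin

definition F :: "real^4 \<Rightarrow> real" where
  "F q = pd2 1 3 \<Theta> q + pd2 2 4 \<Theta> q + pd2 3 3 \<Theta> q * pd2 4 4 \<Theta> q - (pd2 3 4 \<Theta> q)\<^sup>2"

definition box_f :: "real^4 \<Rightarrow> real" where
  "box_f q = pd2 3 1 f q + pd2 4 2 f q + pd2 4 4 \<Theta> q * pd2 3 3 f q + pd2 3 3 \<Theta> q * pd2 4 4 f q
     - 2 * pd2 3 4 \<Theta> q * pd2 3 4 f q"

text \<open>The indices 0 to 4 stand for \<open>w\<close>, \<open>z\<close>, \<open>x\<close>,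
  \<open>y\<close>, \<lambda>. The real direction 1 in the last variable represents the complex
  derivative for functions satisfying \<open>holo\<close>.\<close>

definition dir :: "nat \<Rightarrow> (real^4) \<times> complex" where
  "dir k = [(axis 1 1, 0), (axis 2 1, 0), (axis 3 1, 0), (axis 4 1, 0), (0, 1)] ! k"

definition coef0 :: "nat \<Rightarrow> spectral_fun" where
  "coef0 k = [\<lambda>s. 1, \<lambda>s. 0, \<lambda>s. of_real (pd2 4 4 \<Theta> (fst s)),
     \<lambda>s. of_real (- pd2 3 4 \<Theta> (fst s)) - snd s, \<lambda>s. of_real (pd 4 f (fst s))] ! k"

definition coef1 :: "nat \<Rightarrow> spectral_fun" where
  "coef1 k = [\<lambda>s. 0, \<lambda>s. 1, \<lambda>s. of_real (- pd2 3 4 \<Theta> (fst s)) + snd s,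
     \<lambda>s. of_real (pd2 3 3 \<Theta> (fst s)), \<lambda>s. of_real (- pd 3 f (fst s))] ! k"

lemma sum5: "(\<Sum>k<5. g (k::nat)) = g 0 + g 1 + g 2 + g 3 + g 4"
  by (simp add: eval_nat_numeral)

lemma less5: "k < (5::nat) \<Longrightarrow> k = 0 \<or> k = 1 \<or> k = 2 \<or> k = 3 \<or> k = 4"
  by linarith

lemma dir_simps: "dir 0 = (axis 1 1, 0)" "dir 1 = (axis 2 1, 0)" "dir 2 = (axis 3 1, 0)"
    "dir 3 = (axis 4 1, 0)" "dir 4 = (0, 1)"
  by (simp_all add: dir_def eval_nat_numeral)

lemma coef0_simps: "coef0 0 = (\<lambda>s. 1)" "coef0 1 = (\<lambda>s. 0)" "coef0 2 = (\<lambda>s. of_real (pd2 4 4 \<Theta> (fst s)))"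
    "coef0 3 = (\<lambda>s. of_real (- pd2 3 4 \<Theta> (fst s)) - snd s)" "coef0 4 = (\<lambda>s. of_real (pd 4 f (fst s)))"
  by (simp_all add: coef0_def eval_nat_numeral)

lemma coef1_simps: "coef1 0 = (\<lambda>s. 0)" "coef1 1 = (\<lambda>s. 1)"
    "coef1 2 = (\<lambda>s. of_real (- pd2 3 4 \<Theta> (fst s)) + snd s)"
    "coef1 3 = (\<lambda>s. of_real (pd2 3 3 \<Theta> (fst s)))" "coef1 4 = (\<lambda>s. of_real (- pd 3 f (fst s)))"
  by (simp_all add: coef1_def eval_nat_numeral)

lemma L0_eq:
  assumes "holo W \<Psi>" "s \<in> W" shows "L0 \<Theta> f \<Psi> s = (\<Sum>k<5. coef0 k s * dd (dir k) \<Psi> s)"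
  unfolding sum5 coef0_simps dir_simps L0_def
  by (cases s) (use dlam_eq[OF assms] in \<open>simp add: dcoord_eq algebra_simps\<close>)

lemma L1_eq:
  assumes "holo W \<Psi>" "s \<in> W" shows "L1 \<Theta> f \<Psi> s = (\<Sum>k<5. coef1 k s * dd (dir k) \<Psi> s)"
  unfolding sum5 coef1_simps dir_simps L1_def
  by (cases s) (use dlam_eq[OF assms] in \<open>simp add: dcoord_eq algebra_simps\<close>)

lemma smooth_Th: "smooth_on U (pd2 i j \<Theta>)" "smooth_on U (\<lambda>q. - pd2 i j \<Theta> q)"
  "smooth_on U (pd i f)" "smooth_on U (\<lambda>q. - pd i f q)"
  by (intro smooth_on_minus smooth_on_pd U \<Theta> f)+

lemma holo_lift:
  assumes "open W" "W \<subseteq> U \<times> UNIV" "smooth_on U h"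
  shows "holo W (\<lambda>s. of_real (h (fst s)))"
proof -
  have *: "fst s \<in> U" if "s \<in> W" for s using that assms(2) by auto
  show ?thesis
    unfolding holo_def using smooth_lift[OF U assms] dd_lift[OF U assms(3) *] dd_0[OF assms(3) *] by simp
qed

lemma holo_snd: "holo W snd"
  by (simp add: holo_def smooth_on_bounded_linear bounded_linear_snd frechet_derivative_bounded_linear)

lemma holo_const: "holo W (\<lambda>s. c)"
  by (simp add: holo_def)

lemma holo_add: "open W \<Longrightarrow> holo W \<Psi> \<Longrightarrow> holo W \<Phi> \<Longrightarrow> holo W (\<lambda>s. \<Psi> s + \<Phi> s)"
  unfolding holo_def by (simp add: smooth_on_add dd_add[where S = W] distrib_left)

lemma holo_diff: "open W \<Longrightarrow> holo W \<Psi> \<Longrightarrow> holo W \<Phi> \<Longrightarrow> holo W (\<lambda>s. \<Psi> s - \<Phi> s)"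
  unfolding holo_def by (simp add: smooth_on_diff dd_diff[where S = W] right_diff_distrib)

lemma holo_coef:
  assumes "open W" "W \<subseteq> U \<times> UNIV" "k < 5"
  shows "holo W (coef0 k)" "holo W (coef1 k)"
  using less5[OF assms(3)] holo_lift[OF assms(1,2)] smooth_Th holo_snd holo_const
  by (elim disjE; simp only: coef0_simps coef1_simps; intro holo_const holo_add holo_diff assms holo_lift smooth_Th holo_snd)+

lemma third_commute:
  assumes "q \<in> U"
  shows "pd i (pd j (pd k \<Theta>)) q = pd j (pd i (pd k \<Theta>)) q" "pd i (pd j (pd k \<Theta>)) q = pd i (pd k (pd j \<Theta>)) q"
proof -
  show "pd i (pd j (pd k \<Theta>)) q = pd j (pd i (pd k \<Theta>)) q" by (rule pd_commute[OF U smooth_on_pd[OF \<Theta>] assms])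
  show "pd i (pd j (pd k \<Theta>)) q = pd i (pd k (pd j \<Theta>)) q"
    unfolding pd_def[of i] by (rule dd_cong_open[OF U pd_commute[OF U \<Theta>] assms])
qed

lemma pd_F:
  assumes q: "q \<in> U"
  shows "pd i F q = pd i (pd2 1 3 \<Theta>) q + pd i (pd2 2 4 \<Theta>) q + (pd2 3 3 \<Theta> q * pd i (pd2 4 4 \<Theta>) q
    + pd i (pd2 3 3 \<Theta>) q * pd2 4 4 \<Theta> q) - 2 * pd2 3 4 \<Theta> q * pd i (pd2 3 4 \<Theta>) q"
proof -
  note d = smooth_on_has_derivative[OF smooth_Th(1) q]
  have "(F has_derivative (\<lambda>v. dd v (pd2 1 3 \<Theta>) q + dd v (pd2 2 4 \<Theta>) q + (pd2 3 3 \<Theta> q * dd v (pd2 4 4 \<Theta>) q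
    + dd v (pd2 3 3 \<Theta>) q * pd2 4 4 \<Theta> q) - (pd2 3 4 \<Theta> q * dd v (pd2 3 4 \<Theta>) q + dd v (pd2 3 4 \<Theta>) q * pd2 3 4 \<Theta> q))) (at q)"
    unfolding F_def[abs_def] power2_eq_square
    by (intro has_derivative_add has_derivative_diff has_derivative_mult d)
  from fun_cong[OF frechet_derivative_eqI[OF this], of "axis i 1"] show ?thesis
    unfolding pd_def[of i] by simp
qed

lemma smooth_F: "smooth_on U F"
  unfolding F_def[abs_def] power2_eq_square
  by (intro smooth_on_add smooth_on_diff smooth_on_mult U smooth_Th)

lemma commutator:
  assumes W: "open W" "W \<subseteq> U \<times> UNIV" and \<Psi>: "holo W \<Psi>" and s: "s \<in> W"
  shows "L0 \<Theta> f (L1 \<Theta> f \<Psi>) s - L1 \<Theta> f (L0 \<Theta> f \<Psi>) s =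
    of_real (pd 4 f (fst s) - pd 4 F (fst s)) * dd (axis 3 1, 0) \<Psi> s
    + of_real (pd 3 F (fst s) - pd 3 f (fst s)) * dd (axis 4 1, 0) \<Psi> s - of_real (box_f (fst s)) * dd (0, 1) \<Psi> s"
proof -
  define q where "q = fst s"
  have q: "q \<in> U" using W(2) s by (auto simp: q_def)
  have sm: "smooth_on W \<Psi>" using \<Psi> by (simp add: holo_def)
  have hol: "holo W (\<lambda>s. \<Sum>k<5. c k s * dd (dir k) \<Psi> s)" if "\<And>k. k < 5 \<Longrightarrow> holo W (c k)" for c
    by (rule holo_sum[OF W(1)], rule holo_mult[OF W(1) _ holo_dd[OF W(1) \<Psi>]]) (use that in auto)
  \<comment> \<open>The outer operator contains \<open>dlam\<close>, a complex derivative; it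
    becomes a directional derivative only if the inner result is again holomorphic in
    \<lambda>.\<close>
  have h0: "holo W (L0 \<Theta> f \<Psi>)"
    by (rule holo_cong[OF W(1) L0_eq[OF \<Psi>] hol]) (use holo_coef[OF W] in auto)
  have h1: "holo W (L1 \<Theta> f \<Psi>)"
    by (rule holo_cong[OF W(1) L1_eq[OF \<Psi>] hol]) (use holo_coef[OF W] in auto)
  have d0: "dd v (L0 \<Theta> f \<Psi>) s = dd v (\<lambda>s. \<Sum>k<5. coef0 k s * dd (dir k) \<Psi> s) s" for v
    by (rule dd_cong_open[OF W(1) L0_eq[OF \<Psi>] s])
  have d1: "dd v (L1 \<Theta> f \<Psi>) s = dd v (\<lambda>s. \<Sum>k<5. coef1 k s * dd (dir k) \<Psi> s) s" for v
    by (rule dd_cong_open[OF W(1) L1_eq[OF \<Psi>] s])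
  have main: "L0 \<Theta> f (L1 \<Theta> f \<Psi>) s - L1 \<Theta> f (L0 \<Theta> f \<Psi>) s =
    (\<Sum>k<5. ((\<Sum>j<5. coef0 j s * dd (dir j) (coef1 k) s) - (\<Sum>j<5. coef1 j s * dd (dir j) (coef0 k) s)) * dd (dir k) \<Psi> s)"
    unfolding L0_eq[OF h1 s] L1_eq[OF h0 s] d0 d1
    by (rule commutator_vector_fields[OF W(1) s sm]) (use holo_coef[OF W] in \<open>auto simp: holo_def\<close>)
  have lift: "dd v (\<lambda>s. of_real (h (fst s))) s = complex_of_real (dd (fst v) h q)" if "smooth_on U h" for v h
    unfolding q_def by (rule dd_lift[OF U that q[unfolded q_def]])
  have sl: "smooth_on W (\<lambda>s. complex_of_real (h (fst s)))" if "smooth_on U h" for h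
    by (rule smooth_lift[OF U W that])
  have ssnd: "smooth_on W (\<lambda>s :: (real^4) \<times> complex. snd s)"
    by (rule smooth_on_bounded_linear[OF bounded_linear_snd])
  have dsnd: "dd v (\<lambda>s :: (real^4) \<times> complex. snd s) s = snd v" for v
    by (rule frechet_derivative_bounded_linear[OF bounded_linear_snd])
  have dmin: "dd u (\<lambda>q. - h q) q = - dd u h q" if "smooth_on U h" for u h
    using dd_diff[where v = u, OF smooth_on_const[where c = 0] that q] by simp
  have c: "dd v (coef0 0) s = 0" "dd v (coef0 1) s = 0" "dd v (coef0 2) s = of_real (dd (fst v) (pd2 4 4 \<Theta>) q)"
    "dd v (coef0 3) s = of_real (- dd (fst v) (pd2 3 4 \<Theta>) q) - snd v" "dd v (coef0 4) s = of_real (dd (fst v) (pd 4 f) q)"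
    "dd v (coef1 0) s = 0" "dd v (coef1 1) s = 0" "dd v (coef1 2) s = of_real (- dd (fst v) (pd2 3 4 \<Theta>) q) + snd v"
    "dd v (coef1 3) s = of_real (dd (fst v) (pd2 3 3 \<Theta>) q)" "dd v (coef1 4) s = of_real (- dd (fst v) (pd 3 f) q)" for v
    unfolding coef0_simps coef1_simps dd_diff[OF sl[OF smooth_Th(2)] ssnd s] dd_add[OF sl[OF smooth_Th(2)] ssnd s]
      lift[OF smooth_Th(1)] lift[OF smooth_Th(2)] lift[OF smooth_Th(3)] lift[OF smooth_Th(4)] dsnd dmin[OF smooth_Th(1)] dmin[OF smooth_Th(3)]
    by simp_all
  have z: "dd 0 (pd2 i j \<Theta>) q = 0" "dd 0 (pd i f) q = 0" for i j
    by (rule dd_0[OF smooth_Th(1) q], rule dd_0[OF smooth_Th(3) q])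
  \<comment> \<open>These identities assemble the third derivatives of \<Theta> in the bracket into
    \<open>pd 3 F\<close> and \<open>pd 4 F\<close>; the terms linear in \<lambda> cancel by
    symmetry.\<close>
  have t: "pd 1 (pd2 3 4 \<Theta>) q = pd 4 (pd2 1 3 \<Theta>) q" "pd 4 (pd2 3 4 \<Theta>) q = pd 3 (pd2 4 4 \<Theta>) q"
    "pd 2 (pd2 4 4 \<Theta>) q = pd 4 (pd2 2 4 \<Theta>) q" "pd 3 (pd2 3 4 \<Theta>) q = pd 4 (pd2 3 3 \<Theta>) q"
    "pd 3 (pd2 1 3 \<Theta>) q = pd 1 (pd2 3 3 \<Theta>) q" "pd 3 (pd2 2 4 \<Theta>) q = pd 2 (pd2 3 4 \<Theta>) q"
    using third_commute[OF q] by metis+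
  have fc: "pd 3 (pd 4 f) q = pd 4 (pd 3 f) q" by (rule pd_commute[OF U f q])
  show ?thesis
    unfolding main unfolding sum5 dir_simps unfolding c fst_conv snd_conv z unfolding coef0_simps coef1_simps q_def[symmetric] pd_def[symmetric]
    unfolding pd_F[OF q] box_f_def t fc
    by (simp add: algebra_simps)
qed

lemma lax_integrable_if:
  assumes "eq1 U \<Theta> f" "eq2 U \<Theta> f" shows "lax_integrable U \<Theta> f"
  unfolding lax_integrable_def
proof (intro exI allI impI ballI)
  fix W \<Psi> s assume W: "open W" "W \<subseteq> U \<times> UNIV" "admissible W \<Psi>" and s: "s \<in> W"
  have q: "fst s \<in> U" using W(2) s by auto
  have "pd i F (fst s) = pd i f (fst s)" for i
    unfolding pd_def by (rule dd_cong_open[OF U _ q]) (use assms(1) in \<open>simp add: eq1_def F_def\<close>)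
  moreover have "box_f (fst s) = 0" using assms(2) q by (simp add: eq2_def box_f_def)
  ultimately show "L0 \<Theta> f (L1 \<Theta> f \<Psi>) s - L1 \<Theta> f (L0 \<Theta> f \<Psi>) s = (\<lambda>_. 0) s * L0 \<Theta> f \<Psi> s + (\<lambda>_. 0) s * L1 \<Theta> f \<Psi> s"
    using commutator[OF W(1,2) admissible_holo[OF W(1,3)] s] by simp
qed

text \<open>The five coordinate functions serve as test functions \<Psi>: being linear, their
  derivatives in a direction are their values there. The functions \<open>w\<close> and
  \<open>z\<close> give \<alpha> and \<beta> equal to 0, then \<open>x\<close>, \<open>y\<close>,
  \<lambda> read off the coefficients of the commutator.\<close>

lemma lax_integrableD:
  assumes lax: "lax_integrable U \<Theta> f" and q: "q \<in> U"
  shows "pd 3 f q = pd 3 F q" "pd 4 f q = pd 4 F q" "box_f q = 0"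
proof -
  let ?W = "U \<times> (UNIV :: complex set)"
  have W: "open ?W" using U by (simp add: open_Times)
  \<comment> \<open>The coefficients of the commutator do not involve \<lambda>, so the single value
    0 suffices.\<close>
  define s where "s = (q, 0 :: complex)"
  have s: "s \<in> ?W" and fs: "fst s = q" using q by (simp_all add: s_def)
  obtain \<alpha> \<beta> where ab: "\<And>\<Psi>. admissible ?W \<Psi> \<Longrightarrow>
      L0 \<Theta> f (L1 \<Theta> f \<Psi>) s - L1 \<Theta> f (L0 \<Theta> f \<Psi>) s = \<alpha> s * L0 \<Theta> f \<Psi> s + \<beta> s * L1 \<Theta> f \<Psi> s"
    using lax W s unfolding lax_integrable_def by blast
  have main: "of_real (pd 4 f q - pd 4 F q) * \<Psi> (axis 3 1, 0) + of_real (pd 3 F q - pd 3 f q) * \<Psi> (axis 4 1, 0)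
      - of_real (box_f q) * \<Psi> (0, 1) =
      \<alpha> s * (\<Sum>k<5. coef0 k s * \<Psi> (dir k)) + \<beta> s * (\<Sum>k<5. coef1 k s * \<Psi> (dir k))"
    if \<Psi>: "bounded_linear \<Psi>" "admissible ?W \<Psi>" for \<Psi>
  proof -
    note h = admissible_holo[OF W \<Psi>(2)]
    show ?thesis
      using commutator[OF W order_refl h s] ab[OF \<Psi>(2)]
      unfolding L0_eq[OF h s] L1_eq[OF h s] frechet_derivative_bounded_linear[OF \<Psi>(1)] fs by simp
  qed
  have bl: "bounded_linear (\<lambda>s :: (real^4) \<times> complex. complex_of_real (fst s $ i))" for i
    by (rule bounded_linear_compose[OF bounded_linear_of_real bounded_linear_compose[OF bounded_linear_vec_nth bounded_linear_fst]])
  have ad: "admissible ?W (\<lambda>s. complex_of_real (fst s $ i))" for i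
    using smooth_on_bounded_linear[OF bl] by (simp add: admissible_def)
  have ads: "admissible ?W snd"
    using smooth_on_bounded_linear[OF bounded_linear_snd] by (simp add: admissible_def holomorphic_on_ident)
  have ax: "axis i (1 :: real) $ j = (if j = i then 1 else 0)" for i j :: 4 by (simp add: axis_def)
  note main = main[unfolded sum5, unfolded dir_simps coef0_simps coef1_simps fst_conv snd_conv]
  have \<alpha>: "\<alpha> s = 0" using main[OF bl[of 1] ad] by (simp add: ax)
  have \<beta>: "\<beta> s = 0" using main[OF bl[of 2] ad] by (simp add: ax)
  note main' = main[unfolded \<alpha> \<beta>]
  show "pd 3 f q = pd 3 F q" using main'[OF bl[of 4] ad] by (simp add: ax)
  show "pd 4 f q = pd 4 F q" using main'[OF bl[of 3] ad] by (simp add: ax)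
  show "box_f q = 0" using main'[OF bounded_linear_snd ads] by simp
qed

text \<open>The witness is \<open>F - f\<close>. The first equation then holds by construction, and
  integrability says that this difference has no derivatives along \<open>x\<close> and
  \<open>y\<close>.\<close>

lemma lax_integrable_imp:
  assumes lax: "lax_integrable U \<Theta> f"
  shows "\<exists>h. smooth_on U h \<and> (\<forall>q\<in>U. pd 3 h q = 0 \<and> pd 4 h q = 0) \<and>
    eq1 U \<Theta> (\<lambda>q. f q + h q) \<and> eq2 U \<Theta> (\<lambda>q. f q + h q)"
proof (intro exI conjI ballI)
  define h where "h q = F q - f q" for q
  note D = lax_integrableD[OF lax]
  have sh: "smooth_on U h" unfolding h_def[abs_def] by (rule smooth_on_diff[OF U smooth_F f])
  show "smooth_on U h" by (rule sh)
  have h0: "pd 3 h q = 0" "pd 4 h q = 0" if q: "q \<in> U" for q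
    using D(1,2)[OF q] unfolding h_def[abs_def] pd_def dd_diff[OF smooth_F f q] by simp_all
  show "pd 3 h q = 0" "pd 4 h q = 0" if "q \<in> U" for q by (rule h0[OF that])+
  show "eq1 U \<Theta> (\<lambda>q. f q + h q)" by (simp add: eq1_def h_def F_def)
  \<comment> \<open>Every second derivative in the wave operator is written with \<open>x\<close> or
    \<open>y\<close> innermost, so the correction \<open>h\<close> drops out.\<close>
  have "pd2 i j (\<lambda>q. f q + h q) q = pd2 i j f q" if i: "i \<in> {3, 4}" and q: "q \<in> U" for i j q
  proof -
    have "pd2 i j (\<lambda>q. f q + h q) q = pd j (\<lambda>q. pd i f q + pd i h q) q"
      unfolding pd_def[of j] by (rule dd_cong_open[OF U _ q]) (simp add: pd_def dd_add[OF f sh])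
    also have "\<dots> = pd2 i j f q"
      unfolding pd_def[of j] by (rule dd_cong_open[OF U _ q]) (use h0 i in auto)
    finally show ?thesis .
  qed
  then show "eq2 U \<Theta> (\<lambda>q. f q + h q)" using D(3) by (simp add: eq2_def box_f_def)
qed

end

theorem theorem3p2:
  shows "(\<forall>(A :: 'm::{t2_space, second_countable_topology} chart set) g e L R \<iota>.
      asd_null_kaehler A g e L R \<iota> \<longrightarrow>
      (\<forall>p \<in> carrier_of A. \<exists>c \<Theta> f.
         p \<in> fst c \<and> fst c \<subseteq> carrier_of A \<and> smooth_atlas (insert c A) \<and>
         smooth_on (range_of c) \<Theta> \<and> smooth_on (range_of c) f \<and>
         (\<forall>d\<in>A. \<forall>q\<in>overlap d c. \<forall>v.
            v \<bullet> (g d q *v v) = normal_form \<Theta> (transition d c q) (dtrans d c q v)) \<and>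
         eq1 (range_of c) \<Theta> f \<and> eq2 (range_of c) \<Theta> f)) \<and>
    (\<forall>U \<Theta> f. open U \<longrightarrow> smooth_on U \<Theta> \<longrightarrow> smooth_on U f \<longrightarrow>
      (eq1 U \<Theta> f \<and> eq2 U \<Theta> f \<longrightarrow> lax_integrable U \<Theta> f) \<and>
      (lax_integrable U \<Theta> f \<longrightarrow>
         (\<exists>h. smooth_on U h \<and> (\<forall>q\<in>U. pd 3 h q = 0 \<and> pd 4 h q = 0) \<and>
            eq1 U \<Theta> (\<lambda>q. f q + h q) \<and> eq2 U \<Theta> (\<lambda>q. f q + h q))))"
proof (intro conjI allI impI)
  fix A :: "'m chart set" and g e L R \<iota>
  assume K: "asd_null_kaehler A g e L R \<iota>"
  show "\<forall>p \<in> carrier_of A. \<exists>c \<Theta> f.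
         p \<in> fst c \<and> fst c \<subseteq> carrier_of A \<and> smooth_atlas (insert c A) \<and>
         smooth_on (range_of c) \<Theta> \<and> smooth_on (range_of c) f \<and>
         (\<forall>d\<in>A. \<forall>q\<in>overlap d c. \<forall>v.
            v \<bullet> (g d q *v v) = normal_form \<Theta> (transition d c q) (dtrans d c q v)) \<and>
         eq1 (range_of c) \<Theta> f \<and> eq2 (range_of c) \<Theta> f"
    by (rule ballI) (rule asd_null_kaehler_normal_form[OF K])
next
  fix U :: "(real^4) set" and \<Theta> f :: "real^4 \<Rightarrow> real"
  assume U: "open U" and \<Theta>: "smooth_on U \<Theta>" and f: "smooth_on U f"
  interpret lax_pair U \<Theta> f by (unfold_locales) (rule U \<Theta> f)+
  show "lax_integrable U \<Theta> f" if "eq1 U \<Theta> f \<and> eq2 U \<Theta> f"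
    using lax_integrable_if that by blast
  show "\<exists>h. smooth_on U h \<and> (\<forall>q\<in>U. pd 3 h q = 0 \<and> pd 4 h q = 0) \<and>
      eq1 U \<Theta> (\<lambda>q. f q + h q) \<and> eq2 U \<Theta> (\<lambda>q. f q + h q)" if "lax_integrable U \<Theta> f"
    by (rule lax_integrable_imp[OF that])
qed

end
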